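(* Let $L$ be a finite-dimensional restricted Lie algebra over a field $\mathbb{F}$ of prime characteristic $p$, and let $S$ be an irreducible restricted $L$-module with centralizer algebra $\mathbb{D}:=\operatorname{End}_L(S)$. Then, for the multiplicity $[L:S]_{\rm p\text{-}split}$ computed with respect to any $p$-chief series of $L$, $$[L:S]_{\rm p\text{-}split}=\dim_{\mathbb{D}} H_*^1(L,S)-\dim_{\mathbb{D}} H_*^1(L/\operatorname{Ann}_L(S),S).$$ In particular, $[L:S]_{\rm p\text{-}split}$ is independent of the choice of the $p$-chief series of $L$.
   Context: A $p$-ideal of a restricted Lie algebra is an ideal closed under the $p$-mapping. A $p$-chief series of a finite-dimensional restricted Lie algebra $L$ is an ascending chain $0=L_0\subset L_1\subset\cdots\subset L_n=L$ of $p$-ideals of $L$ such that each $L_j/L_{j-1}$ ($1\le j\le n$) is a minimal non-zero $p$-ideal of $L/L_{j-1}$; the quotients $L_j/L_{j-1}$ are called $p$-chief factors. A $p$-chief factor is strongly abelian if it is an abelian Lie algebra with zero $p$-mapping. The $p$-chief factors are $L$-modules via the action induced by the adjoint action. For an irreducible restricted $L$-module $S$ and a given $p$-chief series, $[L:S]_{\rm p\text{-}split}$ is the number of indices $j$ such that $L_j/L_{j-1}$ is strongly abelian, $L_j/L_{j-1}\cong S$ as an $L$-module, and the exact sequence $0\to L_j/L_{j-1}\to L/L_{j-1}\to L/L_j\to 0$ splits in the category of restricted Lie algebras. $u(L)$ denotes the restricted universal enveloping algebra of $L$. Restricted $L$-modules are the same as $u(L)$-modules. Restricted cohomology with coefficients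 in a restricted $L$-module $M$ is $H_*^n(L,M):=\operatorname{Ext}^n_{u(L)}(\mathbb{F},M)$, where $\mathbb{F}$ is the trivial module. $\operatorname{Ann}_L(S):=\{x\in L\mid x\cdot s=0 \text{ for all } s\in S\}$, which is a $p$-ideal of $L$; $S$ is a restricted $L/\operatorname{Ann}_L(S)$-module. $\mathbb{D}=\operatorname{End}_L(S)$ is a division algebra acting on the cohomology spaces by functoriality in the coefficients. *)

theory Defs
  imports "HOL-Computational_Algebra.Primes" "HOL-Algebra.Module" "HOL-Algebra.QuotRing"
begin

section \<open>Left modules over a (not necessarily commutative) ring\<close>

text \<open>
  The locale \<open>module\<close> of HOL-Algebra is restricted to commutative rings of scalars.
  As in HOL-Algebra, the fields \<open>mult\<close> and \<open>one\<close> of a module record are junk.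
\<close>

locale left_module = R?: ring R + M?: abelian_group M for R (structure) and M (structure) +
  assumes lsmult_closed:
      "\<lbrakk>a \<in> carrier R; x \<in> carrier M\<rbrakk> \<Longrightarrow> a \<odot>\<^bsub>M\<^esub> x \<in> carrier M"
    and lsmult_l_distr:
      "\<lbrakk>a \<in> carrier R; b \<in> carrier R; x \<in> carrier M\<rbrakk> \<Longrightarrow>
       (a \<oplus>\<^bsub>R\<^esub> b) \<odot>\<^bsub>M\<^esub> x = a \<odot>\<^bsub>M\<^esub> x \<oplus>\<^bsub>M\<^esub> b \<odot>\<^bsub>M\<^esub> x"
    and lsmult_r_distr:
      "\<lbrakk>a \<in> carrier R; x \<in> carrier M; y \<in> carrier M\<rbrakk> \<Longrightarrow>
       a \<odot>\<^bsub>M\<^esub> (x \<oplus>\<^bsub>M\<^esub> y) = a \<odot>\<^bsub>M\<^esub> x \<oplus>\<^bsub>M\<^esub> a \<odot>\<^bsub>M\<^esub> y"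
    and lsmult_assoc:
      "\<lbrakk>a \<in> carrier R; b \<in> carrier R; x \<in> carrier M\<rbrakk> \<Longrightarrow>
       (a \<otimes>\<^bsub>R\<^esub> b) \<odot>\<^bsub>M\<^esub> x = a \<odot>\<^bsub>M\<^esub> (b \<odot>\<^bsub>M\<^esub> x)"
    and lsmult_one: "x \<in> carrier M \<Longrightarrow> \<one>\<^bsub>R\<^esub> \<odot>\<^bsub>M\<^esub> x = x"

definition lmod_hom ::
    "('r, 'z) ring_scheme \<Rightarrow> ('r, 'm, 'y) module_scheme \<Rightarrow> ('r, 'n, 'x) module_scheme \<Rightarrow> ('m \<Rightarrow> 'n) set"
  where "lmod_hom R M N = {f \<in> carrier M \<rightarrow>\<^sub>E carrier N.
     (\<forall>x\<in>carrier M. \<forall>y\<in>carrier M. f (x \<oplus>\<^bsub>M\<^esub> y) = f x \<oplus>\<^bsub>N\<^esub> f y) \<and>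
     (\<forall>r\<in>carrier R. \<forall>x\<in>carrier M. f (r \<odot>\<^bsub>M\<^esub> x) = r \<odot>\<^bsub>N\<^esub> f x)}"

definition lmod_quot :: "('r, 'm, 'y) module_scheme \<Rightarrow> 'm set \<Rightarrow> ('r, 'm set) module"
  where "lmod_quot M N =
    \<lparr>carrier = a_rcosets\<^bsub>M\<^esub> N, mult = undefined, one = undefined, zero = N, add = set_add M,
     smult = (\<lambda>r X. \<Union>x\<in>X. N +>\<^bsub>M\<^esub> (r \<odot>\<^bsub>M\<^esub> x))\<rparr>"

text \<open>The free left module \<open>R\<^sup>(\<^sup>I\<^sup>)\<close> of finitely supported functions.\<close>

definition free_lmod :: "('r, 'z) ring_scheme \<Rightarrow> 'i set \<Rightarrow> ('r, 'i \<Rightarrow> 'r) module"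
  where "free_lmod R I =
    \<lparr>carrier = {f. (\<forall>i. f i \<in> carrier R) \<and> (\<forall>i. i \<notin> I \<longrightarrow> f i = \<zero>\<^bsub>R\<^esub>) \<and> finite {i. f i \<noteq> \<zero>\<^bsub>R\<^esub>}},
     mult = undefined, one = undefined, zero = (\<lambda>i. \<zero>\<^bsub>R\<^esub>),
     add = (\<lambda>f g i. f i \<oplus>\<^bsub>R\<^esub> g i), smult = (\<lambda>r f i. r \<otimes>\<^bsub>R\<^esub> f i)\<rparr>"

definition lmod_basis :: "('r, 'z) ring_scheme \<Rightarrow> ('r, 'm, 'y) module_scheme \<Rightarrow> 'm set \<Rightarrow> bool"
  where "lmod_basis R M B \<longleftrightarrow> B \<subseteq> carrier M \<and>
    bij_betw (\<lambda>c. \<Oplus>\<^bsub>M\<^esub>b\<in>{b. c b \<noteq> \<zero>\<^bsub>R\<^esub>}. c b \<odot>\<^bsub>M\<^esub> b) (carrier (free_lmod R B)) (carrier M)"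

definition lmod_fin_dim :: "('r, 'z) ring_scheme \<Rightarrow> ('r, 'm, 'y) module_scheme \<Rightarrow> bool"
  where "lmod_fin_dim R M \<longleftrightarrow> (\<exists>B. finite B \<and> lmod_basis R M B)"

text \<open>Only meaningful if \<open>R\<close> is a division ring and \<open>M\<close> is finite-dimensional.\<close>

definition lmod_dim :: "('r, 'z) ring_scheme \<Rightarrow> ('r, 'm, 'y) module_scheme \<Rightarrow> nat"
  where "lmod_dim R M = (THE n. \<exists>B. finite B \<and> lmod_basis R M B \<and> card B = n)"

text \<open>
  Projective: a direct summand of a free module.  Letting the index set range over sets of
  elements of the type of \<open>P\<close> loses nothing: if \<open>P\<close> is a direct summand of any free module, then
  it has the lifting property, so the canonical surjection onto \<open>P\<close> from the free module on the
  set \<open>carrier P\<close> splits.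
\<close>

definition projective_lmod :: "('r, 'z) ring_scheme \<Rightarrow> ('r, 'c, 'y) module_scheme \<Rightarrow> bool"
  where "projective_lmod R P \<longleftrightarrow> left_module R P \<and>
    (\<exists>(I :: 'c set) i r. i \<in> lmod_hom R P (free_lmod R I) \<and> r \<in> lmod_hom R (free_lmod R I) P \<and>
       (\<forall>x\<in>carrier P. r (i x) = x))"

text \<open>\<open>\<dots> \<longrightarrow> P 2 \<longrightarrow> P 1 \<longrightarrow> P 0 \<longrightarrow> A \<longrightarrow> 0\<close> with \<open>d n : P (Suc n) \<longrightarrow> P n\<close> and \<open>e : P 0 \<longrightarrow> A\<close>.\<close>

definition projective_resolution ::
    "('r, 'z) ring_scheme \<Rightarrow> (nat \<Rightarrow> ('r, 'c) module) \<Rightarrow> (nat \<Rightarrow> 'c \<Rightarrow> 'c) \<Rightarrow> ('c \<Rightarrow> 'n) \<Rightarrow>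
     ('r, 'n, 'y) module_scheme \<Rightarrow> bool"
  where "projective_resolution R P d e A \<longleftrightarrow>
    left_module R A \<and>
    (\<forall>n. projective_lmod R (P n)) \<and>
    (\<forall>n. d n \<in> lmod_hom R (P (Suc n)) (P n)) \<and>
    e \<in> lmod_hom R (P 0) A \<and>
    e ` carrier (P 0) = carrier A \<and>
    {x \<in> carrier (P 0). e x = \<zero>\<^bsub>A\<^esub>} = d 0 ` carrier (P 1) \<and>
    (\<forall>n. {x \<in> carrier (P (Suc n)). d n x = \<zero>\<^bsub>P n\<^esub>} = d (Suc n) ` carrier (P (Suc (Suc n))))"

text \<open>
  \<open>Hom\<^sub>R(M, N)\<close> as a left module over a ring of \<open>R\<close>-endomorphisms of \<open>N\<close>, acting by composition.
\<close>

definition hom_lmod ::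
    "('r, 'z) ring_scheme \<Rightarrow> ('r, 'm, 'y) module_scheme \<Rightarrow> ('r, 'n, 'x) module_scheme \<Rightarrow>
     ('n \<Rightarrow> 'n, 'm \<Rightarrow> 'n) module"
  where "hom_lmod R M N =
    \<lparr>carrier = lmod_hom R M N, mult = undefined, one = undefined,
     zero = (\<lambda>x\<in>carrier M. \<zero>\<^bsub>N\<^esub>),
     add = (\<lambda>f g. \<lambda>x\<in>carrier M. f x \<oplus>\<^bsub>N\<^esub> g x),
     smult = (\<lambda>h f. compose (carrier M) h f)\<rparr>"

definition ext_cocycles ::
    "('r, 'z) ring_scheme \<Rightarrow> (nat \<Rightarrow> ('r, 'c) module) \<Rightarrow> (nat \<Rightarrow> 'c \<Rightarrow> 'c) \<Rightarrow>
     ('r, 'n, 'y) module_scheme \<Rightarrow> nat \<Rightarrow> ('c \<Rightarrow> 'n) set"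
  where "ext_cocycles R P d N n =
    {f \<in> lmod_hom R (P n) N. \<forall>x\<in>carrier (P (Suc n)). f (d n x) = \<zero>\<^bsub>N\<^esub>}"

primrec ext_coboundaries ::
    "('r, 'z) ring_scheme \<Rightarrow> (nat \<Rightarrow> ('r, 'c) module) \<Rightarrow> (nat \<Rightarrow> 'c \<Rightarrow> 'c) \<Rightarrow>
     ('r, 'n, 'y) module_scheme \<Rightarrow> nat \<Rightarrow> ('c \<Rightarrow> 'n) set"
  where
    "ext_coboundaries R P d N 0 = {\<lambda>x\<in>carrier (P 0). \<zero>\<^bsub>N\<^esub>}"
  | "ext_coboundaries R P d N (Suc n) =
       (\<lambda>g. compose (carrier (P (Suc n))) g (d n)) ` lmod_hom R (P n) N"

text \<open>\<open>Ext\<^sub>R\<^sup>n(A, N)\<close>, computed by means of a projective resolution \<open>(P, d)\<close> of \<open>A\<close>.\<close>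

definition Ext_lmod ::
    "('r, 'z) ring_scheme \<Rightarrow> (nat \<Rightarrow> ('r, 'c) module) \<Rightarrow> (nat \<Rightarrow> 'c \<Rightarrow> 'c) \<Rightarrow>
     ('r, 'n, 'y) module_scheme \<Rightarrow> nat \<Rightarrow> ('n \<Rightarrow> 'n, ('c \<Rightarrow> 'n) set) module"
  where "Ext_lmod R P d N n =
    lmod_quot (hom_lmod R (P n) N\<lparr>carrier := ext_cocycles R P d N n\<rparr>) (ext_coboundaries R P d N n)"

section \<open>Restricted Lie algebras\<close>

record ('f, 'a) rlie = "('f, 'a) module" +
  bracket :: "'a \<Rightarrow> 'a \<Rightarrow> 'a"
  pmap :: "'a \<Rightarrow> 'a"

locale lie_algebra = F?: field F + V?: module F L
  for F :: "('f, 'z) ring_scheme" (structure) and L :: "('f, 'a, 'y) rlie_scheme" (structure) +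
  assumes bracket_closed:
      "\<lbrakk>x \<in> carrier L; y \<in> carrier L\<rbrakk> \<Longrightarrow> bracket L x y \<in> carrier L"
    and bracket_add_l: "\<lbrakk>x \<in> carrier L; y \<in> carrier L; z \<in> carrier L\<rbrakk> \<Longrightarrow>
      bracket L (x \<oplus>\<^bsub>L\<^esub> y) z = bracket L x z \<oplus>\<^bsub>L\<^esub> bracket L y z"
    and bracket_add_r: "\<lbrakk>x \<in> carrier L; y \<in> carrier L; z \<in> carrier L\<rbrakk> \<Longrightarrow>
      bracket L x (y \<oplus>\<^bsub>L\<^esub> z) = bracket L x y \<oplus>\<^bsub>L\<^esub> bracket L x z"
    and bracket_smult_l: "\<lbrakk>c \<in> carrier F; x \<in> carrier L; y \<in> carrier L\<rbrakk> \<Longrightarrow>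
      bracket L (c \<odot>\<^bsub>L\<^esub> x) y = c \<odot>\<^bsub>L\<^esub> bracket L x y"
    and bracket_smult_r: "\<lbrakk>c \<in> carrier F; x \<in> carrier L; y \<in> carrier L\<rbrakk> \<Longrightarrow>
      bracket L x (c \<odot>\<^bsub>L\<^esub> y) = c \<odot>\<^bsub>L\<^esub> bracket L x y"
    and bracket_self: "x \<in> carrier L \<Longrightarrow> bracket L x x = \<zero>\<^bsub>L\<^esub>"
    and jacobi: "\<lbrakk>x \<in> carrier L; y \<in> carrier L; z \<in> carrier L\<rbrakk> \<Longrightarrow>
      bracket L x (bracket L y z) \<oplus>\<^bsub>L\<^esub> bracket L y (bracket L z x) \<oplus>\<^bsub>L\<^esub> bracket L z (bracket L x y) = \<zero>\<^bsub>L\<^esub>"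

text \<open>
  \<open>ad_coeff L x y m k\<close> is the coefficient of \<open>t\<^sup>k\<close> in \<open>(ad (t x + y))\<^sup>m (x) \<in> L[t]\<close>.
\<close>

fun ad_coeff :: "('f, 'a, 'y) rlie_scheme \<Rightarrow> 'a \<Rightarrow> 'a \<Rightarrow> nat \<Rightarrow> nat \<Rightarrow> 'a"
  where
    "ad_coeff L x y 0 0 = x"
  | "ad_coeff L x y 0 (Suc k) = \<zero>\<^bsub>L\<^esub>"
  | "ad_coeff L x y (Suc m) 0 = bracket L y (ad_coeff L x y m 0)"
  | "ad_coeff L x y (Suc m) (Suc k) =
       bracket L x (ad_coeff L x y m k) \<oplus>\<^bsub>L\<^esub> bracket L y (ad_coeff L x y m (Suc k))"

text \<open>Jacobson's \<open>s\<^sub>i(x, y)\<close>: \<open>i s\<^sub>i(x, y)\<close> is the coefficient of \<open>t\<^sup>i\<^sup>-\<^sup>1\<close> in \<open>(ad (t x + y))\<^sup>p\<^sup>-\<^sup>1 (x)\<close>.\<close>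

definition jacobson_s ::
    "nat \<Rightarrow> ('f, 'z) ring_scheme \<Rightarrow> ('f, 'a, 'y) rlie_scheme \<Rightarrow> nat \<Rightarrow> 'a \<Rightarrow> 'a \<Rightarrow> 'a"
  where "jacobson_s p F L i x y =
    (inv\<^bsub>F\<^esub> ([i] \<cdot>\<^bsub>F\<^esub> \<one>\<^bsub>F\<^esub>)) \<odot>\<^bsub>L\<^esub> ad_coeff L x y (p - 1) (i - 1)"

text \<open>To be used over fields of prime characteristic \<open>p\<close> only.\<close>

locale restricted_lie_algebra = lie_algebra F L
  for p :: nat
    and F :: "('f, 'z) ring_scheme" (structure) and L :: "('f, 'a, 'y) rlie_scheme" (structure) +
  assumes pmap_closed: "x \<in> carrier L \<Longrightarrow> pmap L x \<in> carrier L"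
    and bracket_pmap: "\<lbrakk>x \<in> carrier L; y \<in> carrier L\<rbrakk> \<Longrightarrow>
      bracket L (pmap L x) y = (bracket L x ^^ p) y"
    and pmap_smult: "\<lbrakk>c \<in> carrier F; x \<in> carrier L\<rbrakk> \<Longrightarrow>
      pmap L (c \<odot>\<^bsub>L\<^esub> x) = (c [^]\<^bsub>F\<^esub> p) \<odot>\<^bsub>L\<^esub> pmap L x"
    and pmap_add: "\<lbrakk>x \<in> carrier L; y \<in> carrier L\<rbrakk> \<Longrightarrow>
      pmap L (x \<oplus>\<^bsub>L\<^esub> y) =
        pmap L x \<oplus>\<^bsub>L\<^esub> pmap L y \<oplus>\<^bsub>L\<^esub> (\<Oplus>\<^bsub>L\<^esub>i\<in>{1..p - 1}. jacobson_s p F L i x y)"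

definition restricted_lie_hom ::
    "('f, 'z) ring_scheme \<Rightarrow> ('f, 'a, 'y) rlie_scheme \<Rightarrow> ('f, 'b, 'x) rlie_scheme \<Rightarrow> ('a \<Rightarrow> 'b) set"
  where "restricted_lie_hom F L K = {f \<in> lmod_hom F L K.
     (\<forall>x\<in>carrier L. \<forall>y\<in>carrier L. f (bracket L x y) = bracket K (f x) (f y)) \<and>
     (\<forall>x\<in>carrier L. f (pmap L x) = pmap K (f x))}"

definition p_ideal :: "('f, 'z) ring_scheme \<Rightarrow> ('f, 'a, 'y) rlie_scheme \<Rightarrow> 'a set \<Rightarrow> bool"
  where "p_ideal F L I \<longleftrightarrow> submodule I F L \<and>
    (\<forall>x\<in>carrier L. \<forall>y\<in>I. bracket L x y \<in> I) \<and> (\<forall>y\<in>I. pmap L y \<in> I)"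

definition minimal_p_ideal :: "('f, 'z) ring_scheme \<Rightarrow> ('f, 'a, 'y) rlie_scheme \<Rightarrow> 'a set \<Rightarrow> bool"
  where "minimal_p_ideal F L I \<longleftrightarrow> p_ideal F L I \<and> I \<noteq> {\<zero>\<^bsub>L\<^esub>} \<and>
    (\<forall>J. p_ideal F L J \<and> J \<subseteq> I \<longrightarrow> J = {\<zero>\<^bsub>L\<^esub>} \<or> J = I)"

definition rlie_quot :: "('f, 'a, 'y) rlie_scheme \<Rightarrow> 'a set \<Rightarrow> ('f, 'a set) rlie"
  where "rlie_quot L I =
    \<lparr>carrier = a_rcosets\<^bsub>L\<^esub> I, mult = undefined, one = undefined, zero = I, add = set_add L,
     smult = (\<lambda>c X. \<Union>x\<in>X. I +>\<^bsub>L\<^esub> (c \<odot>\<^bsub>L\<^esub> x)),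
     bracket = (\<lambda>X Y. \<Union>x\<in>X. \<Union>y\<in>Y. I +>\<^bsub>L\<^esub> bracket L x y),
     pmap = (\<lambda>X. \<Union>x\<in>X. I +>\<^bsub>L\<^esub> pmap L x)\<rparr>"

section \<open>Restricted modules\<close>

record ('f, 'a, 'm) lie_module = "('f, 'm) module" +
  lact :: "'a \<Rightarrow> 'm \<Rightarrow> 'm"

locale restricted_module = V?: module F M
  for p :: nat
    and F :: "('f, 'z) ring_scheme" (structure) and L :: "('f, 'a, 'y) rlie_scheme" (structure)
    and M :: "('f, 'a, 'm, 'x) lie_module_scheme" (structure) +
  assumes lact_closed: "\<lbrakk>x \<in> carrier L; m \<in> carrier M\<rbrakk> \<Longrightarrow> lact M x m \<in> carrier M"
    and lact_add_l: "\<lbrakk>x \<in> carrier L; y \<in> carrier L; m \<in> carrier M\<rbrakk> \<Longrightarrow>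
      lact M (x \<oplus>\<^bsub>L\<^esub> y) m = lact M x m \<oplus>\<^bsub>M\<^esub> lact M y m"
    and lact_add_r: "\<lbrakk>x \<in> carrier L; m \<in> carrier M; n \<in> carrier M\<rbrakk> \<Longrightarrow>
      lact M x (m \<oplus>\<^bsub>M\<^esub> n) = lact M x m \<oplus>\<^bsub>M\<^esub> lact M x n"
    and lact_smult_l: "\<lbrakk>c \<in> carrier F; x \<in> carrier L; m \<in> carrier M\<rbrakk> \<Longrightarrow>
      lact M (c \<odot>\<^bsub>L\<^esub> x) m = c \<odot>\<^bsub>M\<^esub> lact M x m"
    and lact_smult_r: "\<lbrakk>c \<in> carrier F; x \<in> carrier L; m \<in> carrier M\<rbrakk> \<Longrightarrow>
      lact M x (c \<odot>\<^bsub>M\<^esub> m) = c \<odot>\<^bsub>M\<^esub> lact M x m"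
    and lact_bracket: "\<lbrakk>x \<in> carrier L; y \<in> carrier L; m \<in> carrier M\<rbrakk> \<Longrightarrow>
      lact M (bracket L x y) m = lact M x (lact M y m) \<ominus>\<^bsub>M\<^esub> lact M y (lact M x m)"
    and lact_pmap: "\<lbrakk>x \<in> carrier L; m \<in> carrier M\<rbrakk> \<Longrightarrow>
      lact M (pmap L x) m = (lact M x ^^ p) m"

definition lie_submodule ::
    "('f, 'z) ring_scheme \<Rightarrow> ('f, 'a, 'y) rlie_scheme \<Rightarrow> ('f, 'a, 'm, 'x) lie_module_scheme \<Rightarrow> 'm set \<Rightarrow> bool"
  where "lie_submodule F L M U \<longleftrightarrow> submodule U F M \<and> (\<forall>x\<in>carrier L. \<forall>m\<in>U. lact M x m \<in> U)"

definition irreducible_restricted_module ::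
    "nat \<Rightarrow> ('f, 'z) ring_scheme \<Rightarrow> ('f, 'a, 'y) rlie_scheme \<Rightarrow> ('f, 'a, 'm, 'x) lie_module_scheme \<Rightarrow> bool"
  where "irreducible_restricted_module p F L M \<longleftrightarrow> restricted_module p F L M \<and>
    carrier M \<noteq> {\<zero>\<^bsub>M\<^esub>} \<and>
    (\<forall>U. lie_submodule F L M U \<longrightarrow> U = {\<zero>\<^bsub>M\<^esub>} \<or> U = carrier M)"

definition lie_module_hom ::
    "('f, 'z) ring_scheme \<Rightarrow> ('f, 'a, 'y) rlie_scheme \<Rightarrow> ('f, 'a, 'm, 'x) lie_module_scheme \<Rightarrow>
     ('f, 'a, 'n, 'w) lie_module_scheme \<Rightarrow> ('m \<Rightarrow> 'n) set"
  where "lie_module_hom F L M N = {f \<in> lmod_hom F M N.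
     \<forall>x\<in>carrier L. \<forall>m\<in>carrier M. f (lact M x m) = lact N x (f m)}"

definition lie_module_iso ::
    "('f, 'z) ring_scheme \<Rightarrow> ('f, 'a, 'y) rlie_scheme \<Rightarrow> ('f, 'a, 'm, 'x) lie_module_scheme \<Rightarrow>
     ('f, 'a, 'n, 'w) lie_module_scheme \<Rightarrow> bool"
  where "lie_module_iso F L M N \<longleftrightarrow>
    (\<exists>f\<in>lie_module_hom F L M N. bij_betw f (carrier M) (carrier N))"

definition End_ring ::
    "('f, 'z) ring_scheme \<Rightarrow> ('f, 'a, 'y) rlie_scheme \<Rightarrow> ('f, 'a, 'm, 'x) lie_module_scheme \<Rightarrow> ('m \<Rightarrow> 'm) ring"
  where "End_ring F L M =
    \<lparr>carrier = lie_module_hom F L M M,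
     mult = (\<lambda>f g. compose (carrier M) f g), one = (\<lambda>m\<in>carrier M. m),
     zero = (\<lambda>m\<in>carrier M. \<zero>\<^bsub>M\<^esub>), add = (\<lambda>f g. \<lambda>m\<in>carrier M. f m \<oplus>\<^bsub>M\<^esub> g m)\<rparr>"

definition Ann :: "('f, 'a, 'y) rlie_scheme \<Rightarrow> ('f, 'a, 'm, 'x) lie_module_scheme \<Rightarrow> 'a set"
  where "Ann L M = {x \<in> carrier L. \<forall>m\<in>carrier M. lact M x m = \<zero>\<^bsub>M\<^esub>}"

text \<open>\<open>M\<close> as an \<open>L/I\<close>-module; only meaningful if \<open>I \<subseteq> Ann L M\<close>.\<close>

definition quot_act ::
    "('f, 'a, 'm) lie_module \<Rightarrow> ('f, 'a set, 'm) lie_module"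
  where "quot_act M =
    \<lparr>carrier = carrier M, mult = undefined, one = undefined, zero = \<zero>\<^bsub>M\<^esub>, add = add M, smult = smult M,
     lact = (\<lambda>X. lact M (SOME x. x \<in> X))\<rparr>"

definition trivial_module :: "('f, 'z) ring_scheme \<Rightarrow> ('f, 'a, 'f) lie_module"
  where "trivial_module F =
    \<lparr>carrier = carrier F, mult = undefined, one = undefined, zero = \<zero>\<^bsub>F\<^esub>, add = add F, smult = mult F,
     lact = (\<lambda>x c. \<zero>\<^bsub>F\<^esub>)\<rparr>"

section \<open>Restricted universal enveloping algebra and restricted cohomology\<close>

text \<open>
  The free associative unital \<open>F\<close>-algebra on a set \<open>X\<close>: noncommutative polynomials, given by their
  coefficient functions on words over \<open>X\<close>.
\<close>

definition free_assoc :: "('f, 'z) ring_scheme \<Rightarrow> 'a set \<Rightarrow> ('a list \<Rightarrow> 'f) ring"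
  where "free_assoc F X =
    \<lparr>carrier = {a. (\<forall>w. a w \<in> carrier F) \<and> (\<forall>w. \<not> set w \<subseteq> X \<longrightarrow> a w = \<zero>\<^bsub>F\<^esub>) \<and> finite {w. a w \<noteq> \<zero>\<^bsub>F\<^esub>}},
     mult = (\<lambda>a b w. \<Oplus>\<^bsub>F\<^esub>k\<in>{..length w}. a (take k w) \<otimes>\<^bsub>F\<^esub> b (drop k w)),
     one = (\<lambda>w. if w = [] then \<one>\<^bsub>F\<^esub> else \<zero>\<^bsub>F\<^esub>),
     zero = (\<lambda>w. \<zero>\<^bsub>F\<^esub>), add = (\<lambda>a b w. a w \<oplus>\<^bsub>F\<^esub> b w)\<rparr>"

definition word_monom :: "('f, 'z) ring_scheme \<Rightarrow> 'f \<Rightarrow> 'a list \<Rightarrow> ('a list \<Rightarrow> 'f)"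
  where "word_monom F c w = (\<lambda>v. if v = w then c else \<zero>\<^bsub>F\<^esub>)"

definition envel_relations ::
    "nat \<Rightarrow> ('f, 'z) ring_scheme \<Rightarrow> ('f, 'a, 'y) rlie_scheme \<Rightarrow> ('a list \<Rightarrow> 'f) set"
  where "envel_relations p F L =
    (let A = free_assoc F (carrier L); \<mu> = word_monom F \<one>\<^bsub>F\<^esub> in
      {\<mu> [x \<oplus>\<^bsub>L\<^esub> y] \<ominus>\<^bsub>A\<^esub> (\<mu> [x] \<oplus>\<^bsub>A\<^esub> \<mu> [y]) | x y. x \<in> carrier L \<and> y \<in> carrier L} \<union>
      {\<mu> [c \<odot>\<^bsub>L\<^esub> x] \<ominus>\<^bsub>A\<^esub> word_monom F c [x] | c x. c \<in> carrier F \<and> x \<in> carrier L} \<union>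
      {(\<mu> [x, y] \<ominus>\<^bsub>A\<^esub> \<mu> [y, x]) \<ominus>\<^bsub>A\<^esub> \<mu> [bracket L x y] | x y. x \<in> carrier L \<and> y \<in> carrier L} \<union>
      {\<mu> (replicate p x) \<ominus>\<^bsub>A\<^esub> \<mu> [pmap L x] | x. x \<in> carrier L})"

text \<open>
  \<open>u(L)\<close> as the free associative algebra on the set \<open>L\<close> modulo the two-sided ideal expressing that
  \<open>L \<longrightarrow> u(L)\<close> is \<open>F\<close>-linear, maps brackets to commutators, and the \<open>p\<close>-mapping to \<open>p\<close>-th powers
  (dividing by the first two kinds of relations gives the tensor algebra).
\<close>

definition res_envel ::
    "nat \<Rightarrow> ('f, 'z) ring_scheme \<Rightarrow> ('f, 'a, 'y) rlie_scheme \<Rightarrow> ('a list \<Rightarrow> 'f) set ring"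
  where "res_envel p F L =
    free_assoc F (carrier L) Quot (Idl\<^bsub>free_assoc F (carrier L)\<^esub> (envel_relations p F L))"

text \<open>
  A restricted \<open>L\<close>-module as a \<open>u(L)\<close>-module; the result does not depend on the representative \<open>a\<close>
  of the coset \<open>X\<close>.
\<close>

definition envel_module ::
    "('f, 'z) ring_scheme \<Rightarrow> ('f, 'a, 'm) lie_module \<Rightarrow> (('a list \<Rightarrow> 'f) set, 'm) module"
  where "envel_module F M =
    \<lparr>carrier = carrier M, mult = undefined, one = undefined, zero = \<zero>\<^bsub>M\<^esub>, add = add M,
     smult = (\<lambda>X m. let a = (SOME a. a \<in> X) in
       \<Oplus>\<^bsub>M\<^esub>w\<in>{w. a w \<noteq> \<zero>\<^bsub>F\<^esub>}. a w \<odot>\<^bsub>M\<^esub> foldr (lact M) w m)\<rparr>"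

definition trivial_resolution ::
    "nat \<Rightarrow> ('f, 'z) ring_scheme \<Rightarrow> ('f, 'a, 'y) rlie_scheme \<Rightarrow>
     (nat \<Rightarrow> (('a list \<Rightarrow> 'f) set, 'c) module) \<Rightarrow> (nat \<Rightarrow> 'c \<Rightarrow> 'c) \<Rightarrow> ('c \<Rightarrow> 'f) \<Rightarrow> bool"
  where "trivial_resolution p F L P d e \<longleftrightarrow>
    projective_resolution (res_envel p F L) P d e (envel_module F (trivial_module F))"

text \<open>
  \<open>H\<^sub>*\<^sup>n(L, M) = Ext\<^sup>n(F, M)\<close> over \<open>u(L)\<close>, computed by means of a projective resolution \<open>(P, d)\<close> of the
  trivial module; a left module over the ring of endomorphisms of \<open>M\<close>.
\<close>

definition res_cohomology ::
    "nat \<Rightarrow> ('f, 'z) ring_scheme \<Rightarrow> ('f, 'a, 'y) rlie_scheme \<Rightarrow>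
     (nat \<Rightarrow> (('a list \<Rightarrow> 'f) set, 'c) module) \<Rightarrow> (nat \<Rightarrow> 'c \<Rightarrow> 'c) \<Rightarrow>
     nat \<Rightarrow> ('f, 'a, 'm) lie_module \<Rightarrow> ('m \<Rightarrow> 'm, ('c \<Rightarrow> 'm) set) module"
  where "res_cohomology p F L P d n M = Ext_lmod (res_envel p F L) P d (envel_module F M) n"

section \<open>\<open>p\<close>-chief series\<close>

definition p_chief_series ::
    "('f, 'z) ring_scheme \<Rightarrow> ('f, 'a, 'y) rlie_scheme \<Rightarrow> nat \<Rightarrow> (nat \<Rightarrow> 'a set) \<Rightarrow> bool"
  where "p_chief_series F L n Ls \<longleftrightarrow>
    Ls 0 = {\<zero>\<^bsub>L\<^esub>} \<and> Ls n = carrier L \<and>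
    (\<forall>j\<le>n. p_ideal F L (Ls j)) \<and>
    (\<forall>j<n. Ls j \<subset> Ls (Suc j) \<and>
       minimal_p_ideal F (rlie_quot L (Ls j)) ((\<lambda>x. Ls j +>\<^bsub>L\<^esub> x) ` Ls (Suc j)))"

text \<open>\<open>J/I\<close> as an \<open>L\<close>-module via the adjoint action.\<close>

definition factor_module ::
    "('f, 'a, 'y) rlie_scheme \<Rightarrow> 'a set \<Rightarrow> 'a set \<Rightarrow> ('f, 'a, 'a set) lie_module"
  where "factor_module L I J =
    \<lparr>carrier = (\<lambda>x. I +>\<^bsub>L\<^esub> x) ` J, mult = undefined, one = undefined,
     zero = zero (rlie_quot L I), add = add (rlie_quot L I), smult = smult (rlie_quot L I),
     lact = (\<lambda>x X. bracket (rlie_quot L I) (I +>\<^bsub>L\<^esub> x) X)\<rparr>"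

definition strongly_abelian_factor :: "('f, 'a, 'y) rlie_scheme \<Rightarrow> 'a set \<Rightarrow> 'a set \<Rightarrow> bool"
  where "strongly_abelian_factor L I J \<longleftrightarrow>
    (\<forall>X\<in>(\<lambda>x. I +>\<^bsub>L\<^esub> x) ` J. \<forall>Y\<in>(\<lambda>x. I +>\<^bsub>L\<^esub> x) ` J.
       bracket (rlie_quot L I) X Y = \<zero>\<^bsub>rlie_quot L I\<^esub>) \<and>
    (\<forall>X\<in>(\<lambda>x. I +>\<^bsub>L\<^esub> x) ` J. pmap (rlie_quot L I) X = \<zero>\<^bsub>rlie_quot L I\<^esub>)"

text \<open>
  \<open>0 \<longrightarrow> J/I \<longrightarrow> L/I \<longrightarrow> L/J \<longrightarrow> 0\<close> splits in the category of restricted Lie algebras; the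
  projection \<open>L/I \<longrightarrow> L/J\<close> sends a coset \<open>X\<close> of \<open>I\<close> to the coset \<open>J + X\<close> of \<open>J\<close>.
\<close>

definition factor_splits ::
    "('f, 'z) ring_scheme \<Rightarrow> ('f, 'a, 'y) rlie_scheme \<Rightarrow> 'a set \<Rightarrow> 'a set \<Rightarrow> bool"
  where "factor_splits F L I J \<longleftrightarrow>
    (\<exists>\<sigma>\<in>restricted_lie_hom F (rlie_quot L J) (rlie_quot L I).
       \<forall>Y\<in>carrier (rlie_quot L J). J <+>\<^bsub>L\<^esub> \<sigma> Y = Y)"

text \<open>\<open>[L : S]\<^sub>p\<^sub>-\<^sub>s\<^sub>p\<^sub>l\<^sub>i\<^sub>t\<close> for the series \<open>Ls 0 \<subset> \<dots> \<subset> Ls n\<close>.\<close>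

definition p_split_mult ::
    "('f, 'z) ring_scheme \<Rightarrow> ('f, 'a, 'y) rlie_scheme \<Rightarrow> ('f, 'a, 'm, 'x) lie_module_scheme \<Rightarrow>
     nat \<Rightarrow> (nat \<Rightarrow> 'a set) \<Rightarrow> nat"
  where "p_split_mult F L S n Ls =
    card {j \<in> {1..n}. strongly_abelian_factor L (Ls (j - 1)) (Ls j) \<and>
       lie_module_iso F L (factor_module L (Ls (j - 1)) (Ls j)) S \<and>
       factor_splits F L (Ls (j - 1)) (Ls j)}"

end

theory Submission
  imports Defs
begin

text \<open>
  \<open>H\<^sup>1(L, S)\<close> is the space of restricted derivations \<open>L \<longrightarrow> S\<close> modulo the inner ones.  In these terms the
  theorem says how restricted derivations restrict to the members of a chief series: the difference of the
  two dimensions is cut into slices, one for each chief factor, and a slice has dimension one over the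
  centralizer \<open>D\<close> if the factor is strongly abelian, split and isomorphic to \<open>S\<close>, and is zero otherwise.

  \<^emph>\<open>Cohomology as derivations.\<close>  Let \<open>P\<^sub>1 \<longrightarrow> P\<^sub>0 \<longrightarrow> F\<close> be the end of a projective resolution over \<open>u(L)\<close>
  and \<open>q \<in> P\<^sub>0\<close> an element over \<open>1\<close>.  A cocycle on \<open>P\<^sub>1\<close> is a homomorphism on the kernel of \<open>P\<^sub>0 \<longrightarrow> F\<close>, and
  its values at the elements \<open>x q\<close> form a restricted derivation in \<open>x\<close>.  Coboundaries are exactly the
  cocycles that give inner derivations (\<open>coboundaries_eq\<close>).  Up to inner derivations every restricted
  derivation \<open>\<delta>\<close> occurs, by lifting \<open>P\<^sub>0 \<longrightarrow> F\<close> to the module \<open>S \<oplus> F\<close> with action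
  \<open>x(s, c) = (x s + c \<delta>(x), 0)\<close> (\<open>der_of_cocycle_surj\<close>).  For \<open>N = Ann\<^sub>L(S)\<close>, the derivations of \<open>L/N\<close> are
  those of \<open>L\<close> that vanish on \<open>N\<close> (\<open>pull_der\<close>), and these include the inner ones.  So the difference of the
  two dimensions is the dimension of all restricted derivations modulo those vanishing on \<open>N\<close>.

  \<^emph>\<open>Slices.\<close>  For a chief series \<open>L\<^sub>0 \<subset> \<dots> \<subset> L\<^sub>n\<close> let \<open>W\<^sub>j\<close> consist of the restricted derivations
  vanishing on \<open>L\<^sub>j \<inter> N\<close>.  Let \<open>\<delta> \<in> W\<^sub>j\<close> be outside \<open>W\<^sub>j\<^sub>+\<^sub>1\<close>.  Minimality of the factor and irreducibility
  of \<open>S\<close> force \<open>L\<^sub>j\<^sub>+\<^sub>1 \<subseteq> N\<close>, and \<open>\<delta>\<close> induces an isomorphism from \<open>L\<^sub>j\<^sub>+\<^sub>1/L\<^sub>j\<close> to \<open>S\<close>; the factor is then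
  strongly abelian, and the kernel of \<open>\<delta>\<close> is a restricted subalgebra that splits it
  (\<open>new_derivation_factor\<close>).  On \<open>L\<^sub>j\<^sub>+\<^sub>1\<close>, every element of \<open>W\<^sub>j\<close> is \<open>\<delta>\<close> followed by an element
  of \<open>D\<close> (\<open>new_derivation_rel_dim\<close>).  Conversely, the projection onto a split strongly abelian factor along its
  complement is a derivation; it is restricted because only one of Jacobson's terms survives in the
  \<open>p\<close>-th power of a sum (\<open>split_factor_derivation\<close>).

  \<^emph>\<open>Dimensions.\<close>  As \<open>D\<close> need not be commutative, dimensions over \<open>D\<close> are measured by chains of one-element
  extensions of submodules (\<open>rel_dim\<close>).  They are finite because \<open>S\<close> is finite-dimensional: in \<open>u(L)\<close> a long
  word in a basis of \<open>L\<close> is a combination of shorter ones (\<open>word_reducible\<close>).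
\<close>

section \<open>Modules over a noncommutative ring\<close>

lemma (in abelian_group) minus_eqI:
  "\<lbrakk>x \<oplus> y = z; x \<in> carrier G; y \<in> carrier G\<rbrakk> \<Longrightarrow> z \<ominus> y = x"
  by (auto simp: minus_eq a_assoc r_neg)

lemma (in abelian_group) minus_plus:
  "\<lbrakk>x \<in> carrier G; y \<in> carrier G\<rbrakk> \<Longrightarrow> (y \<ominus> x) \<oplus> x = y"
  by (simp add: minus_eq a_assoc l_neg)

lemma (in abelian_group) minus_eq_zero_iff:
  assumes "x \<in> carrier G" "y \<in> carrier G" shows "x \<ominus> y = \<zero> \<longleftrightarrow> x = y"
  using assms minus_plus[of y x] by (auto simp: minus_eq r_neg)

lemma (in module) left_module: "left_module R M"
  by unfold_locales (auto simp: smult_l_distr smult_r_distr smult_assoc1)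

context left_module begin

declare lsmult_closed [simp, intro]

lemma lsmult_zero_left [simp]:
  assumes "x \<in> carrier M" shows "\<zero>\<^bsub>R\<^esub> \<odot>\<^bsub>M\<^esub> x = \<zero>\<^bsub>M\<^esub>"
proof -
  have "\<zero>\<^bsub>R\<^esub> \<odot>\<^bsub>M\<^esub> x \<oplus>\<^bsub>M\<^esub> \<zero>\<^bsub>R\<^esub> \<odot>\<^bsub>M\<^esub> x = \<zero>\<^bsub>R\<^esub> \<odot>\<^bsub>M\<^esub> x"
    using lsmult_l_distr[of "\<zero>\<^bsub>R\<^esub>" "\<zero>\<^bsub>R\<^esub>" x] assms by simp
  then show ?thesis using assms by simp
qed

lemma lsmult_zero_right [simp]:
  assumes "a \<in> carrier R" shows "a \<odot>\<^bsub>M\<^esub> \<zero>\<^bsub>M\<^esub> = \<zero>\<^bsub>M\<^esub>"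
proof -
  have "a \<odot>\<^bsub>M\<^esub> \<zero>\<^bsub>M\<^esub> \<oplus>\<^bsub>M\<^esub> a \<odot>\<^bsub>M\<^esub> \<zero>\<^bsub>M\<^esub> = a \<odot>\<^bsub>M\<^esub> \<zero>\<^bsub>M\<^esub>"
    using lsmult_r_distr[of a "\<zero>\<^bsub>M\<^esub>" "\<zero>\<^bsub>M\<^esub>"] assms by simp
  then show ?thesis using assms by simp
qed

lemma lsmult_minus_left:
  assumes "a \<in> carrier R" "x \<in> carrier M" shows "(\<ominus>\<^bsub>R\<^esub> a) \<odot>\<^bsub>M\<^esub> x = \<ominus>\<^bsub>M\<^esub> (a \<odot>\<^bsub>M\<^esub> x)"
proof -
  have "(\<ominus>\<^bsub>R\<^esub> a) \<odot>\<^bsub>M\<^esub> x \<oplus>\<^bsub>M\<^esub> a \<odot>\<^bsub>M\<^esub> x = \<zero>\<^bsub>M\<^esub>"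
    using lsmult_l_distr[of "\<ominus>\<^bsub>R\<^esub> a" a x] assms by (simp add: R.l_neg)
  then show ?thesis using assms by (simp add: M.minus_equality)
qed

lemma lsmult_minus_right:
  assumes "a \<in> carrier R" "x \<in> carrier M" shows "a \<odot>\<^bsub>M\<^esub> (\<ominus>\<^bsub>M\<^esub> x) = \<ominus>\<^bsub>M\<^esub> (a \<odot>\<^bsub>M\<^esub> x)"
proof -
  have "a \<odot>\<^bsub>M\<^esub> (\<ominus>\<^bsub>M\<^esub> x) \<oplus>\<^bsub>M\<^esub> a \<odot>\<^bsub>M\<^esub> x = \<zero>\<^bsub>M\<^esub>"
    using lsmult_r_distr[of a "\<ominus>\<^bsub>M\<^esub> x" x] assms by (simp add: M.l_neg)
  then show ?thesis using assms by (simp add: M.minus_equality)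
qed

lemma lsubmoduleI:
  assumes "U \<subseteq> carrier M" "\<zero>\<^bsub>M\<^esub> \<in> U"
    and "\<And>x y. x \<in> U \<Longrightarrow> y \<in> U \<Longrightarrow> x \<oplus>\<^bsub>M\<^esub> y \<in> U"
    and "\<And>a x. a \<in> carrier R \<Longrightarrow> x \<in> U \<Longrightarrow> a \<odot>\<^bsub>M\<^esub> x \<in> U"
  shows "submodule U R M"
proof -
  have neg: "\<ominus>\<^bsub>M\<^esub> x \<in> U" if "x \<in> U" for x
  proof -
    have "(\<ominus>\<^bsub>R\<^esub> \<one>\<^bsub>R\<^esub>) \<odot>\<^bsub>M\<^esub> x \<in> U" using that assms(4) by simp
    then show ?thesis using that assms(1) lsmult_minus_left[of "\<one>\<^bsub>R\<^esub>" x] lsmult_one[of x] by auto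
  qed
  show ?thesis
    using assms neg unfolding submodule_def submodule_axioms_def
    by (auto intro!: subgroup.intro simp: a_inv_def[symmetric])
qed

end

lemma submoduleD:
  assumes "submodule U R M"
  shows "U \<subseteq> carrier M" "\<zero>\<^bsub>M\<^esub> \<in> U"
    "\<And>x y. x \<in> U \<Longrightarrow> y \<in> U \<Longrightarrow> x \<oplus>\<^bsub>M\<^esub> y \<in> U"
    "\<And>a x. a \<in> carrier R \<Longrightarrow> x \<in> U \<Longrightarrow> a \<odot>\<^bsub>M\<^esub> x \<in> U"
    "\<And>x. x \<in> U \<Longrightarrow> \<ominus>\<^bsub>M\<^esub> x \<in> U"
    "\<And>x y. x \<in> U \<Longrightarrow> y \<in> U \<Longrightarrow> x \<ominus>\<^bsub>M\<^esub> y \<in> U"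
proof -
  interpret submodule U R M by fact
  show "U \<subseteq> carrier M" "\<zero>\<^bsub>M\<^esub> \<in> U" using subset one_closed by auto
  show a: "\<And>x y. x \<in> U \<Longrightarrow> y \<in> U \<Longrightarrow> x \<oplus>\<^bsub>M\<^esub> y \<in> U" using m_closed by simp
  show "\<And>a x. a \<in> carrier R \<Longrightarrow> x \<in> U \<Longrightarrow> a \<odot>\<^bsub>M\<^esub> x \<in> U" by simp
  show b: "\<And>x. x \<in> U \<Longrightarrow> \<ominus>\<^bsub>M\<^esub> x \<in> U" using m_inv_closed by (simp add: a_inv_def)
  show "\<And>x y. x \<in> U \<Longrightarrow> y \<in> U \<Longrightarrow> x \<ominus>\<^bsub>M\<^esub> y \<in> U" using a b by (simp add: a_minus_def)
qed

lemma lmod_homD: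
  assumes "f \<in> lmod_hom R M N"
  shows "f \<in> carrier M \<rightarrow>\<^sub>E carrier N"
    "\<And>x. x \<in> carrier M \<Longrightarrow> f x \<in> carrier N"
    "\<And>x y. x \<in> carrier M \<Longrightarrow> y \<in> carrier M \<Longrightarrow> f (x \<oplus>\<^bsub>M\<^esub> y) = f x \<oplus>\<^bsub>N\<^esub> f y"
    "\<And>r x. r \<in> carrier R \<Longrightarrow> x \<in> carrier M \<Longrightarrow> f (r \<odot>\<^bsub>M\<^esub> x) = r \<odot>\<^bsub>N\<^esub> f x"
  using assms unfolding lmod_hom_def by auto

lemma additive_zero:
  assumes "abelian_group M" "abelian_group N"
    "\<And>x. x \<in> carrier M \<Longrightarrow> f x \<in> carrier N"
    "\<And>x y. x \<in> carrier M \<Longrightarrow> y \<in> carrier M \<Longrightarrow> f (x \<oplus>\<^bsub>M\<^esub> y) = f x \<oplus>\<^bsub>N\<^esub> f y"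
  shows "f \<zero>\<^bsub>M\<^esub> = \<zero>\<^bsub>N\<^esub>"
proof -
  interpret M: abelian_group M by fact
  interpret N: abelian_group N by fact
  have "f \<zero>\<^bsub>M\<^esub> \<oplus>\<^bsub>N\<^esub> f \<zero>\<^bsub>M\<^esub> = f \<zero>\<^bsub>M\<^esub>" using assms(4)[of "\<zero>\<^bsub>M\<^esub>" "\<zero>\<^bsub>M\<^esub>"] by simp
  then show ?thesis using assms(3)[OF M.zero_closed] by simp
qed

lemma additive_minus:
  assumes "abelian_group M" "abelian_group N"
    and c: "\<And>x. x \<in> carrier M \<Longrightarrow> f x \<in> carrier N"
    and a: "\<And>x y. x \<in> carrier M \<Longrightarrow> y \<in> carrier M \<Longrightarrow> f (x \<oplus>\<^bsub>M\<^esub> y) = f x \<oplus>\<^bsub>N\<^esub> f y"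
    and x: "x \<in> carrier M"
  shows "f (\<ominus>\<^bsub>M\<^esub> x) = \<ominus>\<^bsub>N\<^esub> f x" and "y \<in> carrier M \<Longrightarrow> f (y \<ominus>\<^bsub>M\<^esub> x) = f y \<ominus>\<^bsub>N\<^esub> f x"
proof -
  interpret M: abelian_group M by fact
  interpret N: abelian_group N by fact
  have "f (\<ominus>\<^bsub>M\<^esub> x) \<oplus>\<^bsub>N\<^esub> f x = \<zero>\<^bsub>N\<^esub>"
    using a[of "\<ominus>\<^bsub>M\<^esub> x" x] x additive_zero[OF assms(1-4)] by (simp add: M.l_neg)
  then show m: "f (\<ominus>\<^bsub>M\<^esub> x) = \<ominus>\<^bsub>N\<^esub> f x" using c x by (simp add: N.minus_equality)
  show "y \<in> carrier M \<Longrightarrow> f (y \<ominus>\<^bsub>M\<^esub> x) = f y \<ominus>\<^bsub>N\<^esub> f x"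
    using a[of y "\<ominus>\<^bsub>M\<^esub> x"] x m by (simp add: a_minus_def)
qed

lemma lmod_hom_zero:
  "\<lbrakk>left_module R M; left_module R N; f \<in> lmod_hom R M N\<rbrakk> \<Longrightarrow> f \<zero>\<^bsub>M\<^esub> = \<zero>\<^bsub>N\<^esub>"
  by (rule additive_zero) (auto simp: left_module_def dest: lmod_homD)

lemma lmod_hom_minus:
  "\<lbrakk>left_module R M; left_module R N; f \<in> lmod_hom R M N; x \<in> carrier M; y \<in> carrier M\<rbrakk> \<Longrightarrow>
    f (x \<ominus>\<^bsub>M\<^esub> y) = f x \<ominus>\<^bsub>N\<^esub> f y"
  by (rule additive_minus(2)) (auto simp: left_module_def dest: lmod_homD)

section \<open>Relative dimension\<close>

definition adjoin :: "('r, 'z) ring_scheme \<Rightarrow> ('r, 'm, 'y) module_scheme \<Rightarrow> 'm set \<Rightarrow> 'm \<Rightarrow> 'm set"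
  where "adjoin R M U b = {u \<oplus>\<^bsub>M\<^esub> r \<odot>\<^bsub>M\<^esub> b | u r. u \<in> U \<and> r \<in> carrier R}"

text \<open>
  \<open>rel_dim R M U W n\<close> says that \<open>W/U\<close> has dimension \<open>n\<close>, without forming the quotient: \<open>W\<close> is reached
  from \<open>U\<close> by \<open>n\<close> one-element extensions.  Chains suit the filtrations below better than bases, since
  they concatenate (\<open>rel_dim_trans\<close>) and pull back along homomorphisms (\<open>rel_dim_vimage\<close>).
\<close>

inductive rel_dim ::
  "('r, 'z) ring_scheme \<Rightarrow> ('r, 'm, 'y) module_scheme \<Rightarrow> 'm set \<Rightarrow> 'm set \<Rightarrow> nat \<Rightarrow> bool"
  for R M
  where
    refl: "submodule U R M \<Longrightarrow> rel_dim R M U U 0"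
  | step: "\<lbrakk>rel_dim R M U H n; b \<in> carrier M; b \<notin> H\<rbrakk> \<Longrightarrow> rel_dim R M U (adjoin R M H b) (Suc n)"

context left_module begin

lemma adjoin_submodule:
  assumes U: "submodule U R M" and b: "b \<in> carrier M"
  shows "submodule (adjoin R M U b) R M"
proof (rule lsubmoduleI)
  note D = submoduleD[OF U]
  show "adjoin R M U b \<subseteq> carrier M" unfolding adjoin_def using D(1) b by auto
  show "\<zero>\<^bsub>M\<^esub> \<in> adjoin R M U b"
    unfolding adjoin_def using D(2) b by (auto intro!: exI[of _ "\<zero>\<^bsub>M\<^esub>"] exI[of _ "\<zero>\<^bsub>R\<^esub>"])
  show "x \<oplus>\<^bsub>M\<^esub> y \<in> adjoin R M U b" if xy: "x \<in> adjoin R M U b" "y \<in> adjoin R M U b" for x y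
  proof -
    obtain u r v s where *: "x = u \<oplus>\<^bsub>M\<^esub> r \<odot>\<^bsub>M\<^esub> b" "y = v \<oplus>\<^bsub>M\<^esub> s \<odot>\<^bsub>M\<^esub> b"
      "u \<in> U" "v \<in> U" "r \<in> carrier R" "s \<in> carrier R" using xy unfolding adjoin_def by auto
    have "x \<oplus>\<^bsub>M\<^esub> y = (u \<oplus>\<^bsub>M\<^esub> v) \<oplus>\<^bsub>M\<^esub> (r \<oplus>\<^bsub>R\<^esub> s) \<odot>\<^bsub>M\<^esub> b"
      using * b D(1) by (auto simp: lsmult_l_distr M.a_ac subset_eq)
    then show ?thesis unfolding adjoin_def using * D(3) by blast
  qed
  show "a \<odot>\<^bsub>M\<^esub> x \<in> adjoin R M U b" if ax: "a \<in> carrier R" "x \<in> adjoin R M U b" for a x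
  proof -
    obtain u r where *: "x = u \<oplus>\<^bsub>M\<^esub> r \<odot>\<^bsub>M\<^esub> b" "u \<in> U" "r \<in> carrier R"
      using ax unfolding adjoin_def by auto
    have "a \<odot>\<^bsub>M\<^esub> x = a \<odot>\<^bsub>M\<^esub> u \<oplus>\<^bsub>M\<^esub> (a \<otimes>\<^bsub>R\<^esub> r) \<odot>\<^bsub>M\<^esub> b"
      using * b D(1) ax(1) by (auto simp: lsmult_r_distr lsmult_assoc subset_eq)
    then show ?thesis unfolding adjoin_def using * D(4) ax(1) by blast
  qed
qed

lemma adjoin_base: "submodule U R M \<Longrightarrow> b \<in> carrier M \<Longrightarrow> U \<subseteq> adjoin R M U b"
  unfolding adjoin_def using submoduleD(1)[of U R M] by (force intro: exI[of _ "\<zero>\<^bsub>R\<^esub>"])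

lemma adjoin_new: "submodule U R M \<Longrightarrow> b \<in> carrier M \<Longrightarrow> b \<in> adjoin R M U b"
  unfolding adjoin_def using submoduleD(2)[of U R M]
  by (auto intro!: exI[of _ "\<zero>\<^bsub>M\<^esub>"] exI[of _ "\<one>\<^bsub>R\<^esub>"] simp: lsmult_one)

lemma adjoin_least: "\<lbrakk>submodule W R M; U \<subseteq> W; b \<in> W\<rbrakk> \<Longrightarrow> adjoin R M U b \<subseteq> W"
  unfolding adjoin_def using submoduleD[of W R M] by blast

lemma adjoin_commute:
  assumes "submodule U R M" "a \<in> carrier M" "b \<in> carrier M"
  shows "adjoin R M (adjoin R M U a) b = adjoin R M (adjoin R M U b) a"
proof -
  have "adjoin R M (adjoin R M U a) b \<subseteq> adjoin R M (adjoin R M U b) a"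
    if ab: "a \<in> carrier M" "b \<in> carrier M" for a b
  proof -
    note U = assms(1) and Ub = adjoin_submodule[OF assms(1) ab(2)]
    have "a \<in> adjoin R M (adjoin R M U b) a" "b \<in> adjoin R M (adjoin R M U b) a"
      "U \<subseteq> adjoin R M (adjoin R M U b) a"
      using adjoin_new[OF Ub ab(1)] adjoin_base[OF Ub ab(1)] adjoin_new[OF U ab(2)] adjoin_base[OF U ab(2)]
      by blast+
    then show ?thesis by (simp add: adjoin_least adjoin_submodule[OF Ub ab(1)])
  qed
  then show ?thesis using assms by blast
qed

lemma rel_dim_submodules:
  assumes "rel_dim R M U W n"
  shows "submodule U R M" "submodule W R M" "U \<subseteq> W"
proof -
  have "submodule U R M \<and> submodule W R M \<and> U \<subseteq> W" using assms
  proof induction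
    case (step U H n b)
    then show ?case using adjoin_submodule[of H b] adjoin_base[of H b] by blast
  qed simp
  then show "submodule U R M" "submodule W R M" "U \<subseteq> W" by auto
qed

lemma rel_dim_trans: "rel_dim R M V W b \<Longrightarrow> rel_dim R M U V a \<Longrightarrow> rel_dim R M U W (a + b)"
  by (induction rule: rel_dim.induct) (auto intro: rel_dim.step)

lemma rel_dim_first_step:
  "rel_dim R M U W (Suc m) \<Longrightarrow> \<exists>v\<in>W. v \<notin> U \<and> rel_dim R M (adjoin R M U v) W m"
proof (induction m arbitrary: W)
  case 0
  then obtain H b where *: "rel_dim R M U H 0" "W = adjoin R M H b" "b \<in> carrier M" "b \<notin> H"
    by (auto elim: rel_dim.cases)
  then have "H = U" "submodule U R M" using rel_dim.cases[OF *(1)] by auto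
  with * show ?case by (auto intro!: bexI[of _ b] rel_dim.refl adjoin_submodule adjoin_new)
next
  case (Suc m)
  then obtain H b where *: "rel_dim R M U H (Suc m)" "W = adjoin R M H b" "b \<in> carrier M" "b \<notin> H"
    by (auto elim: rel_dim.cases)
  from Suc.IH[OF *(1)] obtain v where v: "v \<in> H" "v \<notin> U" "rel_dim R M (adjoin R M U v) H m" by auto
  then show ?case using * rel_dim_submodules[OF *(1)] adjoin_base[of H b] rel_dim.step[OF v(3) *(3,4)] by auto
qed

end

lemma rel_dim_zero: "rel_dim R M U W 0 \<Longrightarrow> W = U"
  by (auto elim: rel_dim.cases)

locale division_module = left_module +
  assumes left_inverse: "a \<in> carrier R \<Longrightarrow> a \<noteq> \<zero>\<^bsub>R\<^esub> \<Longrightarrow> \<exists>b\<in>carrier R. b \<otimes>\<^bsub>R\<^esub> a = \<one>\<^bsub>R\<^esub>"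
    and one_neq_zero: "\<one>\<^bsub>R\<^esub> \<noteq> \<zero>\<^bsub>R\<^esub>"
begin

lemma smult_in_submodule:
  assumes "submodule U R M" "r \<in> carrier R" "r \<noteq> \<zero>\<^bsub>R\<^esub>" "x \<in> carrier M" "r \<odot>\<^bsub>M\<^esub> x \<in> U"
  shows "x \<in> U"
proof -
  obtain s where s: "s \<in> carrier R" "s \<otimes>\<^bsub>R\<^esub> r = \<one>\<^bsub>R\<^esub>" using left_inverse assms by blast
  have "s \<odot>\<^bsub>M\<^esub> (r \<odot>\<^bsub>M\<^esub> x) \<in> U" by (rule submoduleD(4)[OF assms(1) s(1) assms(5)])
  moreover have "s \<odot>\<^bsub>M\<^esub> (r \<odot>\<^bsub>M\<^esub> x) = x"
    using s assms lsmult_assoc[of s r x] lsmult_one[of x] by metis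
  ultimately show ?thesis by simp
qed

text \<open>
  The Steinitz exchange step: from \<open>v = u + r b\<close> with \<open>v \<notin> U\<close> one has \<open>r \<noteq> 0\<close>, hence \<open>b\<close> is a
  combination of \<open>v\<close> and \<open>u\<close>.
\<close>

lemma adjoin_exchange:
  assumes U: "submodule U R M" and b: "b \<in> carrier M" and v: "v \<in> adjoin R M U b" "v \<notin> U"
  shows "adjoin R M U v = adjoin R M U b"
proof -
  have vc: "v \<in> carrier M" using submoduleD(1)[OF adjoin_submodule[OF U b]] v by auto
  obtain u r where *: "v = u \<oplus>\<^bsub>M\<^esub> r \<odot>\<^bsub>M\<^esub> b" "u \<in> U" "r \<in> carrier R" using v unfolding adjoin_def by auto
  have uc: "u \<in> carrier M" using * submoduleD(1)[OF U] by auto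
  have r0: "r \<noteq> \<zero>\<^bsub>R\<^esub>" using * uc v b by auto
  have "r \<odot>\<^bsub>M\<^esub> b = v \<ominus>\<^bsub>M\<^esub> u" using * uc b by (simp add: M.minus_eq M.a_ac M.r_neg M.r_neg1 M.r_neg2)
  then have "r \<odot>\<^bsub>M\<^esub> b \<in> adjoin R M U v"
    using submoduleD(6)[OF adjoin_submodule[OF U vc]] adjoin_new[OF U vc] adjoin_base[OF U vc] *(2) by (metis subsetD)
  then have "b \<in> adjoin R M U v" using smult_in_submodule adjoin_submodule[OF U vc] * r0 b by blast
  then show ?thesis
    using v adjoin_least[OF adjoin_submodule[OF U vc] adjoin_base[OF U vc]]
      adjoin_least[OF adjoin_submodule[OF U b] adjoin_base[OF U b]] by blast
qed

text \<open>
  If \<open>v\<close> lies outside the top of a chain, it can be added to every member without collapsing a step: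
  a collapse would, by exchange, put \<open>v\<close> into the next member of the chain.
\<close>

lemma rel_dim_adjoin_both:
  "rel_dim R M U H n \<Longrightarrow> v \<in> carrier M \<Longrightarrow> v \<notin> H \<Longrightarrow> rel_dim R M (adjoin R M U v) (adjoin R M H v) n"
proof (induction rule: rel_dim.induct)
  case (refl U) then show ?case by (intro rel_dim.refl adjoin_submodule)
next
  case (step U H n b)
  have H: "submodule H R M" using rel_dim_submodules step by blast
  have vH: "v \<notin> H" using step.prems(2) adjoin_base[OF H step.hyps(2)] by auto
  have "b \<notin> adjoin R M H v"
  proof
    assume "b \<in> adjoin R M H v"
    then have "adjoin R M H b = adjoin R M H v" using adjoin_exchange H step by blast
    then show False using step.prems adjoin_new[OF H step.prems(1)] by simp
  qed
  then have "rel_dim R M (adjoin R M U v) (adjoin R M (adjoin R M H v) b) (Suc n)"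
    using rel_dim.step[OF step.IH[OF step.prems(1) vH] step.hyps(2)] by simp
  then show ?case using adjoin_commute[OF H step.hyps(2) step.prems(1)] by simp
qed

text \<open>
  An element \<open>v \<in> W - U\<close> enters the chain at exactly one step; adding \<open>v\<close> at the bottom instead makes that
  step superfluous and keeps the others.
\<close>

lemma rel_dim_drop:
  "rel_dim R M U W n \<Longrightarrow> v \<in> W \<Longrightarrow> v \<notin> U \<Longrightarrow> \<exists>k. n = Suc k \<and> rel_dim R M (adjoin R M U v) W k"
proof (induction rule: rel_dim.induct)
  case (refl U) then show ?case by blast
next
  case (step U H n b)
  have H: "submodule H R M" and W: "submodule (adjoin R M H b) R M"
    using rel_dim_submodules step adjoin_submodule by blast+
  have vc: "v \<in> carrier M" using submoduleD(1)[OF W] step by blast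
  show ?case
  proof (cases "v \<in> H")
    case True
    then show ?thesis using step by (auto intro: rel_dim.step)
  next
    case False
    then have "adjoin R M H v = adjoin R M H b" using adjoin_exchange H step by blast
    then show ?thesis using rel_dim_adjoin_both[OF step.hyps(1) vc False] by simp
  qed
qed

text \<open>
  Invariance of dimension: the first step of one chain can be dropped from the other.
\<close>

lemma rel_dim_unique: "rel_dim R M U W n \<Longrightarrow> rel_dim R M U W m \<Longrightarrow> n = m"
proof (induction m arbitrary: U n)
  case 0
  have "W = U" using 0(2) by (rule rel_dim_zero)
  then show ?case using 0(1)
  proof (cases n)
    case (Suc k)
    then show ?thesis using rel_dim_first_step[of U W k] 0(1) \<open>W = U\<close> by auto
  qed simp
next
  case (Suc m)
  obtain v where v: "v \<in> W" "v \<notin> U" "rel_dim R M (adjoin R M U v) W m"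
    using rel_dim_first_step[OF Suc.prems(2)] by auto
  obtain k where k: "n = Suc k" "rel_dim R M (adjoin R M U v) W k"
    using rel_dim_drop[OF Suc.prems(1) v(1,2)] by auto
  then show ?case using Suc.IH v by auto
qed

lemma rel_dim_upper:
  "rel_dim R M U W n \<Longrightarrow> submodule V R M \<Longrightarrow> U \<subseteq> V \<Longrightarrow> V \<subseteq> W \<Longrightarrow> \<exists>k. rel_dim R M V W k"
proof (induction n arbitrary: U)
  case 0
  then show ?case using rel_dim_zero[of R M U W] by (auto intro: exI[of _ 0])
next
  case (Suc n)
  show ?case
  proof (cases "V = U")
    case False
    then obtain v where v: "v \<in> V" "v \<notin> U" using Suc by auto
    then obtain k where "rel_dim R M (adjoin R M U v) W n" using rel_dim_drop[OF Suc.prems(1), of v] Suc by auto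
    then show ?thesis using Suc v adjoin_least by blast
  qed (use Suc in blast)
qed

end

text \<open>
  Taking preimages of the members of a chain makes each step either trivial or again a one-element
  extension, because \<open>H + R b\<close> can be generated over \<open>H\<close> by any of its elements outside \<open>H\<close>.  No step
  becomes trivial if the image of \<open>f\<close> meets every coset of \<open>U\<close> in \<open>W\<close>.
\<close>

lemma rel_dim_vimage:
  assumes M: "division_module R M" and N: "division_module R N" and f: "f \<in> lmod_hom R M N"
    and d: "rel_dim R N U W n"
  defines "pre \<equiv> \<lambda>X. {x \<in> carrier M. f x \<in> X}"
  shows "\<exists>m. rel_dim R M (pre U) (pre W) m \<and> ((\<forall>w\<in>W. \<exists>x\<in>carrier M. f x \<ominus>\<^bsub>N\<^esub> w \<in> U) \<longrightarrow> m = n)"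
  using d
proof (induction rule: rel_dim.induct)
  interpret M: division_module R M by fact
  interpret N: division_module R N by fact
  note fD = lmod_homD[OF f]
  have f0: "f \<zero>\<^bsub>M\<^esub> = \<zero>\<^bsub>N\<^esub>" using lmod_hom_zero M.left_module_axioms N.left_module_axioms f by blast
  have pre_sub: "submodule (pre U) R M" if "submodule U R N" for U
    by (rule M.lsubmoduleI) (use submoduleD[OF that] fD f0 in \<open>auto simp: pre_def\<close>)
  {
    case (refl U)
    then show ?case by (auto intro!: exI[of _ 0] rel_dim.refl pre_sub)
  next
    case (step U H n b)
    from step.IH obtain m where m: "rel_dim R M (pre U) (pre H) m"
      "(\<forall>w\<in>H. \<exists>x\<in>carrier M. f x \<ominus>\<^bsub>N\<^esub> w \<in> U) \<longrightarrow> m = n" by auto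
    have H: "submodule H R N" and U: "submodule U R N" and UH: "U \<subseteq> H"
      using N.rel_dim_submodules step by blast+
    have HW: "H \<subseteq> adjoin R N H b" using N.adjoin_base H step by blast
    have bW: "b \<in> adjoin R N H b" using N.adjoin_new H step by blast
    have W: "submodule (adjoin R N H b) R N" using N.adjoin_submodule H step by blast
    show ?case
    proof (cases "pre (adjoin R N H b) \<subseteq> pre H")
      case True
      then have eq: "pre (adjoin R N H b) = pre H" using HW by (auto simp: pre_def)
      have "\<not> (\<exists>x\<in>carrier M. f x \<ominus>\<^bsub>N\<^esub> b \<in> U)"
      proof safe
        fix x assume x: "x \<in> carrier M" "f x \<ominus>\<^bsub>N\<^esub> b \<in> U"
        have "(f x \<ominus>\<^bsub>N\<^esub> b) \<oplus>\<^bsub>N\<^esub> b \<in> adjoin R N H b"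
          using submoduleD(3)[OF W] x UH HW bW by blast
        then have "x \<in> pre (adjoin R N H b)"
          using x fD(2)[OF x(1)] step.hyps(2) by (simp add: pre_def N.minus_eq N.a_assoc N.l_neg)
        then have "f x \<in> H" using True by (auto simp: pre_def)
        then have "f x \<ominus>\<^bsub>N\<^esub> (f x \<ominus>\<^bsub>N\<^esub> b) \<in> H" using submoduleD(6)[OF H] x UH by blast
        then have "b \<in> H" using fD(2)[OF x(1)] step.hyps(2)
          by (simp add: N.minus_eq N.minus_add N.r_neg2)
        then show False using step by simp
      qed
      then show ?thesis using m eq bW by (intro exI[of _ m]) auto
    next
      case False
      then obtain c where c: "c \<in> carrier M" "f c \<in> adjoin R N H b" "f c \<notin> H" by (auto simp: pre_def)
      have ad: "adjoin R N H (f c) = adjoin R N H b" using N.adjoin_exchange H c step by blast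
      have "pre (adjoin R N H b) = adjoin R M (pre H) c"
      proof
        show "adjoin R M (pre H) c \<subseteq> pre (adjoin R N H b)"
          by (rule M.adjoin_least) (use pre_sub W HW c in \<open>auto simp: pre_def\<close>)
        show "pre (adjoin R N H b) \<subseteq> adjoin R M (pre H) c"
        proof
          fix x assume "x \<in> pre (adjoin R N H b)"
          then obtain h r where x: "x \<in> carrier M" "f x = h \<oplus>\<^bsub>N\<^esub> r \<odot>\<^bsub>N\<^esub> f c" "h \<in> H" "r \<in> carrier R"
            unfolding ad[symmetric] by (auto simp: pre_def adjoin_def)
          have hc: "h \<in> carrier N" using x submoduleD(1)[OF H] by auto
          have "f (x \<ominus>\<^bsub>M\<^esub> r \<odot>\<^bsub>M\<^esub> c) = f x \<ominus>\<^bsub>N\<^esub> r \<odot>\<^bsub>N\<^esub> f c"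
            using lmod_hom_minus[OF M.left_module_axioms N.left_module_axioms f] x c fD by simp
          also have "\<dots> = h" using x hc fD(2)[OF c(1)] by (simp add: N.minus_eq N.a_assoc N.r_neg)
          finally have "x \<ominus>\<^bsub>M\<^esub> r \<odot>\<^bsub>M\<^esub> c \<in> pre H" using x c by (simp add: pre_def)
          moreover have "x = (x \<ominus>\<^bsub>M\<^esub> r \<odot>\<^bsub>M\<^esub> c) \<oplus>\<^bsub>M\<^esub> r \<odot>\<^bsub>M\<^esub> c"
            using x c by (simp add: M.minus_eq M.a_assoc M.l_neg)
          ultimately show "x \<in> adjoin R M (pre H) c" unfolding adjoin_def using x by blast
        qed
      qed
      moreover have "rel_dim R M (pre U) (adjoin R M (pre H) c) (Suc m)"
        by (rule rel_dim.step) (use m c in \<open>auto simp: pre_def\<close>)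
      ultimately show ?thesis using m HW by (intro exI[of _ "Suc m"]) auto
    qed
  }
qed

section \<open>Finite linear combinations and bases\<close>

text \<open>
  One notion of finite linear combination serves three purposes: bases of modules, maps out of free
  modules, and the action of noncommutative polynomials on a Lie module.  The family \<open>y\<close> is indexed
  separately from its values for this reason.
\<close>

definition lin_comb :: "('r, 'z) ring_scheme \<Rightarrow> ('r, 'm, 'y) module_scheme \<Rightarrow> ('i \<Rightarrow> 'm) \<Rightarrow> ('i \<Rightarrow> 'r) \<Rightarrow> 'm"
  where "lin_comb R M y f = (\<Oplus>\<^bsub>M\<^esub>k\<in>{k. f k \<noteq> \<zero>\<^bsub>R\<^esub>}. f k \<odot>\<^bsub>M\<^esub> y k)"

definition fsingle :: "('r, 'z) ring_scheme \<Rightarrow> 'i \<Rightarrow> 'r \<Rightarrow> 'i \<Rightarrow> 'r"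
  where "fsingle R k r = (\<lambda>i. if i = k then r else \<zero>\<^bsub>R\<^esub>)"

lemma free_lmod_simps [simp]:
  "zero (free_lmod R I) = (\<lambda>i. \<zero>\<^bsub>R\<^esub>)"
  "add (free_lmod R I) = (\<lambda>f g i. f i \<oplus>\<^bsub>R\<^esub> g i)"
  "smult (free_lmod R I) = (\<lambda>r f i. r \<otimes>\<^bsub>R\<^esub> f i)"
  by (simp_all add: free_lmod_def)

lemma free_lmod_carrier:
  "f \<in> carrier (free_lmod R I) \<longleftrightarrow>
    (\<forall>i. f i \<in> carrier R) \<and> (\<forall>i. i \<notin> I \<longrightarrow> f i = \<zero>\<^bsub>R\<^esub>) \<and> finite {i. f i \<noteq> \<zero>\<^bsub>R\<^esub>}"
  by (simp add: free_lmod_def)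

lemma (in ring) free_lmod_left_module: "left_module R (free_lmod R (I :: 'c set))"
proof -
  have fin: "finite {i. g i \<noteq> \<zero>}" if "finite {i. f i \<noteq> \<zero>}" "\<And>i. f i = \<zero> \<Longrightarrow> g i = \<zero>" for f g :: "'c \<Rightarrow> 'a"
    by (rule finite_subset[OF _ that(1)]) (use that(2) in blast)
  have fin2: "finite {i. f i \<oplus> g i \<noteq> \<zero>}" if "finite {i. f i \<noteq> \<zero>}" "finite {i. g i \<noteq> \<zero>}" for f g :: "'c \<Rightarrow> 'a"
    by (rule finite_subset[OF _ finite_UnI[OF that]]) auto
  show ?thesis
  proof (intro left_module.intro left_module_axioms.intro)
    show "ring R" by (rule ring_axioms)
    show "abelian_group (free_lmod R I)"
    proof (rule abelian_groupI)
      fix x assume x: "x \<in> carrier (free_lmod R I)"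
      show "\<exists>y\<in>carrier (free_lmod R I). y \<oplus>\<^bsub>free_lmod R I\<^esub> x = \<zero>\<^bsub>free_lmod R I\<^esub>"
        by (rule bexI[of _ "\<lambda>i. \<ominus> x i"]) (use x in \<open>auto simp: free_lmod_carrier l_neg intro!: fin[of x]\<close>)
    qed (auto simp: free_lmod_carrier a_ac intro!: fin2)
  qed (auto simp: free_lmod_carrier l_distr r_distr m_assoc elim!: fin)
qed

lemma (in ring) fsingle_carrier: "k \<in> I \<Longrightarrow> r \<in> carrier R \<Longrightarrow> fsingle R k r \<in> carrier (free_lmod R I)"
  unfolding free_lmod_carrier fsingle_def by (auto intro: finite_subset[of _ "{k}"])

text \<open>
  Finitely supported functions are built up from the zero function by adding one value at a time, so
  that additive statements need to be checked on functions supported at one point only.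
\<close>

lemma (in ring) free_lmod_induct [consumes 1, case_names zero add]:
  assumes "f \<in> carrier (free_lmod R I)"
    and z: "Q (\<lambda>i. \<zero>)"
    and s: "\<And>k r g. \<lbrakk>k \<in> I; r \<in> carrier R; g \<in> carrier (free_lmod R I); Q g\<rbrakk> \<Longrightarrow> Q (\<lambda>i. fsingle R k r i \<oplus> g i)"
  shows "Q f"
proof -
  have "\<forall>f. f \<in> carrier (free_lmod R I) \<and> {i. f i \<noteq> \<zero>} \<subseteq> A \<longrightarrow> Q f" if "finite A" for A
    using that
  proof (induction A)
    case empty
    then show ?case
    proof safe
      fix f assume "f \<in> carrier (free_lmod R I)" "{i. f i \<noteq> \<zero>} \<subseteq> {}"
      then have "f = (\<lambda>i. \<zero>)" by auto
      then show "Q f" using z by simp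
    qed
  next
    case (insert a A)
    show ?case
    proof safe
      fix f assume f: "f \<in> carrier (free_lmod R I)" "{i. f i \<noteq> \<zero>} \<subseteq> insert a A"
      show "Q f"
      proof (cases "f a = \<zero>")
        case True
        then show ?thesis using insert f by blast
      next
        case False
        define g where "g = f(a := \<zero>)"
        have "{i. g i \<noteq> \<zero>} \<subseteq> {i. f i \<noteq> \<zero>}" by (auto simp: g_def)
        then have g: "g \<in> carrier (free_lmod R I)"
          using f(1) finite_subset[of "{i. g i \<noteq> \<zero>}"] unfolding free_lmod_carrier by (simp add: g_def)
        have "{i. g i \<noteq> \<zero>} \<subseteq> A" using f(2) by (auto simp: g_def)
        then have "Q g" using insert.IH g by blast
        moreover have "(\<lambda>i. fsingle R a (f a) i \<oplus> g i) = f"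
          using f(1) by (auto simp: g_def fsingle_def free_lmod_carrier)
        ultimately show ?thesis using s[of a "f a" g] g False f(1) by (auto simp: free_lmod_carrier)
      qed
    qed
  qed
  then show ?thesis using assms(1) by (auto simp: free_lmod_carrier)
qed

context left_module begin

lemma lsmult_finsum:
  assumes "a \<in> carrier R" "finite A" "f \<in> A \<rightarrow> carrier M"
  shows "a \<odot>\<^bsub>M\<^esub> (\<Oplus>\<^bsub>M\<^esub>i\<in>A. f i) = (\<Oplus>\<^bsub>M\<^esub>i\<in>A. a \<odot>\<^bsub>M\<^esub> f i)"
  using assms(2,3)
proof (induction A)
  case (insert x A)
  then show ?case using assms(1) by (simp add: Pi_def lsmult_r_distr)
qed (simp add: assms(1))

lemma lin_comb_superset:
  assumes "finite A" "{k. f k \<noteq> \<zero>\<^bsub>R\<^esub>} \<subseteq> A" "\<And>k. f k \<in> carrier R" "\<And>k. k \<in> A \<Longrightarrow> y k \<in> carrier M"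
  shows "lin_comb R M y f = (\<Oplus>\<^bsub>M\<^esub>k\<in>A. f k \<odot>\<^bsub>M\<^esub> y k)"
  unfolding lin_comb_def
  by (rule M.add.finprod_mono_neutral_cong_left) (use assms in auto)

lemma
  assumes f: "f \<in> carrier (free_lmod R I)" and y: "\<And>k. k \<in> I \<Longrightarrow> y k \<in> carrier M"
  shows lin_comb_closed: "lin_comb R M y f \<in> carrier M"
    and lin_comb_smult: "r \<in> carrier R \<Longrightarrow> lin_comb R M y (\<lambda>i. r \<otimes>\<^bsub>R\<^esub> f i) = r \<odot>\<^bsub>M\<^esub> lin_comb R M y f"
proof -
  let ?A = "{k. f k \<noteq> \<zero>\<^bsub>R\<^esub>}"
  have c: "f k \<in> carrier R" for k using f by (simp add: free_lmod_carrier)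
  have y': "y k \<in> carrier M" if "k \<in> ?A" for k using f y that by (auto simp: free_lmod_carrier)
  have fin: "finite ?A" using f by (simp add: free_lmod_carrier)
  show "lin_comb R M y f \<in> carrier M" unfolding lin_comb_def using c y' by (intro M.finsum_closed) auto
  assume r: "r \<in> carrier R"
  have "lin_comb R M y (\<lambda>i. r \<otimes>\<^bsub>R\<^esub> f i) = (\<Oplus>\<^bsub>M\<^esub>k\<in>?A. (r \<otimes>\<^bsub>R\<^esub> f k) \<odot>\<^bsub>M\<^esub> y k)"
    by (rule lin_comb_superset) (use fin r c y' in auto)
  also have "\<dots> = (\<Oplus>\<^bsub>M\<^esub>k\<in>?A. r \<odot>\<^bsub>M\<^esub> (f k \<odot>\<^bsub>M\<^esub> y k))"
    by (rule M.finsum_cong') (use r c y' in \<open>auto simp: lsmult_assoc\<close>)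
  also have "\<dots> = r \<odot>\<^bsub>M\<^esub> lin_comb R M y f"
    unfolding lin_comb_def by (rule lsmult_finsum[symmetric]) (use fin r c y' in auto)
  finally show "lin_comb R M y (\<lambda>i. r \<otimes>\<^bsub>R\<^esub> f i) = r \<odot>\<^bsub>M\<^esub> lin_comb R M y f" .
qed

lemma lin_comb_add:
  assumes f: "f \<in> carrier (free_lmod R I)" and g: "g \<in> carrier (free_lmod R I)"
    and y: "\<And>k. k \<in> I \<Longrightarrow> y k \<in> carrier M"
  shows "lin_comb R M y (\<lambda>i. f i \<oplus>\<^bsub>R\<^esub> g i) = lin_comb R M y f \<oplus>\<^bsub>M\<^esub> lin_comb R M y g"
proof -
  let ?A = "{k. f k \<noteq> \<zero>\<^bsub>R\<^esub>} \<union> {k. g k \<noteq> \<zero>\<^bsub>R\<^esub>}"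
  have c: "f k \<in> carrier R" "g k \<in> carrier R" for k using f g by (simp_all add: free_lmod_carrier)
  have y': "y k \<in> carrier M" if "k \<in> ?A" for k
    using f g that by (intro y) (auto simp: free_lmod_carrier)
  have fin: "finite ?A" using f g by (simp add: free_lmod_carrier)
  have "lin_comb R M y (\<lambda>i. f i \<oplus>\<^bsub>R\<^esub> g i) = (\<Oplus>\<^bsub>M\<^esub>k\<in>?A. (f k \<oplus>\<^bsub>R\<^esub> g k) \<odot>\<^bsub>M\<^esub> y k)"
    by (rule lin_comb_superset) (use fin c y' in auto)
  also have "\<dots> = (\<Oplus>\<^bsub>M\<^esub>k\<in>?A. f k \<odot>\<^bsub>M\<^esub> y k \<oplus>\<^bsub>M\<^esub> g k \<odot>\<^bsub>M\<^esub> y k)"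
    by (rule M.finsum_cong') (use c y' in \<open>auto simp: lsmult_l_distr\<close>)
  also have "\<dots> = (\<Oplus>\<^bsub>M\<^esub>k\<in>?A. f k \<odot>\<^bsub>M\<^esub> y k) \<oplus>\<^bsub>M\<^esub> (\<Oplus>\<^bsub>M\<^esub>k\<in>?A. g k \<odot>\<^bsub>M\<^esub> y k)"
    by (rule M.finsum_addf) (use c y' in auto)
  also have "(\<Oplus>\<^bsub>M\<^esub>k\<in>?A. f k \<odot>\<^bsub>M\<^esub> y k) = lin_comb R M y f"
    by (rule lin_comb_superset[symmetric]) (use fin c y' in auto)
  also have "(\<Oplus>\<^bsub>M\<^esub>k\<in>?A. g k \<odot>\<^bsub>M\<^esub> y k) = lin_comb R M y g"
    by (rule lin_comb_superset[symmetric]) (use fin c y' in auto)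
  finally show ?thesis .
qed

lemma lin_comb_zero [simp]: "lin_comb R M y (\<lambda>i. \<zero>\<^bsub>R\<^esub>) = \<zero>\<^bsub>M\<^esub>"
  by (simp add: lin_comb_def)

lemma lin_comb_fsingle:
  assumes "r \<in> carrier R" "y k \<in> carrier M"
  shows "lin_comb R M y (fsingle R k r) = r \<odot>\<^bsub>M\<^esub> y k"
proof -
  have "lin_comb R M y (fsingle R k r) = (\<Oplus>\<^bsub>M\<^esub>i\<in>{k}. fsingle R k r i \<odot>\<^bsub>M\<^esub> y i)"
    by (rule lin_comb_superset) (use assms in \<open>auto simp: fsingle_def\<close>)
  then show ?thesis using assms by (simp add: fsingle_def)
qed

lemma lmod_basis_alt:
  "lmod_basis R M B \<longleftrightarrow> B \<subseteq> carrier M \<and> bij_betw (lin_comb R M (\<lambda>b. b)) (carrier (free_lmod R B)) (carrier M)"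
  unfolding lmod_basis_def lin_comb_def by simp

lemma lin_comb_image_insert:
  assumes "finite B" "insert b B \<subseteq> carrier M"
  shows "lin_comb R M (\<lambda>b. b) ` carrier (free_lmod R (insert b B)) =
    adjoin R M (lin_comb R M (\<lambda>b. b) ` carrier (free_lmod R B)) b"
proof -
  have sub: "carrier (free_lmod R B) \<subseteq> carrier (free_lmod R (insert b B))"
    by (auto simp: free_lmod_carrier)
  have sum: "lin_comb R M (\<lambda>b. b) (\<lambda>i. g i \<oplus>\<^bsub>R\<^esub> fsingle R b r i) = lin_comb R M (\<lambda>b. b) g \<oplus>\<^bsub>M\<^esub> r \<odot>\<^bsub>M\<^esub> b"
    "(\<lambda>i. g i \<oplus>\<^bsub>R\<^esub> fsingle R b r i) \<in> carrier (free_lmod R (insert b B))"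
    if "g \<in> carrier (free_lmod R B)" "r \<in> carrier R" for g r
  proof -
    have u: "fsingle R b r \<in> carrier (free_lmod R (insert b B))" using that by (intro R.fsingle_carrier) auto
    show "lin_comb R M (\<lambda>b. b) (\<lambda>i. g i \<oplus>\<^bsub>R\<^esub> fsingle R b r i) = lin_comb R M (\<lambda>b. b) g \<oplus>\<^bsub>M\<^esub> r \<odot>\<^bsub>M\<^esub> b"
      using lin_comb_add[of g "insert b B" "fsingle R b r" "\<lambda>b. b"] that sub u assms by (auto simp: lin_comb_fsingle)
    interpret fr: left_module R "free_lmod R (insert b B)" by (rule R.free_lmod_left_module)
    show "(\<lambda>i. g i \<oplus>\<^bsub>R\<^esub> fsingle R b r i) \<in> carrier (free_lmod R (insert b B))"
      using fr.a_closed[of g "fsingle R b r"] that sub u by auto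
  qed
  show ?thesis
  proof
    show "adjoin R M (lin_comb R M (\<lambda>b. b) ` carrier (free_lmod R B)) b \<subseteq>
      lin_comb R M (\<lambda>b. b) ` carrier (free_lmod R (insert b B))"
    proof
      fix x assume "x \<in> adjoin R M (lin_comb R M (\<lambda>b. b) ` carrier (free_lmod R B)) b"
      then obtain g r where "g \<in> carrier (free_lmod R B)" "r \<in> carrier R"
        "x = lin_comb R M (\<lambda>b. b) g \<oplus>\<^bsub>M\<^esub> r \<odot>\<^bsub>M\<^esub> b" unfolding adjoin_def by auto
      then show "x \<in> lin_comb R M (\<lambda>b. b) ` carrier (free_lmod R (insert b B))"
        using sum[of g r] by (intro image_eqI[of _ _ "\<lambda>i. g i \<oplus>\<^bsub>R\<^esub> fsingle R b r i"]) simp_all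
    qed
    show "lin_comb R M (\<lambda>b. b) ` carrier (free_lmod R (insert b B)) \<subseteq>
      adjoin R M (lin_comb R M (\<lambda>b. b) ` carrier (free_lmod R B)) b"
    proof safe
      fix f assume f: "f \<in> carrier (free_lmod R (insert b B))"
      define g where "g = (if b \<in> B then f else f(b := \<zero>\<^bsub>R\<^esub>))"
      define r where "r = (if b \<in> B then \<zero>\<^bsub>R\<^esub> else f b)"
      have g: "g \<in> carrier (free_lmod R B)" using f unfolding free_lmod_carrier g_def
        by (auto intro: finite_subset[of _ "{i. f i \<noteq> \<zero>\<^bsub>R\<^esub>}"])
      have r: "r \<in> carrier R" using f unfolding free_lmod_carrier r_def by auto
      have "(\<lambda>i. g i \<oplus>\<^bsub>R\<^esub> fsingle R b r i) = f"
        using f by (auto simp: g_def r_def fsingle_def free_lmod_carrier)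
      then have "lin_comb R M (\<lambda>b. b) f = lin_comb R M (\<lambda>b. b) g \<oplus>\<^bsub>M\<^esub> r \<odot>\<^bsub>M\<^esub> b" using sum(1)[OF g r] by simp
      then show "lin_comb R M (\<lambda>b. b) f \<in> adjoin R M (lin_comb R M (\<lambda>b. b) ` carrier (free_lmod R B)) b"
        unfolding adjoin_def using g r by blast
    qed
  qed
qed

lemma lin_comb_empty: "lin_comb R M y ` carrier (free_lmod R ({} :: 'i set)) = {\<zero>\<^bsub>M\<^esub>}"
proof -
  have "carrier (free_lmod R ({} :: 'i set)) = {\<lambda>i. \<zero>\<^bsub>R\<^esub>}" by (auto simp: free_lmod_carrier)
  then show ?thesis by simp
qed

lemma zero_submodule: "submodule {\<zero>\<^bsub>M\<^esub>} R M"
  by (rule lsubmoduleI) auto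

end

context division_module begin

text \<open>
  Adjoining the elements of a basis one after the other gives a chain; uniqueness of coefficients
  prevents an element from lying in the span of its predecessors.
\<close>

lemma lmod_basis_rel_dim:
  assumes B: "finite B" "lmod_basis R M B"
  shows "rel_dim R M {\<zero>\<^bsub>M\<^esub>} (carrier M) (card B)"
proof -
  let ?f = "lin_comb R M (\<lambda>b. b)"
  have Bc: "B \<subseteq> carrier M" and bij: "bij_betw ?f (carrier (free_lmod R B)) (carrier M)"
    using B by (auto simp: lmod_basis_alt)
  have "C \<subseteq> B \<Longrightarrow> rel_dim R M {\<zero>\<^bsub>M\<^esub>} (?f ` carrier (free_lmod R C)) (card C)" if "finite C" for C
    using that
  proof (induction C)
    case empty
    then show ?case using lin_comb_empty[of "\<lambda>b. b"] zero_submodule by (auto intro: rel_dim.refl)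
  next
    case (insert b C)
    have nin: "b \<notin> ?f ` carrier (free_lmod R C)"
    proof
      assume "b \<in> ?f ` carrier (free_lmod R C)"
      then obtain g where g: "g \<in> carrier (free_lmod R C)" "?f g = b" by auto
      have "?f (fsingle R b \<one>\<^bsub>R\<^esub>) = b" using insert Bc by (auto simp: lin_comb_fsingle lsmult_one)
      moreover have "g \<in> carrier (free_lmod R B)" using g insert by (auto simp: free_lmod_carrier)
      moreover have "fsingle R b \<one>\<^bsub>R\<^esub> \<in> carrier (free_lmod R B)" using insert by (auto intro: R.fsingle_carrier)
      ultimately have "g = fsingle R b \<one>\<^bsub>R\<^esub>" using bij g by (metis bij_betw_def inj_onD)
      then show False using g insert one_neq_zero by (auto simp: fsingle_def free_lmod_carrier)
    qed
    have "rel_dim R M {\<zero>\<^bsub>M\<^esub>} (adjoin R M (?f ` carrier (free_lmod R C)) b) (Suc (card C))"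
      by (rule rel_dim.step) (use insert nin Bc in auto)
    moreover have "insert b C \<subseteq> carrier M" using insert Bc by blast
    ultimately show ?case using lin_comb_image_insert[of C b] insert by simp
  qed
  from this[OF B(1)] show ?thesis using bij by (simp add: bij_betw_def)
qed

text \<open>
  Conversely, the elements adjoined along a chain from \<open>0\<close> form a basis of its top.  If the coefficients
  of the last element \<open>b\<close> in two equal combinations differed, \<open>b\<close> would already lie in the member below.
\<close>

lemma rel_dim_lmod_basis:
  "rel_dim R M {\<zero>\<^bsub>M\<^esub>} W n \<Longrightarrow> \<exists>B. finite B \<and> card B = n \<and> B \<subseteq> carrier M \<and>
    bij_betw (lin_comb R M (\<lambda>b. b)) (carrier (free_lmod R B)) W"
proof (induction "{\<zero>\<^bsub>M\<^esub>}" W n rule: rel_dim.induct)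
  case refl
  have "carrier (free_lmod R ({} :: 'c set)) = {\<lambda>i. \<zero>\<^bsub>R\<^esub>}" by (auto simp: free_lmod_carrier)
  then show ?case by (intro exI[of _ "{}"]) (simp add: bij_betw_def)
next
  case (step H n b)
  let ?f = "lin_comb R M (\<lambda>b. b)"
  obtain B where B: "finite B" "card B = n" "B \<subseteq> carrier M" "bij_betw ?f (carrier (free_lmod R B)) H"
    using step by blast
  have H: "submodule H R M" using rel_dim_submodules step by blast
  have bB: "b \<notin> B"
  proof
    assume bB: "b \<in> B"
    then have "fsingle R b \<one>\<^bsub>R\<^esub> \<in> carrier (free_lmod R B)" by (intro R.fsingle_carrier) auto
    then have "?f (fsingle R b \<one>\<^bsub>R\<^esub>) \<in> H" using B(4) by (auto simp: bij_betw_def)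
    then show False using step bB B by (auto simp: lin_comb_fsingle lsmult_one)
  qed
  have "inj_on ?f (carrier (free_lmod R (insert b B)))"
  proof (rule inj_onI)
    fix f g assume fg: "f \<in> carrier (free_lmod R (insert b B))" "g \<in> carrier (free_lmod R (insert b B))" "?f f = ?f g"
    have split: "h(b := \<zero>\<^bsub>R\<^esub>) \<in> carrier (free_lmod R B) \<and> ?f (h(b := \<zero>\<^bsub>R\<^esub>)) \<in> H \<and> h b \<in> carrier R
       \<and> ?f h = ?f (h(b := \<zero>\<^bsub>R\<^esub>)) \<oplus>\<^bsub>M\<^esub> h b \<odot>\<^bsub>M\<^esub> b"
      if h: "h \<in> carrier (free_lmod R (insert b B))" for h
    proof -
      have h0: "h(b := \<zero>\<^bsub>R\<^esub>) \<in> carrier (free_lmod R B)" using h unfolding free_lmod_carrier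
        by (auto intro: finite_subset[of _ "{i. h i \<noteq> \<zero>\<^bsub>R\<^esub>}"])
      then have h0': "h(b := \<zero>\<^bsub>R\<^esub>) \<in> carrier (free_lmod R (insert b B))" by (auto simp: free_lmod_carrier)
      have hb: "h b \<in> carrier R" using h by (auto simp: free_lmod_carrier)
      have u: "fsingle R b (h b) \<in> carrier (free_lmod R (insert b B))" using hb by (intro R.fsingle_carrier) auto
      have "(\<lambda>i. (h(b := \<zero>\<^bsub>R\<^esub>)) i \<oplus>\<^bsub>R\<^esub> fsingle R b (h b) i) = h"
        using h by (auto simp: fsingle_def free_lmod_carrier)
      then have "?f h = ?f (h(b := \<zero>\<^bsub>R\<^esub>)) \<oplus>\<^bsub>M\<^esub> ?f (fsingle R b (h b))"
        using lin_comb_add[OF h0' u, of "\<lambda>b. b"] B(3) step.hyps by auto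
      then show ?thesis using h0 hb B(4) step.hyps by (auto simp: lin_comb_fsingle bij_betw_def)
    qed
    define u v where "u = ?f (f(b := \<zero>\<^bsub>R\<^esub>))" and "v = ?f (g(b := \<zero>\<^bsub>R\<^esub>))"
    have uv: "u \<in> H" "v \<in> H" "u \<in> carrier M" "v \<in> carrier M" "f b \<in> carrier R" "g b \<in> carrier R"
      using split fg submoduleD(1)[OF H] by (auto simp: u_def v_def)
    have eq: "u \<oplus>\<^bsub>M\<^esub> f b \<odot>\<^bsub>M\<^esub> b = v \<oplus>\<^bsub>M\<^esub> g b \<odot>\<^bsub>M\<^esub> b" using split fg by (auto simp: u_def v_def)
    have "f b \<odot>\<^bsub>M\<^esub> b = (v \<oplus>\<^bsub>M\<^esub> g b \<odot>\<^bsub>M\<^esub> b) \<ominus>\<^bsub>M\<^esub> u"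
      unfolding eq[symmetric] using uv step.hyps by (simp add: M.minus_eq M.a_ac M.r_neg M.r_neg1 M.r_neg2)
    then have "(f b \<ominus>\<^bsub>R\<^esub> g b) \<odot>\<^bsub>M\<^esub> b = v \<ominus>\<^bsub>M\<^esub> u"
      using uv step.hyps by (simp add: R.minus_eq lsmult_l_distr lsmult_minus_left M.minus_eq M.a_ac M.r_neg M.r_neg1 M.r_neg2)
    then have "(f b \<ominus>\<^bsub>R\<^esub> g b) \<odot>\<^bsub>M\<^esub> b \<in> H" using submoduleD(6)[OF H] uv by simp
    then have "f b \<ominus>\<^bsub>R\<^esub> g b = \<zero>\<^bsub>R\<^esub>" using smult_in_submodule[OF H] uv step.hyps by blast
    then have fgb: "f b = g b" using uv by (simp add: R.minus_eq) (metis R.a_inv_closed R.minus_equality R.minus_minus)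
    then have "u = v" using eq uv step.hyps by simp
    then have "f(b := \<zero>\<^bsub>R\<^esub>) = g(b := \<zero>\<^bsub>R\<^esub>)"
      using B(4) split fg unfolding u_def v_def bij_betw_def by (meson inj_onD)
    then show "f = g" using fgb by (metis fun_upd_triv fun_upd_upd)
  qed
  moreover have "?f ` carrier (free_lmod R (insert b B)) = adjoin R M H b"
    using lin_comb_image_insert[of B b] B step.hyps by (auto simp: bij_betw_def)
  ultimately show ?case using B step.hyps bB by (intro exI[of _ "insert b B"]) (auto simp: bij_betw_def)
qed

lemma rel_dim_lmod_dim:
  assumes "rel_dim R M {\<zero>\<^bsub>M\<^esub>} (carrier M) n"
  shows "lmod_fin_dim R M" "lmod_dim R M = n"
proof -
  obtain B where B: "finite B" "card B = n" "lmod_basis R M B"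
    using rel_dim_lmod_basis[OF assms] by (auto simp: lmod_basis_alt)
  then show "lmod_fin_dim R M" by (auto simp: lmod_fin_dim_def)
  show "lmod_dim R M = n" unfolding lmod_dim_def
  proof (rule the_equality)
    show "\<exists>B. finite B \<and> lmod_basis R M B \<and> card B = n" using B by blast
    show "m = n" if "\<exists>B. finite B \<and> lmod_basis R M B \<and> card B = m" for m
      using that lmod_basis_rel_dim rel_dim_unique[OF assms] by metis
  qed
qed

end

lemma division_module_change:
  "division_module R M \<Longrightarrow> left_module R N \<Longrightarrow> division_module R N"
  by (simp add: division_module_def division_module_axioms_def)

section \<open>Cosets and quotient modules\<close>

lemma (in left_module) submodule_abelian_subgroup: "submodule U R M \<Longrightarrow> abelian_subgroup U M"
  by (rule abelian_subgroupI3) (auto simp: additive_subgroup_def submodule_def M.abelian_group_axioms)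

lemma (in abelian_subgroup) coset_eq_iff:
  assumes "x \<in> carrier G" "y \<in> carrier G"
  shows "H +> x = H +> y \<longleftrightarrow> x \<ominus> y \<in> H"
proof
  assume "H +> x = H +> y"
  then have "x \<in> H +> y" using a_rcos_self assms by blast
  then obtain h where h: "h \<in> H" "x = h \<oplus> y" by (auto simp: a_r_coset_def')
  then have "x \<ominus> y = h" using assms a_subset by (auto simp: minus_eq a_assoc r_neg subset_eq)
  then show "x \<ominus> y \<in> H" using h by simp
next
  assume "x \<ominus> y \<in> H"
  moreover have "x = (x \<ominus> y) \<oplus> y" using assms by (simp add: minus_eq a_assoc l_neg)
  ultimately have "x \<in> H +> y" by (auto simp: a_r_coset_def')
  then show "H +> x = H +> y" using a_repr_independence[OF _ assms(2) a_subgroup] by simp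
qed

lemma (in abelian_subgroup) mem_coset_iff:
  assumes "x \<in> carrier G"
  shows "y \<in> H +> x \<longleftrightarrow> y \<in> carrier G \<and> y \<ominus> x \<in> H"
proof
  assume y: "y \<in> H +> x"
  then have c: "y \<in> carrier G" using a_r_coset_subset_G[OF a_subset assms] by auto
  then show "y \<in> carrier G \<and> y \<ominus> x \<in> H"
    using a_repr_independence[OF y assms a_subgroup] coset_eq_iff[OF c assms] by simp
next
  assume "y \<in> carrier G \<and> y \<ominus> x \<in> H"
  then show "y \<in> H +> x" using coset_eq_iff[of y x] assms a_rcos_self by blast
qed

lemma (in abelian_subgroup) UN_coset:
  assumes "x \<in> carrier G" "\<And>y. y \<in> carrier G \<Longrightarrow> y \<ominus> x \<in> H \<Longrightarrow> g y = g x"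
  shows "(\<Union>y\<in>H +> x. g y) = g x"
proof -
  have "(\<Union>y\<in>H +> x. g y) = (\<Union>y\<in>H +> x. g x)"
    by (rule SUP_cong) (use assms in \<open>simp_all add: mem_coset_iff\<close>)
  then show ?thesis using a_rcos_self[OF assms(1)] by auto
qed

context left_module begin

lemma lmod_quot_simps:
  assumes "submodule U R M"
  shows "carrier (lmod_quot M U) = {U +>\<^bsub>M\<^esub> x | x. x \<in> carrier M}"
    "\<zero>\<^bsub>lmod_quot M U\<^esub> = U"
    "\<lbrakk>x \<in> carrier M; y \<in> carrier M\<rbrakk> \<Longrightarrow>
      (U +>\<^bsub>M\<^esub> x) \<oplus>\<^bsub>lmod_quot M U\<^esub> (U +>\<^bsub>M\<^esub> y) = U +>\<^bsub>M\<^esub> (x \<oplus>\<^bsub>M\<^esub> y)"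
    "\<lbrakk>r \<in> carrier R; x \<in> carrier M\<rbrakk> \<Longrightarrow> r \<odot>\<^bsub>lmod_quot M U\<^esub> (U +>\<^bsub>M\<^esub> x) = U +>\<^bsub>M\<^esub> (r \<odot>\<^bsub>M\<^esub> x)"
proof -
  interpret U: abelian_subgroup U M using assms by (rule submodule_abelian_subgroup)
  show "carrier (lmod_quot M U) = {U +>\<^bsub>M\<^esub> x | x. x \<in> carrier M}" "\<zero>\<^bsub>lmod_quot M U\<^esub> = U"
    by (auto simp: lmod_quot_def A_RCOSETS_def')
  show "(U +>\<^bsub>M\<^esub> x) \<oplus>\<^bsub>lmod_quot M U\<^esub> (U +>\<^bsub>M\<^esub> y) = U +>\<^bsub>M\<^esub> (x \<oplus>\<^bsub>M\<^esub> y)"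
    if "x \<in> carrier M" "y \<in> carrier M" using that U.a_rcos_sum by (simp add: lmod_quot_def)
  show "r \<odot>\<^bsub>lmod_quot M U\<^esub> (U +>\<^bsub>M\<^esub> x) = U +>\<^bsub>M\<^esub> (r \<odot>\<^bsub>M\<^esub> x)" if rx: "r \<in> carrier R" "x \<in> carrier M"
  proof -
    have "U +>\<^bsub>M\<^esub> (r \<odot>\<^bsub>M\<^esub> y) = U +>\<^bsub>M\<^esub> (r \<odot>\<^bsub>M\<^esub> x)" if y: "y \<in> carrier M" "y \<ominus>\<^bsub>M\<^esub> x \<in> U" for y
    proof -
      have "r \<odot>\<^bsub>M\<^esub> y \<ominus>\<^bsub>M\<^esub> r \<odot>\<^bsub>M\<^esub> x = r \<odot>\<^bsub>M\<^esub> (y \<ominus>\<^bsub>M\<^esub> x)"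
        using y rx by (simp add: M.minus_eq lsmult_r_distr lsmult_minus_right)
      then show ?thesis using submoduleD(4)[OF assms rx(1) y(2)] rx y by (simp add: U.coset_eq_iff)
    qed
    then show ?thesis using rx by (simp add: lmod_quot_def U.UN_coset)
  qed
qed

lemma lmod_quot_left_module:
  assumes U: "submodule U R M"
  shows "left_module R (lmod_quot M U)"
    and "(\<lambda>x\<in>carrier M. U +>\<^bsub>M\<^esub> x) \<in> lmod_hom R M (lmod_quot M U)"
proof -
  interpret U: abelian_subgroup U M using assms by (rule submodule_abelian_subgroup)
  note q = lmod_quot_simps[OF U]
  have U0: "U = U +>\<^bsub>M\<^esub> \<zero>\<^bsub>M\<^esub>" using U.a_subset by simp
  have ag: "abelian_group (lmod_quot M U)"
  proof (rule abelian_groupI, goal_cases)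
    case 2 show ?case using q(1,2) U0 by blast
  next
    case (5 X) then obtain x where "X = U +>\<^bsub>M\<^esub> x" "x \<in> carrier M" by (auto simp: q(1))
    then show ?case using q(3)[of "\<zero>\<^bsub>M\<^esub>" x] U0 q(2) by simp
  next
    case (6 X) then obtain x where x: "X = U +>\<^bsub>M\<^esub> x" "x \<in> carrier M" by (auto simp: q(1))
    show ?case by (rule bexI[of _ "U +>\<^bsub>M\<^esub> (\<ominus>\<^bsub>M\<^esub> x)"])
      (use x q(3)[of "\<ominus>\<^bsub>M\<^esub> x" x] U0 q(2) in \<open>auto simp: q(1) M.l_neg\<close>)
  qed (auto simp: q(1) q(3) M.a_ac)
  show "left_module R (lmod_quot M U)"
    by (intro left_module.intro left_module_axioms.intro R.ring_axioms ag)
      (auto simp: q(1) q(3) q(4) lsmult_l_distr lsmult_r_distr lsmult_assoc lsmult_one)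
  show "(\<lambda>x\<in>carrier M. U +>\<^bsub>M\<^esub> x) \<in> lmod_hom R M (lmod_quot M U)"
    unfolding lmod_hom_def by (auto simp: q)
qed

lemma left_module_submodule:
  assumes U: "submodule U R M"
  shows "left_module R (M\<lparr>carrier := U\<rparr>)"
proof -
  note D = submoduleD[OF U]
  have c: "x \<in> U \<Longrightarrow> x \<in> carrier M" for x using D(1) by blast
  show ?thesis
  proof (intro left_module.intro left_module_axioms.intro R.ring_axioms abelian_groupI)
    fix x assume x: "x \<in> carrier (M\<lparr>carrier := U\<rparr>)"
    then have "\<ominus>\<^bsub>M\<^esub> x \<oplus>\<^bsub>M\<^esub> x = \<zero>\<^bsub>M\<^esub>" "\<ominus>\<^bsub>M\<^esub> x \<in> U" using c D(5) by (auto intro: M.l_neg)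
    then show "\<exists>y\<in>carrier (M\<lparr>carrier := U\<rparr>). y \<oplus>\<^bsub>M\<lparr>carrier := U\<rparr>\<^esub> x = \<zero>\<^bsub>M\<lparr>carrier := U\<rparr>\<^esub>" by auto
  qed (use D in \<open>auto simp: c M.a_ac lsmult_l_distr lsmult_r_distr lsmult_assoc lsmult_one\<close>)
qed

end

text \<open>
  Homomorphic images do not shorten a chain that starts above the kernel.
\<close>

lemma rel_dim_image:
  assumes M: "left_module R M" and N: "left_module R N" and f: "f \<in> lmod_hom R M N"
    and d: "rel_dim R M U W n" and ker: "\<And>x. x \<in> carrier M \<Longrightarrow> f x = \<zero>\<^bsub>N\<^esub> \<Longrightarrow> x \<in> U"
  shows "rel_dim R N (f ` U) (f ` W) n"
  using d ker
proof (induction rule: rel_dim.induct)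
  interpret M: left_module R M by fact
  interpret N: left_module R N by fact
  note fD = lmod_homD[OF f]
  have f0: "f \<zero>\<^bsub>M\<^esub> = \<zero>\<^bsub>N\<^esub>" using lmod_hom_zero M N f by blast
  {
    case (refl U)
    note D = submoduleD[OF refl(1)]
    have "submodule (f ` U) R N"
    proof (rule N.lsubmoduleI)
      show "\<zero>\<^bsub>N\<^esub> \<in> f ` U" using f0 D(2) by force
      show "\<And>x y. x \<in> f ` U \<Longrightarrow> y \<in> f ` U \<Longrightarrow> x \<oplus>\<^bsub>N\<^esub> y \<in> f ` U"
        using D fD(3) by (auto simp: subset_eq) (metis D(3) image_eqI)
      show "\<And>a x. a \<in> carrier R \<Longrightarrow> x \<in> f ` U \<Longrightarrow> a \<odot>\<^bsub>N\<^esub> x \<in> f ` U"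
        using D fD(4) by (auto simp: subset_eq) (metis D(4) image_eqI)
    qed (use D(1) fD(2) in auto)
    then show ?case by (rule rel_dim.refl)
  next
    case (step U H n b)
    have H: "submodule H R M" and UH: "U \<subseteq> H" using M.rel_dim_submodules step by blast+
    note D = submoduleD[OF H]
    have "f b \<notin> f ` H"
    proof
      assume "f b \<in> f ` H"
      then obtain h where h: "h \<in> H" "f b = f h" by auto
      have hc: "h \<in> carrier M" using h D by auto
      have "f (b \<ominus>\<^bsub>M\<^esub> h) = \<zero>\<^bsub>N\<^esub>"
        using lmod_hom_minus[OF M N f step.hyps(2) hc] h fD(2)[OF hc] by (simp add: N.minus_eq N.r_neg)
      then have "b \<ominus>\<^bsub>M\<^esub> h \<in> H" using step.prems step.hyps(2) hc UH by blast
      then have "(b \<ominus>\<^bsub>M\<^esub> h) \<oplus>\<^bsub>M\<^esub> h \<in> H" using D(3) h by blast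
      then show False using step.hyps hc by (simp add: M.minus_eq M.a_assoc M.l_neg)
    qed
    moreover have "adjoin R N (f ` H) (f b) = f ` adjoin R M H b"
    proof -
      have "f (h \<oplus>\<^bsub>M\<^esub> r \<odot>\<^bsub>M\<^esub> b) = f h \<oplus>\<^bsub>N\<^esub> r \<odot>\<^bsub>N\<^esub> f b" if "h \<in> H" "r \<in> carrier R" for h r
        using that D(1) step.hyps(2) fD(3)[of h "r \<odot>\<^bsub>M\<^esub> b"] fD(4)[of r b] by auto
      then show ?thesis unfolding adjoin_def by (auto simp: image_iff) metis+
    qed
    ultimately show ?case using rel_dim.step[OF step.IH[OF step.prems] fD(2)[OF step.hyps(2)]] by simp
  }
qed

text \<open>
  This connects the relative dimension with the dimension of a quotient module, which is how
  cohomology spaces are given.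
\<close>

lemma lmod_quot_dim:
  assumes M: "division_module R M" and d: "rel_dim R M U (carrier M) n"
  shows "lmod_fin_dim R (lmod_quot M U)" "lmod_dim R (lmod_quot M U) = n"
proof -
  interpret M: division_module R M by fact
  have U: "submodule U R M" using M.rel_dim_submodules d by blast
  interpret U: abelian_subgroup U M using U by (rule M.submodule_abelian_subgroup)
  let ?f = "\<lambda>x\<in>carrier M. U +>\<^bsub>M\<^esub> x"
  note q = M.lmod_quot_left_module[OF U] M.lmod_quot_simps[OF U]
  interpret Q: division_module R "lmod_quot M U" using division_module_change M q(1) by blast
  have U0: "U = U +>\<^bsub>M\<^esub> \<zero>\<^bsub>M\<^esub>" using U.a_subset by simp
  have "rel_dim R (lmod_quot M U) (?f ` U) (?f ` carrier M) n"
  proof (rule rel_dim_image[OF M.left_module_axioms q(1) q(2) d])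
    fix x assume x: "x \<in> carrier M" "?f x = \<zero>\<^bsub>lmod_quot M U\<^esub>"
    then show "x \<in> U" using M.a_coset_join1[OF _ x(1) U.a_subgroup] q(4) by simp
  qed
  moreover have "?f ` U = {\<zero>\<^bsub>lmod_quot M U\<^esub>}"
  proof -
    have "?f x = U" if "x \<in> U" for x using that U.a_subset M.a_coset_join2[OF _ U.a_subgroup] by auto
    then show ?thesis using q(4) submoduleD(2)[OF U] by (metis image_constant image_cong)
  qed
  moreover have "?f ` carrier M = carrier (lmod_quot M U)" using q(3) by auto
  ultimately have "rel_dim R (lmod_quot M U) {\<zero>\<^bsub>lmod_quot M U\<^esub>} (carrier (lmod_quot M U)) n" by simp
  then show "lmod_fin_dim R (lmod_quot M U)" "lmod_dim R (lmod_quot M U) = n"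
    by (rule Q.rel_dim_lmod_dim)+
qed

section \<open>The free associative algebra\<close>

lemma abelian_group_transfer:
  assumes "abelian_group M" "carrier N = carrier M" "add N = add M" "zero N = zero M"
  shows "abelian_group N"
  by (rule abelian_groupI) (use abelian_groupE[OF assms(1)] in \<open>simp_all add: assms(2-4)\<close>)

lemma word_monom_fsingle: "word_monom F c w = fsingle F w c"
  by (simp add: word_monom_def fsingle_def)

lemma free_assoc_carrier: "carrier (free_assoc F X) = carrier (free_lmod F {w. set w \<subseteq> X})"
  by (auto simp: free_assoc_def free_lmod_def)

lemma free_assoc_simps [simp]:
  "zero (free_assoc F X) = (\<lambda>w. \<zero>\<^bsub>F\<^esub>)"
  "add (free_assoc F X) = (\<lambda>a b w. a w \<oplus>\<^bsub>F\<^esub> b w)"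
  "one (free_assoc F X) = fsingle F [] \<one>\<^bsub>F\<^esub>"
  by (simp_all add: free_assoc_def fsingle_def)

lemma free_assoc_mult:
  "mult (free_assoc F X) a b w = (\<Oplus>\<^bsub>F\<^esub>k\<in>{..length w}. a (take k w) \<otimes>\<^bsub>F\<^esub> b (drop k w))"
  by (simp add: free_assoc_def)

context ring begin

lemma free_assoc_abelian_group: "abelian_group (free_assoc R X)"
proof -
  interpret fl: left_module R "free_lmod R {w. set w \<subseteq> X}" by (rule free_lmod_left_module)
  show ?thesis by (rule abelian_group_transfer[OF fl.abelian_group_axioms]) (simp_all add: free_assoc_carrier)
qed

lemma free_assoc_mult_closed:
  assumes a: "a \<in> carrier (free_assoc R X)" and b: "b \<in> carrier (free_assoc R X)"
  shows "a \<otimes>\<^bsub>free_assoc R X\<^esub> b \<in> carrier (free_assoc R X)"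
proof -
  have c: "a w \<in> carrier R" "b w \<in> carrier R" for w
    using a b by (auto simp: free_assoc_carrier free_lmod_carrier)
  have nz: "\<exists>u v. w = u @ v \<and> a u \<noteq> \<zero> \<and> b v \<noteq> \<zero>" if "mult (free_assoc R X) a b w \<noteq> \<zero>" for w
  proof (rule ccontr)
    assume "\<not> ?thesis"
    then have "a (take k w) = \<zero> \<or> b (drop k w) = \<zero>" for k by (metis append_take_drop_id)
    then have "a (take k w) \<otimes> b (drop k w) = \<zero>" for k using c l_null r_null by metis
    then show False using that by (simp add: free_assoc_mult)
  qed
  have "finite ((\<lambda>(u, v). u @ v) ` ({w. a w \<noteq> \<zero>} \<times> {w. b w \<noteq> \<zero>}))"
    using a b by (auto simp: free_assoc_carrier free_lmod_carrier)
  then have "finite {w. mult (free_assoc R X) a b w \<noteq> \<zero>}"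
    by (rule finite_subset[rotated]) (use nz in fastforce)
  moreover have "mult (free_assoc R X) a b w = \<zero>" if "\<not> set w \<subseteq> X" for w
  proof (rule ccontr)
    assume "mult (free_assoc R X) a b w \<noteq> \<zero>"
    then obtain u v where "w = u @ v" "a u \<noteq> \<zero>" "b v \<noteq> \<zero>" using nz by blast
    then have "set u \<subseteq> X" "set v \<subseteq> X" using a b by (auto simp: free_assoc_carrier free_lmod_carrier)
    then show False using that \<open>w = u @ v\<close> by auto
  qed
  moreover have "mult (free_assoc R X) a b w \<in> carrier R" for w
    unfolding free_assoc_mult using c by (intro finsum_closed) auto
  ultimately show ?thesis by (simp add: free_assoc_carrier free_lmod_carrier)
qed

lemma free_assoc_distr:
  assumes "a \<in> carrier (free_assoc R X)" "b \<in> carrier (free_assoc R X)" "c \<in> carrier (free_assoc R X)"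
  shows "mult (free_assoc R X) (\<lambda>w. a w \<oplus> b w) c =
      (\<lambda>w. mult (free_assoc R X) a c w \<oplus> mult (free_assoc R X) b c w)"
    and "mult (free_assoc R X) c (\<lambda>w. a w \<oplus> b w) =
      (\<lambda>w. mult (free_assoc R X) c a w \<oplus> mult (free_assoc R X) c b w)"
proof -
  have cl: "a w \<in> carrier R" "b w \<in> carrier R" "c w \<in> carrier R" for w
    using assms by (auto simp: free_assoc_carrier free_lmod_carrier)
  show "mult (free_assoc R X) (\<lambda>w. a w \<oplus> b w) c =
      (\<lambda>w. mult (free_assoc R X) a c w \<oplus> mult (free_assoc R X) b c w)"
    using cl by (simp add: fun_eq_iff free_assoc_mult l_distr finsum_addf)
  show "mult (free_assoc R X) c (\<lambda>w. a w \<oplus> b w) =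
      (\<lambda>w. mult (free_assoc R X) c a w \<oplus> mult (free_assoc R X) c b w)"
    using cl by (simp add: fun_eq_iff free_assoc_mult r_distr finsum_addf)
qed

lemma free_assoc_null:
  assumes "c \<in> carrier (free_assoc R X)"
  shows "mult (free_assoc R X) (\<lambda>w. \<zero>) c = (\<lambda>w. \<zero>)" "mult (free_assoc R X) c (\<lambda>w. \<zero>) = (\<lambda>w. \<zero>)"
proof -
  have cl: "c w \<in> carrier R" for w using assms by (auto simp: free_assoc_carrier free_lmod_carrier)
  show "mult (free_assoc R X) (\<lambda>w. \<zero>) c = (\<lambda>w. \<zero>)" "mult (free_assoc R X) c (\<lambda>w. \<zero>) = (\<lambda>w. \<zero>)"
    using cl by (simp_all add: fun_eq_iff free_assoc_mult)
qed

text \<open>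
  Among the ways of cutting \<open>w\<close> in two, only the one at \<open>length u\<close> can contribute.  Together with
  \<open>free_assoc_induct\<close> this reduces the ring axioms to the monoid of words.
\<close>

lemma free_assoc_monom_mult:
  assumes "c \<in> carrier R" "d \<in> carrier R"
  shows "mult (free_assoc R X) (fsingle R u c) (fsingle R v d) = fsingle R (u @ v) (c \<otimes> d)"
proof
  fix w
  have "(\<Oplus>k\<in>{..length w}. fsingle R u c (take k w) \<otimes> fsingle R v d (drop k w)) =
    (\<Oplus>k\<in>{..length w}. if length u = k then fsingle R (u @ v) (c \<otimes> d) w else \<zero>)"
  proof (rule finsum_cong')
    fix k assume "k \<in> {..length w}"
    then have "take k w = u \<Longrightarrow> length u = k" by auto
    moreover have "w = u @ v \<longleftrightarrow> take (length u) w = u \<and> drop (length u) w = v"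
      by (metis append_eq_conv_conj)
    ultimately show "fsingle R u c (take k w) \<otimes> fsingle R v d (drop k w) =
      (if length u = k then fsingle R (u @ v) (c \<otimes> d) w else \<zero>)"
      using assms by (auto simp: fsingle_def)
  qed (use assms in \<open>auto simp: fsingle_def\<close>)
  also have "\<dots> = fsingle R (u @ v) (c \<otimes> d) w"
  proof (cases "length u \<le> length w")
    case True
    then show ?thesis
      using finsum_singleton[of "length u" "{..length w}" "\<lambda>_. fsingle R (u @ v) (c \<otimes> d) w"] assms
      by (auto simp: fsingle_def)
  next
    case False
    then have "(\<Oplus>k\<in>{..length w}. if length u = k then fsingle R (u @ v) (c \<otimes> d) w else \<zero>) =
        (\<Oplus>k\<in>{..length w}. \<zero>)" by (intro finsum_cong') auto
    then show ?thesis using False by (auto simp: fsingle_def)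
  qed
  finally show "mult (free_assoc R X) (fsingle R u c) (fsingle R v d) w = fsingle R (u @ v) (c \<otimes> d) w"
    by (simp add: free_assoc_mult)
qed

lemma fsingle_free_assoc: "set w \<subseteq> X \<Longrightarrow> c \<in> carrier R \<Longrightarrow> fsingle R w c \<in> carrier (free_assoc R X)"
  unfolding free_assoc_carrier by (rule fsingle_carrier) auto

lemma free_assoc_induct [consumes 1, case_names zero monom add]:
  assumes "a \<in> carrier (free_assoc R X)" "Q (\<lambda>w. \<zero>)"
    and "\<And>w c. set w \<subseteq> X \<Longrightarrow> c \<in> carrier R \<Longrightarrow> Q (fsingle R w c)"
    and "\<And>a b. \<lbrakk>a \<in> carrier (free_assoc R X); b \<in> carrier (free_assoc R X); Q a; Q b\<rbrakk> \<Longrightarrow> Q (\<lambda>w. a w \<oplus> b w)"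
  shows "Q a"
  using assms(1) unfolding free_assoc_carrier
proof (induction rule: free_lmod_induct)
  case (add w c g)
  then have "set w \<subseteq> X" by simp
  then show ?case
    using assms(3)[OF _ add(2)] assms(4)[OF fsingle_free_assoc[OF _ add(2)]] add by (simp add: free_assoc_carrier)
qed (rule assms(2))

lemma free_assoc_ring: "ring (free_assoc R X)"
proof (rule ringI)
  let ?FA = "free_assoc R X"
  interpret FA: abelian_group ?FA by (rule free_assoc_abelian_group)
  show "abelian_group ?FA" by (rule free_assoc_abelian_group)
  show "(x \<oplus>\<^bsub>?FA\<^esub> y) \<otimes>\<^bsub>?FA\<^esub> z = x \<otimes>\<^bsub>?FA\<^esub> z \<oplus>\<^bsub>?FA\<^esub> y \<otimes>\<^bsub>?FA\<^esub> z"
    and "z \<otimes>\<^bsub>?FA\<^esub> (x \<oplus>\<^bsub>?FA\<^esub> y) = z \<otimes>\<^bsub>?FA\<^esub> x \<oplus>\<^bsub>?FA\<^esub> z \<otimes>\<^bsub>?FA\<^esub> y"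
    if "x \<in> carrier ?FA" "y \<in> carrier ?FA" "z \<in> carrier ?FA" for x y z
    using free_assoc_distr that by auto
  show "Group.monoid ?FA"
  proof (rule monoidI)
    show "\<one>\<^bsub>?FA\<^esub> \<in> carrier ?FA" by (auto intro: fsingle_free_assoc)
    show "x \<otimes>\<^bsub>?FA\<^esub> y \<in> carrier ?FA" if "x \<in> carrier ?FA" "y \<in> carrier ?FA" for x y
      using that by (rule free_assoc_mult_closed)
    have one: "fsingle R [] \<one> \<in> carrier ?FA" by (auto intro: fsingle_free_assoc)
    show "\<one>\<^bsub>?FA\<^esub> \<otimes>\<^bsub>?FA\<^esub> x = x" if "x \<in> carrier ?FA" for x using that
      by (induction rule: free_assoc_induct)
        (use one in \<open>simp_all add: free_assoc_null free_assoc_distr free_assoc_monom_mult\<close>)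
    show "x \<otimes>\<^bsub>?FA\<^esub> \<one>\<^bsub>?FA\<^esub> = x" if "x \<in> carrier ?FA" for x using that
      by (induction rule: free_assoc_induct)
        (use one in \<open>simp_all add: free_assoc_null free_assoc_distr free_assoc_monom_mult\<close>)
    have mono: "(fsingle R u c \<otimes>\<^bsub>?FA\<^esub> fsingle R v d) \<otimes>\<^bsub>?FA\<^esub> z = fsingle R u c \<otimes>\<^bsub>?FA\<^esub> (fsingle R v d \<otimes>\<^bsub>?FA\<^esub> z)"
      if "z \<in> carrier ?FA" "set u \<subseteq> X" "set v \<subseteq> X" "c \<in> carrier R" "d \<in> carrier R" for u v c d z
      using that
    proof (induction rule: free_assoc_induct)
      case zero
      then show ?case by (simp add: free_assoc_null fsingle_free_assoc free_assoc_monom_mult)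
    next
      case (monom w e)
      then show ?case by (simp add: free_assoc_monom_mult m_assoc)
    next
      case (add a b)
      then have "fsingle R u c \<in> carrier ?FA" "fsingle R v d \<in> carrier ?FA" by (simp_all add: fsingle_free_assoc)
      then show ?case using add by (simp add: free_assoc_distr free_assoc_mult_closed)
    qed
    have mono2: "(fsingle R u c \<otimes>\<^bsub>?FA\<^esub> y) \<otimes>\<^bsub>?FA\<^esub> z = fsingle R u c \<otimes>\<^bsub>?FA\<^esub> (y \<otimes>\<^bsub>?FA\<^esub> z)"
      if "y \<in> carrier ?FA" "z \<in> carrier ?FA" "set u \<subseteq> X" "c \<in> carrier R" for u c y z
      using that
    proof (induction rule: free_assoc_induct)
      case zero
      then show ?case by (simp add: free_assoc_null fsingle_free_assoc free_assoc_mult_closed)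
    next
      case (monom w e)
      then show ?case by (simp add: mono)
    next
      case (add a b)
      then show ?case by (simp add: free_assoc_distr fsingle_free_assoc free_assoc_mult_closed FA.a_closed[simplified])
    qed
    show "(x \<otimes>\<^bsub>?FA\<^esub> y) \<otimes>\<^bsub>?FA\<^esub> z = x \<otimes>\<^bsub>?FA\<^esub> (y \<otimes>\<^bsub>?FA\<^esub> z)"
      if "x \<in> carrier ?FA" "y \<in> carrier ?FA" "z \<in> carrier ?FA" for x y z
      using that
    proof (induction rule: free_assoc_induct)
      case zero
      then show ?case by (simp add: free_assoc_null fsingle_free_assoc free_assoc_mult_closed)
    next
      case (monom w e)
      then show ?case by (simp add: mono2)
    next
      case (add a b)
      then show ?case by (simp add: free_assoc_distr fsingle_free_assoc free_assoc_mult_closed FA.a_closed[simplified])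
    qed
  qed
qed

end

section \<open>The restricted universal enveloping algebra\<close>

text \<open>
  The construction of \<open>u(L)\<close> and the description of its modules make sense as soon as the carrier of \<open>L\<close>
  is closed under the operations.  Working with these closure properties lets the same results apply to
  \<open>L\<close> and to \<open>L/Ann\<^sub>L(S)\<close>.
\<close>

locale restricted_data = F?: field F
  for p :: nat and F :: "('f, 'z) ring_scheme" (structure) and L :: "('f, 'a, 'y) rlie_scheme" +
  assumes L_closed: "\<lbrakk>x \<in> carrier L; y \<in> carrier L\<rbrakk> \<Longrightarrow> x \<oplus>\<^bsub>L\<^esub> y \<in> carrier L"
    "\<lbrakk>c \<in> carrier F; x \<in> carrier L\<rbrakk> \<Longrightarrow> c \<odot>\<^bsub>L\<^esub> x \<in> carrier L"
    "\<lbrakk>x \<in> carrier L; y \<in> carrier L\<rbrakk> \<Longrightarrow> bracket L x y \<in> carrier L"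
    "x \<in> carrier L \<Longrightarrow> pmap L x \<in> carrier L"
    and p_pos: "0 < p"
begin

abbreviation "FA \<equiv> free_assoc F (carrier L)"
abbreviation "Rel \<equiv> Idl\<^bsub>FA\<^esub> (envel_relations p F L)"
abbreviation "uL \<equiv> res_envel p F L"
abbreviation "gen x \<equiv> Rel +>\<^bsub>FA\<^esub> fsingle F [x] \<one>"
abbreviation "scal c \<equiv> Rel +>\<^bsub>FA\<^esub> fsingle F [] c"

sublocale FA: ring FA by (rule free_assoc_ring)

lemma mon: "set w \<subseteq> carrier L \<Longrightarrow> c \<in> carrier F \<Longrightarrow> fsingle F w c \<in> carrier FA"
  by (rule fsingle_free_assoc)

lemma relations:
  shows "\<lbrakk>x \<in> carrier L; y \<in> carrier L\<rbrakk> \<Longrightarrow>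
      fsingle F [x \<oplus>\<^bsub>L\<^esub> y] \<one> \<ominus>\<^bsub>FA\<^esub> (fsingle F [x] \<one> \<oplus>\<^bsub>FA\<^esub> fsingle F [y] \<one>) \<in> envel_relations p F L"
    "\<lbrakk>c \<in> carrier F; x \<in> carrier L\<rbrakk> \<Longrightarrow>
      fsingle F [c \<odot>\<^bsub>L\<^esub> x] \<one> \<ominus>\<^bsub>FA\<^esub> fsingle F [x] c \<in> envel_relations p F L"
    "\<lbrakk>x \<in> carrier L; y \<in> carrier L\<rbrakk> \<Longrightarrow>
      (fsingle F [x, y] \<one> \<ominus>\<^bsub>FA\<^esub> fsingle F [y, x] \<one>) \<ominus>\<^bsub>FA\<^esub> fsingle F [bracket L x y] \<one> \<in> envel_relations p F L"
    "x \<in> carrier L \<Longrightarrow>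
      fsingle F (replicate p x) \<one> \<ominus>\<^bsub>FA\<^esub> fsingle F [pmap L x] \<one> \<in> envel_relations p F L"
  unfolding envel_relations_def Let_def word_monom_fsingle by blast+

lemma envel_relations_cases:
  assumes "a \<in> envel_relations p F L"
  obtains x y where "x \<in> carrier L" "y \<in> carrier L"
      "a = fsingle F [x \<oplus>\<^bsub>L\<^esub> y] \<one> \<ominus>\<^bsub>FA\<^esub> (fsingle F [x] \<one> \<oplus>\<^bsub>FA\<^esub> fsingle F [y] \<one>)"
  | c x where "c \<in> carrier F" "x \<in> carrier L" "a = fsingle F [c \<odot>\<^bsub>L\<^esub> x] \<one> \<ominus>\<^bsub>FA\<^esub> fsingle F [x] c"
  | x y where "x \<in> carrier L" "y \<in> carrier L"
      "a = (fsingle F [x, y] \<one> \<ominus>\<^bsub>FA\<^esub> fsingle F [y, x] \<one>) \<ominus>\<^bsub>FA\<^esub> fsingle F [bracket L x y] \<one>"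
  | x where "x \<in> carrier L" "a = fsingle F (replicate p x) \<one> \<ominus>\<^bsub>FA\<^esub> fsingle F [pmap L x] \<one>"
  using assms unfolding envel_relations_def Let_def word_monom_fsingle by blast

lemma relations_closed: "envel_relations p F L \<subseteq> carrier FA"
proof
  fix a assume "a \<in> envel_relations p F L"
  then show "a \<in> carrier FA"
    by (cases rule: envel_relations_cases)
      (auto simp del: free_assoc_simps simp: L_closed intro!: FA.minus_closed FA.a_closed mon)
qed

sublocale Rel: ideal Rel FA by (rule FA.genideal_ideal) (rule relations_closed)

lemma U_simps:
  "carrier uL = {Rel +>\<^bsub>FA\<^esub> a | a. a \<in> carrier FA}"
  "\<lbrakk>a \<in> carrier FA; b \<in> carrier FA\<rbrakk> \<Longrightarrow> (Rel +>\<^bsub>FA\<^esub> a) \<otimes>\<^bsub>uL\<^esub> (Rel +>\<^bsub>FA\<^esub> b) = Rel +>\<^bsub>FA\<^esub> (a \<otimes>\<^bsub>FA\<^esub> b)"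
  "\<lbrakk>a \<in> carrier FA; b \<in> carrier FA\<rbrakk> \<Longrightarrow> (Rel +>\<^bsub>FA\<^esub> a) \<oplus>\<^bsub>uL\<^esub> (Rel +>\<^bsub>FA\<^esub> b) = Rel +>\<^bsub>FA\<^esub> (a \<oplus>\<^bsub>FA\<^esub> b)"
  "\<one>\<^bsub>uL\<^esub> = scal \<one>" "\<zero>\<^bsub>uL\<^esub> = Rel"
  by (auto simp: res_envel_def FactRing_def A_RCOSETS_def' Rel.rcoset_mult_add Rel.a_rcos_sum)

sublocale uL: ring uL
  unfolding res_envel_def by (rule Rel.quotient_is_ring)

lemma coset_eqI: "\<lbrakk>a \<in> carrier FA; b \<in> carrier FA; a \<ominus>\<^bsub>FA\<^esub> b \<in> envel_relations p F L\<rbrakk> \<Longrightarrow> Rel +>\<^bsub>FA\<^esub> a = Rel +>\<^bsub>FA\<^esub> b"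
  using Rel.coset_eq_iff FA.genideal_self[OF relations_closed] by blast

lemma gen_closed [simp, intro]: "x \<in> carrier L \<Longrightarrow> gen x \<in> carrier uL"
  and scal_closed [simp, intro]: "c \<in> carrier F \<Longrightarrow> scal c \<in> carrier uL"
  unfolding U_simps(1) using mon by fastforce+

lemma scal_gen: "\<lbrakk>c \<in> carrier F; x \<in> carrier L\<rbrakk> \<Longrightarrow> scal c \<otimes>\<^bsub>uL\<^esub> gen x = gen x \<otimes>\<^bsub>uL\<^esub> scal c"
  by (simp add: U_simps mon free_assoc_monom_mult)

lemma scal_scal: "\<lbrakk>c \<in> carrier F; d \<in> carrier F\<rbrakk> \<Longrightarrow> scal c \<otimes>\<^bsub>uL\<^esub> scal d = scal (c \<otimes> d)"
  by (simp add: U_simps mon free_assoc_monom_mult)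

lemma scal_add: "\<lbrakk>c \<in> carrier F; d \<in> carrier F\<rbrakk> \<Longrightarrow> scal (c \<oplus> d) = scal c \<oplus>\<^bsub>uL\<^esub> scal d"
proof -
  assume "c \<in> carrier F" "d \<in> carrier F"
  moreover have "fsingle F ([] :: 'a list) (c \<oplus> d) = (\<lambda>w. fsingle F [] c w \<oplus> fsingle F [] d w)"
    by (auto simp: fsingle_def)
  ultimately show ?thesis by (simp add: U_simps mon)
qed

lemma scal_zero: "scal \<zero> = \<zero>\<^bsub>uL\<^esub>"
proof -
  have "fsingle F ([] :: 'a list) \<zero> = \<zero>\<^bsub>FA\<^esub>" by (auto simp: fsingle_def)
  then show ?thesis using FA.a_coset_add_zero[OF Rel.a_subset] by (simp add: U_simps del: free_assoc_simps)
qed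

lemma gen_add: "\<lbrakk>x \<in> carrier L; y \<in> carrier L\<rbrakk> \<Longrightarrow> gen (x \<oplus>\<^bsub>L\<^esub> y) = gen x \<oplus>\<^bsub>uL\<^esub> gen y"
  using coset_eqI[OF _ _ relations(1)] by (simp add: U_simps mon L_closed FA.a_closed[simplified])

lemma gen_smult: "\<lbrakk>c \<in> carrier F; x \<in> carrier L\<rbrakk> \<Longrightarrow> gen (c \<odot>\<^bsub>L\<^esub> x) = scal c \<otimes>\<^bsub>uL\<^esub> gen x"
  using coset_eqI[OF _ _ relations(2)] by (simp add: U_simps mon L_closed free_assoc_monom_mult)

lemma gen_bracket:
  assumes "x \<in> carrier L" "y \<in> carrier L"
  shows "gen (bracket L x y) \<oplus>\<^bsub>uL\<^esub> gen y \<otimes>\<^bsub>uL\<^esub> gen x = gen x \<otimes>\<^bsub>uL\<^esub> gen y"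
proof -
  let ?b = "fsingle F [bracket L x y] \<one>" and ?xy = "fsingle F [x, y] \<one>" and ?yx = "fsingle F [y, x] \<one>"
  have c: "?b \<in> carrier FA" "?xy \<in> carrier FA" "?yx \<in> carrier FA" using assms L_closed by (auto intro!: mon)
  have "Rel +>\<^bsub>FA\<^esub> (?xy \<ominus>\<^bsub>FA\<^esub> ?yx) = Rel +>\<^bsub>FA\<^esub> ?b" using coset_eqI[OF _ _ relations(3)] assms c by blast
  then have "(Rel +>\<^bsub>FA\<^esub> ?b) \<oplus>\<^bsub>uL\<^esub> (Rel +>\<^bsub>FA\<^esub> ?yx) = Rel +>\<^bsub>FA\<^esub> ((?xy \<ominus>\<^bsub>FA\<^esub> ?yx) \<oplus>\<^bsub>FA\<^esub> ?yx)"
    using c U_simps(3)[of "?xy \<ominus>\<^bsub>FA\<^esub> ?yx" ?yx] by (metis FA.minus_closed)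
  also have "(?xy \<ominus>\<^bsub>FA\<^esub> ?yx) \<oplus>\<^bsub>FA\<^esub> ?yx = ?xy"
    using c by (simp del: free_assoc_simps add: FA.minus_eq FA.a_assoc FA.l_neg)
  finally show ?thesis using assms by (simp add: U_simps(2) mon free_assoc_monom_mult)
qed

lemma gen_pow:
  assumes "x \<in> carrier L" shows "gen x [^]\<^bsub>uL\<^esub> n = Rel +>\<^bsub>FA\<^esub> fsingle F (replicate n x) \<one>"
proof (induction n)
  case (Suc n)
  then show ?case using assms U_simps(2)[of "fsingle F (replicate n x) \<one>" "fsingle F [x] \<one>"]
    by (simp add: mon free_assoc_monom_mult replicate_append_same set_replicate_conv_if)
qed (simp add: U_simps)

lemma gen_pmap: "x \<in> carrier L \<Longrightarrow> gen (pmap L x) = gen x [^]\<^bsub>uL\<^esub> p"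
  unfolding gen_pow using coset_eqI[OF _ _ relations(4)]
  by (simp add: mon L_closed set_replicate_conv_if)

text \<open>
  \<open>u(L)\<close> is generated by the images of \<open>L\<close> and the scalars, so linearity over \<open>u(L)\<close> is linearity over
  these.  All homomorphisms out of the projective resolution are obtained in this way.
\<close>

lemma U_hom_generators:
  assumes M: "left_module uL M" and N: "left_module uL N"
    and c: "\<And>m. m \<in> carrier M \<Longrightarrow> f m \<in> carrier N"
    and a: "\<And>m n. \<lbrakk>m \<in> carrier M; n \<in> carrier M\<rbrakk> \<Longrightarrow> f (m \<oplus>\<^bsub>M\<^esub> n) = f m \<oplus>\<^bsub>N\<^esub> f n"
    and s: "\<And>c m. \<lbrakk>c \<in> carrier F; m \<in> carrier M\<rbrakk> \<Longrightarrow> f (scal c \<odot>\<^bsub>M\<^esub> m) = scal c \<odot>\<^bsub>N\<^esub> f m"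
    and g: "\<And>x m. \<lbrakk>x \<in> carrier L; m \<in> carrier M\<rbrakk> \<Longrightarrow> f (gen x \<odot>\<^bsub>M\<^esub> m) = gen x \<odot>\<^bsub>N\<^esub> f m"
    and r: "r \<in> carrier uL" and m: "m \<in> carrier M"
  shows "f (r \<odot>\<^bsub>M\<^esub> m) = r \<odot>\<^bsub>N\<^esub> f m"
proof -
  interpret M: left_module uL M by fact
  interpret N: left_module uL N by fact
  have f0: "f \<zero>\<^bsub>M\<^esub> = \<zero>\<^bsub>N\<^esub>"
    by (rule additive_zero[OF M.abelian_group_axioms N.abelian_group_axioms c a])
  obtain b where b: "b \<in> carrier FA" "r = Rel +>\<^bsub>FA\<^esub> b" using r by (auto simp: U_simps)
  have word: "\<forall>m\<in>carrier M. f ((Rel +>\<^bsub>FA\<^esub> fsingle F w c) \<odot>\<^bsub>M\<^esub> m) = (Rel +>\<^bsub>FA\<^esub> fsingle F w c) \<odot>\<^bsub>N\<^esub> f m"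
    if "c \<in> carrier F" "set w \<subseteq> carrier L" for w c using that(2)
  proof (induction w)
    case Nil
    then show ?case using s that by simp
  next
    case (Cons x w)
    let ?w = "Rel +>\<^bsub>FA\<^esub> fsingle F w c"
    have eq: "Rel +>\<^bsub>FA\<^esub> fsingle F (x # w) c = gen x \<otimes>\<^bsub>uL\<^esub> ?w"
      using Cons.prems that(1) by (simp add: U_simps(2) mon free_assoc_monom_mult)
    have wU: "?w \<in> carrier uL" using U_simps(1) mon that(1) Cons.prems by fastforce
    show ?case unfolding eq
    proof
      fix m assume m: "m \<in> carrier M"
      show "f (gen x \<otimes>\<^bsub>uL\<^esub> ?w \<odot>\<^bsub>M\<^esub> m) = gen x \<otimes>\<^bsub>uL\<^esub> ?w \<odot>\<^bsub>N\<^esub> f m"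
        using Cons wU m g c by (simp add: M.lsmult_assoc N.lsmult_assoc)
    qed
  qed
  have "\<forall>m\<in>carrier M. f ((Rel +>\<^bsub>FA\<^esub> b) \<odot>\<^bsub>M\<^esub> m) = (Rel +>\<^bsub>FA\<^esub> b) \<odot>\<^bsub>N\<^esub> f m"
    using b(1)
  proof (induction rule: free_assoc_induct)
    case zero
    have "Rel +>\<^bsub>FA\<^esub> (\<lambda>w. \<zero>) = \<zero>\<^bsub>uL\<^esub>" using FA.a_coset_add_zero[OF Rel.a_subset] by (simp add: U_simps)
    then show ?case using f0 c by simp
  next
    case (monom w c)
    then show ?case using word by blast
  next
    case (add a b)
    have "Rel +>\<^bsub>FA\<^esub> (\<lambda>w. a w \<oplus> b w) = (Rel +>\<^bsub>FA\<^esub> a) \<oplus>\<^bsub>uL\<^esub> (Rel +>\<^bsub>FA\<^esub> b)" using add U_simps(3) by simp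
    moreover have "Rel +>\<^bsub>FA\<^esub> a \<in> carrier uL" "Rel +>\<^bsub>FA\<^esub> b \<in> carrier uL" using add by (auto simp: U_simps)
    ultimately show ?case using add.IH c a by (simp add: M.lsmult_l_distr N.lsmult_l_distr)
  qed
  then show ?thesis using b m by blast
qed

end

section \<open>Restricted modules as modules over the enveloping algebra\<close>

locale restricted_data_module = restricted_data p F L + Mod: restricted_module p F L M
  for p :: nat and F :: "('f, 'z) ring_scheme" (structure) and L :: "('f, 'a, 'y) rlie_scheme"
    and M :: "('f, 'a, 'm) lie_module"
begin

abbreviation "word w m \<equiv> foldr (lact M) w m"
definition "ev a m = lin_comb F M (\<lambda>w. word w m) a"

sublocale MM: left_module F M by (rule Mod.left_module)

lemma word_closed [simp]: "set w \<subseteq> carrier L \<Longrightarrow> m \<in> carrier M \<Longrightarrow> word w m \<in> carrier M"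
  by (induction w) (auto intro: Mod.lact_closed)

lemma word_linear:
  assumes "set w \<subseteq> carrier L"
  shows "\<lbrakk>m \<in> carrier M; n \<in> carrier M\<rbrakk> \<Longrightarrow> word w (m \<oplus>\<^bsub>M\<^esub> n) = word w m \<oplus>\<^bsub>M\<^esub> word w n"
    and "\<lbrakk>c \<in> carrier F; m \<in> carrier M\<rbrakk> \<Longrightarrow> word w (c \<odot>\<^bsub>M\<^esub> m) = c \<odot>\<^bsub>M\<^esub> word w m"
  using assms by (induction w) (auto simp: Mod.lact_add_r Mod.lact_smult_r)

lemma
  assumes "a \<in> carrier FA" "m \<in> carrier M"
  shows ev_closed: "ev a m \<in> carrier M"
    and ev_smult: "c \<in> carrier F \<Longrightarrow> ev a (c \<odot>\<^bsub>M\<^esub> m) = c \<odot>\<^bsub>M\<^esub> ev a m"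
    and ev_add_r: "n \<in> carrier M \<Longrightarrow> ev a (m \<oplus>\<^bsub>M\<^esub> n) = ev a m \<oplus>\<^bsub>M\<^esub> ev a n"
proof -
  show "ev a m \<in> carrier M" unfolding ev_def
    by (rule MM.lin_comb_closed) (use assms in \<open>auto simp: free_assoc_carrier\<close>)
  have sup: "f w \<in> carrier F" if "f \<in> carrier FA" for f w
    using that by (simp add: free_assoc_carrier free_lmod_carrier)
  have sup2: "set w \<subseteq> carrier L" if "f \<in> carrier FA" "f w \<noteq> \<zero>" for f w
    using that by (auto simp: free_assoc_carrier free_lmod_carrier)
  have fin: "finite {w. a w \<noteq> \<zero>}" using assms by (auto simp: free_assoc_carrier free_lmod_carrier)
  show "ev a (c \<odot>\<^bsub>M\<^esub> m) = c \<odot>\<^bsub>M\<^esub> ev a m" if c: "c \<in> carrier F"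
  proof -
    have "ev a (c \<odot>\<^bsub>M\<^esub> m) = (\<Oplus>\<^bsub>M\<^esub>w\<in>{w. a w \<noteq> \<zero>}. c \<odot>\<^bsub>M\<^esub> (a w \<odot>\<^bsub>M\<^esub> word w m))"
      unfolding ev_def lin_comb_def
      by (rule Mod.V.M.finsum_cong') (use assms c sup sup2 in
        \<open>auto simp: word_linear Mod.V.smult_assoc1[symmetric] F.m_comm\<close>)
    then show ?thesis unfolding ev_def lin_comb_def
      by (subst MM.lsmult_finsum) (use assms c sup sup2 fin in auto)
  qed
  show "ev a (m \<oplus>\<^bsub>M\<^esub> n) = ev a m \<oplus>\<^bsub>M\<^esub> ev a n" if n: "n \<in> carrier M"
  proof -
    have "ev a (m \<oplus>\<^bsub>M\<^esub> n) =
        (\<Oplus>\<^bsub>M\<^esub>w\<in>{w. a w \<noteq> \<zero>}. a w \<odot>\<^bsub>M\<^esub> word w m \<oplus>\<^bsub>M\<^esub> a w \<odot>\<^bsub>M\<^esub> word w n)"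
      unfolding ev_def lin_comb_def
      by (rule Mod.V.M.finsum_cong') (use assms n sup sup2 in
        \<open>auto simp: word_linear Mod.V.smult_r_distr\<close>)
    then show ?thesis unfolding ev_def lin_comb_def
      by (subst Mod.V.M.finsum_addf[symmetric]) (use assms n sup sup2 in auto)
  qed
qed

lemma ev_add:
  "\<lbrakk>a \<in> carrier FA; b \<in> carrier FA; m \<in> carrier M\<rbrakk> \<Longrightarrow> ev (\<lambda>w. a w \<oplus> b w) m = ev a m \<oplus>\<^bsub>M\<^esub> ev b m"
  unfolding ev_def free_assoc_carrier by (rule MM.lin_comb_add) auto

lemma ev_zero: "ev (\<lambda>w. \<zero>) m = \<zero>\<^bsub>M\<^esub>"
  by (simp add: ev_def)

lemma ev_mon: "\<lbrakk>set w \<subseteq> carrier L; c \<in> carrier F; m \<in> carrier M\<rbrakk> \<Longrightarrow> ev (fsingle F w c) m = c \<odot>\<^bsub>M\<^esub> word w m"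
  unfolding ev_def by (simp add: MM.lin_comb_fsingle)

lemma ev_mult:
  assumes "a \<in> carrier FA" "b \<in> carrier FA" "m \<in> carrier M"
  shows "ev (a \<otimes>\<^bsub>FA\<^esub> b) m = ev a (ev b m)"
  using assms(1)
proof (induction rule: free_assoc_induct)
  case zero
  then show ?case using assms by (simp add: free_assoc_null ev_zero)
next
  case (add a c)
  then show ?case using assms by (simp add: free_assoc_distr ev_add free_assoc_mult_closed ev_closed)
next
  case (monom w c)
  show ?case using assms(2)
  proof (induction rule: free_assoc_induct)
    case zero
    have "word w \<zero>\<^bsub>M\<^esub> = \<zero>\<^bsub>M\<^esub>"
      using word_linear(2)[OF monom(1), of \<zero> "\<zero>\<^bsub>M\<^esub>"] monom by simp
    then show ?case using monom by (simp add: free_assoc_null mon ev_zero ev_mon)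
  next
    case (monom v d)
    then show ?case using \<open>set w \<subseteq> carrier L\<close> \<open>c \<in> carrier F\<close> assms
      by (simp add: free_assoc_monom_mult ev_mon word_linear Mod.V.smult_assoc1)
  next
    case (add b d)
    then show ?case using monom assms
      by (simp add: free_assoc_distr mon ev_add free_assoc_mult_closed ev_closed ev_add_r)
  qed
qed

lemma ev_minus:
  "\<lbrakk>a \<in> carrier FA; b \<in> carrier FA; m \<in> carrier M\<rbrakk> \<Longrightarrow> ev (a \<ominus>\<^bsub>FA\<^esub> b) m = ev a m \<ominus>\<^bsub>M\<^esub> ev b m"
  by (rule additive_minus(2)[OF FA.abelian_group_axioms Mod.V.M.abelian_group_axioms])
    (auto simp: ev_closed ev_add)

lemma word_replicate: "word (replicate n x) m = (lact M x ^^ n) m"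
  by (induction n) auto

text \<open>
  The polynomials acting as zero on all of \<open>M\<close> form an ideal containing the defining relations of \<open>u(L)\<close>;
  this is where each axiom of a restricted module is used.
\<close>

lemma ev_ideal:
  assumes "a \<in> Rel" "m \<in> carrier M" shows "ev a m = \<zero>\<^bsub>M\<^esub>"
proof -
  define N where "N = {a \<in> carrier FA. \<forall>m\<in>carrier M. ev a m = \<zero>\<^bsub>M\<^esub>}"
  have ev0: "ev a \<zero>\<^bsub>M\<^esub> = \<zero>\<^bsub>M\<^esub>" if "a \<in> carrier FA" for a
    using ev_smult[OF that, of "\<zero>\<^bsub>M\<^esub>" \<zero>] ev_closed[OF that] by simp
  have "ideal N FA"
  proof (rule idealI[OF FA.ring_axioms])
    show "subgroup N (add_monoid FA)"
    proof (rule FA.add.subgroupI)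
      show "N \<subseteq> carrier FA" "N \<noteq> {}" using FA.zero_closed by (auto simp: N_def ev_zero)
      show "\<ominus>\<^bsub>FA\<^esub> a \<in> N" if "a \<in> N" for a
      proof -
        have "ev (\<zero>\<^bsub>FA\<^esub> \<ominus>\<^bsub>FA\<^esub> a) m = \<zero>\<^bsub>M\<^esub>" if "m \<in> carrier M" for m
          using ev_minus[of "\<zero>\<^bsub>FA\<^esub>" a m] that \<open>a \<in> N\<close> FA.zero_closed
          by (simp add: N_def ev_zero Mod.V.M.minus_eq)
        then show ?thesis using that by (simp del: free_assoc_simps add: N_def FA.minus_eq)
      qed
      show "a \<oplus>\<^bsub>FA\<^esub> b \<in> N" if "a \<in> N" "b \<in> N" for a b
        using that FA.a_closed[of a b] by (simp add: N_def ev_add)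
    qed
    show "x \<otimes>\<^bsub>FA\<^esub> a \<in> N" "a \<otimes>\<^bsub>FA\<^esub> x \<in> N" if "a \<in> N" "x \<in> carrier FA" for a x
      using that by (auto simp: N_def ev_mult ev0 ev_closed)
  qed
  moreover have "envel_relations p F L \<subseteq> N"
  proof
    fix a assume a: "a \<in> envel_relations p F L"
    then have ac: "a \<in> carrier FA" using relations_closed by blast
    have "ev a m = \<zero>\<^bsub>M\<^esub>" if m: "m \<in> carrier M" for m
      using a
    proof (cases rule: envel_relations_cases)
      case (1 x y)
      then have "ev a m = lact M (x \<oplus>\<^bsub>L\<^esub> y) m \<ominus>\<^bsub>M\<^esub> (lact M x m \<oplus>\<^bsub>M\<^esub> lact M y m)"
        using m FA.a_closed[of "fsingle F [x] \<one>" "fsingle F [y] \<one>"]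
        by (simp add: ev_minus ev_add mon L_closed ev_mon Mod.lact_closed)
      then show ?thesis using 1 m by (simp add: Mod.lact_add_l Mod.lact_closed Mod.V.M.minus_eq Mod.V.M.r_neg)
    next
      case (2 c x)
      then show ?thesis using m
        by (simp add: ev_minus mon L_closed ev_mon Mod.lact_closed Mod.lact_smult_l Mod.V.M.minus_eq Mod.V.M.r_neg)
    next
      case (3 x y)
      then have "ev a m = (lact M x (lact M y m) \<ominus>\<^bsub>M\<^esub> lact M y (lact M x m)) \<ominus>\<^bsub>M\<^esub> lact M (bracket L x y) m"
        using m FA.minus_closed[of "fsingle F [x, y] \<one>" "fsingle F [y, x] \<one>"]
        by (simp add: ev_minus mon L_closed ev_mon Mod.lact_closed)
      then show ?thesis using 3 m by (simp add: Mod.lact_bracket Mod.lact_closed Mod.V.M.minus_eq Mod.V.M.r_neg)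
    next
      case (4 x)
      then have "ev a m = (lact M x ^^ p) m \<ominus>\<^bsub>M\<^esub> lact M (pmap L x) m"
        using m word_closed[of "replicate p x" m]
        by (simp add: ev_minus mon L_closed ev_mon Mod.lact_closed word_replicate set_replicate_conv_if)
      then show ?thesis using 4 m Mod.lact_closed[of "pmap L x" m]
        by (simp add: Mod.lact_pmap L_closed Mod.V.M.minus_eq Mod.V.M.r_neg)
    qed
    then show "a \<in> N" using ac by (simp add: N_def)
  qed
  ultimately have "Rel \<subseteq> N" by (rule FA.genideal_minimal)
  then show ?thesis using assms by (auto simp: N_def)
qed

abbreviation "EM \<equiv> envel_module F M"

lemma envel_simps [simp]:
  "carrier EM = carrier M" "\<zero>\<^bsub>EM\<^esub> = \<zero>\<^bsub>M\<^esub>" "add EM = add M"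
  by (simp_all add: envel_module_def)

text \<open>
  The action of a coset is defined through an arbitrary representative; the choice does not matter
  because the ideal acts as zero.
\<close>

lemma envel_smult:
  assumes "a \<in> carrier FA" "m \<in> carrier M"
  shows "(Rel +>\<^bsub>FA\<^esub> a) \<odot>\<^bsub>EM\<^esub> m = ev a m"
proof -
  define b where "b = (SOME b. b \<in> Rel +>\<^bsub>FA\<^esub> a)"
  have "b \<in> Rel +>\<^bsub>FA\<^esub> a" unfolding b_def using someI_ex Rel.a_rcos_self[OF assms(1)] by metis
  then have b: "b \<in> carrier FA" "b \<ominus>\<^bsub>FA\<^esub> a \<in> Rel" using Rel.mem_coset_iff[OF assms(1)] by auto
  have "ev b m \<ominus>\<^bsub>M\<^esub> ev a m = \<zero>\<^bsub>M\<^esub>" using ev_ideal[OF b(2) assms(2)] ev_minus b assms by simp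
  then have "ev b m = ev a m"
    using ev_closed[OF b(1) assms(2)] ev_closed[OF assms] by (simp add: Mod.V.M.minus_eq_zero_iff)
  moreover have "(Rel +>\<^bsub>FA\<^esub> a) \<odot>\<^bsub>EM\<^esub> m = ev b m"
    unfolding envel_module_def by (simp add: Let_def b_def[symmetric] ev_def lin_comb_def)
  ultimately show ?thesis by simp
qed

lemma gen_act [simp]: "x \<in> carrier L \<Longrightarrow> m \<in> carrier M \<Longrightarrow> gen x \<odot>\<^bsub>EM\<^esub> m = lact M x m"
  by (simp add: envel_smult mon ev_mon Mod.lact_closed)

lemma scal_act [simp]: "c \<in> carrier F \<Longrightarrow> m \<in> carrier M \<Longrightarrow> scal c \<odot>\<^bsub>EM\<^esub> m = c \<odot>\<^bsub>M\<^esub> m"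
  by (simp add: envel_smult mon ev_mon)

lemma envel_left_module: "left_module uL EM"
proof (intro left_module.intro left_module_axioms.intro)
  show "ring uL" by (rule uL.ring_axioms)
  show "abelian_group EM" by (rule abelian_group_transfer[OF Mod.V.M.abelian_group_axioms]) simp_all
qed (auto simp: U_simps envel_smult ev_closed ev_add ev_add_r ev_mult free_assoc_mult_closed
    FA.a_closed[simplified] mon ev_mon)

sublocale EM: left_module uL EM by (rule envel_left_module)

end

section \<open>Lifting along projective modules\<close>

text \<open>
  Writing \<open>P\<close> as a retract of a free module reduces the lifting property to the free module, where the
  images of the unit vectors can be chosen freely.
\<close>

lemma projective_lift:
  fixes P :: "('r, 'c, 'y) module_scheme"
  assumes P: "projective_lmod R P" and E: "left_module R E" and T: "left_module R T"
    and f: "f \<in> lmod_hom R E T" "f ` carrier E = carrier T" and e: "e \<in> lmod_hom R P T"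
  shows "\<exists>h\<in>lmod_hom R P E. \<forall>q\<in>carrier P. f (h q) = e q"
proof -
  obtain I :: "'c set" and i r where ir: "i \<in> lmod_hom R P (free_lmod R I)"
    "r \<in> lmod_hom R (free_lmod R I) P" "\<And>x. x \<in> carrier P \<Longrightarrow> r (i x) = x"
    using P unfolding projective_lmod_def by blast
  interpret P: left_module R P using P by (simp add: projective_lmod_def)
  interpret E: left_module R E by fact
  interpret T: left_module R T by fact
  interpret Fr: left_module R "free_lmod R I" by (rule P.R.free_lmod_left_module)
  note fD = lmod_homD[OF f(1)] and eD = lmod_homD[OF e] and iD = lmod_homD[OF ir(1)] and rD = lmod_homD[OF ir(2)]
  have "\<exists>y. y \<in> carrier E \<and> f y = e (r (fsingle R k \<one>\<^bsub>R\<^esub>))" if "k \<in> I" for k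
  proof -
    have "e (r (fsingle R k \<one>\<^bsub>R\<^esub>)) \<in> f ` carrier E"
      unfolding f(2) using that by (intro eD rD P.R.fsingle_carrier) auto
    then show ?thesis by (metis imageE)
  qed
  then obtain y where y: "\<And>k. k \<in> I \<Longrightarrow> y k \<in> carrier E" "\<And>k. k \<in> I \<Longrightarrow> f (y k) = e (r (fsingle R k \<one>\<^bsub>R\<^esub>))"
    by metis
  let ?H = "lin_comb R E y"
  have H: "f (?H a) = e (r a)" if "a \<in> carrier (free_lmod R I)" for a using that
  proof (induction rule: P.R.free_lmod_induct)
    case zero
    have "f \<zero>\<^bsub>E\<^esub> = \<zero>\<^bsub>T\<^esub>" "e \<zero>\<^bsub>P\<^esub> = \<zero>\<^bsub>T\<^esub>" "r (\<lambda>i. \<zero>\<^bsub>R\<^esub>) = \<zero>\<^bsub>P\<^esub>"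
      using lmod_hom_zero[OF E T f(1)] lmod_hom_zero[OF P.left_module_axioms T e]
        lmod_hom_zero[OF Fr.left_module_axioms P.left_module_axioms ir(2)] by simp_all
    then show ?case by simp
  next
    case (add k s g)
    have u1: "fsingle R k \<one>\<^bsub>R\<^esub> \<in> carrier (free_lmod R I)" and u: "fsingle R k s \<in> carrier (free_lmod R I)"
      using P.R.fsingle_carrier[OF add(1)] add(2) by auto
    have "fsingle R k s = s \<odot>\<^bsub>free_lmod R I\<^esub> fsingle R k \<one>\<^bsub>R\<^esub>" using add by (auto simp: fsingle_def)
    then have "e (r (fsingle R k s)) = s \<odot>\<^bsub>T\<^esub> e (r (fsingle R k \<one>\<^bsub>R\<^esub>))"
      using rD(4)[OF add(2) u1] eD(4)[OF add(2) rD(2)[OF u1]] by metis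
    also have "\<dots> = f (s \<odot>\<^bsub>E\<^esub> y k)" using fD(4) add y by metis
    also have "s \<odot>\<^bsub>E\<^esub> y k = ?H (fsingle R k s)" using add y by (simp add: E.lin_comb_fsingle)
    finally have 1: "e (r (fsingle R k s)) = f (?H (fsingle R k s))" .
    have Hc: "?H (fsingle R k s) \<in> carrier E" "?H g \<in> carrier E"
      using E.lin_comb_closed[OF u] E.lin_comb_closed[OF add(3)] y by blast+
    have "e (r (\<lambda>i. fsingle R k s i \<oplus>\<^bsub>R\<^esub> g i)) = e (r (fsingle R k s)) \<oplus>\<^bsub>T\<^esub> e (r g)"
      using rD(3)[OF u add(3)] eD(3)[OF rD(2)[OF u] rD(2)[OF add(3)]] by simp
    also have "\<dots> = f (?H (fsingle R k s) \<oplus>\<^bsub>E\<^esub> ?H g)" using 1 add.IH fD(3)[OF Hc] by simp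
    also have "?H (fsingle R k s) \<oplus>\<^bsub>E\<^esub> ?H g = ?H (\<lambda>i. fsingle R k s i \<oplus>\<^bsub>R\<^esub> g i)"
      using E.lin_comb_add[OF u add(3)] y by metis
    finally show ?case by simp
  qed
  define h where "h = (\<lambda>q\<in>carrier P. ?H (i q))"
  have "h \<in> lmod_hom R P E"
  proof -
    have "?H (i q) \<in> carrier E" if "q \<in> carrier P" for q using E.lin_comb_closed[OF iD(2)[OF that]] y by blast
    moreover have "?H (i (q \<oplus>\<^bsub>P\<^esub> q')) = ?H (i q) \<oplus>\<^bsub>E\<^esub> ?H (i q')" if "q \<in> carrier P" "q' \<in> carrier P" for q q'
      using iD(3)[OF that] E.lin_comb_add[OF iD(2)[OF that(1)] iD(2)[OF that(2)]] y by simp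
    moreover have "?H (i (s \<odot>\<^bsub>P\<^esub> q)) = s \<odot>\<^bsub>E\<^esub> ?H (i q)" if "s \<in> carrier R" "q \<in> carrier P" for s q
      using iD(4)[OF that] E.lin_comb_smult[OF iD(2)[OF that(2)]] y that by simp
    ultimately show ?thesis by (auto simp: lmod_hom_def h_def)
  qed
  moreover have "f (h q) = e q" if "q \<in> carrier P" for q
    using H[OF iD(2)[OF that]] ir(3) that by (simp add: h_def)
  ultimately show ?thesis by blast
qed

section \<open>Restricted derivations and the first restricted cohomology\<close>

text \<open>
  The last condition is what \<open>\<delta>(x\<^sup>p)\<close> evaluates to for a derivation of an associative algebra into a
  module on which \<open>x\<close> acts as zero from the right.
\<close>

definition res_der ::
    "nat \<Rightarrow> ('f, 'z) ring_scheme \<Rightarrow> ('f, 'a, 'y) rlie_scheme \<Rightarrow> ('f, 'a, 'm, 'x) lie_module_scheme \<Rightarrow> ('a \<Rightarrow> 'm) set"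
  where "res_der p F L M = {\<delta> \<in> lmod_hom F L M.
     (\<forall>x\<in>carrier L. \<forall>y\<in>carrier L. \<delta> (bracket L x y) = lact M x (\<delta> y) \<ominus>\<^bsub>M\<^esub> lact M y (\<delta> x)) \<and>
     (\<forall>x\<in>carrier L. \<delta> (pmap L x) = (lact M x ^^ (p - 1)) (\<delta> x))}"

definition inner_der :: "('f, 'a, 'y) rlie_scheme \<Rightarrow> ('f, 'a, 'm, 'x) lie_module_scheme \<Rightarrow> ('a \<Rightarrow> 'm) set"
  where "inner_der L M = (\<lambda>m. \<lambda>x\<in>carrier L. lact M x m) ` carrier M"

lemma res_derD:
  assumes "\<delta> \<in> res_der p F L M"
  shows "\<delta> \<in> lmod_hom F L M"
    "\<And>x y. x \<in> carrier L \<Longrightarrow> y \<in> carrier L \<Longrightarrow> \<delta> (bracket L x y) = lact M x (\<delta> y) \<ominus>\<^bsub>M\<^esub> lact M y (\<delta> x)"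
    "\<And>x. x \<in> carrier L \<Longrightarrow> \<delta> (pmap L x) = (lact M x ^^ (p - 1)) (\<delta> x)"
  using assms by (auto simp: res_der_def)

text \<open>
  The extension \<open>0 \<longrightarrow> M \<longrightarrow> M \<oplus> F \<longrightarrow> F \<longrightarrow> 0\<close> with the action \<open>x(m, c) = (x m + c \<delta>(x), 0)\<close>.  The two
  conditions on a restricted derivation express that this is a restricted module.
\<close>

definition der_extension ::
    "('f, 'z) ring_scheme \<Rightarrow> ('f, 'a, 'm) lie_module \<Rightarrow> ('a \<Rightarrow> 'm) \<Rightarrow> ('f, 'a, 'm \<times> 'f) lie_module"
  where "der_extension F M \<delta> =
    \<lparr>carrier = carrier M \<times> carrier F, mult = undefined, one = undefined, zero = (\<zero>\<^bsub>M\<^esub>, \<zero>\<^bsub>F\<^esub>),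
     add = (\<lambda>u v. (fst u \<oplus>\<^bsub>M\<^esub> fst v, snd u \<oplus>\<^bsub>F\<^esub> snd v)),
     smult = (\<lambda>c u. (c \<odot>\<^bsub>M\<^esub> fst u, c \<otimes>\<^bsub>F\<^esub> snd u)),
     lact = (\<lambda>x u. (lact M x (fst u) \<oplus>\<^bsub>M\<^esub> snd u \<odot>\<^bsub>M\<^esub> \<delta> x, \<zero>\<^bsub>F\<^esub>))\<rparr>"

lemma trivial_module_simps:
  "carrier (trivial_module F) = carrier F" "\<zero>\<^bsub>trivial_module F\<^esub> = \<zero>\<^bsub>F\<^esub>" "add (trivial_module F) = add F"
  "smult (trivial_module F) = mult F" "lact (trivial_module F) = (\<lambda>x c. \<zero>\<^bsub>F\<^esub>)"
  by (simp_all add: trivial_module_def)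

lemma der_extension_simps:
  "carrier (der_extension F M \<delta>) = carrier M \<times> carrier F"
  "\<zero>\<^bsub>der_extension F M \<delta>\<^esub> = (\<zero>\<^bsub>M\<^esub>, \<zero>\<^bsub>F\<^esub>)"
  "u \<oplus>\<^bsub>der_extension F M \<delta>\<^esub> v = (fst u \<oplus>\<^bsub>M\<^esub> fst v, snd u \<oplus>\<^bsub>F\<^esub> snd v)"
  "c \<odot>\<^bsub>der_extension F M \<delta>\<^esub> u = (c \<odot>\<^bsub>M\<^esub> fst u, c \<otimes>\<^bsub>F\<^esub> snd u)"
  "lact (der_extension F M \<delta>) x u = (lact M x (fst u) \<oplus>\<^bsub>M\<^esub> snd u \<odot>\<^bsub>M\<^esub> \<delta> x, \<zero>\<^bsub>F\<^esub>)"
  by (simp_all add: der_extension_def)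

context restricted_data begin

lemma trivial_restricted: "restricted_module p F L (trivial_module F)"
proof -
  have pw: "((\<lambda>c. \<zero>) ^^ p) m = \<zero>" for m :: 'f using p_pos by (cases p) auto
  let ?T = "trivial_module F :: ('f, 'a, 'f) lie_module"
  have ag: "abelian_group ?T"
    by (rule abelian_group_transfer[OF F.abelian_group_axioms]) (auto simp: trivial_module_simps)
  have "\<zero>\<^bsub>?T\<^esub> \<ominus>\<^bsub>?T\<^esub> \<zero>\<^bsub>?T\<^esub> = \<zero>\<^bsub>?T\<^esub>"
  proof -
    interpret T: abelian_group ?T by (rule ag)
    show ?thesis by (simp add: T.minus_eq T.r_neg)
  qed
  then have z: "\<zero> \<ominus>\<^bsub>?T\<^esub> \<zero> = \<zero>" by (simp add: trivial_module_simps)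
  show ?thesis
    by (intro restricted_module.intro restricted_module_axioms.intro moduleI F.is_cring ag)
      (use z in \<open>auto simp: trivial_module_simps pw F.l_distr F.r_distr F.m_assoc\<close>)
qed

end

context restricted_data_module begin

lemma lact_zero [simp]: "x \<in> carrier L \<Longrightarrow> lact M x \<zero>\<^bsub>M\<^esub> = \<zero>\<^bsub>M\<^esub>"
  using Mod.lact_smult_r[of \<zero> x "\<zero>\<^bsub>M\<^esub>"] Mod.lact_closed[of x "\<zero>\<^bsub>M\<^esub>"] by simp

lemma lact_pow_closed [simp]: "x \<in> carrier L \<Longrightarrow> m \<in> carrier M \<Longrightarrow> (lact M x ^^ n) m \<in> carrier M"
  by (induction n) (auto intro: Mod.lact_closed)

lemma lact_minus:
  "\<lbrakk>x \<in> carrier L; m \<in> carrier M; n \<in> carrier M\<rbrakk> \<Longrightarrow> lact M x (m \<ominus>\<^bsub>M\<^esub> n) = lact M x m \<ominus>\<^bsub>M\<^esub> lact M x n"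
  by (rule additive_minus(2)[OF Mod.V.M.abelian_group_axioms Mod.V.M.abelian_group_axioms])
    (auto simp: Mod.lact_add_r Mod.lact_closed)

lemma der_extension_restricted:
  assumes \<delta>: "\<delta> \<in> res_der p F L M"
  shows "restricted_module p F L (der_extension F M \<delta>)"
proof -
  let ?E = "der_extension F M \<delta>"
  note D = res_derD[OF \<delta>] and H = lmod_homD[OF res_derD(1)[OF \<delta>]]
  have ag: "abelian_group ?E"
  proof (rule abelian_groupI)
    fix u assume "u \<in> carrier ?E"
    then show "\<exists>v\<in>carrier ?E. v \<oplus>\<^bsub>?E\<^esub> u = \<zero>\<^bsub>?E\<^esub>"
      by (intro bexI[of _ "(\<ominus>\<^bsub>M\<^esub> fst u, \<ominus> snd u)"])
        (auto simp: der_extension_simps Mod.V.M.l_neg F.l_neg)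
  qed (auto simp: der_extension_simps Mod.V.M.a_ac F.a_ac)
  interpret E: abelian_group ?E by (rule ag)
  have inv: "\<ominus>\<^bsub>?E\<^esub> u = (\<ominus>\<^bsub>M\<^esub> fst u, \<ominus> snd u)" if "u \<in> carrier ?E" for u
    by (rule E.minus_equality)
      (use that in \<open>auto simp: der_extension_simps Mod.V.M.l_neg F.l_neg\<close>)
  have pow: "(lact ?E x ^^ Suc n) u =
      ((lact M x ^^ Suc n) (fst u) \<oplus>\<^bsub>M\<^esub> snd u \<odot>\<^bsub>M\<^esub> (lact M x ^^ n) (\<delta> x), \<zero>)"
    if "x \<in> carrier L" "u \<in> carrier ?E" for x u n
  proof (induction n)
    case 0
    show ?case by (simp add: der_extension_simps)
  next
    case (Suc n)
    have "(lact ?E x ^^ Suc (Suc n)) u = lact ?E x ((lact ?E x ^^ Suc n) u)" by simp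
    also have "\<dots> = ((lact M x ^^ Suc (Suc n)) (fst u) \<oplus>\<^bsub>M\<^esub> snd u \<odot>\<^bsub>M\<^esub> (lact M x ^^ Suc n) (\<delta> x), \<zero>)"
      unfolding Suc using that H(2)[OF that(1)] lact_pow_closed[OF that(1), of _ "Suc n"]
        lact_pow_closed[OF that(1), of _ "n"]
      by (auto simp: der_extension_simps Mod.lact_add_r Mod.lact_smult_r Mod.lact_closed)
    finally show ?case .
  qed
  show ?thesis
  proof (intro restricted_module.intro restricted_module_axioms.intro)
    show "module F ?E"
      by (intro moduleI F.is_cring ag)
        (auto simp: der_extension_simps Mod.V.smult_l_distr Mod.V.smult_r_distr Mod.V.smult_assoc1
          F.l_distr F.r_distr F.m_assoc)
  next
    fix x u assume xu: "x \<in> carrier L" "u \<in> carrier ?E"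
    have "lact ?E (pmap L x) u = ((lact M x ^^ p) (fst u) \<oplus>\<^bsub>M\<^esub> snd u \<odot>\<^bsub>M\<^esub> (lact M x ^^ (p - 1)) (\<delta> x), \<zero>)"
      using xu D(3) Mod.lact_pmap by (auto simp: der_extension_simps)
    also have "\<dots> = (lact ?E x ^^ p) u" using pow[OF xu, of "p - 1"] p_pos by simp
    finally show "lact ?E (pmap L x) u = (lact ?E x ^^ p) u" .
  next
    fix x y u assume xyu: "x \<in> carrier L" "y \<in> carrier L" "u \<in> carrier ?E"
    obtain m c where u: "u = (m, c)" "m \<in> carrier M" "c \<in> carrier F" using xyu by (auto simp: der_extension_simps)
    have cl: "\<delta> x \<in> carrier M" "\<delta> y \<in> carrier M" using H xyu by auto
    note cl = cl Mod.lact_closed[OF xyu(1)] Mod.lact_closed[OF xyu(2)]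
    have lE: "lact ?E z v \<in> carrier ?E" if "z \<in> carrier L" "v \<in> carrier ?E" for z v
      using that H(2) Mod.lact_closed by (auto simp: der_extension_simps)
    have "lact ?E x (lact ?E y u) \<ominus>\<^bsub>?E\<^esub> lact ?E y (lact ?E x u) =
      (lact M x (fst (lact ?E y u)) \<ominus>\<^bsub>M\<^esub> lact M y (fst (lact ?E x u)), \<zero>)"
      unfolding E.minus_eq using inv[OF lE[OF xyu(2) lE[OF xyu(1) xyu(3)]]] xyu lE cl
      by (simp add: u der_extension_simps Mod.V.M.minus_eq)
    also have "lact M x (fst (lact ?E y u)) \<ominus>\<^bsub>M\<^esub> lact M y (fst (lact ?E x u)) =
      (lact M x (lact M y m) \<ominus>\<^bsub>M\<^esub> lact M y (lact M x m)) \<oplus>\<^bsub>M\<^esub>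
      c \<odot>\<^bsub>M\<^esub> (lact M x (\<delta> y) \<ominus>\<^bsub>M\<^esub> lact M y (\<delta> x))"
      using xyu u cl by (simp add: der_extension_simps Mod.lact_add_r Mod.lact_smult_r Mod.V.M.minus_eq
          Mod.V.smult_r_distr Mod.V.smult_r_minus Mod.V.M.minus_add Mod.V.M.a_ac)
    also have "(\<dots>, \<zero>) = lact ?E (bracket L x y) u"
      using xyu u D(2) by (simp add: der_extension_simps Mod.lact_bracket)
    finally show "lact ?E (bracket L x y) u = lact ?E x (lact ?E y u) \<ominus>\<^bsub>?E\<^esub> lact ?E y (lact ?E x u)" ..
  next
    fix x u assume "x \<in> carrier L" "u \<in> carrier ?E"
    then show "lact ?E x u \<in> carrier ?E" using H(2) Mod.lact_closed by (auto simp: der_extension_simps)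
  next
    fix x y u assume "x \<in> carrier L" "y \<in> carrier L" "u \<in> carrier ?E"
    then show "lact ?E (x \<oplus>\<^bsub>L\<^esub> y) u = lact ?E x u \<oplus>\<^bsub>?E\<^esub> lact ?E y u"
      using H(2,3) Mod.lact_closed
      by (auto simp: der_extension_simps Mod.lact_add_l Mod.V.smult_r_distr Mod.V.M.a_ac)
  next
    fix x u v assume "x \<in> carrier L" "u \<in> carrier ?E" "v \<in> carrier ?E"
    then show "lact ?E x (u \<oplus>\<^bsub>?E\<^esub> v) = lact ?E x u \<oplus>\<^bsub>?E\<^esub> lact ?E x v"
      using H(2) Mod.lact_closed
      by (auto simp: der_extension_simps Mod.lact_add_r Mod.V.smult_l_distr Mod.V.M.a_ac)
  next
    fix c x u assume *: "c \<in> carrier F" "x \<in> carrier L" "u \<in> carrier ?E"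
    then obtain m k where u: "u = (m, k)" "m \<in> carrier M" "k \<in> carrier F" by (auto simp: der_extension_simps)
    have "k \<odot>\<^bsub>M\<^esub> (c \<odot>\<^bsub>M\<^esub> \<delta> x) = c \<odot>\<^bsub>M\<^esub> (k \<odot>\<^bsub>M\<^esub> \<delta> x)"
      using * u H(2) Mod.V.smult_assoc1 F.m_comm by metis
    then show "lact ?E (c \<odot>\<^bsub>L\<^esub> x) u = c \<odot>\<^bsub>?E\<^esub> lact ?E x u"
      using * u H Mod.lact_closed by (simp add: der_extension_simps Mod.lact_smult_l Mod.V.smult_r_distr)
    show "lact ?E x (c \<odot>\<^bsub>?E\<^esub> u) = c \<odot>\<^bsub>?E\<^esub> lact ?E x u"
      using * u H(2) Mod.lact_closed
      by (simp add: der_extension_simps Mod.lact_smult_r Mod.V.smult_r_distr Mod.V.smult_assoc1)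
  qed
qed

end


text \<open>
  First cohomology is computed from the end \<open>P\<^sub>1 \<longrightarrow> P\<^sub>0 \<longrightarrow> F\<close> of a projective resolution: a cocycle on \<open>P\<^sub>1\<close>
  amounts to a homomorphism on the kernel of \<open>P\<^sub>0 \<longrightarrow> F\<close>, and a coboundary to one that extends to \<open>P\<^sub>0\<close>.
\<close>

locale ext_one = restricted_data_module p F L M
  for p :: nat and F :: "('f, 'z) ring_scheme" (structure) and L :: "('f, 'a, 'y) rlie_scheme"
    and M :: "('f, 'a, 'm) lie_module" +
  fixes P :: "nat \<Rightarrow> (('a list \<Rightarrow> 'f) set, 'c) module" and d e
  assumes resolution: "trivial_resolution p F L P d e"
begin

sublocale T: restricted_data_module p F L "trivial_module F"
  by (intro restricted_data_module.intro trivial_restricted restricted_data_axioms)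

abbreviation "P0 \<equiv> P 0"
abbreviation "P1 \<equiv> P (Suc 0)"
abbreviation "d0 \<equiv> d 0"
abbreviation TM :: "(('a list \<Rightarrow> 'f) set, 'f) module" where "TM \<equiv> envel_module F (trivial_module F)"
abbreviation "Z \<equiv> ext_cocycles uL P d EM 1"

lemma TM_simps: "carrier TM = carrier F" "add TM = add F" "zero TM = zero F"
  unfolding T.envel_simps by (simp_all add: trivial_module_simps)

lemma res:
  shows proj: "projective_lmod uL (P n)" and d_hom: "d n \<in> lmod_hom uL (P (Suc n)) (P n)"
    and e_hom: "e \<in> lmod_hom uL P0 TM" and e_surj: "e ` carrier P0 = carrier F"
    and exact0: "{x \<in> carrier P0. e x = \<zero>} = d0 ` carrier P1"
    and exact1: "{x \<in> carrier P1. d0 x = \<zero>\<^bsub>P0\<^esub>} = d (Suc 0) ` carrier (P (Suc (Suc 0)))"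
proof -
  have r: "projective_resolution uL P d e TM" using resolution by (simp add: trivial_resolution_def)
  note r = r[unfolded projective_resolution_def TM_simps One_nat_def]
  from r have "\<forall>n. projective_lmod uL (P n)" by (elim conjE)
  then show "projective_lmod uL (P n)" ..
  from r have "\<forall>n. d n \<in> lmod_hom uL (P (Suc n)) (P n)" by (elim conjE)
  then show "d n \<in> lmod_hom uL (P (Suc n)) (P n)" ..
  from r show "e \<in> lmod_hom uL P0 TM" by (elim conjE)
  from r show "e ` carrier P0 = carrier F" by (elim conjE)
  from r show "{x \<in> carrier P0. e x = \<zero>} = d0 ` carrier P1" by (elim conjE)
  from r have "\<forall>n. {x \<in> carrier (P (Suc n)). d n x = \<zero>\<^bsub>P n\<^esub>} = d (Suc n) ` carrier (P (Suc (Suc n)))"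
    by (elim conjE)
  then show "{x \<in> carrier P1. d0 x = \<zero>\<^bsub>P0\<^esub>} = d (Suc 0) ` carrier (P (Suc (Suc 0)))" ..
qed

lemma P_mod: "left_module uL (P n)"
  using proj by (auto simp: projective_lmod_def)

sublocale P0: left_module uL P0 by (rule P_mod)
sublocale P1: left_module uL P1 by (rule P_mod)

lemma e_simps:
  shows "q \<in> carrier P0 \<Longrightarrow> e q \<in> carrier F"
    and "\<lbrakk>q \<in> carrier P0; r \<in> carrier P0\<rbrakk> \<Longrightarrow> e (q \<oplus>\<^bsub>P0\<^esub> r) = e q \<oplus> e r"
    and "\<lbrakk>c \<in> carrier F; q \<in> carrier P0\<rbrakk> \<Longrightarrow> e (scal c \<odot>\<^bsub>P0\<^esub> q) = c \<otimes> e q"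
    and "\<lbrakk>x \<in> carrier L; q \<in> carrier P0\<rbrakk> \<Longrightarrow> e (gen x \<odot>\<^bsub>P0\<^esub> q) = \<zero>"
    and "e \<zero>\<^bsub>P0\<^esub> = \<zero>"
    and "\<lbrakk>q \<in> carrier P0; r \<in> carrier P0\<rbrakk> \<Longrightarrow> e (q \<ominus>\<^bsub>P0\<^esub> r) = e q \<ominus> e r"
proof -
  note eD = lmod_homD[OF e_hom, unfolded TM_simps]
  show 1: "q \<in> carrier P0 \<Longrightarrow> e q \<in> carrier F" for q by (rule eD)
  show 2: "\<lbrakk>q \<in> carrier P0; r \<in> carrier P0\<rbrakk> \<Longrightarrow> e (q \<oplus>\<^bsub>P0\<^esub> r) = e q \<oplus> e r" for q r by (rule eD)
  show "\<lbrakk>c \<in> carrier F; q \<in> carrier P0\<rbrakk> \<Longrightarrow> e (scal c \<odot>\<^bsub>P0\<^esub> q) = c \<otimes> e q"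
    using eD(4)[of "scal c" q] 1 T.scal_act[of c "e q"] by (simp add: trivial_module_simps)
  show "\<lbrakk>x \<in> carrier L; q \<in> carrier P0\<rbrakk> \<Longrightarrow> e (gen x \<odot>\<^bsub>P0\<^esub> q) = \<zero>"
    using eD(4)[of "gen x" q] 1 T.gen_act[of x "e q"] by (simp add: trivial_module_simps)
  show "e \<zero>\<^bsub>P0\<^esub> = \<zero>"
    by (rule additive_zero[OF P0.M.abelian_group_axioms F.abelian_group_axioms 1 2])
  show "\<lbrakk>q \<in> carrier P0; r \<in> carrier P0\<rbrakk> \<Longrightarrow> e (q \<ominus>\<^bsub>P0\<^esub> r) = e q \<ominus> e r"
    by (rule additive_minus(2)[OF P0.M.abelian_group_axioms F.abelian_group_axioms 1 2])
qed

lemma d0_simps: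
  shows "q \<in> carrier P1 \<Longrightarrow> d0 q \<in> carrier P0"
    and "\<lbrakk>q \<in> carrier P1; r \<in> carrier P1\<rbrakk> \<Longrightarrow> d0 (q \<oplus>\<^bsub>P1\<^esub> r) = d0 q \<oplus>\<^bsub>P0\<^esub> d0 r"
    and "\<lbrakk>q \<in> carrier P1; r \<in> carrier P1\<rbrakk> \<Longrightarrow> d0 (q \<ominus>\<^bsub>P1\<^esub> r) = d0 q \<ominus>\<^bsub>P0\<^esub> d0 r"
    and "\<lbrakk>u \<in> carrier uL; q \<in> carrier P1\<rbrakk> \<Longrightarrow> d0 (u \<odot>\<^bsub>P1\<^esub> q) = u \<odot>\<^bsub>P0\<^esub> d0 q"
    and "q \<in> carrier P1 \<Longrightarrow> e (d0 q) = \<zero>"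
  using lmod_homD[OF d_hom[of 0]] lmod_hom_minus[OF P1.left_module_axioms P0.left_module_axioms d_hom[of 0]] exact0
  by auto

lemma d0_lift: "q \<in> carrier P0 \<Longrightarrow> e q = \<zero> \<Longrightarrow> \<exists>r. r \<in> carrier P1 \<and> d0 r = q"
  using exact0 by (metis (mono_tags, lifting) imageE mem_Collect_eq)

text \<open>
  This element plays the role of \<open>1 \<in> u(L)\<close>; the elements \<open>x \<cdot> base\<close> with \<open>x \<in> L\<close> lie in the kernel of the
  augmentation and correspond to the generators \<open>x\<close> of the augmentation ideal of \<open>u(L)\<close>.
\<close>

definition "base = (SOME q. q \<in> carrier P0 \<and> e q = \<one>)"

lemma base: "base \<in> carrier P0" "e base = \<one>"
proof -
  have "\<exists>q. q \<in> carrier P0 \<and> e q = \<one>" using e_surj F.one_closed by (metis imageE)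
  from someI_ex[OF this] show "base \<in> carrier P0" "e base = \<one>" by (auto simp: base_def)
qed

lemma gen_base_lift: "x \<in> carrier L \<Longrightarrow> \<exists>q. q \<in> carrier P1 \<and> d0 q = gen x \<odot>\<^bsub>P0\<^esub> base"
  by (rule d0_lift) (auto simp: e_simps base)

lemma ZD:
  assumes "g \<in> Z"
  shows "g \<in> lmod_hom uL P1 EM"
    "q \<in> carrier P1 \<Longrightarrow> g q \<in> carrier M"
    "\<lbrakk>q \<in> carrier P1; r \<in> carrier P1\<rbrakk> \<Longrightarrow> g (q \<oplus>\<^bsub>P1\<^esub> r) = g q \<oplus>\<^bsub>M\<^esub> g r"
    "\<lbrakk>q \<in> carrier P1; r \<in> carrier P1\<rbrakk> \<Longrightarrow> g (q \<ominus>\<^bsub>P1\<^esub> r) = g q \<ominus>\<^bsub>M\<^esub> g r"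
    "\<lbrakk>u \<in> carrier uL; q \<in> carrier P1\<rbrakk> \<Longrightarrow> g (u \<odot>\<^bsub>P1\<^esub> q) = u \<odot>\<^bsub>EM\<^esub> g q"
    "\<lbrakk>q \<in> carrier P1; r \<in> carrier P1; d0 q = d0 r\<rbrakk> \<Longrightarrow> g q = g r"
proof -
  show gh: "g \<in> lmod_hom uL P1 EM" using assms by (simp add: ext_cocycles_def)
  note gD = lmod_homD[OF gh, unfolded envel_simps]
  show c: "q \<in> carrier P1 \<Longrightarrow> g q \<in> carrier M" for q by (rule gD)
  show a: "\<lbrakk>q \<in> carrier P1; r \<in> carrier P1\<rbrakk> \<Longrightarrow> g (q \<oplus>\<^bsub>P1\<^esub> r) = g q \<oplus>\<^bsub>M\<^esub> g r" for q r by (rule gD)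
  show m: "\<lbrakk>q \<in> carrier P1; r \<in> carrier P1\<rbrakk> \<Longrightarrow> g (q \<ominus>\<^bsub>P1\<^esub> r) = g q \<ominus>\<^bsub>M\<^esub> g r" for q r
    by (rule additive_minus(2)[OF P1.M.abelian_group_axioms Mod.V.M.abelian_group_axioms c a])
  show "\<lbrakk>u \<in> carrier uL; q \<in> carrier P1\<rbrakk> \<Longrightarrow> g (u \<odot>\<^bsub>P1\<^esub> q) = u \<odot>\<^bsub>EM\<^esub> g q" by (rule gD)
  show "g q = g r" if "q \<in> carrier P1" "r \<in> carrier P1" "d0 q = d0 r"
  proof -
    have "d0 (q \<ominus>\<^bsub>P1\<^esub> r) = \<zero>\<^bsub>P0\<^esub>" using that d0_simps by (simp add: P0.M.minus_eq P0.M.r_neg)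
    then have "q \<ominus>\<^bsub>P1\<^esub> r \<in> {x \<in> carrier P1. d0 x = \<zero>\<^bsub>P0\<^esub>}" using that by simp
    then obtain t where "t \<in> carrier (P (Suc (Suc 0)))" "q \<ominus>\<^bsub>P1\<^esub> r = d (Suc 0) t"
      unfolding exact1 by blast
    then have "g (q \<ominus>\<^bsub>P1\<^esub> r) = \<zero>\<^bsub>M\<^esub>" using assms by (simp add: ext_cocycles_def)
    then have "g q \<ominus>\<^bsub>M\<^esub> g r = \<zero>\<^bsub>M\<^esub>" using m that by simp
    then show ?thesis using c[OF that(1)] c[OF that(2)] by (simp add: Mod.V.M.minus_eq_zero_iff)
  qed
qed

lemma cocycle_zero:
  assumes "g \<in> Z" "q \<in> carrier P1" "d0 q = \<zero>\<^bsub>P0\<^esub>" shows "g q = \<zero>\<^bsub>M\<^esub>"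
proof -
  have "d0 \<zero>\<^bsub>P1\<^esub> = \<zero>\<^bsub>P0\<^esub>" "g \<zero>\<^bsub>P1\<^esub> = \<zero>\<^bsub>M\<^esub>"
    using lmod_hom_zero[OF P1.left_module_axioms P0.left_module_axioms d_hom[of 0]]
      lmod_hom_zero[OF P1.left_module_axioms EM.left_module_axioms ZD(1)[OF assms(1)]] by simp_all
  then show ?thesis using ZD(6)[OF assms(1,2) P1.M.zero_closed] assms(3) by simp
qed

text \<open>
  A preimage of \<open>x \<cdot> base\<close> in \<open>P\<^sub>1\<close> may be chosen arbitrarily, since a cocycle vanishes on the kernel of
  \<open>P\<^sub>1 \<longrightarrow> P\<^sub>0\<close>.
\<close>

definition "der_of_cocycle g = (\<lambda>x\<in>carrier L. g (SOME q. q \<in> carrier P1 \<and> d0 q = gen x \<odot>\<^bsub>P0\<^esub> base))"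

lemma der_of_cocycle_eq:
  assumes "g \<in> Z" "x \<in> carrier L" "q \<in> carrier P1" "d0 q = gen x \<odot>\<^bsub>P0\<^esub> base"
  shows "der_of_cocycle g x = g q"
proof -
  define s where "s = (SOME q. q \<in> carrier P1 \<and> d0 q = gen x \<odot>\<^bsub>P0\<^esub> base)"
  have "s \<in> carrier P1 \<and> d0 s = gen x \<odot>\<^bsub>P0\<^esub> base"
    unfolding s_def by (rule someI[of _ q]) (use assms in blast)
  then have "g s = g q" using assms(3,4) by (intro ZD(6)[OF assms(1)]) simp_all
  then show ?thesis using assms(2) by (simp add: der_of_cocycle_def s_def)
qed

lemma der_of_cocycle_pointwise:
  assumes "\<And>q. q \<in> carrier P1 \<Longrightarrow> k q = h (g q) (g' q)" "x \<in> carrier L"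
  shows "der_of_cocycle k x = h (der_of_cocycle g x) (der_of_cocycle g' x)"
proof -
  have "(SOME q. q \<in> carrier P1 \<and> d0 q = gen x \<odot>\<^bsub>P0\<^esub> base) \<in> carrier P1 \<and>
    d0 (SOME q. q \<in> carrier P1 \<and> d0 q = gen x \<odot>\<^bsub>P0\<^esub> base) = gen x \<odot>\<^bsub>P0\<^esub> base"
    by (rule someI_ex) (use gen_base_lift assms in blast)
  then show ?thesis using assms by (simp add: der_of_cocycle_def)
qed

text \<open>
  Each property of the derivation comes from the corresponding relation in \<open>u(L)\<close>, applied to \<open>base\<close>.
\<close>

lemma der_of_cocycle_res_der:
  assumes g: "g \<in> Z" shows "der_of_cocycle g \<in> res_der p F L M"
proof -
  note Zg = ZD[OF g] and te = der_of_cocycle_eq[OF g]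
  have sg: "scal c \<odot>\<^bsub>P0\<^esub> (gen x \<odot>\<^bsub>P0\<^esub> base) = gen (c \<odot>\<^bsub>L\<^esub> x) \<odot>\<^bsub>P0\<^esub> base"
    if "c \<in> carrier F" "x \<in> carrier L" for c x
    using that base by (simp add: gen_smult P0.lsmult_assoc)
  have "der_of_cocycle g \<in> lmod_hom F L M"
    unfolding lmod_hom_def
  proof (intro CollectI conjI ballI)
    show "der_of_cocycle g \<in> carrier L \<rightarrow>\<^sub>E carrier M"
    proof (rule PiE_I)
      fix x assume x: "x \<in> carrier L"
      then obtain q where q: "q \<in> carrier P1" "d0 q = gen x \<odot>\<^bsub>P0\<^esub> base" using gen_base_lift by meson
      then show "der_of_cocycle g x \<in> carrier M" using te[OF x q] Zg(2) by simp
    qed (simp add: der_of_cocycle_def)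
  next
    fix x y assume xy: "x \<in> carrier L" "y \<in> carrier L"
    obtain q r where *: "q \<in> carrier P1" "d0 q = gen x \<odot>\<^bsub>P0\<^esub> base" "r \<in> carrier P1" "d0 r = gen y \<odot>\<^bsub>P0\<^esub> base"
      using gen_base_lift xy by meson
    have d: "d0 (q \<oplus>\<^bsub>P1\<^esub> r) = gen (x \<oplus>\<^bsub>L\<^esub> y) \<odot>\<^bsub>P0\<^esub> base"
      using * xy base by (simp add: d0_simps gen_add P0.lsmult_l_distr)
    then show "der_of_cocycle g (x \<oplus>\<^bsub>L\<^esub> y) = der_of_cocycle g x \<oplus>\<^bsub>M\<^esub> der_of_cocycle g y"
      using te[OF _ _ d] te[OF xy(1) *(1,2)] te[OF xy(2) *(3,4)] xy * L_closed(1) Zg(3) by simp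
  next
    fix c x assume cx: "c \<in> carrier F" "x \<in> carrier L"
    obtain q where *: "q \<in> carrier P1" "d0 q = gen x \<odot>\<^bsub>P0\<^esub> base" using gen_base_lift cx by meson
    have d: "d0 (scal c \<odot>\<^bsub>P1\<^esub> q) = gen (c \<odot>\<^bsub>L\<^esub> x) \<odot>\<^bsub>P0\<^esub> base"
      using * cx by (simp add: d0_simps sg)
    then show "der_of_cocycle g (c \<odot>\<^bsub>L\<^esub> x) = c \<odot>\<^bsub>M\<^esub> der_of_cocycle g x"
      using te[OF _ _ d] te[OF cx(2) *] cx * L_closed(2) Zg(2,5) by simp
  qed
  moreover have "der_of_cocycle g (bracket L x y) = lact M x (der_of_cocycle g y) \<ominus>\<^bsub>M\<^esub> lact M y (der_of_cocycle g x)"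
    if xy: "x \<in> carrier L" "y \<in> carrier L" for x y
  proof -
    obtain q r where *: "q \<in> carrier P1" "d0 q = gen x \<odot>\<^bsub>P0\<^esub> base" "r \<in> carrier P1" "d0 r = gen y \<odot>\<^bsub>P0\<^esub> base"
      using gen_base_lift xy by meson
    have "(gen (bracket L x y) \<oplus>\<^bsub>uL\<^esub> gen y \<otimes>\<^bsub>uL\<^esub> gen x) \<odot>\<^bsub>P0\<^esub> base = (gen x \<otimes>\<^bsub>uL\<^esub> gen y) \<odot>\<^bsub>P0\<^esub> base"
      using gen_bracket[OF xy] by simp
    then have "gen (bracket L x y) \<odot>\<^bsub>P0\<^esub> base \<oplus>\<^bsub>P0\<^esub> gen y \<odot>\<^bsub>P0\<^esub> d0 q = gen x \<odot>\<^bsub>P0\<^esub> d0 r"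
      using xy base * L_closed by (simp add: P0.lsmult_l_distr P0.lsmult_assoc)
    then have "gen x \<odot>\<^bsub>P0\<^esub> d0 r \<ominus>\<^bsub>P0\<^esub> gen y \<odot>\<^bsub>P0\<^esub> d0 q = gen (bracket L x y) \<odot>\<^bsub>P0\<^esub> base"
      by (rule P0.M.minus_eqI) (use xy base * L_closed(3) in \<open>auto intro: d0_simps(1)\<close>)
    then have "d0 (gen x \<odot>\<^bsub>P1\<^esub> r \<ominus>\<^bsub>P1\<^esub> gen y \<odot>\<^bsub>P1\<^esub> q) = gen (bracket L x y) \<odot>\<^bsub>P0\<^esub> base"
      using xy * by (simp add: d0_simps(3,4))
    from te[OF _ _ this] show ?thesis
      using te[OF xy(1) *(1,2)] te[OF xy(2) *(3,4)] xy * L_closed(3) Zg(2,4,5) by simp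
  qed
  moreover have "der_of_cocycle g (pmap L x) = (lact M x ^^ (p - 1)) (der_of_cocycle g x)" if x: "x \<in> carrier L" for x
  proof -
    obtain q where *: "q \<in> carrier P1" "d0 q = gen x \<odot>\<^bsub>P0\<^esub> base" using gen_base_lift x by meson
    have pow: "gen x [^]\<^bsub>uL\<^esub> n \<odot>\<^bsub>EM\<^esub> m = (lact M x ^^ n) m" if "m \<in> carrier M" for m and n :: nat
    proof (induction n)
      case (Suc n)
      have "gen x [^]\<^bsub>uL\<^esub> Suc n = gen x \<otimes>\<^bsub>uL\<^esub> gen x [^]\<^bsub>uL\<^esub> n" using x uL.nat_pow_Suc2 by simp
      then show ?case using Suc that x EM.lsmult_assoc[of "gen x" "gen x [^]\<^bsub>uL\<^esub> n" m] by simp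
    qed (use that in \<open>simp add: EM.lsmult_one\<close>)
    have "gen x [^]\<^bsub>uL\<^esub> p = gen x [^]\<^bsub>uL\<^esub> (p - 1) \<otimes>\<^bsub>uL\<^esub> gen x" using p_pos uL.nat_pow_Suc[of "gen x" "p - 1"] by simp
    then have "d0 (gen x [^]\<^bsub>uL\<^esub> (p - 1) \<odot>\<^bsub>P1\<^esub> q) = gen (pmap L x) \<odot>\<^bsub>P0\<^esub> base"
      using x * base by (simp add: d0_simps(4) gen_pmap P0.lsmult_assoc)
    from te[OF _ _ this] show ?thesis using te[OF x *] x * L_closed(4) Zg(2,5) pow by simp
  qed
  ultimately show ?thesis by (simp add: res_der_def)
qed

lemma hom_from_generators:
  assumes N: "left_module uL N"
    and c: "\<And>q. q \<in> carrier N \<Longrightarrow> f q \<in> carrier M"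
    and "\<And>q r. \<lbrakk>q \<in> carrier N; r \<in> carrier N\<rbrakk> \<Longrightarrow> f (q \<oplus>\<^bsub>N\<^esub> r) = f q \<oplus>\<^bsub>M\<^esub> f r"
    and "\<And>c q. \<lbrakk>c \<in> carrier F; q \<in> carrier N\<rbrakk> \<Longrightarrow> f (scal c \<odot>\<^bsub>N\<^esub> q) = c \<odot>\<^bsub>M\<^esub> f q"
    and "\<And>x q. \<lbrakk>x \<in> carrier L; q \<in> carrier N\<rbrakk> \<Longrightarrow> f (gen x \<odot>\<^bsub>N\<^esub> q) = lact M x (f q)"
  shows "(\<lambda>q\<in>carrier N. f q) \<in> lmod_hom uL N EM"
proof -
  interpret N: left_module uL N by fact
  have "f (r \<odot>\<^bsub>N\<^esub> m) = r \<odot>\<^bsub>EM\<^esub> f m" if "r \<in> carrier uL" "m \<in> carrier N" for r m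
    by (rule U_hom_generators[OF N EM.left_module_axioms]) (use assms that in simp_all)
  then show ?thesis using assms by (auto simp: lmod_hom_def)
qed

lemma cocycleI:
  assumes f: "f \<in> lmod_hom uL P1 EM" and z: "\<And>q. \<lbrakk>q \<in> carrier P1; d0 q = \<zero>\<^bsub>P0\<^esub>\<rbrakk> \<Longrightarrow> f q = \<zero>\<^bsub>M\<^esub>"
  shows "f \<in> Z"
proof -
  have "f (d (Suc 0) t) = \<zero>\<^bsub>M\<^esub>" if "t \<in> carrier (P (Suc (Suc 0)))" for t
    using z[of "d (Suc 0) t"] that exact1 by blast
  then show ?thesis using f by (simp add: ext_cocycles_def)
qed

text \<open>
  The augmentation \<open>P\<^sub>0 \<longrightarrow> F\<close> lifts to a homomorphism \<open>h\<close> into the extension of \<open>F\<close> by \<open>M\<close> defined by \<open>\<delta>\<close>.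
  Its restriction to the kernel of the augmentation takes values in \<open>M\<close>, and maps \<open>x \<cdot> base\<close> to
  \<open>x m + \<delta>(x)\<close>, where \<open>m\<close> is the first component of \<open>h(base)\<close>.
\<close>

lemma der_of_cocycle_surj:
  assumes \<delta>: "\<delta> \<in> res_der p F L M"
  shows "\<exists>g\<in>Z. \<exists>m\<in>carrier M. \<forall>x\<in>carrier L. der_of_cocycle g x = lact M x m \<oplus>\<^bsub>M\<^esub> \<delta> x"
proof -
  let ?E = "der_extension F M \<delta>"
  interpret E: restricted_data_module p F L ?E
    by (intro restricted_data_module.intro der_extension_restricted \<delta> restricted_data_axioms)
  note H = lmod_homD[OF res_derD(1)[OF \<delta>]]
  have Ec: "carrier E.EM = carrier M \<times> carrier F" unfolding E.envel_simps by (simp add: der_extension_simps)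
  define f where "f = (\<lambda>u\<in>carrier M \<times> carrier F. snd u)"
  have f: "f \<in> lmod_hom uL E.EM TM"
  proof -
    have "snd (r \<odot>\<^bsub>E.EM\<^esub> u) = r \<odot>\<^bsub>TM\<^esub> snd u" if "r \<in> carrier uL" "u \<in> carrier E.EM" for r u
    proof (rule U_hom_generators[OF E.EM.left_module_axioms T.EM.left_module_axioms])
      fix x v assume "x \<in> carrier L" "v \<in> carrier E.EM"
      then show "snd (gen x \<odot>\<^bsub>E.EM\<^esub> v) = gen x \<odot>\<^bsub>TM\<^esub> snd v"
        using T.gen_act[of x "snd v"] E.gen_act[of x v] by (auto simp: der_extension_simps trivial_module_simps)
    next
      fix c v assume "c \<in> carrier F" "v \<in> carrier E.EM"
      then show "snd (scal c \<odot>\<^bsub>E.EM\<^esub> v) = scal c \<odot>\<^bsub>TM\<^esub> snd v"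
        using T.scal_act[of c "snd v"] E.scal_act[of c v] by (auto simp: der_extension_simps trivial_module_simps)
    qed (use that in \<open>auto simp: der_extension_simps trivial_module_simps\<close>)
    moreover have "r \<odot>\<^bsub>E.EM\<^esub> u \<in> carrier M \<times> carrier F" if "r \<in> carrier uL" "u \<in> carrier E.EM" for r u
      using E.EM.lsmult_closed[OF that] by (simp only: Ec)
    ultimately show ?thesis unfolding lmod_hom_def f_def using TM_simps Ec
      by (auto simp: der_extension_simps)
  qed
  have "f ` carrier E.EM = carrier TM"
    unfolding TM_simps Ec using Mod.V.M.zero_closed by (force simp: f_def image_iff)
  then obtain h where h: "h \<in> lmod_hom uL P0 E.EM" "\<And>q. q \<in> carrier P0 \<Longrightarrow> f (h q) = e q"
    using projective_lift[OF proj E.EM.left_module_axioms T.EM.left_module_axioms f _ e_hom] by blast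
  note hD = lmod_homD[OF h(1)]
  have hc: "h q \<in> carrier M \<times> carrier F" if "q \<in> carrier P0" for q using hD(2)[OF that] unfolding Ec .
  have h2: "snd (h q) = e q" if "q \<in> carrier P0" for q using h(2)[OF that] hc[OF that] by (simp add: f_def)
  have h1: "fst (h q) \<in> carrier M" if "q \<in> carrier P0" for q using hc[OF that] by (cases "h q") auto
  have hgen: "h (gen x \<odot>\<^bsub>P0\<^esub> q) = (lact M x (fst (h q)) \<oplus>\<^bsub>M\<^esub> e q \<odot>\<^bsub>M\<^esub> \<delta> x, \<zero>)"
    if "x \<in> carrier L" "q \<in> carrier P0" for x q
    using hD(4)[of "gen x" q] that E.gen_act[of x "h q"] hD(2)[OF that(2)] h2 by (simp add: der_extension_simps)
  have hscal: "fst (h (scal c \<odot>\<^bsub>P0\<^esub> q)) = c \<odot>\<^bsub>M\<^esub> fst (h q)"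
    if "c \<in> carrier F" "q \<in> carrier P0" for c q
    using hD(4)[of "scal c" q] that E.scal_act[of c "h q"] hD(2)[OF that(2)] by (simp add: der_extension_simps)
  have hadd: "fst (h (q \<oplus>\<^bsub>P0\<^esub> r)) = fst (h q) \<oplus>\<^bsub>M\<^esub> fst (h r)"
    if "q \<in> carrier P0" "r \<in> carrier P0" for q r
    using hD(3)[OF that] by (simp add: der_extension_simps)
  have h0: "fst (h \<zero>\<^bsub>P0\<^esub>) = \<zero>\<^bsub>M\<^esub>"
    using lmod_hom_zero[OF P0.left_module_axioms E.EM.left_module_axioms h(1)] by (simp add: der_extension_simps)
  define g where "g = (\<lambda>q\<in>carrier P1. fst (h (d0 q)))"
  have "g \<in> lmod_hom uL P1 EM" unfolding g_def
    by (rule hom_from_generators[OF P1.left_module_axioms])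
      (use d0_simps h1 hadd hscal hgen H(2) Mod.lact_closed in \<open>simp_all\<close>)
  then have g: "g \<in> Z" by (rule cocycleI) (simp add: g_def h0)
  have "der_of_cocycle g x = lact M x (fst (h base)) \<oplus>\<^bsub>M\<^esub> \<delta> x" if x: "x \<in> carrier L" for x
  proof -
    obtain q where q: "q \<in> carrier P1" "d0 q = gen x \<odot>\<^bsub>P0\<^esub> base" using gen_base_lift x by meson
    have "der_of_cocycle g x = fst (h (gen x \<odot>\<^bsub>P0\<^esub> base))" using der_of_cocycle_eq[OF g x q] q by (simp add: g_def)
    then show ?thesis using hgen[OF x base(1)] base(2) H(2)[OF x] by simp
  qed
  then show ?thesis using g h1 base by blast
qed

text \<open>
  A homomorphism \<open>G\<close> on \<open>P\<^sub>0\<close> gives the inner derivation of \<open>G(base)\<close>.  Conversely, as a vector space, \<open>P\<^sub>0\<close> is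
  the sum of the kernel of the augmentation and \<open>F base\<close>; if the derivation is the inner one of \<open>s\<close>, the
  extension of \<open>g\<close> with \<open>base \<mapsto> s\<close> is compatible with the action of \<open>L\<close>.
\<close>

lemma coboundaries_eq: "ext_coboundaries uL P d EM 1 = {g \<in> Z. der_of_cocycle g \<in> inner_der L M}"
proof (intro equalityI subsetI)
  fix g assume "g \<in> ext_coboundaries uL P d EM 1"
  then obtain G where G: "G \<in> lmod_hom uL P0 EM" and g: "g = compose (carrier P1) G d0" by auto
  note GD = lmod_homD[OF G, unfolded envel_simps]
  have "g \<in> lmod_hom uL P1 EM"
    unfolding lmod_hom_def g using GD d0_simps by (auto simp: compose_def)
  moreover have "G \<zero>\<^bsub>P0\<^esub> = \<zero>\<^bsub>M\<^esub>"
    using lmod_hom_zero[OF P0.left_module_axioms EM.left_module_axioms G] by simp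
  ultimately have gZ: "g \<in> Z" by (intro cocycleI) (auto simp: g compose_def)
  have "der_of_cocycle g x = lact M x (G base)" if x: "x \<in> carrier L" for x
  proof -
    obtain q where q: "q \<in> carrier P1" "d0 q = gen x \<odot>\<^bsub>P0\<^esub> base" using gen_base_lift x by meson
    then have "der_of_cocycle g x = G (gen x \<odot>\<^bsub>P0\<^esub> base)" using der_of_cocycle_eq[OF gZ x q] by (simp add: g compose_def)
    then show ?thesis using GD(4)[of "gen x" base] x base GD(2) by simp
  qed
  then have "der_of_cocycle g = (\<lambda>x\<in>carrier L. lact M x (G base))" by (auto simp: der_of_cocycle_def restrict_def fun_eq_iff)
  then show "g \<in> {g \<in> Z. der_of_cocycle g \<in> inner_der L M}" using gZ GD(2)[OF base(1)] by (auto simp: inner_der_def)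
next
  fix g assume "g \<in> {g \<in> Z. der_of_cocycle g \<in> inner_der L M}"
  then obtain s where gZ: "g \<in> Z" and s: "s \<in> carrier M" and th: "\<And>x. x \<in> carrier L \<Longrightarrow> der_of_cocycle g x = lact M x s"
    by (auto simp: inner_der_def)
  note Zg = ZD[OF gZ]
  \<comment> \<open>\<open>r\<close> lifts the component of \<open>q\<close> in the kernel of the augmentation, along \<open>F base\<close>\<close>
  define red where "red q r \<longleftrightarrow> r \<in> carrier P1 \<and> d0 r = q \<ominus>\<^bsub>P0\<^esub> scal (e q) \<odot>\<^bsub>P0\<^esub> base" for q r
  define G where "G q = g (SOME r. red q r) \<oplus>\<^bsub>M\<^esub> e q \<odot>\<^bsub>M\<^esub> s" for q
  have redex: "\<exists>r. red q r" if q: "q \<in> carrier P0" for q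
    unfolding red_def by (rule d0_lift) (use q base e_simps in \<open>simp_all add: F.minus_eq F.r_neg\<close>)
  have Geq: "G q = g r \<oplus>\<^bsub>M\<^esub> e q \<odot>\<^bsub>M\<^esub> s" if "red q r" for q r
  proof -
    have "red q (SOME r. red q r)" using that by (rule someI)
    then have "g (SOME r. red q r) = g r" using that Zg(6) by (simp add: red_def)
    then show ?thesis by (simp add: G_def)
  qed
  have sb: "scal c \<odot>\<^bsub>P0\<^esub> base \<in> carrier P0" if "c \<in> carrier F" for c using that base by simp
  have G: "(\<lambda>q\<in>carrier P0. G q) \<in> lmod_hom uL P0 EM"
  proof (rule hom_from_generators[OF P0.left_module_axioms])
    show "G q \<in> carrier M" if q: "q \<in> carrier P0" for q
      using redex[OF q] Geq Zg(2) e_simps(1)[OF q] s by (auto simp: red_def)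
  next
    fix q q' assume qq: "q \<in> carrier P0" "q' \<in> carrier P0"
    obtain r r' where r: "red q r" "red q' r'" using redex qq by meson
    have "red (q \<oplus>\<^bsub>P0\<^esub> q') (r \<oplus>\<^bsub>P1\<^esub> r')"
      using r qq e_simps base unfolding red_def
      by (simp add: d0_simps scal_add P0.lsmult_l_distr P0.M.minus_eq P0.M.minus_add P0.M.a_ac)
    from Geq[OF this] have "G (q \<oplus>\<^bsub>P0\<^esub> q') = (g r \<oplus>\<^bsub>M\<^esub> g r') \<oplus>\<^bsub>M\<^esub> (e q \<oplus> e q') \<odot>\<^bsub>M\<^esub> s"
      using r qq Zg(3) e_simps(2) by (simp add: red_def)
    moreover have "g r \<in> carrier M" "g r' \<in> carrier M" "e q \<in> carrier F" "e q' \<in> carrier F"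
      using r qq Zg(2) e_simps(1) by (simp_all add: red_def)
    ultimately show "G (q \<oplus>\<^bsub>P0\<^esub> q') = G q \<oplus>\<^bsub>M\<^esub> G q'"
      unfolding Geq[OF r(1)] Geq[OF r(2)] using s by (simp add: Mod.V.smult_l_distr Mod.V.M.a_ac)
  next
    fix c q assume cq: "c \<in> carrier F" "q \<in> carrier P0"
    obtain r where r: "red q r" using redex cq by meson
    have "red (scal c \<odot>\<^bsub>P0\<^esub> q) (scal c \<odot>\<^bsub>P1\<^esub> r)"
      using r cq e_simps base unfolding red_def
      by (simp add: d0_simps scal_scal[symmetric] P0.lsmult_r_distr P0.lsmult_minus_right P0.M.minus_eq P0.lsmult_assoc)
    from Geq[OF this] have "G (scal c \<odot>\<^bsub>P0\<^esub> q) = c \<odot>\<^bsub>M\<^esub> g r \<oplus>\<^bsub>M\<^esub> (c \<otimes> e q) \<odot>\<^bsub>M\<^esub> s"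
      using r cq Zg(2,5) e_simps(3) by (simp add: red_def)
    moreover have "g r \<in> carrier M" "e q \<in> carrier F" using r cq Zg(2) e_simps(1) by (simp_all add: red_def)
    ultimately show "G (scal c \<odot>\<^bsub>P0\<^esub> q) = c \<odot>\<^bsub>M\<^esub> G q"
      unfolding Geq[OF r] using s cq by (simp add: Mod.V.smult_r_distr Mod.V.smult_assoc1)
  next
    fix x q assume xq: "x \<in> carrier L" "q \<in> carrier P0"
    obtain r where r: "red q r" using redex xq by meson
    obtain t where t: "t \<in> carrier P1" "d0 t = gen x \<odot>\<^bsub>P0\<^esub> base" using gen_base_lift xq by meson
    let ?r = "gen x \<odot>\<^bsub>P1\<^esub> r \<oplus>\<^bsub>P1\<^esub> scal (e q) \<odot>\<^bsub>P1\<^esub> t"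
    have eq: "e q \<in> carrier F" using e_simps xq by simp
    have comm: "gen x \<odot>\<^bsub>P0\<^esub> (scal (e q) \<odot>\<^bsub>P0\<^esub> base) = scal (e q) \<odot>\<^bsub>P0\<^esub> (gen x \<odot>\<^bsub>P0\<^esub> base)"
      using P0.lsmult_assoc[of "gen x" "scal (e q)" base] P0.lsmult_assoc[of "scal (e q)" "gen x" base]
        scal_gen[OF eq xq(1)] eq xq base by simp
    have "d0 ?r = gen x \<odot>\<^bsub>P0\<^esub> (q \<ominus>\<^bsub>P0\<^esub> scal (e q) \<odot>\<^bsub>P0\<^esub> base) \<oplus>\<^bsub>P0\<^esub> scal (e q) \<odot>\<^bsub>P0\<^esub> (gen x \<odot>\<^bsub>P0\<^esub> base)"
      using r t eq xq by (simp add: red_def d0_simps)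
    also have "\<dots> = gen x \<odot>\<^bsub>P0\<^esub> q"
      using eq xq base comm
      by (simp add: P0.M.minus_eq P0.lsmult_r_distr P0.lsmult_minus_right P0.M.a_assoc P0.M.l_neg)
    finally have d: "d0 ?r = gen x \<odot>\<^bsub>P0\<^esub> q" .
    have "red (gen x \<odot>\<^bsub>P0\<^esub> q) ?r"
      unfolding red_def d using r t eq xq base by (simp add: red_def e_simps P0.M.minus_eq scal_zero)
    then have "G (gen x \<odot>\<^bsub>P0\<^esub> q) = g ?r \<oplus>\<^bsub>M\<^esub> \<zero> \<odot>\<^bsub>M\<^esub> s" using Geq e_simps(4)[OF xq] by simp
    also have "\<dots> = lact M x (g r) \<oplus>\<^bsub>M\<^esub> e q \<odot>\<^bsub>M\<^esub> lact M x s"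
    proof -
      have rc: "r \<in> carrier P1" using r by (simp add: red_def)
      have gt: "g t = lact M x s" using der_of_cocycle_eq[OF gZ xq(1) t] th[OF xq(1)] by simp
      have "g ?r = gen x \<odot>\<^bsub>EM\<^esub> g r \<oplus>\<^bsub>M\<^esub> scal (e q) \<odot>\<^bsub>EM\<^esub> g t"
        using Zg(3,5) rc t(1) eq xq(1) by simp
      then have "g ?r = lact M x (g r) \<oplus>\<^bsub>M\<^esub> e q \<odot>\<^bsub>M\<^esub> g t"
        using Zg(2) rc t(1) eq xq(1) by simp
      then show ?thesis
        using gt Zg(2)[OF rc] Mod.lact_closed[OF xq(1)] s eq by simp
    qed
    also have "\<dots> = lact M x (G q)"
      using Geq[OF r] r Zg(2) eq xq s by (simp add: red_def Mod.lact_add_r Mod.lact_smult_r)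
    finally show "G (gen x \<odot>\<^bsub>P0\<^esub> q) = lact M x (G q)" .
  qed
  have "g = compose (carrier P1) (\<lambda>q\<in>carrier P0. G q) d0"
  proof
    fix q
    show "g q = compose (carrier P1) (\<lambda>q\<in>carrier P0. G q) d0 q"
    proof (cases "q \<in> carrier P1")
      case True
      have "red (d0 q) q" using True d0_simps base by (simp add: red_def P0.M.minus_eq scal_zero)
      from Geq[OF this] show ?thesis using True Zg(2) d0_simps s by (simp add: compose_def)
    next
      case False
      then show ?thesis using lmod_homD(1)[OF Zg(1)] by (simp add: compose_def PiE_arb[of g])
    qed
  qed
  then show "g \<in> ext_coboundaries uL P d EM 1" using G by auto
qed

end

section \<open>The centralizer algebra\<close>

lemma extfun_eqI:
  assumes "h \<in> X \<rightarrow>\<^sub>E Y" "k \<in> X \<rightarrow>\<^sub>E Y" "\<And>m. m \<in> X \<Longrightarrow> h m = k m"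
  shows "h = k"
  using assms by (rule PiE_ext)

definition eval_module :: "('r, 'm, 'y) module_scheme \<Rightarrow> ('m \<Rightarrow> 'm, 'm) module"
  where "eval_module M = \<lparr>carrier = carrier M, mult = undefined, one = undefined, zero = \<zero>\<^bsub>M\<^esub>,
    add = add M, smult = (\<lambda>h m. h m)\<rparr>"

definition fun_module :: "'i set \<Rightarrow> ('r, 'm, 'y) module_scheme \<Rightarrow> ('m \<Rightarrow> 'm, 'i \<Rightarrow> 'm) module"
  where "fun_module X M = \<lparr>carrier = X \<rightarrow>\<^sub>E carrier M, mult = undefined, one = undefined,
    zero = (\<lambda>x\<in>X. \<zero>\<^bsub>M\<^esub>), add = (\<lambda>f g. \<lambda>x\<in>X. f x \<oplus>\<^bsub>M\<^esub> g x), smult = (\<lambda>h f. compose X h f)\<rparr>"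

lemma eval_module_simps [simp]:
  "carrier (eval_module M) = carrier M" "\<zero>\<^bsub>eval_module M\<^esub> = \<zero>\<^bsub>M\<^esub>" "add (eval_module M) = add M"
  "h \<odot>\<^bsub>eval_module M\<^esub> m = h m"
  by (simp_all add: eval_module_def)

lemma fun_module_simps [simp]:
  "carrier (fun_module X M) = X \<rightarrow>\<^sub>E carrier M" "\<zero>\<^bsub>fun_module X M\<^esub> = (\<lambda>x\<in>X. \<zero>\<^bsub>M\<^esub>)"
  "f \<oplus>\<^bsub>fun_module X M\<^esub> g = (\<lambda>x\<in>X. f x \<oplus>\<^bsub>M\<^esub> g x)" "h \<odot>\<^bsub>fun_module X M\<^esub> f = (\<lambda>x\<in>X. h (f x))"
  by (simp_all add: fun_module_def compose_def)

lemma End_ring_simps [simp]: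
  "carrier (End_ring F L M) = lie_module_hom F L M M"
  "f \<otimes>\<^bsub>End_ring F L M\<^esub> g = (\<lambda>m\<in>carrier M. f (g m))" "\<one>\<^bsub>End_ring F L M\<^esub> = (\<lambda>m\<in>carrier M. m)"
  "\<zero>\<^bsub>End_ring F L M\<^esub> = (\<lambda>m\<in>carrier M. \<zero>\<^bsub>M\<^esub>)"
  "f \<oplus>\<^bsub>End_ring F L M\<^esub> g = (\<lambda>m\<in>carrier M. f m \<oplus>\<^bsub>M\<^esub> g m)"
  by (simp_all add: End_ring_def compose_def)

lemma lie_module_homD:
  assumes "h \<in> lie_module_hom F L M N"
  shows "h \<in> carrier M \<rightarrow>\<^sub>E carrier N" "\<And>m. m \<in> carrier M \<Longrightarrow> h m \<in> carrier N"
    "\<And>m n. \<lbrakk>m \<in> carrier M; n \<in> carrier M\<rbrakk> \<Longrightarrow> h (m \<oplus>\<^bsub>M\<^esub> n) = h m \<oplus>\<^bsub>N\<^esub> h n"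
    "\<And>c m. \<lbrakk>c \<in> carrier F; m \<in> carrier M\<rbrakk> \<Longrightarrow> h (c \<odot>\<^bsub>M\<^esub> m) = c \<odot>\<^bsub>N\<^esub> h m"
    "\<And>x m. \<lbrakk>x \<in> carrier L; m \<in> carrier M\<rbrakk> \<Longrightarrow> h (lact M x m) = lact N x (h m)"
  using assms unfolding lie_module_hom_def lmod_hom_def by auto

lemma lie_module_homI:
  assumes "\<And>m. m \<in> carrier M \<Longrightarrow> h m \<in> carrier N"
    "\<And>m n. \<lbrakk>m \<in> carrier M; n \<in> carrier M\<rbrakk> \<Longrightarrow> m \<oplus>\<^bsub>M\<^esub> n \<in> carrier M \<and> h (m \<oplus>\<^bsub>M\<^esub> n) = h m \<oplus>\<^bsub>N\<^esub> h n"
    "\<And>c m. \<lbrakk>c \<in> carrier F; m \<in> carrier M\<rbrakk> \<Longrightarrow> c \<odot>\<^bsub>M\<^esub> m \<in> carrier M \<and> h (c \<odot>\<^bsub>M\<^esub> m) = c \<odot>\<^bsub>N\<^esub> h m"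
    "\<And>x m. \<lbrakk>x \<in> carrier L; m \<in> carrier M\<rbrakk> \<Longrightarrow> lact M x m \<in> carrier M \<and> h (lact M x m) = lact N x (h m)"
  shows "(\<lambda>m\<in>carrier M. h m) \<in> lie_module_hom F L M N"
  using assms unfolding lie_module_hom_def lmod_hom_def by auto

context restricted_data_module begin

abbreviation "Cent \<equiv> End_ring F L M"

lemma End_closed:
  assumes "h \<in> carrier Cent" "k \<in> carrier Cent"
  shows "h \<oplus>\<^bsub>Cent\<^esub> k \<in> carrier Cent" "h \<otimes>\<^bsub>Cent\<^esub> k \<in> carrier Cent"
    "(\<lambda>m\<in>carrier M. \<ominus>\<^bsub>M\<^esub> h m) \<in> carrier Cent"
proof -
  note H = lie_module_homD[OF assms(1)[unfolded End_ring_simps]]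
    and K = lie_module_homD[OF assms(2)[unfolded End_ring_simps]]
  have neg: "\<ominus>\<^bsub>M\<^esub> lact M x m = lact M x (\<ominus>\<^bsub>M\<^esub> m)" if "x \<in> carrier L" "m \<in> carrier M" for x m
    by (rule additive_minus(1)[symmetric, OF Mod.V.M.abelian_group_axioms Mod.V.M.abelian_group_axioms])
      (use that in \<open>auto simp: Mod.lact_add_r Mod.lact_closed\<close>)
  show "h \<oplus>\<^bsub>Cent\<^esub> k \<in> carrier Cent" unfolding End_ring_simps
    by (rule lie_module_homI)
      (use H(2-) K(2-) in \<open>auto simp: Mod.V.M.a_ac Mod.V.smult_r_distr Mod.lact_add_r Mod.lact_closed\<close>)
  show "h \<otimes>\<^bsub>Cent\<^esub> k \<in> carrier Cent" unfolding End_ring_simps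
    by (rule lie_module_homI) (use H(2-) K(2-) in \<open>auto simp: Mod.lact_closed\<close>)
  show "(\<lambda>m\<in>carrier M. \<ominus>\<^bsub>M\<^esub> h m) \<in> carrier Cent" unfolding End_ring_simps
    by (rule lie_module_homI)
      (use H(2-) in \<open>auto simp: Mod.V.M.minus_add Mod.V.M.a_comm Mod.V.smult_r_minus Mod.lact_closed neg\<close>)
qed

lemma End_scalar: "c \<in> carrier F \<Longrightarrow> (\<lambda>m\<in>carrier M. c \<odot>\<^bsub>M\<^esub> m) \<in> carrier Cent"
  unfolding End_ring_simps
  by (rule lie_module_homI)
    (auto simp: Mod.V.smult_r_distr Mod.V.smult_assoc1[symmetric] F.m_comm Mod.lact_smult_r Mod.lact_closed)

lemma End_ring_ring: "ring Cent"
proof (rule ringI)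
  have one: "\<one>\<^bsub>Cent\<^esub> \<in> carrier Cent" and zero: "\<zero>\<^bsub>Cent\<^esub> \<in> carrier Cent"
    unfolding End_ring_simps by (rule lie_module_homI; auto simp: Mod.lact_closed)+
  note cl = End_closed[unfolded End_ring_simps] one[unfolded End_ring_simps] zero[unfolded End_ring_simps]
  note PE = lie_module_homD(1)
  have mem: "h m \<in> carrier M" if "h \<in> lie_module_hom F L M M" "m \<in> carrier M" for h m
    using that by (rule lie_module_homD(2))
  show "abelian_group Cent"
  proof (rule abelian_groupI)
    fix h assume h: "h \<in> carrier Cent"
    show "\<exists>k\<in>carrier Cent. k \<oplus>\<^bsub>Cent\<^esub> h = \<zero>\<^bsub>Cent\<^esub>"
    proof (rule bexI[OF _ End_closed(3)[OF h h]])
      have "\<ominus>\<^bsub>M\<^esub> h m \<oplus>\<^bsub>M\<^esub> h m = \<zero>\<^bsub>M\<^esub>" if "m \<in> carrier M" for m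
        using mem[OF h[unfolded End_ring_simps] that] by (rule Mod.V.M.l_neg)
      then show "(\<lambda>m\<in>carrier M. \<ominus>\<^bsub>M\<^esub> h m) \<oplus>\<^bsub>Cent\<^esub> h = \<zero>\<^bsub>Cent\<^esub>"
        unfolding End_ring_simps by (intro restrict_ext) simp
    qed
  next
    fix h assume h: "h \<in> carrier Cent"
    note hm = mem[OF h[unfolded End_ring_simps]] and hP = PE[OF h[unfolded End_ring_simps]]
    show "\<zero>\<^bsub>Cent\<^esub> \<oplus>\<^bsub>Cent\<^esub> h = h"
      by (rule extfun_eqI[of _ "carrier M" "carrier M"]) (use hm hP in auto)
  qed (use End_closed zero mem in \<open>auto simp: Mod.V.M.a_ac intro!: restrict_ext\<close>)
  show "Group.monoid Cent"
  proof (rule monoidI)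
    fix h assume h: "h \<in> carrier Cent"
    note hm = mem[OF h[unfolded End_ring_simps]] and hP = PE[OF h[unfolded End_ring_simps]]
    show "\<one>\<^bsub>Cent\<^esub> \<otimes>\<^bsub>Cent\<^esub> h = h"
      by (rule extfun_eqI[of _ "carrier M" "carrier M"]) (use hm hP in auto)
    show "h \<otimes>\<^bsub>Cent\<^esub> \<one>\<^bsub>Cent\<^esub> = h"
      by (rule extfun_eqI[of _ "carrier M" "carrier M"]) (use hm hP in auto)
  qed (use End_closed one mem in \<open>auto intro!: restrict_ext\<close>)
qed (auto simp: lie_module_homD(2,3) intro!: restrict_ext)

lemma eval_left_module: "left_module Cent (eval_module M)"
  by (intro left_module.intro left_module_axioms.intro End_ring_ring
      abelian_group_transfer[OF Mod.V.M.abelian_group_axioms])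
    (auto simp: lie_module_homD(2,3))

lemma fun_left_module: "left_module Cent (fun_module X M)"
proof (intro left_module.intro left_module_axioms.intro End_ring_ring)
  show "abelian_group (fun_module X M)"
  proof (rule abelian_groupI)
    fix f assume f: "f \<in> carrier (fun_module X M)"
    show "\<exists>g\<in>carrier (fun_module X M). g \<oplus>\<^bsub>fun_module X M\<^esub> f = \<zero>\<^bsub>fun_module X M\<^esub>"
      by (rule bexI[of _ "\<lambda>x\<in>X. \<ominus>\<^bsub>M\<^esub> f x"]) (use f in \<open>auto intro!: restrict_ext Mod.V.M.l_neg intro: PiE_mem\<close>)
    show "\<zero>\<^bsub>fun_module X M\<^esub> \<oplus>\<^bsub>fun_module X M\<^esub> f = f"
      by (rule extfun_eqI[of _ X "carrier M"]) (use f in \<open>auto simp: PiE_iff\<close>)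
  qed (auto intro!: restrict_ext Mod.V.M.a_closed Mod.V.M.a_assoc Mod.V.M.a_comm intro: PiE_mem)
next
  fix f assume f: "f \<in> carrier (fun_module X M)"
  show "\<one>\<^bsub>Cent\<^esub> \<odot>\<^bsub>fun_module X M\<^esub> f = f"
    by (rule extfun_eqI[of _ X "carrier M"]) (use f in auto)
next
  fix h f assume *: "h \<in> carrier Cent" "f \<in> carrier (fun_module X M)"
  note H = lie_module_homD[OF *(1)[unfolded End_ring_simps]]
  have fx: "f x \<in> carrier M" if "x \<in> X" for x using * that by auto
  show "h \<odot>\<^bsub>fun_module X M\<^esub> f \<in> carrier (fun_module X M)" using H(2) fx by auto
  show "h \<odot>\<^bsub>fun_module X M\<^esub> (f \<oplus>\<^bsub>fun_module X M\<^esub> g) =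
      h \<odot>\<^bsub>fun_module X M\<^esub> f \<oplus>\<^bsub>fun_module X M\<^esub> h \<odot>\<^bsub>fun_module X M\<^esub> g"
    if g: "g \<in> carrier (fun_module X M)" for g
  proof -
    have "g x \<in> carrier M" if "x \<in> X" for x using g that by auto
    then show ?thesis using H(3) fx by (auto intro!: restrict_ext)
  qed
  show "(h \<oplus>\<^bsub>Cent\<^esub> k) \<odot>\<^bsub>fun_module X M\<^esub> f =
      h \<odot>\<^bsub>fun_module X M\<^esub> f \<oplus>\<^bsub>fun_module X M\<^esub> k \<odot>\<^bsub>fun_module X M\<^esub> f" for k
    using fx by (auto intro!: restrict_ext)
  show "(h \<otimes>\<^bsub>Cent\<^esub> k) \<odot>\<^bsub>fun_module X M\<^esub> f = h \<odot>\<^bsub>fun_module X M\<^esub> (k \<odot>\<^bsub>fun_module X M\<^esub> f)" for k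
    using fx by (auto intro!: restrict_ext)
qed

lemma kernel_image_submodule:
  assumes h: "h \<in> carrier Cent"
  shows "lie_submodule F L M {m \<in> carrier M. h m = \<zero>\<^bsub>M\<^esub>}" "lie_submodule F L M (h ` carrier M)"
proof -
  note H = lie_module_homD[OF h[unfolded End_ring_simps]]
  have h0: "h \<zero>\<^bsub>M\<^esub> = \<zero>\<^bsub>M\<^esub>"
    by (rule additive_zero[OF Mod.V.M.abelian_group_axioms Mod.V.M.abelian_group_axioms H(2,3)])
  have "submodule {m \<in> carrier M. h m = \<zero>\<^bsub>M\<^esub>} F M"
    by (rule MM.lsubmoduleI) (use H(2-) h0 in auto)
  then show "lie_submodule F L M {m \<in> carrier M. h m = \<zero>\<^bsub>M\<^esub>}"
    unfolding lie_submodule_def using H(5) Mod.lact_closed by auto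
  have "submodule (h ` carrier M) F M"
  proof (rule MM.lsubmoduleI)
    show "\<zero>\<^bsub>M\<^esub> \<in> h ` carrier M" using h0 by force
    show "x \<oplus>\<^bsub>M\<^esub> y \<in> h ` carrier M" if xy: "x \<in> h ` carrier M" "y \<in> h ` carrier M" for x y
    proof -
      obtain u v where uv: "u \<in> carrier M" "v \<in> carrier M" "x = h u" "y = h v" using xy by blast
      then have "x \<oplus>\<^bsub>M\<^esub> y = h (u \<oplus>\<^bsub>M\<^esub> v)" using H(3) by simp
      then show ?thesis using uv by blast
    qed
    show "a \<odot>\<^bsub>M\<^esub> x \<in> h ` carrier M" if ax: "a \<in> carrier F" "x \<in> h ` carrier M" for a x
    proof -
      obtain u where u: "u \<in> carrier M" "x = h u" using ax by blast
      then have "a \<odot>\<^bsub>M\<^esub> x = h (a \<odot>\<^bsub>M\<^esub> u)" using H(4) ax by simp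
      then show ?thesis using u ax by blast
    qed
  qed (use H(2) in auto)
  then show "lie_submodule F L M (h ` carrier M)"
    unfolding lie_submodule_def using Mod.lact_closed H(5) by (auto simp flip: H(5))
qed

text \<open>
  Schur's lemma: kernel and image of an endomorphism are submodules, and an irreducible module has only the two trivial ones.
\<close>

lemma schur:
  assumes irr: "irreducible_restricted_module p F L M" and h: "h \<in> carrier Cent" "h \<noteq> \<zero>\<^bsub>Cent\<^esub>"
  shows "\<exists>k\<in>carrier Cent. k \<otimes>\<^bsub>Cent\<^esub> h = \<one>\<^bsub>Cent\<^esub>"
proof -
  note H = lie_module_homD[OF h(1)[unfolded End_ring_simps]]
  have sub: "uL = {\<zero>\<^bsub>M\<^esub>} \<or> uL = carrier M" if "lie_submodule F L M uL" for uL
    using irr that by (simp add: irreducible_restricted_module_def)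
  have "\<exists>m\<in>carrier M. h m \<noteq> \<zero>\<^bsub>M\<^esub>"
  proof (rule ccontr)
    assume "\<not> ?thesis"
    then have "h m = \<zero>\<^bsub>M\<^esub>" if "m \<in> carrier M" for m using that by blast
    then have "h = \<zero>\<^bsub>Cent\<^esub>" by (intro extfun_eqI[of h "carrier M" "carrier M"]) (use H(1) in auto)
    then show False using h(2) by simp
  qed
  then obtain m where m: "m \<in> carrier M" "h m \<noteq> \<zero>\<^bsub>M\<^esub>" by blast
  have ker: "{m \<in> carrier M. h m = \<zero>\<^bsub>M\<^esub>} = {\<zero>\<^bsub>M\<^esub>}"
    using sub[OF kernel_image_submodule(1)[OF h(1)]] m by blast
  have im: "h ` carrier M = carrier M"
    using sub[OF kernel_image_submodule(2)[OF h(1)]] m by blast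
  have inj: "inj_on h (carrier M)"
  proof (rule inj_onI)
    fix x y assume xy: "x \<in> carrier M" "y \<in> carrier M" "h x = h y"
    have "h (x \<ominus>\<^bsub>M\<^esub> y) = h x \<ominus>\<^bsub>M\<^esub> h y"
      by (rule additive_minus(2)[OF Mod.V.M.abelian_group_axioms Mod.V.M.abelian_group_axioms H(2,3)])
        (use xy in auto)
    then have "x \<ominus>\<^bsub>M\<^esub> y \<in> {m \<in> carrier M. h m = \<zero>\<^bsub>M\<^esub>}" using xy H(2) by (simp add: Mod.V.M.minus_eq Mod.V.M.r_neg)
    then have "x \<ominus>\<^bsub>M\<^esub> y = \<zero>\<^bsub>M\<^esub>" unfolding ker by simp
    then show "x = y" using xy by (simp add: Mod.V.M.minus_eq_zero_iff)
  qed
  define k where "k = the_inv_into (carrier M) h"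
  have kc: "k m \<in> carrier M" and hk: "h (k m) = m" if "m \<in> carrier M" for m
    using that the_inv_into_into[OF inj, of m "carrier M"] f_the_inv_into_f[OF inj, of m] im
    by (auto simp: k_def)
  have kh: "k (h m) = m" if "m \<in> carrier M" for m using the_inv_into_f_f[OF inj that] by (simp add: k_def)
  have inv: "k x = y" if "x = h y" "y \<in> carrier M" for x y using that kh by simp
  have "(\<lambda>m\<in>carrier M. k m) \<in> carrier Cent" unfolding End_ring_simps
    by (rule lie_module_homI) (use kc hk H(3-5) Mod.lact_closed in \<open>auto intro!: inv\<close>)
  moreover have "(\<lambda>m\<in>carrier M. k m) \<otimes>\<^bsub>Cent\<^esub> h = \<one>\<^bsub>Cent\<^esub>"
    using H(2) kh by (auto intro!: restrict_ext)
  ultimately show ?thesis by blast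
qed

lemma division_module_End:
  assumes irr: "irreducible_restricted_module p F L M" and N: "left_module Cent N"
  shows "division_module Cent N"
proof -
  have ne: "carrier M \<noteq> {\<zero>\<^bsub>M\<^esub>}" using irr by (simp add: irreducible_restricted_module_def)
  then obtain m where "m \<in> carrier M" "m \<noteq> \<zero>\<^bsub>M\<^esub>" using Mod.V.M.zero_closed by blast
  then have "\<one>\<^bsub>Cent\<^esub> \<noteq> \<zero>\<^bsub>Cent\<^esub>" unfolding End_ring_simps by (metis restrict_apply')
  then show ?thesis
    using N schur[OF irr] by (auto simp: division_module_def division_module_axioms_def simp del: End_ring_simps)
qed

end

section \<open>Dimension of the first cohomology\<close>

lemma hom_lmod_carrier_update:
  "carrier N = carrier M \<Longrightarrow> add N = add M \<Longrightarrow> zero N = zero M \<Longrightarrow>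
    hom_lmod R Q N\<lparr>carrier := K\<rparr> = fun_module (carrier Q) M\<lparr>carrier := K\<rparr>"
  by (simp add: hom_lmod_def fun_module_def)

text \<open>
  The comparison of cocycles with derivations, composed with a reparametrization \<open>j\<close> of \<open>L\<close>.  With the
  identity it computes \<open>H\<^sup>1\<close> of \<open>L\<close>; with the projection onto \<open>L/Ann\<^sub>L(S)\<close> it expresses \<open>H\<^sup>1\<close> of the quotient
  through derivations of \<open>L\<close>, so that both dimensions are read off in the same space of functions.
\<close>

lemma (in ext_one) ext_one_dim:
  fixes Y :: "'i set"
  assumes div: "division_module D (fun_module Y M)" "left_module D (fun_module (carrier P1) M)"
    and sub: "carrier D \<subseteq> lie_module_hom F L M M"
    and j: "j ` Y = carrier L"
    and d: "rel_dim D (fun_module Y M) ((\<lambda>\<delta>. \<lambda>y\<in>Y. \<delta> (j y)) ` inner_der L M)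
      ((\<lambda>\<delta>. \<lambda>y\<in>Y. \<delta> (j y)) ` res_der p F L M) n"
  shows "lmod_fin_dim D (res_cohomology p F L P d 1 M)" "lmod_dim D (res_cohomology p F L P d 1 M) = n"
proof -
  let ?pull = "\<lambda>\<delta>. \<lambda>y\<in>Y. \<delta> (j y)"
  let ?C = "fun_module (carrier P1) M\<lparr>carrier := Z\<rparr>"
  interpret Y: division_module D "fun_module Y M" by fact
  interpret X: left_module D "fun_module (carrier P1) M" by fact
  note hD = lie_module_homD[OF subsetD[OF sub]]
  have ZPi: "g \<in> carrier P1 \<rightarrow>\<^sub>E carrier M" if "g \<in> Z" for g using lmod_homD(1)[OF ZD(1)[OF that]] by simp
  have ZU: "u \<odot>\<^bsub>EM\<^esub> (m \<oplus>\<^bsub>M\<^esub> n) = u \<odot>\<^bsub>EM\<^esub> m \<oplus>\<^bsub>M\<^esub> u \<odot>\<^bsub>EM\<^esub> n"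
    if "u \<in> carrier uL" "m \<in> carrier M" "n \<in> carrier M" for u m n
    using EM.lsmult_r_distr[of u m n] that by simp
  have Zsub: "submodule Z D (fun_module (carrier P1) M)"
  proof (rule X.lsubmoduleI)
    show "Z \<subseteq> carrier (fun_module (carrier P1) M)" using ZPi by auto
    show "\<zero>\<^bsub>fun_module (carrier P1) M\<^esub> \<in> Z"
      unfolding fun_module_simps
      by (intro cocycleI hom_from_generators P1.left_module_axioms) auto
    show "f \<oplus>\<^bsub>fun_module (carrier P1) M\<^esub> g \<in> Z" if fg: "f \<in> Z" "g \<in> Z" for f g
      unfolding fun_module_simps
    proof (intro cocycleI hom_from_generators P1.left_module_axioms)
      fix q assume q: "q \<in> carrier P1" "d0 q = \<zero>\<^bsub>P0\<^esub>"
      show "(\<lambda>q\<in>carrier P1. f q \<oplus>\<^bsub>M\<^esub> g q) q = \<zero>\<^bsub>M\<^esub>"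
        using q cocycle_zero[OF fg(1) q] cocycle_zero[OF fg(2) q] by simp
    qed (use ZD(2,3,5)[OF fg(1)] ZD(2,3,5)[OF fg(2)] in
        \<open>auto simp: Mod.V.M.a_ac Mod.V.smult_r_distr Mod.lact_add_r\<close>)
    show "h \<odot>\<^bsub>fun_module (carrier P1) M\<^esub> g \<in> Z" if hg: "h \<in> carrier D" "g \<in> Z" for h g
      unfolding fun_module_simps
    proof (intro cocycleI hom_from_generators P1.left_module_axioms)
      fix q assume q: "q \<in> carrier P1" "d0 q = \<zero>\<^bsub>P0\<^esub>"
      have "g q = \<zero>\<^bsub>M\<^esub>" by (rule cocycle_zero[OF hg(2) q])
      moreover have "h \<zero>\<^bsub>M\<^esub> = \<zero>\<^bsub>M\<^esub>"
        by (rule additive_zero[OF Mod.V.M.abelian_group_axioms Mod.V.M.abelian_group_axioms hD(2,3)[OF hg(1)]])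
      ultimately show "(\<lambda>q\<in>carrier P1. h (g q)) q = \<zero>\<^bsub>M\<^esub>" using q by simp
    qed (use ZD(2,3,5)[OF hg(2)] hD(2-5)[OF hg(1)] in auto)
  qed
  interpret C: left_module D ?C by (rule X.left_module_submodule[OF Zsub])
  have divC: "division_module D ?C" by (rule division_module_change[OF div(1) C.left_module_axioms])
  have jL: "j y \<in> carrier L" if "y \<in> Y" for y using j that by blast
  have thc: "der_of_cocycle g x \<in> carrier M" if "g \<in> Z" "x \<in> carrier L" for g x
    using lmod_homD(2)[OF res_derD(1)[OF der_of_cocycle_res_der[OF that(1)]] that(2)] .
  define f where "f = (\<lambda>g\<in>Z. ?pull (der_of_cocycle g))"
  have f: "f \<in> lmod_hom D ?C (fun_module Y M)"
    unfolding lmod_hom_def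
  proof (intro CollectI conjI ballI)
    show "f \<in> carrier ?C \<rightarrow>\<^sub>E carrier (fun_module Y M)" using thc jL by (auto simp: f_def)
    fix g g' assume g: "g \<in> carrier ?C" "g' \<in> carrier ?C"
    have "g \<oplus>\<^bsub>fun_module (carrier P1) M\<^esub> g' \<in> Z" using submoduleD(3)[OF Zsub] g by simp
    then show "f (g \<oplus>\<^bsub>?C\<^esub> g') = f g \<oplus>\<^bsub>fun_module Y M\<^esub> f g'"
      using g jL der_of_cocycle_pointwise[of "\<lambda>q\<in>carrier P1. g q \<oplus>\<^bsub>M\<^esub> g' q" "\<lambda>u v. u \<oplus>\<^bsub>M\<^esub> v" g g']
      by (auto simp: f_def intro!: restrict_ext)
  next
    fix h g assume g: "h \<in> carrier D" "g \<in> carrier ?C"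
    have "h \<odot>\<^bsub>fun_module (carrier P1) M\<^esub> g \<in> Z" using submoduleD(4)[OF Zsub] g by simp
    then show "f (h \<odot>\<^bsub>?C\<^esub> g) = h \<odot>\<^bsub>fun_module Y M\<^esub> f g"
      using g jL der_of_cocycle_pointwise[of "\<lambda>q\<in>carrier P1. h (g q)" "\<lambda>u v. h u" g g]
      by (auto simp: f_def intro!: restrict_ext)
  qed
  have pull_inj: "\<delta> = \<delta>'" if "?pull \<delta> = ?pull \<delta>'" "\<delta> \<in> carrier L \<rightarrow>\<^sub>E carrier M" "\<delta>' \<in> carrier L \<rightarrow>\<^sub>E carrier M"
    for \<delta> \<delta>'
  proof (rule extfun_eqI[OF that(2,3)])
    fix x assume "x \<in> carrier L"
    then obtain y where y: "y \<in> Y" "x = j y" using j by blast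
    then show "\<delta> x = \<delta>' x" using fun_cong[OF that(1), of y] by simp
  qed
  have innerPi: "\<delta> \<in> carrier L \<rightarrow>\<^sub>E carrier M" if "\<delta> \<in> inner_der L M" for \<delta>
    using that Mod.lact_closed by (auto simp: inner_der_def)
  have derPi: "\<delta> \<in> carrier L \<rightarrow>\<^sub>E carrier M" if "\<delta> \<in> res_der p F L M" for \<delta>
    using lmod_homD(1)[OF res_derD(1)[OF that]] .
  have pre1: "{g \<in> carrier ?C. f g \<in> ?pull ` inner_der L M} = ext_coboundaries uL P d EM 1"
    unfolding coboundaries_eq
  proof (intro equalityI subsetI)
    fix g assume g: "g \<in> {g \<in> carrier ?C. f g \<in> ?pull ` inner_der L M}"
    then obtain \<delta> where \<delta>: "\<delta> \<in> inner_der L M" "?pull (der_of_cocycle g) = ?pull \<delta>" by (auto simp: f_def)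
    have "der_of_cocycle g = \<delta>" by (rule pull_inj[OF \<delta>(2)]) (use g derPi der_of_cocycle_res_der innerPi \<delta>(1) in auto)
    then show "g \<in> {g \<in> Z. der_of_cocycle g \<in> inner_der L M}" using g \<delta> by simp
  qed (auto simp: f_def)
  have pre2: "{g \<in> carrier ?C. f g \<in> ?pull ` res_der p F L M} = carrier ?C"
    using der_of_cocycle_res_der by (auto simp: f_def)
  have surj: "\<forall>w\<in>?pull ` res_der p F L M. \<exists>g\<in>carrier ?C. f g \<ominus>\<^bsub>fun_module Y M\<^esub> w \<in> ?pull ` inner_der L M"
  proof
    fix w assume "w \<in> ?pull ` res_der p F L M"
    then obtain \<delta> where \<delta>: "\<delta> \<in> res_der p F L M" "w = ?pull \<delta>" by auto
    obtain g m where g: "g \<in> Z" "m \<in> carrier M" "\<And>x. x \<in> carrier L \<Longrightarrow> der_of_cocycle g x = lact M x m \<oplus>\<^bsub>M\<^esub> \<delta> x"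
      using der_of_cocycle_surj[OF \<delta>(1)] by blast
    let ?i = "\<lambda>x\<in>carrier L. lact M x m"
    have i: "?i \<in> inner_der L M" using g by (auto simp: inner_der_def)
    have eq: "f g \<ominus>\<^bsub>fun_module Y M\<^esub> w = ?pull ?i"
    proof (rule Y.M.minus_eqI)
      show "?pull ?i \<oplus>\<^bsub>fun_module Y M\<^esub> w = f g"
        using g jL by (auto simp: f_def \<delta>(2) intro!: restrict_ext)
      show "?pull ?i \<in> carrier (fun_module Y M)" "w \<in> carrier (fun_module Y M)"
        using jL g(2) Mod.lact_closed derPi[OF \<delta>(1)] by (auto simp: \<delta>(2))
    qed
    show "\<exists>g\<in>carrier ?C. f g \<ominus>\<^bsub>fun_module Y M\<^esub> w \<in> ?pull ` inner_der L M"
    proof (rule bexI[of _ g])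
      show "f g \<ominus>\<^bsub>fun_module Y M\<^esub> w \<in> ?pull ` inner_der L M" unfolding eq by (rule imageI[OF i])
    qed (use g(1) in simp)
  qed
  have "rel_dim D ?C (ext_coboundaries uL P d EM 1) (carrier ?C) n"
    using rel_dim_vimage[OF divC div(1) f d] surj unfolding pre1 pre2 by auto
  note q = lmod_quot_dim[OF divC this]
  have "res_cohomology p F L P d 1 M = lmod_quot ?C (ext_coboundaries uL P d EM 1)"
    unfolding res_cohomology_def Ext_lmod_def
    using hom_lmod_carrier_update[where R = uL and N = EM and M = M and Q = P1 and K = Z] by simp
  then show "lmod_fin_dim D (res_cohomology p F L P d 1 M)" "lmod_dim D (res_cohomology p F L P d 1 M) = n"
    using q by simp_all
qed

section \<open>Finitely spanned modules\<close>

lemma (in left_module) lin_comb_in_submodule: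
  assumes W: "submodule W R M" and y: "\<And>k. k \<in> I \<Longrightarrow> y k \<in> W" and f: "f \<in> carrier (free_lmod R I)"
  shows "lin_comb R M y f \<in> W"
  using f
proof (induction rule: R.free_lmod_induct)
  case zero
  then show ?case using submoduleD(2)[OF W] by simp
next
  case (add k r g)
  have yc: "y k \<in> carrier M" if "k \<in> I" for k using y[OF that] submoduleD(1)[OF W] by blast
  have "lin_comb R M y (\<lambda>i. fsingle R k r i \<oplus>\<^bsub>R\<^esub> g i) = r \<odot>\<^bsub>M\<^esub> y k \<oplus>\<^bsub>M\<^esub> lin_comb R M y g"
    using lin_comb_add[OF R.fsingle_carrier[OF add(1,2)] add(3) yc] lin_comb_fsingle[of r y k, OF add(2) yc[OF add(1)]] by simp
  then show ?case using submoduleD(3,4)[OF W] add y by simp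
qed

lemma (in left_module) lmod_basis_spans:
  assumes "lmod_basis R M B" "submodule W R M" "B \<subseteq> W"
  shows "W = carrier M"
proof
  show "carrier M \<subseteq> W"
  proof
    fix x assume "x \<in> carrier M"
    then obtain f where "f \<in> carrier (free_lmod R B)" "x = lin_comb R M (\<lambda>b. b) f"
      using assms(1) by (auto simp: lmod_basis_alt bij_betw_def)
    then show "x \<in> W" using lin_comb_in_submodule[OF assms(2), of B "\<lambda>b. b" f] assms(3) by blast
  qed
qed (rule submoduleD(1)[OF assms(2)])

lemma (in left_module) submodule_Inter:
  assumes "\<W> \<noteq> {}" "\<And>W. W \<in> \<W> \<Longrightarrow> submodule W R M"
  shows "submodule (\<Inter>\<W>) R M"
proof (rule lsubmoduleI)
  show "\<Inter>\<W> \<subseteq> carrier M" using assms(1) submoduleD(1)[OF assms(2)] by blast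
  show "\<zero>\<^bsub>M\<^esub> \<in> \<Inter>\<W>" using submoduleD(2)[OF assms(2)] by blast
  show "x \<oplus>\<^bsub>M\<^esub> y \<in> \<Inter>\<W>" if "x \<in> \<Inter>\<W>" "y \<in> \<Inter>\<W>" for x y
    using that submoduleD(3)[OF assms(2)] by blast
  show "a \<odot>\<^bsub>M\<^esub> x \<in> \<Inter>\<W>" if "a \<in> carrier R" "x \<in> \<Inter>\<W>" for a x
    using that submoduleD(4)[OF assms(2)] by blast
qed

text \<open>
  \<open>rel_dim_vimage\<close> yields chains inside a submodule regarded as a module of its own; they are chains of
  the ambient module.
\<close>

lemma (in left_module) rel_dim_from_submodule:
  assumes K: "submodule K R M" and d: "rel_dim R (M\<lparr>carrier := K\<rparr>) V W n"
  shows "rel_dim R M V W n"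
proof -
  interpret K: left_module R "M\<lparr>carrier := K\<rparr>" by (rule left_module_submodule[OF K])
  let ?i = "\<lambda>x\<in>K. x"
  have "?i \<in> lmod_hom R (M\<lparr>carrier := K\<rparr>) M"
    using submoduleD[OF K] by (auto simp: lmod_hom_def)
  then have "rel_dim R M (?i ` V) (?i ` W) n"
    by (rule rel_dim_image[OF K.left_module_axioms left_module_axioms _ d])
      (use submoduleD(2)[OF K.rel_dim_submodules(1)[OF d]] in auto)
  moreover have "V \<subseteq> K" "W \<subseteq> K" using K.rel_dim_submodules[OF d] submoduleD(1) by fastforce+
  then have "?i ` V = V" "?i ` W = W" by (auto simp: subset_eq image_iff)
  ultimately show ?thesis by simp
qed

context division_module begin

lemma rel_dim_lower:
  assumes d: "rel_dim R M V W n" and K: "submodule K R M" "V \<subseteq> K" "K \<subseteq> W"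
  shows "\<exists>k. rel_dim R M V K k"
proof -
  have "division_module R (M\<lparr>carrier := K\<rparr>)"
    by (rule division_module_change[OF division_module_axioms left_module_submodule[OF K(1)]])
  moreover have "(\<lambda>x\<in>K. x) \<in> lmod_hom R (M\<lparr>carrier := K\<rparr>) M"
    using submoduleD[OF K(1)] by (auto simp: lmod_hom_def)
  ultimately obtain m where "rel_dim R (M\<lparr>carrier := K\<rparr>) {x \<in> K. (\<lambda>x\<in>K. x) x \<in> V} {x \<in> K. (\<lambda>x\<in>K. x) x \<in> W} m"
    using rel_dim_vimage[OF _ division_module_axioms _ d] by force
  moreover have "{x \<in> K. (\<lambda>x\<in>K. x) x \<in> V} = V" "{x \<in> K. (\<lambda>x\<in>K. x) x \<in> W} = K" using K by auto
  ultimately have "rel_dim R (M\<lparr>carrier := K\<rparr>) V K m" by simp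
  then show ?thesis by (intro exI) (rule rel_dim_from_submodule[OF K(1)])
qed

lemma rel_dim_finite_span:
  assumes "finite T" "T \<subseteq> carrier M" "\<And>W. submodule W R M \<Longrightarrow> T \<subseteq> W \<Longrightarrow> W = carrier M"
  shows "\<exists>n. rel_dim R M {\<zero>\<^bsub>M\<^esub>} (carrier M) n"
proof -
  have "\<exists>W n. T \<subseteq> W \<and> rel_dim R M {\<zero>\<^bsub>M\<^esub>} W n" using assms(1,2)
  proof (induction T)
    case empty
    then show ?case using rel_dim.refl[OF zero_submodule] by blast
  next
    case (insert t T)
    then obtain W n where W: "T \<subseteq> W" "rel_dim R M {\<zero>\<^bsub>M\<^esub>} W n" by blast
    have Ws: "submodule W R M" using rel_dim_submodules W by blast
    show ?case
    proof (cases "t \<in> W")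
      case False
      have "rel_dim R M {\<zero>\<^bsub>M\<^esub>} (adjoin R M W t) (Suc n)"
        by (rule rel_dim.step[OF W(2) _ False]) (use insert in blast)
      moreover have "insert t T \<subseteq> adjoin R M W t"
        using adjoin_base[OF Ws, of t] adjoin_new[OF Ws, of t] insert.prems W(1) by auto
      ultimately show ?thesis by blast
    qed (use W in blast)
  qed
  then obtain W n where "T \<subseteq> W" "rel_dim R M {\<zero>\<^bsub>M\<^esub>} W n" by blast
  then show ?thesis using assms(3) rel_dim_submodules by blast
qed

end

section \<open>Irreducible representations are finite-dimensional\<close>

sublocale restricted_lie_algebra \<subseteq> LL: left_module F L
  by (rule V.left_module)

locale modular_lie_algebra = restricted_lie_algebra p F L
  for p :: nat and F :: "('f, 'z) ring_scheme" (structure) and L :: "('f, 'a, 'y) rlie_scheme" (structure) +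
  assumes p_prime: "Factorial_Ring.prime p" and char_p: "[p] \<cdot>\<^bsub>F\<^esub> \<one>\<^bsub>F\<^esub> = \<zero>\<^bsub>F\<^esub>"
begin

lemma p_ge_2: "2 \<le> p"
  using p_prime by (rule prime_ge_2_nat)

sublocale restricted_data p F L
  by unfold_locales (use V.M.a_closed V.smult_closed bracket_closed pmap_closed p_ge_2 in auto)

end

locale irreducible_rep = modular_lie_algebra p F L
  for p :: nat and F :: "('f, 'z) ring_scheme" (structure) and L :: "('f, 'a, 'y) rlie_scheme" (structure) +
  fixes S :: "('f, 'a, 's) lie_module"
  assumes L_fin: "lmod_fin_dim F L" and irr: "irreducible_restricted_module p F L S"

sublocale irreducible_rep \<subseteq> restricted_data_module p F L S
  by (intro restricted_data_module.intro restricted_data_axioms)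
    (use irr in \<open>simp add: irreducible_restricted_module_def\<close>)

context irreducible_rep begin

abbreviation "Cochain \<equiv> fun_module (carrier L) S"

sublocale SD: division_module Cent "eval_module S"
  by (rule division_module_End[OF irr eval_left_module])
sublocale Cochain: division_module Cent Cochain
  by (rule division_module_End[OF irr fun_left_module])

definition "Lbasis = (SOME B. finite B \<and> lmod_basis F L B)"

lemma Lbasis: "finite Lbasis" "Lbasis \<subseteq> carrier L" "\<And>W. submodule W F L \<Longrightarrow> Lbasis \<subseteq> W \<Longrightarrow> W = carrier L"
proof -
  have "\<exists>B. finite B \<and> lmod_basis F L B" using L_fin by (simp add: lmod_fin_dim_def)
  then have *: "finite Lbasis \<and> lmod_basis F L Lbasis" unfolding Lbasis_def by (rule someI_ex)
  then show "finite Lbasis" "Lbasis \<subseteq> carrier L" by (auto simp: lmod_basis_def)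
  show "\<And>W. submodule W F L \<Longrightarrow> Lbasis \<subseteq> W \<Longrightarrow> W = carrier L" using LL.lmod_basis_spans * by blast
qed

text \<open>
  To show that \<open>S\<close> is finite-dimensional, \<open>S\<close> is generated from a single vector \<open>s\<close> by words in a finite
  basis of \<open>L\<close>.  Up to words of smaller length the letters may be permuted, and a letter occurring \<open>p\<close>
  times in front acts as a single element of \<open>L\<close>.  So sufficiently long words are redundant.
\<close>

fun short_words :: "'s \<Rightarrow> nat \<Rightarrow> 's set"
  where "short_words s 0 = {s}"
  | "short_words s (Suc k) = short_words s k \<union> {lact S x t | x t. x \<in> Lbasis \<and> t \<in> short_words s k}"

definition "span_words s k = \<Inter>{W. submodule W F S \<and> short_words s k \<subseteq> W}"

context
  fixes s assumes s: "s \<in> carrier S"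
begin

abbreviation "SW \<equiv> span_words s"

lemma short_words_closed: "short_words s k \<subseteq> carrier S"
  by (induction k) (use s Lbasis(2) Mod.lact_closed in auto)

lemma short_words_finite: "finite (short_words s k)"
proof (induction k)
  case (Suc k)
  have "{lact S x t | x t. x \<in> Lbasis \<and> t \<in> short_words s k} = (\<lambda>(x, t). lact S x t) ` (Lbasis \<times> short_words s k)" by auto
  then show ?case using Suc Lbasis(1) by simp
qed simp

lemma carrier_sub: "submodule (carrier S) F S"
  by (rule MM.lsubmoduleI) auto

lemma V_submodule: "submodule (SW k) F S"
  unfolding span_words_def by (rule MM.submodule_Inter) (use short_words_closed carrier_sub in auto)

lemmas VD = submoduleD[OF V_submodule]

lemma V_base: "short_words s k \<subseteq> SW k"
  unfolding span_words_def by blast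

lemma V_least: "submodule W F S \<Longrightarrow> short_words s k \<subseteq> W \<Longrightarrow> SW k \<subseteq> W"
  unfolding span_words_def by blast

lemma V_mono: "j \<le> k \<Longrightarrow> SW j \<subseteq> SW k"
proof (induction k)
  case (Suc k)
  have "SW k \<subseteq> SW (Suc k)" by (rule V_least[OF V_submodule]) (use V_base[of "Suc k"] in auto)
  then show ?case using Suc by (cases "j = Suc k") auto
qed simp

text \<open>
  Linearity in \<open>x\<close> and in \<open>v\<close> reduces the claim to a basis element acting on a word.
\<close>

lemma V_act:
  assumes "x \<in> carrier L" "v \<in> SW k" shows "lact S x v \<in> SW (Suc k)"
proof -
  let ?W = "{v \<in> carrier S. \<forall>x\<in>carrier L. lact S x v \<in> SW (Suc k)}"
  have "submodule ?W F S"
    by (rule MM.lsubmoduleI) (use VD[where k = "Suc k"] in \<open>auto simp: Mod.lact_add_r Mod.lact_smult_r\<close>)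
  moreover have "short_words s k \<subseteq> ?W"
  proof
    fix t assume t: "t \<in> short_words s k"
    then have tc: "t \<in> carrier S" using short_words_closed by blast
    let ?Y = "{x \<in> carrier L. lact S x t \<in> SW (Suc k)}"
    have "lact S \<zero>\<^bsub>L\<^esub> t = \<zero>\<^bsub>S\<^esub>"
      using Mod.lact_smult_l[of \<zero> "\<zero>\<^bsub>L\<^esub>" t] tc Mod.lact_closed[of "\<zero>\<^bsub>L\<^esub>" t] by simp
    then have "submodule ?Y F L"
      by (intro LL.lsubmoduleI) (use VD[where k = "Suc k"] tc in \<open>auto simp: Mod.lact_add_l Mod.lact_smult_l\<close>)
    moreover have "Lbasis \<subseteq> ?Y"
    proof
      fix x assume x: "x \<in> Lbasis"
      then have "lact S x t \<in> short_words s (Suc k)" using t by auto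
      then show "x \<in> ?Y" using V_base Lbasis(2) x by blast
    qed
    ultimately have "?Y = carrier L" by (rule Lbasis(3))
    then show "t \<in> ?W" using tc by blast
  qed
  ultimately have "SW k \<subseteq> ?W" by (rule V_least)
  then show ?thesis using assms by blast
qed

lemma V_word: "set w \<subseteq> carrier L \<Longrightarrow> v \<in> SW k \<Longrightarrow> word w v \<in> SW (length w + k)"
  by (induction w) (auto intro: V_act)

lemma s_V: "s \<in> SW 0"
  using V_base[of 0] by auto

lemma V_word_s: "set w \<subseteq> carrier L \<Longrightarrow> length w \<le> k \<Longrightarrow> word w s \<in> SW k"
  using V_word[OF _ s_V, of w] V_mono[of "length w" k] by auto

lemma word_diff:
  assumes "set u \<subseteq> carrier L" "m \<in> carrier S" "n \<in> carrier S"
  shows "word u (m \<ominus>\<^bsub>S\<^esub> n) = word u m \<ominus>\<^bsub>S\<^esub> word u n"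
  by (rule additive_minus(2)[OF Mod.V.M.abelian_group_axioms Mod.V.M.abelian_group_axioms])
    (use assms in \<open>auto simp: word_linear\<close>)

lemma diff_trans:
  assumes "a \<ominus>\<^bsub>S\<^esub> b \<in> SW k" "b \<ominus>\<^bsub>S\<^esub> c \<in> SW k" "a \<in> carrier S" "b \<in> carrier S" "c \<in> carrier S"
  shows "a \<ominus>\<^bsub>S\<^esub> c \<in> SW k"
proof -
  have "a \<ominus>\<^bsub>S\<^esub> c = (a \<ominus>\<^bsub>S\<^esub> b) \<oplus>\<^bsub>S\<^esub> (b \<ominus>\<^bsub>S\<^esub> c)"
    using assms(3-) by (simp add: Mod.V.M.minus_eq Mod.V.M.a_assoc Mod.V.M.r_neg1)
  then show ?thesis using VD(3)[OF assms(1,2)] by simp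
qed

text \<open>
  Exchanging two neighbouring letters changes a word by one in which they are replaced by their bracket.
\<close>

lemma move_to_front:
  "set w \<subseteq> carrier L \<Longrightarrow> x \<in> set w \<Longrightarrow> word w s \<ominus>\<^bsub>S\<^esub> word (x # remove1 x w) s \<in> SW (length w - 1)"
proof (induction w)
  case (Cons y w)
  have c: "y \<in> carrier L" "set w \<subseteq> carrier L" "word w s \<in> carrier S" using Cons s by auto
  show ?case
  proof (cases "x = y")
    case True
    then show ?thesis using c VD(2) Mod.lact_closed[OF c(1,3)] by (simp add: Mod.V.M.minus_eq Mod.V.M.r_neg)
  next
    case False
    then have xw: "x \<in> set w" using Cons by simp
    then obtain k where k: "length w = Suc k" by (cases w) auto
    have xL: "x \<in> carrier L" using Cons by auto
    define r where "r = remove1 x w"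
    have r: "set r \<subseteq> carrier L" "length r = k" using c(2) k xw set_remove1_subset[of x w]
      by (auto simp: r_def length_remove1)
    have wr: "word r s \<in> carrier S" using r s by simp
    note lc = Mod.lact_closed[OF c(1)] Mod.lact_closed[OF xL]
    have "word w s \<ominus>\<^bsub>S\<^esub> lact S x (word r s) \<in> SW k" using Cons.IH[OF c(2) xw] k by (simp add: r_def)
    then have "lact S y (word w s \<ominus>\<^bsub>S\<^esub> lact S x (word r s)) \<in> SW (Suc k)" by (rule V_act[OF c(1)])
    then have 1: "lact S y (word w s) \<ominus>\<^bsub>S\<^esub> lact S y (lact S x (word r s)) \<in> SW (Suc k)"
      using lact_minus[OF c(1,3)] lc wr by simp
    have "lact S (bracket L y x) (word r s) \<in> SW (Suc k)"
      using V_act[OF bracket_closed[OF c(1) xL]] V_word_s[OF r(1), of k] r(2) by simp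
    then have 2: "lact S y (lact S x (word r s)) \<ominus>\<^bsub>S\<^esub> lact S x (lact S y (word r s)) \<in> SW (Suc k)"
      using Mod.lact_bracket[OF c(1) xL wr] by simp
    have "lact S y (word w s) \<ominus>\<^bsub>S\<^esub> lact S x (lact S y (word r s)) \<in> SW (Suc k)"
      by (rule diff_trans[OF 1 2]) (use lc c wr in auto)
    then show ?thesis using False k by (simp add: r_def)
  qed
qed simp

lemma collect_power:
  "set w \<subseteq> carrier L \<Longrightarrow> j \<le> count_list w x \<Longrightarrow>
    \<exists>v. set v \<subseteq> carrier L \<and> length v + j = length w \<and> count_list v x = count_list w x - j \<and>
      word w s \<ominus>\<^bsub>S\<^esub> word (replicate j x @ v) s \<in> SW (length w - 1)"
proof (induction j)
  case 0
  then show ?case using VD(2) word_closed[OF _ s, of w] by (intro exI[of _ w]) (simp add: Mod.V.M.minus_eq Mod.V.M.r_neg)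
next
  case (Suc j)
  then obtain v where v: "set v \<subseteq> carrier L" "length v + j = length w" "count_list v x = count_list w x - j"
    "word w s \<ominus>\<^bsub>S\<^esub> word (replicate j x @ v) s \<in> SW (length w - 1)" by auto
  then have xv: "x \<in> set v" using Suc.prems count_list_0_iff[of v x] by auto
  then obtain k where k: "length v = Suc k" by (cases v) auto
  have xL: "x \<in> carrier L" using xv v by auto
  define r where "r = remove1 x v"
  have r: "set r \<subseteq> carrier L" "length r = k" using v k xv set_remove1_subset[of x v]
    by (auto simp: r_def length_remove1)
  have cr: "count_list r x = count_list w x - Suc j"
  proof -
    have "count_list (remove1 x v) x = count_list v x - 1" by (induction v) auto
    then show ?thesis using v by (simp add: r_def)
  qed
  have rep: "set (replicate j x) \<subseteq> carrier L" using xL by (auto simp: set_replicate_conv_if)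
  have len: "length w - 1 = j + k" using v(2) k by simp
  have "word v s \<ominus>\<^bsub>S\<^esub> word (x # r) s \<in> SW k" using move_to_front[OF v(1) xv] k by (simp add: r_def)
  then have "word (replicate j x) (word v s \<ominus>\<^bsub>S\<^esub> word (x # r) s) \<in> SW (j + k)"
    using V_word[OF rep, of _ k] by simp
  then have "word (replicate j x) (word v s) \<ominus>\<^bsub>S\<^esub> word (replicate j x) (word (x # r) s) \<in> SW (length w - 1)"
    using word_diff[OF rep, of "word v s" "word (x # r) s"] word_closed[OF v(1) s] word_closed[of "x # r" s]
      xL r s len by simp
  then have "word (replicate j x @ v) s \<ominus>\<^bsub>S\<^esub> word (replicate (Suc j) x @ r) s \<in> SW (length w - 1)"
  proof -
    have "replicate (Suc j) x @ r = replicate j x @ x # r" by (simp add: replicate_app_Cons_same)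
    moreover assume "word (replicate j x) (word v s) \<ominus>\<^bsub>S\<^esub> word (replicate j x) (word (x # r) s) \<in> SW (length w - 1)"
    ultimately show ?thesis by (simp only: foldr_append comp_apply)
  qed
  then have "word w s \<ominus>\<^bsub>S\<^esub> word (replicate (Suc j) x @ r) s \<in> SW (length w - 1)"
  proof (rule diff_trans[OF v(4)])
    show "word w s \<in> carrier S" using Suc.prems s by simp
    show "word (replicate j x @ v) s \<in> carrier S" by (rule word_closed[OF _ s]) (use rep v in auto)
    show "word (replicate (Suc j) x @ r) s \<in> carrier S" by (rule word_closed[OF _ s]) (use rep r xL in auto)
  qed
  then show ?case using r cr v(2) k by (intro exI[of _ r]) auto
qed

lemma word_reducible:
  assumes w: "set w \<subseteq> carrier L" "p \<le> count_list w x" "length w = Suc n"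
  shows "word w s \<in> SW n"
proof -
  obtain v where v: "set v \<subseteq> carrier L" "length v + p = Suc n"
    "word w s \<ominus>\<^bsub>S\<^esub> word (replicate p x @ v) s \<in> SW n"
    using collect_power[OF w(1,2)] w(3) by auto
  have "x \<in> set w" using w(2) p_ge_2 count_list_0_iff[of w x] by auto
  then have xL: "x \<in> carrier L" using w by auto
  have wv: "word v s \<in> carrier S" using v s by simp
  have "word (replicate p x @ v) s = lact S (pmap L x) (word v s)"
    using Mod.lact_pmap[OF xL wv] by (simp add: word_replicate)
  also have "\<dots> \<in> SW (Suc (length v))" using V_act[OF pmap_closed[OF xL]] V_word_s[OF v(1)] by simp
  \<comment> \<open>here \<open>p \<ge> 2\<close> makes \<open>pmap L x\<close> followed by \<open>v\<close> shorter than \<open>w\<close>\<close>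
  finally have "word (replicate p x @ v) s \<in> SW n" using V_mono[of "Suc (length v)" n] v(2) p_ge_2 by auto
  then have "(word w s \<ominus>\<^bsub>S\<^esub> word (replicate p x @ v) s) \<oplus>\<^bsub>S\<^esub> word (replicate p x @ v) s \<in> SW n"
    using VD(3) v(3) by blast
  moreover have "word (replicate p x @ v) s \<in> carrier S" "word w s \<in> carrier S"
    using xL v w s by (auto intro!: word_closed simp: set_replicate_conv_if)
  ultimately show ?thesis by (simp add: Mod.V.M.minus_eq Mod.V.M.a_assoc Mod.V.M.l_neg del: foldr_append)
qed

lemma short_words_words: "t \<in> short_words s k \<Longrightarrow> \<exists>w. set w \<subseteq> Lbasis \<and> length w \<le> k \<and> t = word w s"
proof (induction k arbitrary: t)
  case 0
  then show ?case by (intro exI[of _ "[]"]) auto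
next
  case (Suc k)
  show ?case
  proof (cases "t \<in> short_words s k")
    case True
    then show ?thesis using Suc.IH[of t] le_SucI by blast
  next
    case False
    then obtain x t' where *: "t = lact S x t'" "x \<in> Lbasis" "t' \<in> short_words s k" using Suc.prems by auto
    then obtain w where "set w \<subseteq> Lbasis" "length w \<le> k" "t' = word w s" using Suc.IH by blast
    then show ?thesis using * by (intro exI[of _ "x # w"]) auto
  qed
qed

text \<open>
  By the pigeonhole principle, a word longer than \<open>card Lbasis * (p - 1)\<close> has a letter occurring at
  least \<open>p\<close> times.
\<close>

lemma V_stable: "SW (Suc (card Lbasis * (p - 1))) \<subseteq> SW (card Lbasis * (p - 1))"
proof (rule V_least[OF V_submodule])
  let ?N = "card Lbasis * (p - 1)"
  show "short_words s (Suc ?N) \<subseteq> SW ?N"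
  proof
    fix t assume "t \<in> short_words s (Suc ?N)"
    then obtain w where w: "set w \<subseteq> Lbasis" "length w \<le> Suc ?N" "t = word w s" using short_words_words by blast
    have wL: "set w \<subseteq> carrier L" using w Lbasis by blast
    show "t \<in> SW ?N"
    proof (cases "length w \<le> ?N")
      case True
      then show ?thesis using V_word_s wL w by blast
    next
      case False
      then have len: "length w = Suc ?N" using w by simp
      have "\<exists>x. p \<le> count_list w x"
      proof (rule ccontr)
        assume "\<not> ?thesis"
        then have "count_list w x \<le> p - 1" for x using p_ge_2 by (metis Suc_diff_1 linorder_not_le less_Suc_eq_le p_pos)
        then have "sum (count_list w) Lbasis \<le> card Lbasis * (p - 1)" using sum_bounded_above[of Lbasis "count_list w" "p - 1"] by simp
        then show False using sum_count_set[OF w(1) Lbasis(1)] len by simp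
      qed
      then show ?thesis using word_reducible[OF wL _ len] w(3) by blast
    qed
  qed
qed

end

text \<open>
  The span of the short words is stable under \<open>L\<close>, hence all of \<open>S\<close>.  Scalars of \<open>F\<close> are endomorphisms of
  \<open>S\<close>, so a finite set spanning \<open>S\<close> over \<open>F\<close> also spans it over the centralizer.
\<close>

lemma S_fin: "\<exists>n. rel_dim Cent (eval_module S) {\<zero>\<^bsub>S\<^esub>} (carrier S) n"
proof -
  have ne: "carrier S \<noteq> {\<zero>\<^bsub>S\<^esub>}" and sub: "\<And>W. lie_submodule F L S W \<Longrightarrow> W = {\<zero>\<^bsub>S\<^esub>} \<or> W = carrier S"
    using irr by (auto simp: irreducible_restricted_module_def)
  obtain s where s: "s \<in> carrier S" "s \<noteq> \<zero>\<^bsub>S\<^esub>" using ne Mod.V.M.zero_closed by blast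
  let ?N = "card Lbasis * (p - 1)"
  have "lie_submodule F L S (span_words s ?N)"
    unfolding lie_submodule_def using V_submodule[OF s(1)] V_act[OF s(1)] V_stable[OF s(1)] by blast
  moreover have "s \<in> span_words s ?N" using s_V[OF s(1)] V_mono[OF s(1), of 0 ?N] by blast
  ultimately have eq: "span_words s ?N = carrier S" using sub s by blast
  have "\<exists>n. rel_dim Cent (eval_module S) {\<zero>\<^bsub>eval_module S\<^esub>} (carrier (eval_module S)) n"
  proof (rule SD.rel_dim_finite_span)
    show "finite (short_words s ?N)" by (rule short_words_finite[OF s(1)])
    show "short_words s ?N \<subseteq> carrier (eval_module S)" using short_words_closed[OF s(1)] by simp
    fix W assume W: "submodule W Cent (eval_module S)" "short_words s ?N \<subseteq> W"
    note WD = submoduleD[OF W(1), simplified]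
    have "submodule W F S"
    proof (rule MM.lsubmoduleI)
      show "c \<odot>\<^bsub>S\<^esub> m \<in> W" if "c \<in> carrier F" "m \<in> W" for c m
        using WD(4)[OF End_scalar[OF that(1), simplified] that(2)] WD(1) that by auto
    qed (use WD in auto)
    then have "span_words s ?N \<subseteq> W" by (rule V_least[OF s(1) _ W(2)])
    then show "W = carrier (eval_module S)" using eq WD(1) by simp
  qed
  then show ?thesis by simp
qed

section \<open>Derivations vanishing on a set\<close>

definition der_vanish :: "'a set \<Rightarrow> ('a \<Rightarrow> 's) set"
  where "der_vanish N = {\<delta> \<in> res_der p F L S. \<forall>x\<in>N. \<delta> x = \<zero>\<^bsub>S\<^esub>}"

lemma res_derI:
  assumes "\<And>x. x \<in> carrier L \<Longrightarrow> \<delta> x \<in> carrier S"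
    "\<And>x y. \<lbrakk>x \<in> carrier L; y \<in> carrier L\<rbrakk> \<Longrightarrow> \<delta> (x \<oplus>\<^bsub>L\<^esub> y) = \<delta> x \<oplus>\<^bsub>S\<^esub> \<delta> y"
    "\<And>c x. \<lbrakk>c \<in> carrier F; x \<in> carrier L\<rbrakk> \<Longrightarrow> \<delta> (c \<odot>\<^bsub>L\<^esub> x) = c \<odot>\<^bsub>S\<^esub> \<delta> x"
    "\<And>x y. \<lbrakk>x \<in> carrier L; y \<in> carrier L\<rbrakk> \<Longrightarrow> \<delta> (bracket L x y) = lact S x (\<delta> y) \<ominus>\<^bsub>S\<^esub> lact S y (\<delta> x)"
    "\<And>x. x \<in> carrier L \<Longrightarrow> \<delta> (pmap L x) = (lact S x ^^ (p - 1)) (\<delta> x)"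
  shows "(\<lambda>x\<in>carrier L. \<delta> x) \<in> res_der p F L S"
  using assms bracket_closed pmap_closed by (auto simp: res_der_def lmod_hom_def)

lemma lact_pow_additive:
  assumes "x \<in> carrier L" "m \<in> carrier S" "n \<in> carrier S"
  shows "(lact S x ^^ k) (m \<oplus>\<^bsub>S\<^esub> n) = (lact S x ^^ k) m \<oplus>\<^bsub>S\<^esub> (lact S x ^^ k) n"
  using word_linear(1)[of "replicate k x" m n] assms by (simp add: word_replicate set_replicate_conv_if)

lemma End_pow:
  assumes "h \<in> lie_module_hom F L S S" "x \<in> carrier L" "m \<in> carrier S"
  shows "h ((lact S x ^^ k) m) = (lact S x ^^ k) (h m)"
  by (induction k) (use lie_module_homD[OF assms(1)] assms in auto)

lemma End_minus:
  assumes "h \<in> lie_module_hom F L S S" "m \<in> carrier S" "n \<in> carrier S"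
  shows "h (m \<ominus>\<^bsub>S\<^esub> n) = h m \<ominus>\<^bsub>S\<^esub> h n"
  by (rule additive_minus(2)[OF Mod.V.M.abelian_group_axioms Mod.V.M.abelian_group_axioms])
    (use lie_module_homD[OF assms(1)] assms in auto)

lemma End_zero:
  assumes "h \<in> lie_module_hom F L S S" shows "h \<zero>\<^bsub>S\<^esub> = \<zero>\<^bsub>S\<^esub>"
  by (rule additive_zero[OF Mod.V.M.abelian_group_axioms Mod.V.M.abelian_group_axioms])
    (use lie_module_homD[OF assms(1)] in auto)

lemma derD:
  assumes "\<delta> \<in> res_der p F L S"
  shows "\<And>x. x \<in> carrier L \<Longrightarrow> \<delta> x \<in> carrier S"
    "\<And>x y. \<lbrakk>x \<in> carrier L; y \<in> carrier L\<rbrakk> \<Longrightarrow> \<delta> (x \<oplus>\<^bsub>L\<^esub> y) = \<delta> x \<oplus>\<^bsub>S\<^esub> \<delta> y"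
    "\<And>c x. \<lbrakk>c \<in> carrier F; x \<in> carrier L\<rbrakk> \<Longrightarrow> \<delta> (c \<odot>\<^bsub>L\<^esub> x) = c \<odot>\<^bsub>S\<^esub> \<delta> x"
    "\<And>x y. \<lbrakk>x \<in> carrier L; y \<in> carrier L\<rbrakk> \<Longrightarrow> \<delta> (bracket L x y) = lact S x (\<delta> y) \<ominus>\<^bsub>S\<^esub> lact S y (\<delta> x)"
    "\<And>x. x \<in> carrier L \<Longrightarrow> \<delta> (pmap L x) = (lact S x ^^ (p - 1)) (\<delta> x)"
    "\<delta> \<in> carrier L \<rightarrow>\<^sub>E carrier S"
    "\<delta> \<zero>\<^bsub>L\<^esub> = \<zero>\<^bsub>S\<^esub>"
    "\<And>x y. \<lbrakk>x \<in> carrier L; y \<in> carrier L\<rbrakk> \<Longrightarrow> \<delta> (x \<ominus>\<^bsub>L\<^esub> y) = \<delta> x \<ominus>\<^bsub>S\<^esub> \<delta> y"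
proof -
  note H = lmod_homD[OF res_derD(1)[OF assms]]
  show "\<And>x. x \<in> carrier L \<Longrightarrow> \<delta> x \<in> carrier S"
    "\<And>x y. \<lbrakk>x \<in> carrier L; y \<in> carrier L\<rbrakk> \<Longrightarrow> \<delta> (x \<oplus>\<^bsub>L\<^esub> y) = \<delta> x \<oplus>\<^bsub>S\<^esub> \<delta> y"
    "\<And>c x. \<lbrakk>c \<in> carrier F; x \<in> carrier L\<rbrakk> \<Longrightarrow> \<delta> (c \<odot>\<^bsub>L\<^esub> x) = c \<odot>\<^bsub>S\<^esub> \<delta> x"
    "\<delta> \<in> carrier L \<rightarrow>\<^sub>E carrier S" by (fact H)+
  show "\<And>x y. \<lbrakk>x \<in> carrier L; y \<in> carrier L\<rbrakk> \<Longrightarrow> \<delta> (bracket L x y) = lact S x (\<delta> y) \<ominus>\<^bsub>S\<^esub> lact S y (\<delta> x)"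
    "\<And>x. x \<in> carrier L \<Longrightarrow> \<delta> (pmap L x) = (lact S x ^^ (p - 1)) (\<delta> x)"
    by (fact res_derD[OF assms])+
  show "\<delta> \<zero>\<^bsub>L\<^esub> = \<zero>\<^bsub>S\<^esub>"
    by (rule lmod_hom_zero[OF LL.left_module_axioms MM.left_module_axioms res_derD(1)[OF assms]])
  show "\<And>x y. \<lbrakk>x \<in> carrier L; y \<in> carrier L\<rbrakk> \<Longrightarrow> \<delta> (x \<ominus>\<^bsub>L\<^esub> y) = \<delta> x \<ominus>\<^bsub>S\<^esub> \<delta> y"
    by (rule lmod_hom_minus[OF LL.left_module_axioms MM.left_module_axioms res_derD(1)[OF assms]])
qed

lemma res_der_submodule: "submodule (res_der p F L S) Cent Cochain"
proof (rule Cochain.lsubmoduleI)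
  show "res_der p F L S \<subseteq> carrier Cochain" using derD(6) by auto
  show "\<zero>\<^bsub>Cochain\<^esub> \<in> res_der p F L S"
    unfolding fun_module_simps
  proof (rule res_derI)
    have "(lact S x ^^ k) \<zero>\<^bsub>S\<^esub> = \<zero>\<^bsub>S\<^esub>" if "x \<in> carrier L" for x k
      by (induction k) (use that in auto)
    then show "\<zero>\<^bsub>S\<^esub> = (lact S x ^^ (p - 1)) \<zero>\<^bsub>S\<^esub>" if "x \<in> carrier L" for x using that by simp
    have "\<zero>\<^bsub>S\<^esub> \<ominus>\<^bsub>S\<^esub> \<zero>\<^bsub>S\<^esub> = \<zero>\<^bsub>S\<^esub>" by (rule Mod.V.M.minus_eqI) auto
    then show "\<zero>\<^bsub>S\<^esub> = lact S x \<zero>\<^bsub>S\<^esub> \<ominus>\<^bsub>S\<^esub> lact S y \<zero>\<^bsub>S\<^esub>"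
      if "x \<in> carrier L" "y \<in> carrier L" for x y using that by simp
  qed auto
next
  fix \<delta> \<epsilon> assume *: "\<delta> \<in> res_der p F L S" "\<epsilon> \<in> res_der p F L S"
  note d = derD[OF *(1)] and e = derD[OF *(2)]
  show "\<delta> \<oplus>\<^bsub>Cochain\<^esub> \<epsilon> \<in> res_der p F L S"
    unfolding fun_module_simps
  proof (rule res_derI)
    fix x y assume xy: "x \<in> carrier L" "y \<in> carrier L"
    show "\<delta> (x \<oplus>\<^bsub>L\<^esub> y) \<oplus>\<^bsub>S\<^esub> \<epsilon> (x \<oplus>\<^bsub>L\<^esub> y) = \<delta> x \<oplus>\<^bsub>S\<^esub> \<epsilon> x \<oplus>\<^bsub>S\<^esub> (\<delta> y \<oplus>\<^bsub>S\<^esub> \<epsilon> y)"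
      using xy d(1,2) e(1,2) by (simp add: Mod.V.M.a_ac)
    show "\<delta> (bracket L x y) \<oplus>\<^bsub>S\<^esub> \<epsilon> (bracket L x y) =
        lact S x (\<delta> y \<oplus>\<^bsub>S\<^esub> \<epsilon> y) \<ominus>\<^bsub>S\<^esub> lact S y (\<delta> x \<oplus>\<^bsub>S\<^esub> \<epsilon> x)"
      using xy d(1,4) e(1,4) Mod.lact_closed
      by (simp add: Mod.lact_add_r Mod.V.M.minus_eq Mod.V.M.minus_add Mod.V.M.a_ac)
  qed (use d(1,3,5) e(1,3,5) in \<open>auto simp: lact_pow_additive Mod.V.smult_r_distr\<close>)
next
  fix h \<delta> assume *: "h \<in> carrier Cent" "\<delta> \<in> res_der p F L S"
  note d = derD[OF *(2)] and h = *(1)[unfolded End_ring_simps]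
  note H = lie_module_homD[OF h]
  show "h \<odot>\<^bsub>Cochain\<^esub> \<delta> \<in> res_der p F L S"
    unfolding fun_module_simps
  proof (rule res_derI)
    fix x y assume xy: "x \<in> carrier L" "y \<in> carrier L"
    show "h (\<delta> (bracket L x y)) = lact S x (h (\<delta> y)) \<ominus>\<^bsub>S\<^esub> lact S y (h (\<delta> x))"
      using xy d(1,4) Mod.lact_closed by (simp add: End_minus[OF h] H(5))
  qed (use d(1,2,3,5) H(2-4) End_pow[OF h] in auto)
qed

lemma der_vanish_submodule:
  assumes "N \<subseteq> carrier L" shows "submodule (der_vanish N) Cent Cochain"
proof (rule Cochain.lsubmoduleI)
  note R = submoduleD[OF res_der_submodule]
  show "der_vanish N \<subseteq> carrier Cochain" using R(1) by (auto simp: der_vanish_def)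
  show "\<zero>\<^bsub>Cochain\<^esub> \<in> der_vanish N" using R(2) assms by (auto simp: der_vanish_def)
  show "\<delta> \<oplus>\<^bsub>Cochain\<^esub> \<epsilon> \<in> der_vanish N" if "\<delta> \<in> der_vanish N" "\<epsilon> \<in> der_vanish N" for \<delta> \<epsilon>
    using that R(3)[of \<delta> \<epsilon>] assms by (auto simp: der_vanish_def)
  show "h \<odot>\<^bsub>Cochain\<^esub> \<delta> \<in> der_vanish N" if "h \<in> carrier Cent" "\<delta> \<in> der_vanish N" for h \<delta>
    using that R(4)[of h \<delta>] assms by (auto simp: der_vanish_def End_zero)
qed

lemma inner_der_submodule: "submodule (inner_der L S) Cent Cochain"
proof (rule Cochain.lsubmoduleI)
  show "inner_der L S \<subseteq> carrier Cochain" using Mod.lact_closed by (auto simp: inner_der_def)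
  show "\<zero>\<^bsub>Cochain\<^esub> \<in> inner_der L S"
    by (auto simp: inner_der_def intro!: image_eqI[of _ _ "\<zero>\<^bsub>S\<^esub>"] restrict_ext)
  show "\<delta> \<oplus>\<^bsub>Cochain\<^esub> \<epsilon> \<in> inner_der L S" if de: "\<delta> \<in> inner_der L S" "\<epsilon> \<in> inner_der L S" for \<delta> \<epsilon>
  proof -
    obtain m n where "m \<in> carrier S" "n \<in> carrier S" "\<delta> = (\<lambda>x\<in>carrier L. lact S x m)" "\<epsilon> = (\<lambda>x\<in>carrier L. lact S x n)"
      using de by (auto simp: inner_der_def)
    then show ?thesis
      by (auto simp: inner_der_def Mod.lact_add_r intro!: image_eqI[of _ _ "m \<oplus>\<^bsub>S\<^esub> n"] restrict_ext)
  qed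
  show "h \<odot>\<^bsub>Cochain\<^esub> \<delta> \<in> inner_der L S" if hd: "h \<in> carrier Cent" "\<delta> \<in> inner_der L S" for h \<delta>
  proof -
    obtain m where "m \<in> carrier S" "\<delta> = (\<lambda>x\<in>carrier L. lact S x m)"
      using hd by (auto simp: inner_der_def)
    then show ?thesis using lie_module_homD[OF hd(1)[unfolded End_ring_simps]]
      by (auto simp: inner_der_def intro!: image_eqI[of _ _ "h m"] restrict_ext)
  qed
qed

text \<open>
  The restrictedness of an inner derivation is the axiom on the \<open>p\<close>-mapping of the module.
\<close>

lemma inner_der_vanish: "inner_der L S \<subseteq> der_vanish (Ann L S)"
proof
  fix \<delta> assume "\<delta> \<in> inner_der L S"
  then obtain m where m: "m \<in> carrier S" "\<delta> = (\<lambda>x\<in>carrier L. lact S x m)" by (auto simp: inner_der_def)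
  have "(lact S x ^^ Suc (p - 1)) m = (lact S x ^^ (p - 1)) (lact S x m)" for x
    by (simp only: funpow_Suc_right comp_apply)
  then have "(lact S x ^^ p) m = (lact S x ^^ (p - 1)) (lact S x m)" for x using p_pos by simp
  then have "(\<lambda>x\<in>carrier L. lact S x m) \<in> res_der p F L S"
    by (intro res_derI) (use m Mod.lact_closed in
      \<open>auto simp: Mod.lact_add_l Mod.lact_smult_l Mod.lact_bracket Mod.lact_pmap\<close>)
  then show "\<delta> \<in> der_vanish (Ann L S)" using m by (auto simp: der_vanish_def Ann_def)
qed

text \<open>
  A derivation is determined by its values on a basis of \<open>L\<close>.  Prescribing zeros at the basis elements one
  after the other, each step is controlled by the evaluation map into the finite-dimensional \<open>S\<close>.
\<close>

lemma der_fin: "\<exists>n. rel_dim Cent Cochain {\<zero>\<^bsub>Cochain\<^esub>} (res_der p F L S) n"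
proof -
  obtain n where n: "rel_dim Cent (eval_module S) {\<zero>\<^bsub>S\<^esub>} (carrier S) n" using S_fin by blast
  have "\<exists>k. rel_dim Cent Cochain (der_vanish Y) (res_der p F L S) k" if "finite Y" "Y \<subseteq> Lbasis" for Y
    using that
  proof (induction Y)
    case empty
    have "der_vanish {} = res_der p F L S" by (simp add: der_vanish_def)
    then show ?case using rel_dim.refl[OF res_der_submodule] by auto
  next
    case (insert x Y)
    then obtain k where k: "rel_dim Cent Cochain (der_vanish Y) (res_der p F L S) k" by auto
    have xL: "x \<in> carrier L" and YL: "Y \<subseteq> carrier L" using insert Lbasis(2) by auto
    let ?K = "Cochain\<lparr>carrier := der_vanish Y\<rparr>"
    note K = der_vanish_submodule[OF YL]
    have divK: "division_module Cent ?K"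
      by (rule division_module_change[OF Cochain.division_module_axioms Cochain.left_module_submodule[OF K]])
    have f: "(\<lambda>\<delta>\<in>der_vanish Y. \<delta> x) \<in> lmod_hom Cent ?K (eval_module S)"
      using submoduleD(3,4)[OF K] derD(1) xL by (auto simp: lmod_hom_def der_vanish_def)
    obtain m where m: "rel_dim Cent ?K {\<delta> \<in> carrier ?K. (\<lambda>\<delta>\<in>der_vanish Y. \<delta> x) \<delta> \<in> {\<zero>\<^bsub>S\<^esub>}}
       {\<delta> \<in> carrier ?K. (\<lambda>\<delta>\<in>der_vanish Y. \<delta> x) \<delta> \<in> carrier S} m"
      using rel_dim_vimage[OF divK SD.division_module_axioms f n] by blast
    moreover have "{\<delta> \<in> carrier ?K. (\<lambda>\<delta>\<in>der_vanish Y. \<delta> x) \<delta> \<in> {\<zero>\<^bsub>S\<^esub>}} = der_vanish (insert x Y)"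
      by (auto simp: der_vanish_def)
    moreover have "{\<delta> \<in> carrier ?K. (\<lambda>\<delta>\<in>der_vanish Y. \<delta> x) \<delta> \<in> carrier S} = der_vanish Y"
      using derD(1) xL by (auto simp: der_vanish_def)
    ultimately have "rel_dim Cent Cochain (der_vanish (insert x Y)) (der_vanish Y) m"
      using Cochain.rel_dim_from_submodule[OF K] by simp
    then show ?case using Cochain.rel_dim_trans[OF k] by blast
  qed
  from this[OF Lbasis(1)] obtain k where k: "rel_dim Cent Cochain (der_vanish Lbasis) (res_der p F L S) k" by auto
  have "der_vanish Lbasis \<subseteq> {\<zero>\<^bsub>Cochain\<^esub>}"
  proof
    fix \<delta> assume d: "\<delta> \<in> der_vanish Lbasis"
    then have \<delta>: "\<delta> \<in> res_der p F L S" by (simp add: der_vanish_def)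
    have "submodule {x \<in> carrier L. \<delta> x = \<zero>\<^bsub>S\<^esub>} F L"
      by (rule LL.lsubmoduleI) (use derD[OF \<delta>] in auto)
    moreover have "Lbasis \<subseteq> {x \<in> carrier L. \<delta> x = \<zero>\<^bsub>S\<^esub>}" using d Lbasis(2) by (auto simp: der_vanish_def)
    ultimately have "{x \<in> carrier L. \<delta> x = \<zero>\<^bsub>S\<^esub>} = carrier L" by (rule Lbasis(3))
    then have "\<delta> = \<zero>\<^bsub>Cochain\<^esub>" by (intro extfun_eqI[OF derD(6)[OF \<delta>]]) auto
    then show "\<delta> \<in> {\<zero>\<^bsub>Cochain\<^esub>}" by simp
  qed
  moreover have "\<zero>\<^bsub>Cochain\<^esub> \<in> der_vanish Lbasis" by (rule submoduleD(2)[OF der_vanish_submodule[OF Lbasis(2)]])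
  ultimately have "der_vanish Lbasis = {\<zero>\<^bsub>Cochain\<^esub>}" by blast
  then show ?thesis using k by auto
qed

lemma inner_vanish_fin: "\<exists>k. rel_dim Cent Cochain (inner_der L S) (der_vanish (Ann L S)) k"
proof -
  obtain n where n: "rel_dim Cent Cochain {\<zero>\<^bsub>Cochain\<^esub>} (res_der p F L S) n" using der_fin by blast
  have A: "Ann L S \<subseteq> carrier L" by (auto simp: Ann_def)
  have sub: "der_vanish (Ann L S) \<subseteq> res_der p F L S" by (auto simp: der_vanish_def)
  obtain m where "rel_dim Cent Cochain (inner_der L S) (res_der p F L S) m"
    using Cochain.rel_dim_upper[OF n inner_der_submodule] submoduleD(2)[OF inner_der_submodule] inner_der_vanish sub by blast
  then show ?thesis using Cochain.rel_dim_lower der_vanish_submodule[OF A] inner_der_vanish sub by blast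
qed

end

section \<open>Restricted ideals and quotients\<close>

lemma left_module_transfer:
  assumes "left_module R M" "carrier N = carrier M" "add N = add M" "zero N = zero M" "smult N = smult M"
  shows "left_module R N"
proof -
  interpret left_module R M by fact
  show ?thesis
    by (intro left_module.intro left_module_axioms.intro R.ring_axioms
        abelian_group_transfer[OF M.abelian_group_axioms assms(2,3,4)])
      (simp_all add: assms(2-5) lsmult_l_distr lsmult_r_distr lsmult_assoc lsmult_one)
qed

lemma (in left_module) finsum_in_submodule:
  assumes "submodule W R M" "finite I" "\<And>i. i \<in> I \<Longrightarrow> f i \<in> W"
  shows "(\<Oplus>\<^bsub>M\<^esub>i\<in>I. f i) \<in> W"
  using assms(2,3)
proof (induction I)
  case (insert i I)
  have "f \<in> I \<rightarrow> carrier M" "f i \<in> carrier M" using insert.prems submoduleD(1)[OF assms(1)] by auto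
  then show ?case using insert submoduleD(3)[OF assms(1)] by simp
qed (simp add: submoduleD(2)[OF assms(1)])

lemma p_idealD:
  assumes "p_ideal F L N"
  shows "submodule N F L" "\<And>x y. x \<in> carrier L \<Longrightarrow> y \<in> N \<Longrightarrow> bracket L x y \<in> N"
    "\<And>y. y \<in> N \<Longrightarrow> pmap L y \<in> N"
  using assms by (auto simp: p_ideal_def)

lemma rlie_quot_left_simps [simp]:
  "zero (rlie_quot L N) = N" "add (rlie_quot L N) = set_add L"
  by (simp_all add: rlie_quot_def)

context modular_lie_algebra begin

lemma bracket_antisym:
  assumes "x \<in> carrier L" "y \<in> carrier L" shows "bracket L y x = \<ominus>\<^bsub>L\<^esub> bracket L x y"
proof -
  note c = bracket_closed[OF assms] bracket_closed[OF assms(2,1)]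
  have "bracket L (x \<oplus>\<^bsub>L\<^esub> y) (x \<oplus>\<^bsub>L\<^esub> y) = bracket L x y \<oplus>\<^bsub>L\<^esub> bracket L y x"
    using assms c bracket_self[of x] bracket_self[of y] by (simp add: bracket_add_l bracket_add_r V.M.a_comm)
  then have "bracket L y x \<oplus>\<^bsub>L\<^esub> bracket L x y = \<zero>\<^bsub>L\<^esub>"
    using bracket_self[of "x \<oplus>\<^bsub>L\<^esub> y"] assms c by (simp add: V.M.a_comm)
  then show ?thesis using c V.M.minus_equality by metis
qed

lemma p_ideal_bracket_left:
  assumes "p_ideal F L N" "y \<in> N" "x \<in> carrier L" shows "bracket L y x \<in> N"
proof -
  have "y \<in> carrier L" using submoduleD(1)[OF p_idealD(1)[OF assms(1)]] assms(2) by blast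
  then show ?thesis
    using bracket_antisym[OF assms(3)] p_idealD(2)[OF assms(1,3,2)] submoduleD(5)[OF p_idealD(1)[OF assms(1)]] by simp
qed

lemma add_pow_one_neq_zero:
  assumes "0 < i" "i < p" shows "[i] \<cdot>\<^bsub>F\<^esub> \<one> \<noteq> \<zero>"
proof
  assume z: "[i] \<cdot>\<^bsub>F\<^esub> \<one> = \<zero>"
  have "coprime i p" using assms p_prime
    by (metis coprime_commute dvd_imp_le linorder_not_le prime_imp_coprime)
  then obtain a b where ab: "a * i = b * p + 1"
    using bezout_nat[of i p] assms by (auto simp: mult.commute)
  have "[(a * i)] \<cdot>\<^bsub>F\<^esub> \<one> = [a] \<cdot>\<^bsub>F\<^esub> ([i] \<cdot>\<^bsub>F\<^esub> \<one>)"
    using F.add.nat_pow_pow[of \<one> a i] by (simp add: mult.commute)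
  then have 1: "[(a * i)] \<cdot>\<^bsub>F\<^esub> \<one> = \<zero>" using z F.add.nat_pow_one by simp
  have "[(b * p + 1)] \<cdot>\<^bsub>F\<^esub> \<one> = [b] \<cdot>\<^bsub>F\<^esub> ([p] \<cdot>\<^bsub>F\<^esub> \<one>) \<oplus> \<one>"
    using F.add.nat_pow_pow[of \<one> b p] F.add.nat_pow_mult[of \<one> "b * p" 1] by (simp add: mult.commute)
  then have "[(b * p + 1)] \<cdot>\<^bsub>F\<^esub> \<one> = \<one>" using char_p F.add.nat_pow_one by simp
  then show False using 1 ab by simp
qed

text \<open>
  The scalars \<open>1/i\<close> in Jacobson's formula exist because \<open>i < p\<close> is invertible modulo \<open>p\<close>.
\<close>

lemma jacobson_scalar_closed:
  assumes "i \<in> {1..p - 1}" shows "inv ([i] \<cdot>\<^bsub>F\<^esub> \<one>) \<in> carrier F"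
proof -
  have "[i] \<cdot>\<^bsub>F\<^esub> \<one> \<noteq> \<zero>" using assms p_ge_2 by (intro add_pow_one_neq_zero) auto
  then have "[i] \<cdot>\<^bsub>F\<^esub> \<one> \<in> Units F" using field_Units F.add.nat_pow_closed by auto
  then show ?thesis by (rule Units_inv_closed)
qed

lemma ad_coeff_p_ideal:
  assumes N: "p_ideal F L N" and x: "x \<in> N" and y: "y \<in> carrier L"
  shows "ad_coeff L x y m k \<in> N"
proof (induction m arbitrary: k)
  case 0
  then show ?case using x submoduleD(2)[OF p_idealD(1)[OF N]] by (cases k) auto
next
  case (Suc m)
  have xL: "x \<in> carrier L" using x submoduleD(1)[OF p_idealD(1)[OF N]] by blast
  show ?case using Suc p_idealD(2)[OF N xL] p_idealD(2)[OF N y] submoduleD(3)[OF p_idealD(1)[OF N]]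
    by (cases k) auto
qed

lemma jacobson_p_ideal:
  assumes "p_ideal F L N" "x \<in> N" "y \<in> carrier L" "i \<in> {1..p - 1}"
  shows "jacobson_s p F L i x y \<in> N"
  unfolding jacobson_s_def
  by (rule submoduleD(4)[OF p_idealD(1)[OF assms(1)] jacobson_scalar_closed[OF assms(4)] ad_coeff_p_ideal[OF assms(1-3)]])

text \<open>
  Jacobson's formula: the correction terms of \<open>(x + y)\<^sup>[\<^sup>p\<^sup>]\<close> are iterated brackets that contain \<open>x\<close>.  This
  makes the \<open>p\<close>-mapping of a quotient well defined.
\<close>

lemma pmap_mod_p_ideal:
  assumes N: "p_ideal F L N" and x: "x \<in> N" and y: "y \<in> carrier L"
  shows "pmap L (x \<oplus>\<^bsub>L\<^esub> y) \<ominus>\<^bsub>L\<^esub> pmap L y \<in> N"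
proof -
  note Ns = p_idealD(1)[OF N]
  have xL: "x \<in> carrier L" using x submoduleD(1)[OF Ns] by blast
  let ?s = "\<Oplus>\<^bsub>L\<^esub>i\<in>{1..p - 1}. jacobson_s p F L i x y"
  have s: "?s \<in> N" by (rule LL.finsum_in_submodule[OF Ns]) (use jacobson_p_ideal[OF N x y] in auto)
  then have sL: "?s \<in> carrier L" using submoduleD(1)[OF Ns] by blast
  have "pmap L (x \<oplus>\<^bsub>L\<^esub> y) \<ominus>\<^bsub>L\<^esub> pmap L y = pmap L x \<oplus>\<^bsub>L\<^esub> ?s"
    by (rule V.M.minus_eqI) (use pmap_add[OF xL y] pmap_closed[OF xL] pmap_closed[OF y] sL in \<open>auto simp: V.M.a_ac\<close>)
  then show ?thesis using submoduleD(3)[OF Ns p_idealD(3)[OF N x] s] by simp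
qed

lemma p_ideal_inter: "p_ideal F L M \<Longrightarrow> p_ideal F L N \<Longrightarrow> p_ideal F L (M \<inter> N)"
  unfolding p_ideal_def
  using submoduleD[of M F L] submoduleD[of N F L] by (auto intro!: LL.lsubmoduleI)

lemma p_ideal_sum:
  assumes M: "p_ideal F L M" and N: "p_ideal F L N"
  shows "p_ideal F L {m \<oplus>\<^bsub>L\<^esub> n | m n. m \<in> M \<and> n \<in> N}" (is "p_ideal F L ?S")
proof -
  note MD = submoduleD[OF p_idealD(1)[OF M]] and ND = submoduleD[OF p_idealD(1)[OF N]]
  have cM: "m \<in> carrier L" if "m \<in> M" for m using that MD(1) by blast
  have cN: "n \<in> carrier L" if "n \<in> N" for n using that ND(1) by blast
  have "submodule ?S F L"
  proof (rule LL.lsubmoduleI)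
    show "?S \<subseteq> carrier L" using cM cN by auto
    show "\<zero>\<^bsub>L\<^esub> \<in> ?S" using MD(2) ND(2) by force
    show "x \<oplus>\<^bsub>L\<^esub> y \<in> ?S" if xy: "x \<in> ?S" "y \<in> ?S" for x y
    proof -
      obtain m n m' n' where *: "x = m \<oplus>\<^bsub>L\<^esub> n" "y = m' \<oplus>\<^bsub>L\<^esub> n'" "m \<in> M" "n \<in> N" "m' \<in> M" "n' \<in> N"
        using xy by blast
      then have "x \<oplus>\<^bsub>L\<^esub> y = (m \<oplus>\<^bsub>L\<^esub> m') \<oplus>\<^bsub>L\<^esub> (n \<oplus>\<^bsub>L\<^esub> n')" using cM cN by (simp add: V.M.a_ac)
      then show ?thesis using * MD(3) ND(3) by blast
    qed
    show "c \<odot>\<^bsub>L\<^esub> x \<in> ?S" if cx: "c \<in> carrier F" "x \<in> ?S" for c x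
    proof -
      obtain m n where *: "x = m \<oplus>\<^bsub>L\<^esub> n" "m \<in> M" "n \<in> N" using cx by blast
      then have "c \<odot>\<^bsub>L\<^esub> x = c \<odot>\<^bsub>L\<^esub> m \<oplus>\<^bsub>L\<^esub> c \<odot>\<^bsub>L\<^esub> n" using cM cN cx by (simp add: V.smult_r_distr)
      then show ?thesis using * MD(4) ND(4) cx(1) by blast
    qed
  qed
  moreover have "bracket L x y \<in> ?S" if xy: "x \<in> carrier L" "y \<in> ?S" for x y
  proof -
    obtain m n where *: "y = m \<oplus>\<^bsub>L\<^esub> n" "m \<in> M" "n \<in> N" using xy by blast
    then have "bracket L x y = bracket L x m \<oplus>\<^bsub>L\<^esub> bracket L x n" using cM cN xy by (simp add: bracket_add_r)
    then show ?thesis using * p_idealD(2)[OF M xy(1)] p_idealD(2)[OF N xy(1)] by blast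
  qed
  moreover have "pmap L y \<in> ?S" if y: "y \<in> ?S" for y
  proof -
    obtain m n where *: "y = m \<oplus>\<^bsub>L\<^esub> n" "m \<in> M" "n \<in> N" using y by blast
    have "pmap L y = (pmap L y \<ominus>\<^bsub>L\<^esub> pmap L n) \<oplus>\<^bsub>L\<^esub> pmap L n"
      using * cM cN pmap_closed by (simp add: V.M.minus_eq V.M.a_assoc V.M.l_neg)
    then show ?thesis using pmap_mod_p_ideal[OF M *(2) cN[OF *(3)]] p_idealD(3)[OF N *(3)] *(1) by blast
  qed
  ultimately show ?thesis by (simp add: p_ideal_def)
qed

context
  fixes N assumes N: "p_ideal F L N"
begin

lemma p_ideal_subgroup: "abelian_subgroup N L"
  by (rule LL.submodule_abelian_subgroup[OF p_idealD(1)[OF N]])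

interpretation N: abelian_subgroup N L by (rule p_ideal_subgroup)

lemma rlie_quot_simps:
  shows "carrier (rlie_quot L N) = {N +>\<^bsub>L\<^esub> x | x. x \<in> carrier L}"
    "\<lbrakk>x \<in> carrier L; y \<in> carrier L\<rbrakk> \<Longrightarrow> (N +>\<^bsub>L\<^esub> x) <+>\<^bsub>L\<^esub> (N +>\<^bsub>L\<^esub> y) = N +>\<^bsub>L\<^esub> (x \<oplus>\<^bsub>L\<^esub> y)"
    "\<lbrakk>c \<in> carrier F; x \<in> carrier L\<rbrakk> \<Longrightarrow> c \<odot>\<^bsub>rlie_quot L N\<^esub> (N +>\<^bsub>L\<^esub> x) = N +>\<^bsub>L\<^esub> (c \<odot>\<^bsub>L\<^esub> x)"
    "\<lbrakk>x \<in> carrier L; y \<in> carrier L\<rbrakk> \<Longrightarrow> bracket (rlie_quot L N) (N +>\<^bsub>L\<^esub> x) (N +>\<^bsub>L\<^esub> y) = N +>\<^bsub>L\<^esub> bracket L x y"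
    "x \<in> carrier L \<Longrightarrow> pmap (rlie_quot L N) (N +>\<^bsub>L\<^esub> x) = N +>\<^bsub>L\<^esub> pmap L x"
    "N +>\<^bsub>L\<^esub> \<zero>\<^bsub>L\<^esub> = N"
proof -
  note Ns = p_idealD(1)[OF N] and q = LL.lmod_quot_simps[OF p_idealD(1)[OF N]]
  have eq: "carrier (rlie_quot L N) = carrier (lmod_quot L N)" "set_add L = add (lmod_quot L N)"
    "smult (rlie_quot L N) = smult (lmod_quot L N)" by (simp_all add: rlie_quot_def lmod_quot_def)
  show "carrier (rlie_quot L N) = {N +>\<^bsub>L\<^esub> x | x. x \<in> carrier L}"
    "\<lbrakk>x \<in> carrier L; y \<in> carrier L\<rbrakk> \<Longrightarrow> (N +>\<^bsub>L\<^esub> x) <+>\<^bsub>L\<^esub> (N +>\<^bsub>L\<^esub> y) = N +>\<^bsub>L\<^esub> (x \<oplus>\<^bsub>L\<^esub> y)"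
    "\<lbrakk>c \<in> carrier F; x \<in> carrier L\<rbrakk> \<Longrightarrow> c \<odot>\<^bsub>rlie_quot L N\<^esub> (N +>\<^bsub>L\<^esub> x) = N +>\<^bsub>L\<^esub> (c \<odot>\<^bsub>L\<^esub> x)"
    unfolding eq using q by auto
  show "N +>\<^bsub>L\<^esub> \<zero>\<^bsub>L\<^esub> = N" using N.a_subset by simp
  have c: "y \<in> carrier L" if "y \<in> N" for y using that N.a_subset by blast
  have shift: "y = (y \<ominus>\<^bsub>L\<^esub> x) \<oplus>\<^bsub>L\<^esub> x" if "x \<in> carrier L" "y \<in> carrier L" for x y
    using that by (simp add: V.M.minus_eq V.M.a_assoc V.M.l_neg)
  show "bracket (rlie_quot L N) (N +>\<^bsub>L\<^esub> x) (N +>\<^bsub>L\<^esub> y) = N +>\<^bsub>L\<^esub> bracket L x y"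
    if xy: "x \<in> carrier L" "y \<in> carrier L"
  proof -
    have 1: "N +>\<^bsub>L\<^esub> bracket L x' y' = N +>\<^bsub>L\<^esub> bracket L x' y"
      if y': "x' \<in> carrier L" "y' \<in> carrier L" "y' \<ominus>\<^bsub>L\<^esub> y \<in> N" for x' y'
    proof -
      have "bracket L x' y' = bracket L x' (y' \<ominus>\<^bsub>L\<^esub> y) \<oplus>\<^bsub>L\<^esub> bracket L x' y"
        using shift[OF xy(2) y'(2)] bracket_add_r[of x' "y' \<ominus>\<^bsub>L\<^esub> y" y] y' xy by simp
      then have "bracket L x' y' \<ominus>\<^bsub>L\<^esub> bracket L x' y = bracket L x' (y' \<ominus>\<^bsub>L\<^esub> y)"
        by (intro V.M.minus_eqI) (use y' xy bracket_closed in auto)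
      then show ?thesis using N.coset_eq_iff p_idealD(2)[OF N y'(1,3)] y' xy bracket_closed by simp
    qed
    have 2: "N +>\<^bsub>L\<^esub> bracket L x' y = N +>\<^bsub>L\<^esub> bracket L x y"
      if x': "x' \<in> carrier L" "x' \<ominus>\<^bsub>L\<^esub> x \<in> N" for x'
    proof -
      have "bracket L x' y = bracket L (x' \<ominus>\<^bsub>L\<^esub> x) y \<oplus>\<^bsub>L\<^esub> bracket L x y"
        using shift[OF xy(1) x'(1)] bracket_add_l[of "x' \<ominus>\<^bsub>L\<^esub> x" x y] x' xy by simp
      then have "bracket L x' y \<ominus>\<^bsub>L\<^esub> bracket L x y = bracket L (x' \<ominus>\<^bsub>L\<^esub> x) y"
        by (intro V.M.minus_eqI) (use x' xy bracket_closed in auto)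
      then show ?thesis using N.coset_eq_iff p_ideal_bracket_left[OF N x'(2) xy(2)] x' xy bracket_closed by simp
    qed
    have "(\<Union>y'\<in>N +>\<^bsub>L\<^esub> y. N +>\<^bsub>L\<^esub> bracket L x' y') = N +>\<^bsub>L\<^esub> bracket L x' y" if "x' \<in> carrier L" for x'
      using that 1 by (intro N.UN_coset[OF xy(2), of "\<lambda>y'. N +>\<^bsub>L\<^esub> bracket L x' y'"])
    then have "(\<Union>x'\<in>N +>\<^bsub>L\<^esub> x. \<Union>y'\<in>N +>\<^bsub>L\<^esub> y. N +>\<^bsub>L\<^esub> bracket L x' y') =
        (\<Union>y'\<in>N +>\<^bsub>L\<^esub> y. N +>\<^bsub>L\<^esub> bracket L x y')"
      using 2 xy by (intro N.UN_coset) auto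
    also have "\<dots> = N +>\<^bsub>L\<^esub> bracket L x y"
      using 1 xy by (intro N.UN_coset[OF xy(2), of "\<lambda>y'. N +>\<^bsub>L\<^esub> bracket L x y'"])
    finally show ?thesis by (simp add: rlie_quot_def)
  qed
  show "pmap (rlie_quot L N) (N +>\<^bsub>L\<^esub> x) = N +>\<^bsub>L\<^esub> pmap L x" if x: "x \<in> carrier L"
  proof -
    have "N +>\<^bsub>L\<^esub> pmap L y = N +>\<^bsub>L\<^esub> pmap L x" if y: "y \<in> carrier L" "y \<ominus>\<^bsub>L\<^esub> x \<in> N" for y
      using pmap_mod_p_ideal[OF N y(2) x] shift[OF x y(1)] N.coset_eq_iff pmap_closed x y(1) by simp
    then show ?thesis using N.UN_coset[OF x, of "\<lambda>y. N +>\<^bsub>L\<^esub> pmap L y"] by (simp add: rlie_quot_def)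
  qed
qed

lemma rlie_quot_left_module: "left_module F (rlie_quot L N)"
  by (rule left_module_transfer[OF LL.lmod_quot_left_module(1)[OF p_idealD(1)[OF N]]])
    (simp_all add: rlie_quot_def lmod_quot_def)

lemma rlie_quot_restricted_data: "restricted_data p F (rlie_quot L N)"
proof -
  interpret Q: left_module F "rlie_quot L N" by (rule rlie_quot_left_module)
  show ?thesis
    by (intro restricted_data.intro restricted_data_axioms.intro F.field_axioms)
      (use p_pos in \<open>auto simp: rlie_quot_simps bracket_closed pmap_closed intro: V.M.a_closed\<close>)
qed

end

text \<open>
  The correspondence between \<open>p\<close>-ideals of \<open>L/I\<close> and \<open>p\<close>-ideals of \<open>L\<close> containing \<open>I\<close>.
\<close>

lemma chief_factor_minimal:
  assumes I: "p_ideal F L I" and J: "p_ideal F L J"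
    and min: "minimal_p_ideal F (rlie_quot L I) ((\<lambda>x. I +>\<^bsub>L\<^esub> x) ` J)"
    and K: "p_ideal F L K" "I \<subseteq> K" "K \<subseteq> J"
  shows "K = I \<or> K = J"
proof -
  interpret I: abelian_subgroup I L by (rule p_ideal_subgroup[OF I])
  interpret Q: left_module F "rlie_quot L I" by (rule rlie_quot_left_module[OF I])
  note q = rlie_quot_simps[OF I]
  have sub: "N \<subseteq> carrier L" if "p_ideal F L N" for N using submoduleD(1)[OF p_idealD(1)[OF that]] .
  have KL: "x \<in> carrier L" if "x \<in> K" for x using sub[OF K(1)] that by blast
  note KD = submoduleD[OF p_idealD(1)[OF K(1)]]
  let ?K = "(\<lambda>x. I +>\<^bsub>L\<^esub> x) ` K"
  have "p_ideal F (rlie_quot L I) ?K"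
    unfolding p_ideal_def
  proof (intro conjI ballI)
    show "submodule ?K F (rlie_quot L I)"
    proof (rule Q.lsubmoduleI)
      show "?K \<subseteq> carrier (rlie_quot L I)" using KL by (auto simp: q)
      show "\<zero>\<^bsub>rlie_quot L I\<^esub> \<in> ?K" using KD(2) q(6) by auto
      show "A \<oplus>\<^bsub>rlie_quot L I\<^esub> B \<in> ?K" if "A \<in> ?K" "B \<in> ?K" for A B
        using that KL KD(3) by (auto simp: q)
      show "c \<odot>\<^bsub>rlie_quot L I\<^esub> A \<in> ?K" if "c \<in> carrier F" "A \<in> ?K" for c A
        using that KL KD(4) by (auto simp: q)
    qed
    show "bracket (rlie_quot L I) A B \<in> ?K" if "A \<in> carrier (rlie_quot L I)" "B \<in> ?K" for A B
      using that KL p_idealD(2)[OF K(1)] by (auto simp: q)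
    show "pmap (rlie_quot L I) A \<in> ?K" if "A \<in> ?K" for A
      using that KL p_idealD(3)[OF K(1)] by (auto simp: q)
  qed
  moreover have "?K \<subseteq> (\<lambda>x. I +>\<^bsub>L\<^esub> x) ` J" using K(3) by blast
  ultimately have "?K = {I} \<or> ?K = (\<lambda>x. I +>\<^bsub>L\<^esub> x) ` J" using min by (simp add: minimal_p_ideal_def)
  then show ?thesis
  proof
    assume e: "?K = {I}"
    have "K \<subseteq> I"
    proof
      fix x assume x: "x \<in> K"
      then have "I +>\<^bsub>L\<^esub> x = I" using e by blast
      then show "x \<in> I" using V.M.a_coset_join1[OF _ KL[OF x] I.a_subgroup] by simp
    qed
    then show ?thesis using K(2) by blast
  next
    assume e: "?K = (\<lambda>x. I +>\<^bsub>L\<^esub> x) ` J"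
    have "J \<subseteq> K"
    proof
      fix y assume y: "y \<in> J"
      then obtain x where x: "x \<in> K" "I +>\<^bsub>L\<^esub> y = I +>\<^bsub>L\<^esub> x" using e by blast
      have yL: "y \<in> carrier L" using y sub[OF J] by blast
      have "y \<ominus>\<^bsub>L\<^esub> x \<in> K" using I.coset_eq_iff[OF yL KL[OF x(1)]] x(2) K(2) by blast
      then have "(y \<ominus>\<^bsub>L\<^esub> x) \<oplus>\<^bsub>L\<^esub> x \<in> K" using KD(3) x(1) by blast
      then show "y \<in> K" using yL KL[OF x(1)] by (simp add: V.M.minus_eq V.M.a_assoc V.M.l_neg)
    qed
    then show ?thesis using K(3) by blast
  qed
qed

end

section \<open>Passing to the quotient by the annihilator\<close>

context irreducible_rep begin

lemma Ann_p_ideal: "p_ideal F L (Ann L S)"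
proof -
  have z: "lact S \<zero>\<^bsub>L\<^esub> m = \<zero>\<^bsub>S\<^esub>" if "m \<in> carrier S" for m
    using Mod.lact_smult_l[of \<zero> "\<zero>\<^bsub>L\<^esub>" m] that Mod.lact_closed[of "\<zero>\<^bsub>L\<^esub>" m] by simp
  have "submodule (Ann L S) F L"
    by (rule LL.lsubmoduleI) (auto simp: Ann_def z Mod.lact_add_l Mod.lact_smult_l)
  moreover have "bracket L x y \<in> Ann L S" if "x \<in> carrier L" "y \<in> Ann L S" for x y
    using that Mod.lact_closed by (auto simp: Ann_def bracket_closed Mod.lact_bracket Mod.V.M.minus_eq
        Mod.V.M.r_neg intro: Mod.V.M.minus_eqI)
  moreover have "pmap L y \<in> Ann L S" if y: "y \<in> Ann L S" for y
  proof -
    have "(lact S y ^^ p) m = \<zero>\<^bsub>S\<^esub>" if "m \<in> carrier S" for m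
    proof -
      have "(lact S y ^^ Suc (p - 1)) m = lact S y ((lact S y ^^ (p - 1)) m)" by simp
      then show ?thesis using y that p_pos by (simp add: Ann_def del: funpow.simps)
    qed
    then show ?thesis using y by (auto simp: Ann_def pmap_closed Mod.lact_pmap)
  qed
  ultimately show ?thesis by (simp add: p_ideal_def)
qed

abbreviation "N \<equiv> Ann L S"
abbreviation "LN \<equiv> rlie_quot L N"

lemma N_sub: "N \<subseteq> carrier L"
  by (auto simp: Ann_def)

sublocale N: abelian_subgroup N L by (rule p_ideal_subgroup[OF Ann_p_ideal])

lemmas LN_simps = rlie_quot_simps[OF Ann_p_ideal]

lemma quot_act_simps [simp]:
  "carrier (quot_act S) = carrier S" "\<zero>\<^bsub>quot_act S\<^esub> = \<zero>\<^bsub>S\<^esub>" "add (quot_act S) = add S" "smult (quot_act S) = smult S"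
  by (simp_all add: quot_act_def)

lemma quot_act_minus [simp]: "a_minus (quot_act S) = a_minus S"
proof -
  have "a_inv (quot_act S) = a_inv S" by (simp add: a_inv_def m_inv_def fun_eq_iff)
  then show ?thesis by (simp add: a_minus_def fun_eq_iff)
qed

text \<open>
  The quotient acts on \<open>S\<close> through an arbitrarily chosen representative of each coset.
\<close>

lemma some_coset:
  assumes "x \<in> carrier L"
  shows "(SOME y. y \<in> N +>\<^bsub>L\<^esub> x) \<in> carrier L" "(SOME y. y \<in> N +>\<^bsub>L\<^esub> x) \<ominus>\<^bsub>L\<^esub> x \<in> N"
proof -
  have "(SOME y. y \<in> N +>\<^bsub>L\<^esub> x) \<in> N +>\<^bsub>L\<^esub> x" by (rule someI, rule N.a_rcos_self[OF assms])
  then show "(SOME y. y \<in> N +>\<^bsub>L\<^esub> x) \<in> carrier L" "(SOME y. y \<in> N +>\<^bsub>L\<^esub> x) \<ominus>\<^bsub>L\<^esub> x \<in> N"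
    using N.mem_coset_iff[OF assms] by auto
qed

lemma lact_eq_mod_Ann:
  assumes "x \<in> carrier L" "y \<in> carrier L" "y \<ominus>\<^bsub>L\<^esub> x \<in> N" "m \<in> carrier S"
  shows "lact S y m = lact S x m"
proof -
  have "lact S ((y \<ominus>\<^bsub>L\<^esub> x) \<oplus>\<^bsub>L\<^esub> x) m = lact S (y \<ominus>\<^bsub>L\<^esub> x) m \<oplus>\<^bsub>S\<^esub> lact S x m"
    using assms by (intro Mod.lact_add_l) auto
  moreover have "lact S (y \<ominus>\<^bsub>L\<^esub> x) m = \<zero>\<^bsub>S\<^esub>" using assms(3,4) unfolding Ann_def by blast
  ultimately show ?thesis using assms V.M.minus_plus[OF assms(1,2)] Mod.lact_closed[OF assms(1,4)] by simp
qed

lemma quot_act_lact: "x \<in> carrier L \<Longrightarrow> m \<in> carrier S \<Longrightarrow> lact (quot_act S) (N +>\<^bsub>L\<^esub> x) m = lact S x m"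
  unfolding quot_act_def using lact_eq_mod_Ann[OF _ some_coset] by simp

lemma quot_act_pow:
  "x \<in> carrier L \<Longrightarrow> m \<in> carrier S \<Longrightarrow> (lact (quot_act S) (N +>\<^bsub>L\<^esub> x) ^^ n) m = (lact S x ^^ n) m"
  by (induction n) (auto simp: quot_act_lact)

lemma quot_act_restricted: "restricted_module p F LN (quot_act S)"
proof -
  have ag: "abelian_group (quot_act S)"
    by (rule abelian_group_transfer[OF Mod.V.M.abelian_group_axioms]) simp_all
  have "module F (quot_act S)"
    by (intro moduleI F.is_cring ag)
      (simp_all add: Mod.V.smult_l_distr Mod.V.smult_r_distr Mod.V.smult_assoc1)
  then show ?thesis
    by (intro restricted_module.intro restricted_module_axioms.intro)
      (auto simp: LN_simps quot_act_lact Mod.lact_closed Mod.lact_add_l Mod.lact_add_r Mod.lact_smult_l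
        Mod.lact_smult_r bracket_closed pmap_closed Mod.lact_bracket Mod.lact_pmap quot_act_pow)
qed

lemma End_quot: "lie_module_hom F L S S \<subseteq> lie_module_hom F LN (quot_act S) (quot_act S)"
proof
  fix h assume h: "h \<in> lie_module_hom F L S S"
  note H = lie_module_homD[OF h]
  have "h \<in> lmod_hom F (quot_act S) (quot_act S)" using H(1,3,4) by (simp add: lmod_hom_def)
  then show "h \<in> lie_module_hom F LN (quot_act S) (quot_act S)"
    using H(2,5) by (auto simp: lie_module_hom_def LN_simps(1) quot_act_lact)
qed

abbreviation "pull \<equiv> \<lambda>\<delta>. \<lambda>x\<in>carrier L. \<delta> (N +>\<^bsub>L\<^esub> x)"

lemma pull_inner: "pull ` inner_der LN (quot_act S) = inner_der L S"
proof -
  have "pull (\<lambda>x\<in>carrier LN. lact (quot_act S) x m) = (\<lambda>x\<in>carrier L. lact S x m)" if "m \<in> carrier S" for m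
    using that by (auto simp: LN_simps(1) quot_act_lact intro!: restrict_ext)
  then show ?thesis unfolding inner_der_def image_image by (intro image_cong) auto
qed

text \<open>
  Inflation identifies the derivations of \<open>L/Ann\<^sub>L(S)\<close> with the derivations of \<open>L\<close> that are constant on the
  cosets of the annihilator.
\<close>

lemma pull_der: "pull ` res_der p F LN (quot_act S) = der_vanish N"
proof (intro equalityI subsetI)
  fix \<epsilon> assume "\<epsilon> \<in> pull ` res_der p F LN (quot_act S)"
  then obtain \<delta> where \<delta>: "\<delta> \<in> res_der p F LN (quot_act S)" "\<epsilon> = pull \<delta>" by blast
  note H = lmod_homD[OF res_derD(1)[OF \<delta>(1)]] and D = res_derD(2,3)[OF \<delta>(1)]
  have cl: "\<delta> (N +>\<^bsub>L\<^esub> x) \<in> carrier S" if "x \<in> carrier L" for x using H(2)[of "N +>\<^bsub>L\<^esub> x"] that by (auto simp: LN_simps)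
  have ad: "\<delta> (N +>\<^bsub>L\<^esub> (x \<oplus>\<^bsub>L\<^esub> y)) = \<delta> (N +>\<^bsub>L\<^esub> x) \<oplus>\<^bsub>S\<^esub> \<delta> (N +>\<^bsub>L\<^esub> y)" if "x \<in> carrier L" "y \<in> carrier L" for x y
    using H(3)[of "N +>\<^bsub>L\<^esub> x" "N +>\<^bsub>L\<^esub> y"] that by (auto simp: LN_simps)
  have "pull \<delta> \<in> res_der p F L S"
  proof (rule res_derI)
    fix x y assume xy: "x \<in> carrier L" "y \<in> carrier L"
    show "\<delta> (N +>\<^bsub>L\<^esub> bracket L x y) = lact S x (\<delta> (N +>\<^bsub>L\<^esub> y)) \<ominus>\<^bsub>S\<^esub> lact S y (\<delta> (N +>\<^bsub>L\<^esub> x))"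
      using D(1)[of "N +>\<^bsub>L\<^esub> x" "N +>\<^bsub>L\<^esub> y"] xy cl by (auto simp: LN_simps quot_act_lact)
  next
    fix c x assume "c \<in> carrier F" "x \<in> carrier L"
    then show "\<delta> (N +>\<^bsub>L\<^esub> (c \<odot>\<^bsub>L\<^esub> x)) = c \<odot>\<^bsub>S\<^esub> \<delta> (N +>\<^bsub>L\<^esub> x)"
      using H(4)[of c "N +>\<^bsub>L\<^esub> x"] by (auto simp: LN_simps)
  next
    fix x assume "x \<in> carrier L"
    then show "\<delta> (N +>\<^bsub>L\<^esub> pmap L x) = (lact S x ^^ (p - 1)) (\<delta> (N +>\<^bsub>L\<^esub> x))"
      using D(2)[of "N +>\<^bsub>L\<^esub> x"] cl by (auto simp: LN_simps quot_act_pow)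
  qed (use cl ad in auto)
  moreover have "\<delta> (N +>\<^bsub>L\<^esub> x) = \<zero>\<^bsub>S\<^esub>" if "x \<in> N" for x
  proof -
    have "N +>\<^bsub>L\<^esub> x = N +>\<^bsub>L\<^esub> \<zero>\<^bsub>L\<^esub>" using that N_sub V.M.a_coset_join2[OF _ N.a_subgroup that] by auto
    moreover have "\<delta> (N +>\<^bsub>L\<^esub> \<zero>\<^bsub>L\<^esub>) = \<zero>\<^bsub>S\<^esub>"
      by (rule additive_zero[OF V.M.abelian_group_axioms Mod.V.M.abelian_group_axioms, of "\<lambda>x. \<delta> (N +>\<^bsub>L\<^esub> x)"])
        (use cl ad in auto)
    ultimately show ?thesis by simp
  qed
  ultimately show "\<epsilon> \<in> der_vanish N" using N_sub by (auto simp: der_vanish_def \<delta>(2))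
next
  fix \<delta> assume "\<delta> \<in> der_vanish N"
  then have \<delta>: "\<delta> \<in> res_der p F L S" and van: "\<And>x. x \<in> N \<Longrightarrow> \<delta> x = \<zero>\<^bsub>S\<^esub>" by (auto simp: der_vanish_def)
  note D = derD[OF \<delta>]
  define \<epsilon> where "\<epsilon> = (\<lambda>A\<in>carrier LN. \<delta> (SOME x. x \<in> A))"
  have \<epsilon>: "\<epsilon> (N +>\<^bsub>L\<^esub> x) = \<delta> x" if x: "x \<in> carrier L" for x
  proof -
    let ?y = "SOME y. y \<in> N +>\<^bsub>L\<^esub> x"
    have y: "?y \<in> carrier L" "?y \<ominus>\<^bsub>L\<^esub> x \<in> N" using some_coset[OF x] by auto
    have "\<delta> ((?y \<ominus>\<^bsub>L\<^esub> x) \<oplus>\<^bsub>L\<^esub> x) = \<delta> (?y \<ominus>\<^bsub>L\<^esub> x) \<oplus>\<^bsub>S\<^esub> \<delta> x" by (rule D(2)) (use x y in auto)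
    then have "\<delta> ?y = \<delta> x" using V.M.minus_plus[OF x y(1)] van[OF y(2)] D(1)[OF x] by simp
    then show ?thesis using x by (auto simp: \<epsilon>_def LN_simps(1))
  qed
  have "\<epsilon> \<in> res_der p F LN (quot_act S)"
    unfolding res_der_def lmod_hom_def
  proof (intro CollectI conjI ballI)
    show "\<epsilon> \<in> carrier LN \<rightarrow>\<^sub>E carrier (quot_act S)"
    proof (rule PiE_I)
      fix A assume "A \<in> carrier LN"
      then show "\<epsilon> A \<in> carrier (quot_act S)" using \<epsilon> D(1) by (auto simp: LN_simps(1))
    qed (simp add: \<epsilon>_def)
  qed (auto simp: LN_simps \<epsilon> D(1-5) bracket_closed pmap_closed quot_act_lact quot_act_pow)
  moreover have "pull \<epsilon> = \<delta>" by (rule extfun_eqI[OF _ D(6)]) (use \<epsilon> D(1) in auto)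
  ultimately show "\<delta> \<in> pull ` res_der p F LN (quot_act S)" by blast
qed

end

section \<open>Strongly abelian and split factors\<close>

context modular_lie_algebra begin

lemma p_ideal_carrier: "p_ideal F L N \<Longrightarrow> x \<in> N \<Longrightarrow> x \<in> carrier L"
  using submoduleD(1)[OF p_idealD(1)] by blast

lemma coset_eq_p_ideal_iff:
  assumes "p_ideal F L N" "x \<in> carrier L" shows "N +>\<^bsub>L\<^esub> x = N \<longleftrightarrow> x \<in> N"
proof -
  interpret N: abelian_subgroup N L by (rule p_ideal_subgroup[OF assms(1)])
  show ?thesis
    using V.M.a_coset_join1[OF _ assms(2) N.a_subgroup] V.M.a_coset_join2[OF assms(2) N.a_subgroup] by blast
qed

context
  fixes I J assumes I: "p_ideal F L I" and J: "p_ideal F L J" and IJ: "I \<subseteq> J"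
begin

lemmas JL = p_ideal_carrier[OF J] and IL = p_ideal_carrier[OF I] and coset_zero_iff = coset_eq_p_ideal_iff[OF I]

interpretation I: abelian_subgroup I L by (rule p_ideal_subgroup[OF I])
interpretation J: abelian_subgroup J L by (rule p_ideal_subgroup[OF J])

lemma strongly_abelian_iff:
  "strongly_abelian_factor L I J \<longleftrightarrow> (\<forall>y\<in>J. \<forall>z\<in>J. bracket L y z \<in> I) \<and> (\<forall>y\<in>J. pmap L y \<in> I)"
  unfolding strongly_abelian_factor_def
  by (simp add: JL rlie_quot_simps[OF I] coset_zero_iff bracket_closed pmap_closed)

text \<open>
  A section of \<open>L/I \<longrightarrow> L/J\<close> is recorded by the preimage \<open>C\<close> in \<open>L\<close> of its image.
\<close>

lemma factor_splits_iff:
  "factor_splits F L I J \<longleftrightarrow>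
    (\<exists>C. submodule C F L \<and> (\<forall>x\<in>C. \<forall>y\<in>C. bracket L x y \<in> C) \<and> (\<forall>x\<in>C. pmap L x \<in> C) \<and>
      C \<inter> J = I \<and> (\<forall>x\<in>carrier L. \<exists>y\<in>J. \<exists>k\<in>C. x = y \<oplus>\<^bsub>L\<^esub> k))" (is "_ \<longleftrightarrow> ?R")
proof
  note qI = rlie_quot_simps[OF I] and qJ = rlie_quot_simps[OF J]
  have JI: "J <+>\<^bsub>L\<^esub> (I +>\<^bsub>L\<^esub> k) = J +>\<^bsub>L\<^esub> k" if k: "k \<in> carrier L" for k
  proof -
    have "J <+>\<^bsub>L\<^esub> I = J"
    proof
      show "J <+>\<^bsub>L\<^esub> I \<subseteq> J" using IJ submoduleD(3)[OF p_idealD(1)[OF J]] by (auto simp: set_add_def')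
      show "J \<subseteq> J <+>\<^bsub>L\<^esub> I"
      proof
        fix y assume y: "y \<in> J"
        then have "y = y \<oplus>\<^bsub>L\<^esub> \<zero>\<^bsub>L\<^esub>" using JL by simp
        then show "y \<in> J <+>\<^bsub>L\<^esub> I"
          using y submoduleD(2)[OF p_idealD(1)[OF I]] unfolding set_add_def' by blast
      qed
    qed
    then show ?thesis using V.M.a_setmult_rcos_assoc[OF J.a_subset I.a_subset k] by simp
  qed
  {
    assume "factor_splits F L I J"
    then obtain \<sigma> where \<sigma>: "\<sigma> \<in> restricted_lie_hom F (rlie_quot L J) (rlie_quot L I)"
      and sec: "\<And>Y. Y \<in> carrier (rlie_quot L J) \<Longrightarrow> J <+>\<^bsub>L\<^esub> \<sigma> Y = Y"
      by (auto simp: factor_splits_def)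
    have \<sigma>h: "\<sigma> \<in> lmod_hom F (rlie_quot L J) (rlie_quot L I)"
      and \<sigma>b: "\<And>x y. \<lbrakk>x \<in> carrier L; y \<in> carrier L\<rbrakk> \<Longrightarrow>
        \<sigma> (J +>\<^bsub>L\<^esub> bracket L x y) = bracket (rlie_quot L I) (\<sigma> (J +>\<^bsub>L\<^esub> x)) (\<sigma> (J +>\<^bsub>L\<^esub> y))"
      and \<sigma>p: "\<And>x. x \<in> carrier L \<Longrightarrow> \<sigma> (J +>\<^bsub>L\<^esub> pmap L x) = pmap (rlie_quot L I) (\<sigma> (J +>\<^bsub>L\<^esub> x))"
    proof -
      have \<sigma>': "\<sigma> \<in> lmod_hom F (rlie_quot L J) (rlie_quot L I)"
        "\<forall>A\<in>carrier (rlie_quot L J). \<forall>B\<in>carrier (rlie_quot L J).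
          \<sigma> (bracket (rlie_quot L J) A B) = bracket (rlie_quot L I) (\<sigma> A) (\<sigma> B)"
        "\<forall>A\<in>carrier (rlie_quot L J). \<sigma> (pmap (rlie_quot L J) A) = pmap (rlie_quot L I) (\<sigma> A)"
        using \<sigma> by (auto simp: restricted_lie_hom_def)
      have c: "J +>\<^bsub>L\<^esub> x \<in> carrier (rlie_quot L J)" if "x \<in> carrier L" for x using that by (auto simp: qJ(1))
      show "\<sigma> \<in> lmod_hom F (rlie_quot L J) (rlie_quot L I)" by fact
      show "\<sigma> (J +>\<^bsub>L\<^esub> bracket L x y) = bracket (rlie_quot L I) (\<sigma> (J +>\<^bsub>L\<^esub> x)) (\<sigma> (J +>\<^bsub>L\<^esub> y))"
        if "x \<in> carrier L" "y \<in> carrier L" for x y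
        using bspec[OF bspec[OF \<sigma>'(2) c[OF that(1)]] c[OF that(2)]] qJ(4)[OF that] by simp
      show "\<sigma> (J +>\<^bsub>L\<^esub> pmap L x) = pmap (rlie_quot L I) (\<sigma> (J +>\<^bsub>L\<^esub> x))" if "x \<in> carrier L" for x
        using bspec[OF \<sigma>'(3) c[OF that]] qJ(5)[OF that] by simp
    qed
    note H = lmod_homD[OF \<sigma>h]
    have \<sigma>0: "\<sigma> J = I"
      using lmod_hom_zero[OF rlie_quot_left_module[OF J] rlie_quot_left_module[OF I] \<sigma>h] by simp
    define C where "C = {k \<in> carrier L. \<sigma> (J +>\<^bsub>L\<^esub> k) = I +>\<^bsub>L\<^esub> k}"
    have "submodule C F L"
    proof (rule LL.lsubmoduleI)
      show "C \<subseteq> carrier L" by (auto simp: C_def)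
      show "\<zero>\<^bsub>L\<^esub> \<in> C" using \<sigma>0 by (simp add: C_def qJ(6) qI(6))
      show "x \<oplus>\<^bsub>L\<^esub> y \<in> C" if "x \<in> C" "y \<in> C" for x y
        using that H(3)[of "J +>\<^bsub>L\<^esub> x" "J +>\<^bsub>L\<^esub> y"] by (auto simp: C_def qI qJ)
      show "c \<odot>\<^bsub>L\<^esub> x \<in> C" if "c \<in> carrier F" "x \<in> C" for c x
        using that H(4)[of c "J +>\<^bsub>L\<^esub> x"] by (auto simp: C_def qI qJ)
    qed
    moreover have "bracket L x y \<in> C" if "x \<in> C" "y \<in> C" for x y
      using that \<sigma>b[of x y] by (auto simp: C_def qI bracket_closed)
    moreover have "pmap L x \<in> C" if "x \<in> C" for x
      using that \<sigma>p[of x] by (auto simp: C_def qI pmap_closed)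
    moreover have "C \<inter> J = I"
    proof (intro equalityI subsetI)
      fix k assume k: "k \<in> C \<inter> J"
      then have "J +>\<^bsub>L\<^esub> k = J" using V.M.a_coset_join2[OF _ J.a_subgroup] JL by blast
      then have "I +>\<^bsub>L\<^esub> k = I" using k \<sigma>0 by (auto simp: C_def)
      then show "k \<in> I" using coset_zero_iff k by (auto simp: C_def)
    next
      fix k assume k: "k \<in> I"
      then have "J +>\<^bsub>L\<^esub> k = J" using V.M.a_coset_join2[OF _ J.a_subgroup] IJ IL by blast
      moreover have "I +>\<^bsub>L\<^esub> k = I" using coset_zero_iff[OF IL[OF k]] k by simp
      ultimately have "k \<in> C" using IL[OF k] \<sigma>0 by (simp add: C_def)
      then show "k \<in> C \<inter> J" using k IJ by blast
    qed
    moreover have "\<exists>y\<in>J. \<exists>k\<in>C. x = y \<oplus>\<^bsub>L\<^esub> k" if x: "x \<in> carrier L" for x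
    proof -
      have Jx: "J +>\<^bsub>L\<^esub> x \<in> carrier (rlie_quot L J)" using x by (auto simp: qJ)
      then obtain k where k: "k \<in> carrier L" "\<sigma> (J +>\<^bsub>L\<^esub> x) = I +>\<^bsub>L\<^esub> k" using H(2) by (auto simp: qI(1))
      have eq: "J +>\<^bsub>L\<^esub> x = J +>\<^bsub>L\<^esub> k" using sec[OF Jx] k JI by simp
      then have "x \<ominus>\<^bsub>L\<^esub> k \<in> J" using J.coset_eq_iff x k(1) by simp
      moreover have "k \<in> C" using k eq by (simp add: C_def)
      ultimately show ?thesis using V.M.minus_plus[OF k(1) x] by metis
    qed
    ultimately show ?R by blast
  next
    assume ?R
    then obtain C where C: "submodule C F L" "\<And>x y. x \<in> C \<Longrightarrow> y \<in> C \<Longrightarrow> bracket L x y \<in> C"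
      "\<And>x. x \<in> C \<Longrightarrow> pmap L x \<in> C" "C \<inter> J = I" "\<And>x. x \<in> carrier L \<Longrightarrow> \<exists>y\<in>J. \<exists>k\<in>C. x = y \<oplus>\<^bsub>L\<^esub> k" by blast
    note CD = submoduleD[OF C(1)]
    have CL: "k \<in> carrier L" if "k \<in> C" for k using CD(1) that by blast
    define \<sigma> where "\<sigma> = (\<lambda>Y\<in>carrier (rlie_quot L J). I +>\<^bsub>L\<^esub> (SOME k. k \<in> Y \<and> k \<in> C))"
    have \<sigma>: "\<sigma> (J +>\<^bsub>L\<^esub> k) = I +>\<^bsub>L\<^esub> k" if k: "k \<in> C" for k
    proof -
      define k' where "k' = (SOME k'. k' \<in> J +>\<^bsub>L\<^esub> k \<and> k' \<in> C)"
      have "k' \<in> J +>\<^bsub>L\<^esub> k \<and> k' \<in> C" unfolding k'_def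
        by (rule someI[of _ k]) (use k J.a_rcos_self[OF CL[OF k]] in blast)
      then have "k' \<ominus>\<^bsub>L\<^esub> k \<in> J" "k' \<in> C" using J.mem_coset_iff[OF CL[OF k]] by auto
      then have "k' \<ominus>\<^bsub>L\<^esub> k \<in> I" using C(4) CD(6)[of k' k] k by blast
      then have "I +>\<^bsub>L\<^esub> k' = I +>\<^bsub>L\<^esub> k" using I.coset_eq_iff CL k \<open>k' \<in> C\<close> by blast
      moreover have "J +>\<^bsub>L\<^esub> k \<in> carrier (rlie_quot L J)" using CL[OF k] by (auto simp: qJ)
      ultimately show ?thesis by (simp add: \<sigma>_def k'_def)
    qed
    have rep: "\<exists>k. k \<in> C \<and> Y = J +>\<^bsub>L\<^esub> k" if Y: "Y \<in> carrier (rlie_quot L J)" for Y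
    proof -
      obtain x where x: "x \<in> carrier L" "Y = J +>\<^bsub>L\<^esub> x" using Y by (auto simp: qJ)
      obtain y k where yk: "y \<in> J" "k \<in> C" "x = y \<oplus>\<^bsub>L\<^esub> k" using C(5)[OF x(1)] by blast
      have "x \<ominus>\<^bsub>L\<^esub> k = y" by (rule V.M.minus_eqI) (use yk JL CL in auto)
      then have "Y = J +>\<^bsub>L\<^esub> k" using J.coset_eq_iff[OF x(1) CL[OF yk(2)]] yk(1) x(2) by simp
      then show ?thesis using yk by blast
    qed
    have "\<sigma> \<in> restricted_lie_hom F (rlie_quot L J) (rlie_quot L I)"
      unfolding restricted_lie_hom_def lmod_hom_def
    proof (intro CollectI conjI ballI)
      show "\<sigma> \<in> carrier (rlie_quot L J) \<rightarrow>\<^sub>E carrier (rlie_quot L I)"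
      proof (rule PiE_I)
        fix Y assume "Y \<in> carrier (rlie_quot L J)"
        then obtain k where "k \<in> C" "Y = J +>\<^bsub>L\<^esub> k" using rep by blast
        then show "\<sigma> Y \<in> carrier (rlie_quot L I)" using \<sigma> CL by (auto simp: qI)
      qed (simp add: \<sigma>_def)
    next
      fix Y Y' assume "Y \<in> carrier (rlie_quot L J)" "Y' \<in> carrier (rlie_quot L J)"
      then obtain k k' where k: "k \<in> C" "Y = J +>\<^bsub>L\<^esub> k" "k' \<in> C" "Y' = J +>\<^bsub>L\<^esub> k'" using rep by metis
      then show "\<sigma> (Y \<oplus>\<^bsub>rlie_quot L J\<^esub> Y') = \<sigma> Y \<oplus>\<^bsub>rlie_quot L I\<^esub> \<sigma> Y'"
        using \<sigma>[OF CD(3)[OF k(1,3)]] \<sigma> CL by (simp add: qI qJ)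
      show "\<sigma> (bracket (rlie_quot L J) Y Y') = bracket (rlie_quot L I) (\<sigma> Y) (\<sigma> Y')"
        using k \<sigma>[OF C(2)[OF k(1,3)]] \<sigma> CL by (simp add: qI qJ)
    next
      fix c Y assume *: "c \<in> carrier F" "Y \<in> carrier (rlie_quot L J)"
      then obtain k where k: "k \<in> C" "Y = J +>\<^bsub>L\<^esub> k" using rep by metis
      then show "\<sigma> (c \<odot>\<^bsub>rlie_quot L J\<^esub> Y) = c \<odot>\<^bsub>rlie_quot L I\<^esub> \<sigma> Y"
        using * \<sigma>[OF CD(4)[OF *(1) k(1)]] \<sigma> CL by (simp add: qI qJ)
    next
      fix Y assume "Y \<in> carrier (rlie_quot L J)"
      then obtain k where k: "k \<in> C" "Y = J +>\<^bsub>L\<^esub> k" using rep by metis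
      then show "\<sigma> (pmap (rlie_quot L J) Y) = pmap (rlie_quot L I) (\<sigma> Y)"
        using \<sigma>[OF C(3)[OF k(1)]] \<sigma> CL by (simp add: qI qJ)
    qed
    moreover have "J <+>\<^bsub>L\<^esub> \<sigma> Y = Y" if Y: "Y \<in> carrier (rlie_quot L J)" for Y
      using rep[OF Y] \<sigma> JI CL by metis
    ultimately show "factor_splits F L I J" by (auto simp: factor_splits_def)
  }
qed

lemma ad_coeff_strongly_abelian:
  assumes ab: "\<And>y z. y \<in> J \<Longrightarrow> z \<in> J \<Longrightarrow> bracket L y z \<in> I" and y: "y \<in> J" and k: "k \<in> carrier L"
  shows "ad_coeff L y k m (Suc j) \<in> I"
proof (induction m arbitrary: j)
  case 0
  then show ?case using submoduleD(2)[OF p_idealD(1)[OF I]] by simp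
next
  case (Suc m)
  then show ?case
    using ab[OF y ad_coeff_p_ideal[OF J y k]] p_idealD(2)[OF I k] submoduleD(3)[OF p_idealD(1)[OF I]] by simp
qed

lemma ad_coeff_zero: "ad_coeff L y k m 0 = (bracket L k ^^ m) y"
  by (induction m) auto

text \<open>
  In \<open>(ad (t y + k))\<^sup>p\<^sup>-\<^sup>1 (y)\<close> every coefficient of a positive power of \<open>t\<close> involves a bracket of two elements
  of \<open>J\<close>, so modulo \<open>I\<close> only \<open>s\<^sub>1(y, k) = (ad k)\<^sup>p\<^sup>-\<^sup>1 (y)\<close> remains.
\<close>

lemma jacobson_sum_strongly_abelian:
  assumes ab: "\<And>y z. y \<in> J \<Longrightarrow> z \<in> J \<Longrightarrow> bracket L y z \<in> I" and y: "y \<in> J" and k: "k \<in> carrier L"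
  shows "\<exists>r\<in>I. (\<Oplus>\<^bsub>L\<^esub>i\<in>{1..p - 1}. jacobson_s p F L i y k) = (bracket L k ^^ (p - 1)) y \<oplus>\<^bsub>L\<^esub> r"
proof -
  let ?s = "\<lambda>i. jacobson_s p F L i y k"
  have sL: "?s i \<in> carrier L" if "i \<in> {1..p - 1}" for i
    using jacobson_p_ideal[OF J y k that] JL by blast
  have sI: "?s i \<in> I" if "i \<in> {2..p - 1}" for i
  proof -
    have "i - 1 = Suc (i - 2)" using that by auto
    then have "ad_coeff L y k (p - 1) (i - 1) \<in> I" using ad_coeff_strongly_abelian[OF assms] by metis
    moreover have "i \<in> {1..p - 1}" using that by auto
    ultimately show ?thesis
      unfolding jacobson_s_def using submoduleD(4)[OF p_idealD(1)[OF I] jacobson_scalar_closed] by blast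
  qed
  have "{1..p - 1} = insert 1 {2..p - 1}" using p_ge_2 by auto
  then have "(\<Oplus>\<^bsub>L\<^esub>i\<in>{1..p - 1}. ?s i) = ?s 1 \<oplus>\<^bsub>L\<^esub> (\<Oplus>\<^bsub>L\<^esub>i\<in>{2..p - 1}. ?s i)"
    using V.M.finsum_insert[of "{2..p - 1}" 1 ?s] sL by (auto simp: Pi_def)
  moreover have "(\<Oplus>\<^bsub>L\<^esub>i\<in>{2..p - 1}. ?s i) \<in> I"
    by (rule LL.finsum_in_submodule[OF p_idealD(1)[OF I]]) (use sI in auto)
  moreover have "?s 1 = (bracket L k ^^ (p - 1)) y"
  proof -
    have "ad_coeff L y k (p - 1) 0 \<in> carrier L" using ad_coeff_p_ideal[OF J y k] JL by blast
    moreover have "inv (add_pow F (1::nat) \<one>) = \<one>" by simp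
    ultimately show ?thesis unfolding jacobson_s_def by (simp add: ad_coeff_zero)
  qed
  ultimately show ?thesis by auto
qed

end

end

section \<open>Derivations along a chief factor\<close>

context irreducible_rep begin

abbreviation "W K \<equiv> der_vanish (K \<inter> N)"

text \<open>An isomorphism \<open>J/I \<cong> S\<close>, kept as a map on \<open>J\<close> so that no coset representatives are involved.\<close>

definition factor_map :: "'a set \<Rightarrow> 'a set \<Rightarrow> ('a \<Rightarrow> 's) \<Rightarrow> bool"
  where "factor_map I J \<phi> \<longleftrightarrow>
    (\<forall>y\<in>J. \<phi> y \<in> carrier S) \<and> (\<forall>y\<in>J. \<forall>z\<in>J. \<phi> (y \<oplus>\<^bsub>L\<^esub> z) = \<phi> y \<oplus>\<^bsub>S\<^esub> \<phi> z) \<and>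
    (\<forall>c\<in>carrier F. \<forall>y\<in>J. \<phi> (c \<odot>\<^bsub>L\<^esub> y) = c \<odot>\<^bsub>S\<^esub> \<phi> y) \<and>
    (\<forall>x\<in>carrier L. \<forall>y\<in>J. \<phi> (bracket L x y) = lact S x (\<phi> y)) \<and>
    (\<forall>y\<in>J. \<phi> y = \<zero>\<^bsub>S\<^esub> \<longleftrightarrow> y \<in> I) \<and> \<phi> ` J = carrier S"

lemma factor_mapD:
  assumes "factor_map I J \<phi>"
  shows "\<And>y. y \<in> J \<Longrightarrow> \<phi> y \<in> carrier S" "\<And>y z. y \<in> J \<Longrightarrow> z \<in> J \<Longrightarrow> \<phi> (y \<oplus>\<^bsub>L\<^esub> z) = \<phi> y \<oplus>\<^bsub>S\<^esub> \<phi> z"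
    "\<And>c y. c \<in> carrier F \<Longrightarrow> y \<in> J \<Longrightarrow> \<phi> (c \<odot>\<^bsub>L\<^esub> y) = c \<odot>\<^bsub>S\<^esub> \<phi> y"
    "\<And>x y. x \<in> carrier L \<Longrightarrow> y \<in> J \<Longrightarrow> \<phi> (bracket L x y) = lact S x (\<phi> y)"
    "\<And>y. y \<in> J \<Longrightarrow> \<phi> y = \<zero>\<^bsub>S\<^esub> \<longleftrightarrow> y \<in> I" "\<phi> ` J = carrier S"
  using assms unfolding factor_map_def by blast+

context
  fixes I J assumes I: "p_ideal F L I" and J: "p_ideal F L J" and IJ: "I \<subseteq> J"
begin

interpretation I: abelian_subgroup I L by (rule p_ideal_subgroup[OF I])
interpretation J: abelian_subgroup J L by (rule p_ideal_subgroup[OF J])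

lemma module_iso_factor_map:
  "lie_module_iso F L (factor_module L I J) S \<longleftrightarrow> (\<exists>\<phi>. factor_map I J \<phi>)"
proof
  note qI = rlie_quot_simps[OF I] and JL = p_ideal_carrier[OF J] and z = coset_eq_p_ideal_iff[OF I]
  note JD = submoduleD[OF p_idealD(1)[OF J]]
  let ?M = "factor_module L I J"
  have M: "carrier ?M = (\<lambda>x. I +>\<^bsub>L\<^esub> x) ` J" by (simp add: factor_module_def)
  have MI: "I +>\<^bsub>L\<^esub> y \<in> carrier ?M" if "y \<in> J" for y using that by (simp add: M)
  have Mops: "(I +>\<^bsub>L\<^esub> y) \<oplus>\<^bsub>?M\<^esub> (I +>\<^bsub>L\<^esub> z) = I +>\<^bsub>L\<^esub> (y \<oplus>\<^bsub>L\<^esub> z)"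
    "c \<in> carrier F \<Longrightarrow> c \<odot>\<^bsub>?M\<^esub> (I +>\<^bsub>L\<^esub> y) = I +>\<^bsub>L\<^esub> (c \<odot>\<^bsub>L\<^esub> y)"
    "x \<in> carrier L \<Longrightarrow> lact ?M x (I +>\<^bsub>L\<^esub> y) = I +>\<^bsub>L\<^esub> bracket L x y"
    if "y \<in> J" "z \<in> J" for x y z c
    using that JL by (simp_all add: factor_module_def qI)
  {
    assume "lie_module_iso F L ?M S"
    then obtain f where f: "f \<in> lie_module_hom F L ?M S" "bij_betw f (carrier ?M) (carrier S)"
      by (auto simp: lie_module_iso_def)
    note H = lie_module_homD[OF f(1)]
    let ?\<phi> = "\<lambda>y. f (I +>\<^bsub>L\<^esub> y)"
    have add: "?\<phi> (y \<oplus>\<^bsub>L\<^esub> z) = ?\<phi> y \<oplus>\<^bsub>S\<^esub> ?\<phi> z" if "y \<in> J" "z \<in> J" for y z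
      using H(3)[OF MI MI, of y z] Mops(1) that by simp
    have c: "?\<phi> y \<in> carrier S" if "y \<in> J" for y using H(2)[OF MI[OF that]] .
    have zero: "?\<phi> \<zero>\<^bsub>L\<^esub> = \<zero>\<^bsub>S\<^esub>"
      using add[OF JD(2) JD(2)] c[OF JD(2)] by simp
    have "factor_map I J ?\<phi>"
      unfolding factor_map_def
    proof (intro conjI ballI)
      fix y assume y: "y \<in> J"
      show "?\<phi> y = \<zero>\<^bsub>S\<^esub> \<longleftrightarrow> y \<in> I"
      proof
        assume "?\<phi> y = \<zero>\<^bsub>S\<^esub>"
        then have "I +>\<^bsub>L\<^esub> y = I +>\<^bsub>L\<^esub> \<zero>\<^bsub>L\<^esub>"
          using inj_onD[OF bij_betw_imp_inj_on[OF f(2)] _ MI[OF y] MI[OF JD(2)]] zero by simp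
        then show "y \<in> I" using z[OF JL[OF y]] qI(6) by simp
      next
        assume "y \<in> I"
        then have "I +>\<^bsub>L\<^esub> y = I +>\<^bsub>L\<^esub> \<zero>\<^bsub>L\<^esub>" using z[OF JL[OF y]] qI(6) by simp
        then show "?\<phi> y = \<zero>\<^bsub>S\<^esub>" using zero by simp
      qed
    next
      show "?\<phi> ` J = carrier S" using bij_betw_imp_surj_on[OF f(2)] unfolding M image_image .
    next
      show "?\<phi> (c \<odot>\<^bsub>L\<^esub> y) = c \<odot>\<^bsub>S\<^esub> ?\<phi> y" if "c \<in> carrier F" "y \<in> J" for c y
        using H(4)[OF that(1) MI[OF that(2)]] Mops(2)[OF that(2,2,1)] by simp
      show "?\<phi> (bracket L x y) = lact S x (?\<phi> y)" if "x \<in> carrier L" "y \<in> J" for x y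
        using H(5)[OF that(1) MI[OF that(2)]] Mops(3)[OF that(2,2,1)] by simp
    qed (use c add in auto)
    then show "\<exists>\<phi>. factor_map I J \<phi>" by blast
  next
    assume "\<exists>\<phi>. factor_map I J \<phi>"
    then obtain \<phi> where \<phi>: "factor_map I J \<phi>" by blast
    note H = factor_mapD[OF \<phi>]
    have eqI: "\<phi> y = \<phi> x" if "x \<in> J" "y \<in> J" "y \<ominus>\<^bsub>L\<^esub> x \<in> I" for x y
    proof -
      have "\<phi> ((y \<ominus>\<^bsub>L\<^esub> x) \<oplus>\<^bsub>L\<^esub> x) = \<phi> (y \<ominus>\<^bsub>L\<^esub> x) \<oplus>\<^bsub>S\<^esub> \<phi> x" by (rule H(2)) (use that IJ in auto)
      moreover have "\<phi> (y \<ominus>\<^bsub>L\<^esub> x) = \<zero>\<^bsub>S\<^esub>" using H(5) that IJ by blast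
      ultimately show ?thesis using V.M.minus_plus[OF JL JL, of x y] that H(1) by simp
    qed
    define f where "f = (\<lambda>A\<in>carrier ?M. \<phi> (SOME y. y \<in> A))"
    have f: "f (I +>\<^bsub>L\<^esub> y) = \<phi> y" if y: "y \<in> J" for y
    proof -
      let ?x = "SOME x. x \<in> I +>\<^bsub>L\<^esub> y"
      have "?x \<in> I +>\<^bsub>L\<^esub> y" by (rule someI, rule I.a_rcos_self[OF JL[OF y]])
      then have x: "?x \<in> carrier L" "?x \<ominus>\<^bsub>L\<^esub> y \<in> I" using I.mem_coset_iff[OF JL[OF y]] by auto
      then have "?x \<in> J" using V.M.minus_plus[OF JL[OF y] x(1)] JD(3)[of "?x \<ominus>\<^bsub>L\<^esub> y" y] y IJ by auto
      then show ?thesis using eqI[OF y _ x(2)] MI[OF y] by (simp add: f_def)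
    qed
    have "f \<in> lie_module_hom F L ?M S"
      unfolding lie_module_hom_def lmod_hom_def
    proof (intro CollectI conjI ballI)
      show "f \<in> carrier ?M \<rightarrow>\<^sub>E carrier S"
      proof (rule PiE_I)
        show "f A \<in> carrier S" if "A \<in> carrier ?M" for A using that f H(1) by (auto simp: M)
      qed (simp add: f_def)
    next
      fix A B assume "A \<in> carrier ?M" "B \<in> carrier ?M"
      then obtain y z where yz: "y \<in> J" "z \<in> J" "A = I +>\<^bsub>L\<^esub> y" "B = I +>\<^bsub>L\<^esub> z" by (auto simp: M)
      then show "f (A \<oplus>\<^bsub>?M\<^esub> B) = f A \<oplus>\<^bsub>S\<^esub> f B"
        using f[OF JD(3)[OF yz(1,2)]] f H(2) by (simp add: Mops)
    next
      fix c A assume "c \<in> carrier F" "A \<in> carrier ?M"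
      then obtain y where yz: "c \<in> carrier F" "y \<in> J" "A = I +>\<^bsub>L\<^esub> y" by (auto simp: M)
      then show "f (c \<odot>\<^bsub>?M\<^esub> A) = c \<odot>\<^bsub>S\<^esub> f A"
        using f[OF JD(4)[OF yz(1,2)]] f H(3) by (simp add: Mops)
    next
      fix x A assume "x \<in> carrier L" "A \<in> carrier ?M"
      then obtain y where yz: "x \<in> carrier L" "y \<in> J" "A = I +>\<^bsub>L\<^esub> y" by (auto simp: M)
      then show "f (lact ?M x A) = lact S x (f A)"
        using f[OF p_idealD(2)[OF J yz(1,2)]] f H(4) by (simp add: Mops)
    qed
    moreover have "bij_betw f (carrier ?M) (carrier S)"
      unfolding bij_betw_def
    proof
      show "f ` carrier ?M = carrier S" using f H(6) unfolding M image_image by (metis (no_types, lifting) image_cong)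
      show "inj_on f (carrier ?M)"
      proof (rule inj_onI)
        fix A B assume AB: "A \<in> carrier ?M" "B \<in> carrier ?M" "f A = f B"
        then obtain y z where yz: "y \<in> J" "z \<in> J" "A = I +>\<^bsub>L\<^esub> y" "B = I +>\<^bsub>L\<^esub> z" by (auto simp: M)
        have yzJ: "y \<ominus>\<^bsub>L\<^esub> z \<in> J" using JD(6) yz by blast
        have "\<phi> (y \<ominus>\<^bsub>L\<^esub> z) \<oplus>\<^bsub>S\<^esub> \<phi> z = \<phi> z"
          using H(2)[OF yzJ yz(2)] V.M.minus_plus[OF JL[OF yz(2)] JL[OF yz(1)]] AB(3) f yz by simp
        then have "\<phi> (y \<ominus>\<^bsub>L\<^esub> z) = \<zero>\<^bsub>S\<^esub>" using H(1)[OF yzJ] H(1)[OF yz(2)] by simp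
        then have "y \<ominus>\<^bsub>L\<^esub> z \<in> I" using H(5)[OF yzJ] by simp
        then show "A = B" using I.coset_eq_iff[OF JL[OF yz(1)] JL[OF yz(2)]] yz by simp
      qed
    qed
    ultimately show "lie_module_iso F L ?M S" by (auto simp: lie_module_iso_def)
  }
qed

text \<open>
  An abelian factor \<open>J/I\<close> is annihilated by \<open>J\<close>, and so is the isomorphic module \<open>S\<close>.
\<close>

lemma factor_map_Ann:
  assumes "strongly_abelian_factor L I J" "factor_map I J \<phi>"
  shows "J \<subseteq> N"
proof
  fix y assume y: "y \<in> J"
  note H = factor_mapD[OF assms(2)] and JL = p_ideal_carrier[OF J]
  have "lact S y s = \<zero>\<^bsub>S\<^esub>" if s: "s \<in> carrier S" for s
  proof -
    obtain z where z: "z \<in> J" "s = \<phi> z" using s H(6) by blast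
    have "bracket L y z \<in> I" using assms(1) y z unfolding strongly_abelian_iff[OF I J IJ] by blast
    then have "\<phi> (bracket L y z) = \<zero>\<^bsub>S\<^esub>" using H(5) IJ by blast
    then show ?thesis using H(4)[OF JL[OF y] z(1)] z(2) by simp
  qed
  then show "y \<in> N" using JL[OF y] unfolding Ann_def by blast
qed

lemma WD:
  assumes "\<delta> \<in> W K"
  shows "\<delta> \<in> res_der p F L S" "\<And>x. x \<in> K \<Longrightarrow> x \<in> N \<Longrightarrow> \<delta> x = \<zero>\<^bsub>S\<^esub>"
  using assms by (auto simp: der_vanish_def)

lemma Ann_act: "x \<in> N \<Longrightarrow> m \<in> carrier S \<Longrightarrow> lact S x m = \<zero>\<^bsub>S\<^esub>"
  unfolding Ann_def by blast

lemma Ann_pow: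
  assumes "x \<in> N" "m \<in> carrier S" shows "(lact S x ^^ (p - 1)) m = \<zero>\<^bsub>S\<^esub>"
proof -
  have "p - 1 = Suc (p - 2)" using p_ge_2 by simp
  moreover have "(lact S x ^^ Suc (p - 2)) m = lact S x ((lact S x ^^ (p - 2)) m)" by simp
  ultimately show ?thesis using Ann_act[OF assms(1)] lact_pow_closed[OF _ assms(2)] assms(1) N_sub
    by (metis subsetD)
qed

text \<open>
  On elements that annihilate \<open>S\<close> a derivation is \<open>L\<close>-linear, and it kills their \<open>p\<close>-th powers because
  \<open>p - 1 > 0\<close>.
\<close>

lemma der_Ann:
  assumes "\<delta> \<in> res_der p F L S" "a \<in> N"
  shows "x \<in> carrier L \<Longrightarrow> \<delta> (bracket L x a) = lact S x (\<delta> a)" "\<delta> (pmap L a) = \<zero>\<^bsub>S\<^esub>"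
proof -
  note D = derD[OF assms(1)]
  have aL: "a \<in> carrier L" using assms(2) N_sub by blast
  show "\<delta> (bracket L x a) = lact S x (\<delta> a)" if "x \<in> carrier L"
    using D(4)[OF that aL] Ann_act[OF assms(2) D(1)[OF that]] Mod.lact_closed[OF that D(1)[OF aL]]
      Mod.V.M.minus_eqI[of "lact S x (\<delta> a)" "\<zero>\<^bsub>S\<^esub>"] by simp
  show "\<delta> (pmap L a) = \<zero>\<^bsub>S\<^esub>" using D(5)[OF aL] Ann_pow[OF assms(2) D(1)[OF aL]] by simp
qed

lemma der_kernel_p_ideal:
  assumes \<delta>: "\<delta> \<in> res_der p F L S" and K: "p_ideal F L K" "K \<subseteq> N"
  shows "p_ideal F L {a \<in> K. \<delta> a = \<zero>\<^bsub>S\<^esub>}"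
proof -
  note D = derD[OF \<delta>] and KD = submoduleD[OF p_idealD(1)[OF K(1)]] and KL = p_ideal_carrier[OF K(1)]
  have "submodule {a \<in> K. \<delta> a = \<zero>\<^bsub>S\<^esub>} F L"
    by (rule LL.lsubmoduleI) (use KD KL D in auto)
  then show ?thesis
    using der_Ann[OF \<delta>] K p_idealD(2,3)[OF K(1)] by (auto simp: p_ideal_def)
qed

lemma der_image_full:
  assumes \<delta>: "\<delta> \<in> res_der p F L S" and K: "p_ideal F L K" "K \<subseteq> N" and a: "a \<in> K" "\<delta> a \<noteq> \<zero>\<^bsub>S\<^esub>"
  shows "\<delta> ` K = carrier S"
proof -
  note D = derD[OF \<delta>] and KD = submoduleD[OF p_idealD(1)[OF K(1)]] and KL = p_ideal_carrier[OF K(1)]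
  have "submodule (\<delta> ` K) F S"
  proof (rule MM.lsubmoduleI)
    show "\<delta> ` K \<subseteq> carrier S" using D(1) KL by blast
    show "\<zero>\<^bsub>S\<^esub> \<in> \<delta> ` K" using D(7) KD(2) by (metis imageI)
    show "m \<oplus>\<^bsub>S\<^esub> n \<in> \<delta> ` K" if mn: "m \<in> \<delta> ` K" "n \<in> \<delta> ` K" for m n
    proof -
      obtain b c where bc: "b \<in> K" "c \<in> K" "m = \<delta> b" "n = \<delta> c" using mn by blast
      then have "m \<oplus>\<^bsub>S\<^esub> n = \<delta> (b \<oplus>\<^bsub>L\<^esub> c)" using D(2) KL by simp
      then show ?thesis using KD(3) bc by blast
    qed
    show "c \<odot>\<^bsub>S\<^esub> m \<in> \<delta> ` K" if cm: "c \<in> carrier F" "m \<in> \<delta> ` K" for c m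
    proof -
      obtain b where b: "b \<in> K" "m = \<delta> b" using cm by blast
      then have "c \<odot>\<^bsub>S\<^esub> m = \<delta> (c \<odot>\<^bsub>L\<^esub> b)" using D(3) KL cm by simp
      then show ?thesis using KD(4) b cm by blast
    qed
  qed
  moreover have "lact S x m \<in> \<delta> ` K" if xm: "x \<in> carrier L" "m \<in> \<delta> ` K" for x m
  proof -
    obtain b where b: "b \<in> K" "m = \<delta> b" using xm by blast
    then have "lact S x m = \<delta> (bracket L x b)" using der_Ann(1)[OF \<delta> _ xm(1)] K(2) by auto
    then show ?thesis using p_idealD(2)[OF K(1) xm(1) b(1)] by blast
  qed
  ultimately have "lie_submodule F L S (\<delta> ` K)" by (simp add: lie_submodule_def)
  then have "\<delta> ` K = {\<zero>\<^bsub>S\<^esub>} \<or> \<delta> ` K = carrier S" using irr by (simp add: irreducible_restricted_module_def)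
  then show ?thesis using a by blast
qed

context
  assumes min: "minimal_p_ideal F (rlie_quot L I) ((\<lambda>x. I +>\<^bsub>L\<^esub> x) ` J)"
begin

text \<open>
  Let \<open>\<delta>\<close> vanish on \<open>I \<inter> N\<close> but not on \<open>J \<inter> N\<close>.  By minimality \<open>J = I + (J \<inter> N)\<close>, and \<open>\<delta>\<close> maps \<open>J \<inter> N\<close>
  onto \<open>S\<close> by irreducibility.  For \<open>i \<in> I\<close> and \<open>b \<in> J \<inter> N\<close> one gets \<open>0 = \<delta>[i, b] = i \<delta>(b)\<close>, so \<open>I\<close>
  annihilates \<open>S\<close>, and hence so does \<open>J\<close>.  Now the kernel of \<open>\<delta>\<close> on \<open>J\<close> is a \<open>p\<close>-ideal between \<open>I\<close> and \<open>J\<close>,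
  that is, \<open>I\<close>.  So \<open>\<delta>\<close> identifies \<open>J/I\<close> with \<open>S\<close>, and the kernel of \<open>\<delta>\<close> on \<open>L\<close> is a complement of \<open>J/I\<close>.
\<close>

lemma new_derivation_factor:
  assumes \<delta>: "\<delta> \<in> W I" "\<delta> \<notin> W J"
  shows "J \<subseteq> N" "factor_map I J \<delta>" "strongly_abelian_factor L I J" "factor_splits F L I J"
proof -
  note der = WD(1)[OF \<delta>(1)]
  note D = derD[OF der]
  note JD = submoduleD[OF p_idealD(1)[OF J]]
  note IL = p_ideal_carrier[OF I] and JL = p_ideal_carrier[OF J]
  have JN: "p_ideal F L (J \<inter> N)" by (rule p_ideal_inter[OF J Ann_p_ideal])
  obtain a where a: "a \<in> J \<inter> N" "\<delta> a \<noteq> \<zero>\<^bsub>S\<^esub>" using \<delta> by (auto simp: der_vanish_def)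
  have aI: "a \<notin> I" using WD(2)[OF \<delta>(1)] a by blast
  \<comment> \<open>this \<open>p\<close>-ideal lies strictly above \<open>I\<close>, since it contains \<open>a\<close>\<close>
  let ?K = "{i \<oplus>\<^bsub>L\<^esub> b | i b. i \<in> I \<and> b \<in> J \<inter> N}"
  have IK: "I \<subseteq> ?K"
  proof
    fix i assume i: "i \<in> I"
    then have "i = i \<oplus>\<^bsub>L\<^esub> \<zero>\<^bsub>L\<^esub>" using IL by simp
    then show "i \<in> ?K" using i submoduleD(2)[OF p_idealD(1)[OF JN]] by blast
  qed
  have KJ: "?K \<subseteq> J" using IJ JD(3) by auto
  have aK: "a \<in> ?K"
  proof -
    have "a = \<zero>\<^bsub>L\<^esub> \<oplus>\<^bsub>L\<^esub> a" using a JL by simp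
    then show ?thesis using a submoduleD(2)[OF p_idealD(1)[OF I]] by blast
  qed
  have KJ': "?K = J"
    using chief_factor_minimal[OF I J min p_ideal_sum[OF I JN] IK KJ] aK aI by blast
  have full: "\<delta> ` (J \<inter> N) = carrier S" by (rule der_image_full[OF der JN _ a]) blast
  have IN: "I \<subseteq> N"
  proof
    fix i assume i: "i \<in> I"
    have "lact S i s = \<zero>\<^bsub>S\<^esub>" if s: "s \<in> carrier S" for s
    proof -
      obtain b where b: "b \<in> J \<inter> N" "s = \<delta> b" using s full by blast
      have "bracket L i b \<in> I" "bracket L i b \<in> N"
        using p_ideal_bracket_left[OF I i] p_idealD(2)[OF Ann_p_ideal IL[OF i]] b JL by auto
      then have "\<delta> (bracket L i b) = \<zero>\<^bsub>S\<^esub>" using WD(2)[OF \<delta>(1)] by blast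
      then show ?thesis using der_Ann(1)[OF der _ IL[OF i]] b by simp
    qed
    then show "i \<in> N" using IL[OF i] unfolding Ann_def by blast
  qed
  show JsN: "J \<subseteq> N"
  proof
    fix y assume "y \<in> J"
    then obtain i b where "y = i \<oplus>\<^bsub>L\<^esub> b" "i \<in> I" "b \<in> N" using KJ' by blast
    then show "y \<in> N" using submoduleD(3)[OF p_idealD(1)[OF Ann_p_ideal]] IN by blast
  qed
  then have fullJ: "\<delta> ` J = carrier S" using full by (simp add: Int_absorb2)
  have ker: "{y \<in> J. \<delta> y = \<zero>\<^bsub>S\<^esub>} = I"
  proof -
    have "I \<subseteq> {y \<in> J. \<delta> y = \<zero>\<^bsub>S\<^esub>}" using IJ IN WD(2)[OF \<delta>(1)] by blast
    moreover have "{y \<in> J. \<delta> y = \<zero>\<^bsub>S\<^esub>} \<noteq> J" using a by blast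
    ultimately show ?thesis
      using chief_factor_minimal[OF I J min der_kernel_p_ideal[OF der J JsN]] by blast
  qed
  have brJ: "\<delta> (bracket L x y) = lact S x (\<delta> y)" if "x \<in> carrier L" "y \<in> J" for x y
    using der_Ann(1)[OF der _ that(1)] that(2) JsN by blast
  show "factor_map I J \<delta>"
    unfolding factor_map_def
  proof (intro conjI ballI)
    show "\<delta> y = \<zero>\<^bsub>S\<^esub> \<longleftrightarrow> y \<in> I" if "y \<in> J" for y using ker that by blast
  qed (use D(1-3) JL brJ fullJ in simp_all)
  show "strongly_abelian_factor L I J"
    unfolding strongly_abelian_iff[OF I J IJ]
  proof (intro conjI ballI)
    fix y assume y: "y \<in> J"
    show "pmap L y \<in> I" using der_Ann(2)[OF der] y JsN p_idealD(3)[OF J y] ker by blast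
    fix z assume z: "z \<in> J"
    have "\<delta> (bracket L y z) = \<zero>\<^bsub>S\<^esub>"
      using brJ[OF JL[OF y] z] Ann_act[OF subsetD[OF JsN y] D(1)[OF JL[OF z]]] by simp
    then show "bracket L y z \<in> I" using ker p_idealD(2)[OF J JL[OF y] z] by blast
  qed
  show "factor_splits F L I J"
    unfolding factor_splits_iff[OF I J IJ]
  proof (intro exI conjI ballI)
    \<comment> \<open>the complement is the kernel of \<open>\<delta>\<close>, a restricted subalgebra\<close>
    let ?C = "{x \<in> carrier L. \<delta> x = \<zero>\<^bsub>S\<^esub>}"
    show "submodule ?C F L" by (rule LL.lsubmoduleI) (use D in auto)
    show "bracket L x y \<in> ?C" if "x \<in> ?C" "y \<in> ?C" for x y
      using that D(4) bracket_closed Mod.V.M.minus_eqI[of "\<zero>\<^bsub>S\<^esub>" "\<zero>\<^bsub>S\<^esub>" "\<zero>\<^bsub>S\<^esub>"] by simp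
    show "pmap L x \<in> ?C" if "x \<in> ?C" for x
    proof -
      have "(lact S x ^^ n) \<zero>\<^bsub>S\<^esub> = \<zero>\<^bsub>S\<^esub>" for n by (induction n) (use that in auto)
      then show ?thesis using that D(5) pmap_closed by simp
    qed
    show "?C \<inter> J = I" using ker JL by blast
    show "\<exists>y\<in>J. \<exists>k\<in>?C. x = y \<oplus>\<^bsub>L\<^esub> k" if x: "x \<in> carrier L" for x
    proof -
      have "\<delta> x \<in> \<delta> ` J" using fullJ D(1)[OF x] by simp
      then obtain y where y: "y \<in> J" "\<delta> y = \<delta> x" by force
      have "\<delta> (x \<ominus>\<^bsub>L\<^esub> y) = \<zero>\<^bsub>S\<^esub>"
        using D(8)[OF x JL[OF y(1)]] y D(1)[OF x] Mod.V.M.minus_eqI[of "\<zero>\<^bsub>S\<^esub>" "\<delta> x" "\<delta> x"] by simp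
      then have "x \<ominus>\<^bsub>L\<^esub> y \<in> ?C" using x JL[OF y(1)] by simp
      moreover have "x = y \<oplus>\<^bsub>L\<^esub> (x \<ominus>\<^bsub>L\<^esub> y)"
        using V.M.minus_plus[OF JL[OF y(1)] x] x JL[OF y(1)] by (simp add: V.M.a_comm)
      ultimately show ?thesis using y by blast
    qed
  qed
qed

text \<open>
  On \<open>L = J + C\<close> the map \<open>y + k \<mapsto> \<phi>(y)\<close> is well defined because \<open>\<phi>\<close> vanishes on \<open>J \<inter> C = I\<close>.  Since
  \<open>J\<close> annihilates \<open>S\<close>, an element \<open>y + k\<close> acts on \<open>S\<close> as \<open>k\<close>.
\<close>

lemma split_factor_derivation:
  assumes ab: "strongly_abelian_factor L I J" and iso: "lie_module_iso F L (factor_module L I J) S"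
    and split: "factor_splits F L I J"
  shows "\<exists>\<delta>. \<delta> \<in> W I \<and> \<delta> \<notin> W J"
proof -
  obtain \<phi> where \<phi>: "factor_map I J \<phi>" using iso unfolding module_iso_factor_map by blast
  obtain C where C: "submodule C F L" "\<And>x y. x \<in> C \<Longrightarrow> y \<in> C \<Longrightarrow> bracket L x y \<in> C"
    "\<And>x. x \<in> C \<Longrightarrow> pmap L x \<in> C" "C \<inter> J = I" "\<And>x. x \<in> carrier L \<Longrightarrow> \<exists>y\<in>J. \<exists>k\<in>C. x = y \<oplus>\<^bsub>L\<^esub> k"
    using split unfolding factor_splits_iff[OF I J IJ] by blast
  note H = factor_mapD[OF \<phi>] and CD = submoduleD[OF C(1)] and JD = submoduleD[OF p_idealD(1)[OF J]]
  note JL = p_ideal_carrier[OF J]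
  have CL: "k \<in> carrier L" if "k \<in> C" for k using CD(1) that by blast
  have JN: "J \<subseteq> N" by (rule factor_map_Ann[OF ab \<phi>])
  have ab': "bracket L y z \<in> I" "pmap L y \<in> I" if "y \<in> J" "z \<in> J" for y z
    using ab that unfolding strongly_abelian_iff[OF I J IJ] by blast+
  have \<phi>I: "\<phi> i = \<zero>\<^bsub>S\<^esub>" if "i \<in> I" for i using H(5) IJ that by blast
  define \<delta> where "\<delta> x = \<phi> (SOME y. y \<in> J \<and> (\<exists>k\<in>C. x = y \<oplus>\<^bsub>L\<^esub> k))" for x
  have \<delta>: "\<delta> (y \<oplus>\<^bsub>L\<^esub> k) = \<phi> y" if yk: "y \<in> J" "k \<in> C" for y k
  proof -
    define y' where "y' = (SOME y'. y' \<in> J \<and> (\<exists>k'\<in>C. y \<oplus>\<^bsub>L\<^esub> k = y' \<oplus>\<^bsub>L\<^esub> k'))"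
    have "y' \<in> J \<and> (\<exists>k'\<in>C. y \<oplus>\<^bsub>L\<^esub> k = y' \<oplus>\<^bsub>L\<^esub> k')" unfolding y'_def by (rule someI[of _ y]) (use yk in blast)
    then obtain k' where y': "y' \<in> J" "k' \<in> C" "y \<oplus>\<^bsub>L\<^esub> k = y' \<oplus>\<^bsub>L\<^esub> k'" by blast
    note cl = JL[OF yk(1)] JL[OF y'(1)] CL[OF yk(2)] CL[OF y'(2)]
    have "y' = (y \<oplus>\<^bsub>L\<^esub> k) \<ominus>\<^bsub>L\<^esub> k'" using V.M.minus_eqI[OF y'(3)[symmetric]] cl by simp
    also have "\<dots> = (k \<ominus>\<^bsub>L\<^esub> k') \<oplus>\<^bsub>L\<^esub> y" using cl by (simp add: V.M.minus_eq V.M.a_ac)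
    finally have eq: "(k \<ominus>\<^bsub>L\<^esub> k') \<oplus>\<^bsub>L\<^esub> y = y'" ..
    then have "y' \<ominus>\<^bsub>L\<^esub> y = k \<ominus>\<^bsub>L\<^esub> k'" using cl by (intro V.M.minus_eqI) auto
    then have "k \<ominus>\<^bsub>L\<^esub> k' \<in> I" using C(4) CD(6)[OF yk(2) y'(2)] JD(6)[OF y'(1) yk(1)] by auto
    then have "\<phi> y' = \<phi> y" using H(2)[of "k \<ominus>\<^bsub>L\<^esub> k'" y] \<phi>I IJ yk(1) H(1)[OF yk(1)] eq by auto
    then show ?thesis by (simp add: \<delta>_def y'_def)
  qed
  have "(\<lambda>x\<in>carrier L. \<delta> x) \<in> res_der p F L S"
  proof (rule res_derI)
    fix x assume x: "x \<in> carrier L"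
    obtain y k where yk: "y \<in> J" "k \<in> C" "x = y \<oplus>\<^bsub>L\<^esub> k" using C(5)[OF x] by blast
    note yL = JL[OF yk(1)] and kL = CL[OF yk(2)]
    show "\<delta> x \<in> carrier S" using \<delta>[OF yk(1,2)] H(1) yk by simp
    have xk: "lact S x m = lact S k m" if "m \<in> carrier S" for m
      using Mod.lact_add_l[OF yL kL that] Ann_act[OF subsetD[OF JN yk(1)] that] Mod.lact_closed[OF kL that] yk(3) by simp
    show "\<delta> (c \<odot>\<^bsub>L\<^esub> x) = c \<odot>\<^bsub>S\<^esub> \<delta> x" if c: "c \<in> carrier F" for c
      using \<delta>[OF JD(4)[OF c yk(1)] CD(4)[OF c yk(2)]] \<delta>[OF yk(1,2)] H(3)[OF c yk(1)] yk(3) yL kL c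
      by (simp add: V.smult_r_distr)
    show "\<delta> (pmap L x) = (lact S x ^^ (p - 1)) (\<delta> x)"
    proof -
      have adJ: "(bracket L k ^^ m) y \<in> J \<and> \<phi> ((bracket L k ^^ m) y) = (lact S k ^^ m) (\<phi> y)" for m
        by (induction m) (use yk(1) p_idealD(2)[OF J kL] H(4)[OF kL] in auto)
      have powk: "(lact S x ^^ m) (\<phi> y) = (lact S k ^^ m) (\<phi> y)" for m
      proof (induction m)
        case (Suc m)
        then show ?case using xk[OF lact_pow_closed[OF kL H(1)[OF yk(1)]]] by simp
      qed simp
      \<comment> \<open>modulo \<open>I\<close>, only the first of Jacobson's terms remains\<close>
      obtain r where r: "r \<in> I" "(\<Oplus>\<^bsub>L\<^esub>i\<in>{1..p - 1}. jacobson_s p F L i y k) = (bracket L k ^^ (p - 1)) y \<oplus>\<^bsub>L\<^esub> r"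
        using jacobson_sum_strongly_abelian[OF I J IJ _ yk(1) kL] ab' by blast
      let ?b = "(bracket L k ^^ (p - 1)) y"
      have bJ: "?b \<in> J" using adJ by blast
      have rJ: "r \<in> J" and pJ: "pmap L y \<in> J" using r(1) IJ p_idealD(3)[OF J yk(1)] by auto
      have "pmap L x = pmap L y \<oplus>\<^bsub>L\<^esub> pmap L k \<oplus>\<^bsub>L\<^esub> (?b \<oplus>\<^bsub>L\<^esub> r)"
        using pmap_add[OF yL kL] yk(3) r(2) by simp
      also have "\<dots> = (pmap L y \<oplus>\<^bsub>L\<^esub> (?b \<oplus>\<^bsub>L\<^esub> r)) \<oplus>\<^bsub>L\<^esub> pmap L k"
        using JL[OF bJ] JL[OF rJ] JL[OF pJ] pmap_closed[OF kL] by (simp add: V.M.a_ac)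
      finally have "\<delta> (pmap L x) = \<phi> (pmap L y \<oplus>\<^bsub>L\<^esub> (?b \<oplus>\<^bsub>L\<^esub> r))"
        using \<delta>[OF JD(3)[OF pJ JD(3)[OF bJ rJ]] C(3)[OF yk(2)]] by simp
      also have "\<dots> = \<phi> ?b"
        using H(2)[OF pJ JD(3)[OF bJ rJ]] H(2)[OF bJ rJ] \<phi>I[OF r(1)] \<phi>I[OF ab'(2)[OF yk(1,1)]] H(1)[OF bJ] by simp
      also have "\<dots> = (lact S x ^^ (p - 1)) (\<delta> x)" using adJ powk \<delta>[OF yk(1,2)] yk(3) by simp
      finally show ?thesis .
    qed
    fix x' assume x': "x' \<in> carrier L"
    obtain y' k' where yk': "y' \<in> J" "k' \<in> C" "x' = y' \<oplus>\<^bsub>L\<^esub> k'" using C(5)[OF x'] by blast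
    note yL' = JL[OF yk'(1)] and kL' = CL[OF yk'(2)]
    have xk': "lact S x' m = lact S k' m" if "m \<in> carrier S" for m
      using Mod.lact_add_l[OF yL' kL' that] Ann_act[OF subsetD[OF JN yk'(1)] that] Mod.lact_closed[OF kL' that] yk'(3) by simp
    have "x \<oplus>\<^bsub>L\<^esub> x' = (y \<oplus>\<^bsub>L\<^esub> y') \<oplus>\<^bsub>L\<^esub> (k \<oplus>\<^bsub>L\<^esub> k')" using yk(3) yk'(3) yL yL' kL kL' by (simp add: V.M.a_ac)
    then show "\<delta> (x \<oplus>\<^bsub>L\<^esub> x') = \<delta> x \<oplus>\<^bsub>S\<^esub> \<delta> x'"
      using \<delta>[OF JD(3)[OF yk(1) yk'(1)] CD(3)[OF yk(2) yk'(2)]] \<delta>[OF yk(1,2)] \<delta>[OF yk'(1,2)] H(2)[OF yk(1) yk'(1)]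
        yk(3) yk'(3) by simp
    show "\<delta> (bracket L x x') = lact S x (\<delta> x') \<ominus>\<^bsub>S\<^esub> lact S x' (\<delta> x)"
    proof -
      let ?a = "bracket L y y'" and ?b = "bracket L y k'" and ?c = "bracket L k y'"
      have aJ: "?a \<in> J" and bJ: "?b \<in> J" and cJ: "?c \<in> J"
        using p_idealD(2)[OF J yL yk'(1)] p_ideal_bracket_left[OF J yk(1) kL'] p_idealD(2)[OF J kL yk'(1)] by auto
      have "bracket L x x' = (?a \<oplus>\<^bsub>L\<^esub> (?c \<oplus>\<^bsub>L\<^esub> ?b)) \<oplus>\<^bsub>L\<^esub> bracket L k k'"
        using yk(3) yk'(3) yL yL' kL kL' bracket_closed by (simp add: bracket_add_l bracket_add_r V.M.a_ac)
      then have "\<delta> (bracket L x x') = \<phi> (?a \<oplus>\<^bsub>L\<^esub> (?c \<oplus>\<^bsub>L\<^esub> ?b))"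
        using \<delta>[OF JD(3)[OF aJ JD(3)[OF cJ bJ]] C(2)[OF yk(2) yk'(2)]] by simp
      also have "\<dots> = \<phi> ?c \<oplus>\<^bsub>S\<^esub> \<phi> ?b"
        using H(2)[OF aJ JD(3)[OF cJ bJ]] H(2)[OF cJ bJ] \<phi>I[OF ab'(1)[OF yk(1) yk'(1)]] H(1)[OF cJ] H(1)[OF bJ] by simp
      also have "\<phi> ?b = \<ominus>\<^bsub>S\<^esub> \<phi> (bracket L k' y)"
      proof -
        have dJ: "bracket L k' y \<in> J" by (rule p_idealD(2)[OF J kL' yk(1)])
        have "?b \<oplus>\<^bsub>L\<^esub> bracket L k' y = \<zero>\<^bsub>L\<^esub>"
          using bracket_antisym[OF kL' yL] JL[OF dJ] by (simp add: V.M.l_neg)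
        then have "\<phi> ?b \<oplus>\<^bsub>S\<^esub> \<phi> (bracket L k' y) = \<zero>\<^bsub>S\<^esub>"
          using H(2)[OF bJ dJ] \<phi>I[OF submoduleD(2)[OF p_idealD(1)[OF I]]] by simp
        then show ?thesis using Mod.V.M.minus_equality[of "\<phi> ?b" "\<phi> (bracket L k' y)"] H(1)[OF bJ] H(1)[OF dJ] by simp
      qed
      finally show ?thesis
        using H(4)[OF kL yk'(1)] H(4)[OF kL' yk(1)] \<delta>[OF yk(1,2)] \<delta>[OF yk'(1,2)] yk(3) yk'(3)
          xk[OF H(1)[OF yk'(1)]] xk'[OF H(1)[OF yk(1)]] by (simp add: Mod.V.M.minus_eq)
    qed
  qed
  moreover have \<delta>J: "\<delta> y = \<phi> y" if "y \<in> J" for y using \<delta>[OF that CD(2)] JL[OF that] by simp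
  ultimately have "(\<lambda>x\<in>carrier L. \<delta> x) \<in> W I"
    using \<phi>I IJ JL by (auto simp: der_vanish_def)
  moreover have "(\<lambda>x\<in>carrier L. \<delta> x) \<notin> W J"
  proof
    assume "(\<lambda>x\<in>carrier L. \<delta> x) \<in> W J"
    then have "\<phi> y = \<zero>\<^bsub>S\<^esub>" if "y \<in> J" for y using \<delta>J[OF that] that JN JL by (auto simp: der_vanish_def)
    then have "\<phi> ` J \<subseteq> {\<zero>\<^bsub>S\<^esub>}" by auto
    then have "carrier S \<subseteq> {\<zero>\<^bsub>S\<^esub>}" unfolding H(6) .
    then show False using irr Mod.V.M.zero_closed by (auto simp: irreducible_restricted_module_def)
  qed
  ultimately show ?thesis by blast
qed

text \<open>
  As \<open>J\<close> annihilates \<open>S\<close>, any \<open>\<epsilon> \<in> W I\<close> vanishes on \<open>I\<close>.  It factors on \<open>J\<close>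
  through the isomorphism \<open>J/I \<cong> S\<close> given by \<open>\<delta>\<close>, so on \<open>J\<close> it is \<open>\<delta>\<close> followed by an endomorphism \<open>h\<close>
  of \<open>S\<close>.  Hence \<open>\<epsilon> - h \<delta>\<close> vanishes on \<open>J\<close>.
\<close>

lemma new_derivation_rel_dim:
  assumes \<delta>: "\<delta> \<in> W I" "\<delta> \<notin> W J"
  shows "rel_dim Cent Cochain (W J) (W I) 1"
proof -
  note fac = new_derivation_factor[OF \<delta>] and IL = p_ideal_carrier[OF I] and JL = p_ideal_carrier[OF J]
  note H = factor_mapD[OF fac(2)] and der = WD(1)[OF \<delta>(1)]
  have sJ: "submodule (W J) Cent Cochain" and sI: "submodule (W I) Cent Cochain"
    using der_vanish_submodule[of "J \<inter> N"] der_vanish_submodule[of "I \<inter> N"] N_sub by blast+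
  have WJI: "W J \<subseteq> W I" using IJ by (auto simp: der_vanish_def)
  have "W I \<subseteq> adjoin Cent Cochain (W J) \<delta>"
  proof
    fix \<epsilon> assume \<epsilon>: "\<epsilon> \<in> W I"
    note D = derD[OF WD(1)[OF \<epsilon>]]
    \<comment> \<open>the endomorphism of \<open>S\<close> with \<open>h (\<delta> y) = \<epsilon> y\<close> for \<open>y \<in> J\<close>\<close>
    define h where "h s = \<epsilon> (SOME y. y \<in> J \<and> \<delta> y = s)" for s
    have h: "h (\<delta> y) = \<epsilon> y" if y: "y \<in> J" for y
    proof -
      define z where "z = (SOME z. z \<in> J \<and> \<delta> z = \<delta> y)"
      have z: "z \<in> J" "\<delta> z = \<delta> y" using someI[of "\<lambda>z. z \<in> J \<and> \<delta> z = \<delta> y" y] y by (auto simp: z_def)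
      have "\<delta> (z \<ominus>\<^bsub>L\<^esub> y) = \<zero>\<^bsub>S\<^esub>"
        using derD(8)[OF der JL[OF z(1)] JL[OF y]] z(2) H(1)[OF y] Mod.V.M.minus_eqI[of "\<zero>\<^bsub>S\<^esub>" "\<delta> y" "\<delta> y"] by simp
      then have "z \<ominus>\<^bsub>L\<^esub> y \<in> I" using H(5) submoduleD(6)[OF p_idealD(1)[OF J] z(1) y] by blast
      then have "\<epsilon> (z \<ominus>\<^bsub>L\<^esub> y) = \<zero>\<^bsub>S\<^esub>" using WD(2)[OF \<epsilon>] IJ fac(1) by blast
      moreover have "\<epsilon> ((z \<ominus>\<^bsub>L\<^esub> y) \<oplus>\<^bsub>L\<^esub> y) = \<epsilon> (z \<ominus>\<^bsub>L\<^esub> y) \<oplus>\<^bsub>S\<^esub> \<epsilon> y"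
        by (rule D(2)) (use JL z(1) y in auto)
      ultimately show ?thesis using V.M.minus_plus[OF JL[OF y] JL[OF z(1)]] D(1)[OF JL[OF y]] by (simp add: h_def z_def)
    qed
    have surj: "\<exists>y. y \<in> J \<and> s = \<delta> y" if "s \<in> carrier S" for s using that H(6) by blast
    have hD: "(\<lambda>s\<in>carrier S. h s) \<in> carrier Cent"
      unfolding End_ring_simps
    proof (rule lie_module_homI)
      fix s assume "s \<in> carrier S"
      then obtain y where y: "y \<in> J" "s = \<delta> y" using surj by blast
      note yL = JL[OF y(1)]
      show "h s \<in> carrier S" using h y D(1) yL by simp
      show "c \<odot>\<^bsub>S\<^esub> s \<in> carrier S \<and> h (c \<odot>\<^bsub>S\<^esub> s) = c \<odot>\<^bsub>S\<^esub> h s" if c: "c \<in> carrier F" for c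
        using h[OF submoduleD(4)[OF p_idealD(1)[OF J] c y(1)]] h[OF y(1)] H(3)[OF c y(1)] D(3)[OF c yL] y(2) H(1)[OF y(1)] c by simp
      show "lact S x s \<in> carrier S \<and> h (lact S x s) = lact S x (h s)" if x: "x \<in> carrier L" for x
        using h[OF p_idealD(2)[OF J x y(1)]] h[OF y(1)] H(4)[OF x y(1)] y(2) Mod.lact_closed[OF x H(1)[OF y(1)]]
          der_Ann(1)[OF WD(1)[OF \<epsilon>] subsetD[OF fac(1) y(1)] x] by simp
      fix s' assume "s' \<in> carrier S"
      then obtain y' where y': "y' \<in> J" "s' = \<delta> y'" using surj by blast
      show "s \<oplus>\<^bsub>S\<^esub> s' \<in> carrier S \<and> h (s \<oplus>\<^bsub>S\<^esub> s') = h s \<oplus>\<^bsub>S\<^esub> h s'"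
        using h[OF submoduleD(3)[OF p_idealD(1)[OF J] y(1) y'(1)]] h[OF y(1)] h[OF y'(1)] H(2)[OF y(1) y'(1)]
          D(2)[OF yL JL[OF y'(1)]] y(2) y'(2) H(1)[OF y(1)] H(1)[OF y'(1)] by simp
    qed
    let ?h = "\<lambda>s\<in>carrier S. h s"
    let ?r = "\<epsilon> \<ominus>\<^bsub>Cochain\<^esub> ?h \<odot>\<^bsub>Cochain\<^esub> \<delta>"
    have hdI: "?h \<odot>\<^bsub>Cochain\<^esub> \<delta> \<in> W I" by (rule submoduleD(4)[OF sI hD \<delta>(1)])
    have rI: "?r \<in> W I" by (rule submoduleD(6)[OF sI \<epsilon> hdI])
    have cl: "\<epsilon> \<in> carrier Cochain" "?h \<odot>\<^bsub>Cochain\<^esub> \<delta> \<in> carrier Cochain" "?r \<in> carrier Cochain"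
      using submoduleD(1)[OF sI] \<epsilon> hdI rI by blast+
    have eq: "?r \<oplus>\<^bsub>Cochain\<^esub> ?h \<odot>\<^bsub>Cochain\<^esub> \<delta> = \<epsilon>"
      using cl(1,2) by (simp only: Cochain.M.minus_eq Cochain.M.a_assoc Cochain.M.l_neg Cochain.M.a_inv_closed Cochain.M.r_zero)
    have "?r y = \<zero>\<^bsub>S\<^esub>" if y: "y \<in> J" for y
    proof -
      note rD = derD[OF WD(1)[OF rI]]
      have "(?r \<oplus>\<^bsub>Cochain\<^esub> ?h \<odot>\<^bsub>Cochain\<^esub> \<delta>) y = \<epsilon> y" using eq by simp
      then have "?r y \<oplus>\<^bsub>S\<^esub> \<epsilon> y = \<epsilon> y" using JL[OF y] H(1)[OF y] h[OF y] by simp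
      then show ?thesis using rD(1)[OF JL[OF y]] D(1)[OF JL[OF y]] by simp
    qed
    then have "?r \<in> W J" using WD(1)[OF rI] by (simp add: der_vanish_def)
    then show "\<epsilon> \<in> adjoin Cent Cochain (W J) \<delta>" unfolding adjoin_def using eq[symmetric] hD by blast
  qed
  moreover have "adjoin Cent Cochain (W J) \<delta> \<subseteq> W I" by (rule Cochain.adjoin_least[OF sI WJI \<delta>(1)])
  ultimately have "adjoin Cent Cochain (W J) \<delta> = W I" by blast
  moreover have "rel_dim Cent Cochain (W J) (adjoin Cent Cochain (W J) \<delta>) (Suc 0)"
    by (rule rel_dim.step[OF rel_dim.refl[OF sJ] _ \<delta>(2)]) (use submoduleD(1)[OF sI] \<delta>(1) in blast)
  ultimately show ?thesis by simp
qed

lemma chief_step: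
  "rel_dim Cent Cochain (W J) (W I)
    (if strongly_abelian_factor L I J \<and> lie_module_iso F L (factor_module L I J) S \<and> factor_splits F L I J
     then 1 else 0)"
proof (cases "\<exists>\<delta>. \<delta> \<in> W I \<and> \<delta> \<notin> W J")
  case True
  then obtain \<delta> where \<delta>: "\<delta> \<in> W I" "\<delta> \<notin> W J" by blast
  have "lie_module_iso F L (factor_module L I J) S"
    using module_iso_factor_map new_derivation_factor(2)[OF \<delta>] by blast
  then show ?thesis using new_derivation_factor(3,4)[OF \<delta>] new_derivation_rel_dim[OF \<delta>] by simp
next
  case False
  then have "W I = W J" using IJ by (auto simp: der_vanish_def)
  moreover have "submodule (W J) Cent Cochain" using der_vanish_submodule[of "J \<inter> N"] N_sub by blast
  ultimately show ?thesis using False split_factor_derivation rel_dim.refl[of "W J" Cent Cochain] by auto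
qed

end

end

text \<open>
  Along a chief series the spaces \<open>W (Ls j)\<close> descend from all restricted derivations to those vanishing on
  the annihilator of \<open>S\<close>, by one dimension at each factor that counts.
\<close>

lemma chief_series_rel_dim:
  assumes ser: "p_chief_series F L n Ls"
  shows "rel_dim Cent Cochain (der_vanish N) (res_der p F L S) (p_split_mult F L S n Ls)"
proof -
  let ?good = "\<lambda>j. strongly_abelian_factor L (Ls (j - 1)) (Ls j) \<and>
    lie_module_iso F L (factor_module L (Ls (j - 1)) (Ls j)) S \<and> factor_splits F L (Ls (j - 1)) (Ls j)"
  have "m \<le> n \<Longrightarrow> rel_dim Cent Cochain (W (Ls m)) (res_der p F L S) (card {j \<in> {1..m}. ?good j})" for m
  proof (induction m)
    case 0
    have "W (Ls 0) = res_der p F L S"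
      using ser derD(7) by (auto simp: p_chief_series_def der_vanish_def)
    then show ?case using rel_dim.refl[OF res_der_submodule] by simp
  next
    case (Suc m)
    have "Ls m \<subset> Ls (Suc m)" and *: "p_ideal F L (Ls m)" "p_ideal F L (Ls (Suc m))"
      "minimal_p_ideal F (rlie_quot L (Ls m)) ((\<lambda>x. Ls m +>\<^bsub>L\<^esub> x) ` Ls (Suc m))"
      using ser Suc.prems by (simp_all add: p_chief_series_def)
    then have sub: "Ls m \<subseteq> Ls (Suc m)" by blast
    have "{j \<in> {1..Suc m}. ?good j} = {j \<in> {1..m}. ?good j} \<union> (if ?good (Suc m) then {Suc m} else {})"
      by (auto simp: le_Suc_eq)
    then have "card {j \<in> {1..Suc m}. ?good j} = (if ?good (Suc m) then 1 else 0) + card {j \<in> {1..m}. ?good j}"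
      by (auto simp: card_insert_if)
    then show ?case using Cochain.rel_dim_trans[OF Suc.IH chief_step[OF *(1,2) sub *(3)]] Suc.prems by simp
  qed
  from this[of n] show ?thesis
    using ser N_sub by (simp add: p_split_mult_def p_chief_series_def Int_absorb1)
qed

end

section \<open>The multiplicity of split chief factors\<close>

theorem theorem2p3:
  fixes p :: nat and F :: "'f ring" and L :: "('f, 'a) rlie" and S :: "('f, 'a, 's) lie_module"
    and P :: "nat \<Rightarrow> (('a list \<Rightarrow> 'f) set, 'c) module"
    and Q :: "nat \<Rightarrow> (('a set list \<Rightarrow> 'f) set, 'd) module"
  assumes "field F" and "Factorial_Ring.prime p" and "[p] \<cdot>\<^bsub>F\<^esub> \<one>\<^bsub>F\<^esub> = \<zero>\<^bsub>F\<^esub>"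
    and "restricted_lie_algebra p F L" and "lmod_fin_dim F L"
    and "irreducible_restricted_module p F L S"
    and "D = End_ring F L S"
    and "trivial_resolution p F L P d e"
    and "trivial_resolution p F (rlie_quot L (Ann L S)) Q d' e'"
  shows "lmod_fin_dim D (res_cohomology p F L P d 1 S) \<and>
    lmod_fin_dim D (res_cohomology p F (rlie_quot L (Ann L S)) Q d' 1 (quot_act S)) \<and>
    (\<forall>n Ls. p_chief_series F L n Ls \<longrightarrow>
       int (p_split_mult F L S n Ls) =
         int (lmod_dim D (res_cohomology p F L P d 1 S)) -
         int (lmod_dim D (res_cohomology p F (rlie_quot L (Ann L S)) Q d' 1 (quot_act S)))) \<and>
    (\<forall>n Ls n' Ls'. p_chief_series F L n Ls \<and> p_chief_series F L n' Ls' \<longrightarrow>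
       p_split_mult F L S n Ls = p_split_mult F L S n' Ls')"
proof -
  interpret irreducible_rep p F L S
    by (intro irreducible_rep.intro modular_lie_algebra.intro modular_lie_algebra_axioms.intro
        irreducible_rep_axioms.intro assms)
  interpret P: ext_one p F L S P d e
    by (intro ext_one.intro ext_one_axioms.intro restricted_data_module_axioms assms)
  interpret Q: ext_one p F LN "quot_act S" Q d' e'
    by (intro ext_one.intro ext_one_axioms.intro restricted_data_module.intro
        rlie_quot_restricted_data Ann_p_ideal quot_act_restricted assms)
  have fun_eq: "fun_module Y (quot_act S) = fun_module Y S" for Y :: "'i set"
    by (simp add: fun_module_def)
  \<comment> \<open>\<open>k\<close> is the dimension for the quotient by the annihilator, \<open>n\<close> the one for \<open>L\<close>\<close>
  obtain k where k: "rel_dim Cent Cochain (inner_der L S) (der_vanish N) k" using inner_vanish_fin by blast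
  obtain n0 where n0: "rel_dim Cent Cochain {\<zero>\<^bsub>Cochain\<^esub>} (res_der p F L S) n0" using der_fin by blast
  have "inner_der L S \<subseteq> res_der p F L S" using inner_der_vanish by (auto simp: der_vanish_def)
  then obtain n where n: "rel_dim Cent Cochain (inner_der L S) (res_der p F L S) n"
    using Cochain.rel_dim_upper[OF n0 inner_der_submodule] submoduleD(2)[OF inner_der_submodule] by blast
  have id_pull: "(\<lambda>\<delta>. \<lambda>x\<in>carrier L. \<delta> x) ` K = K" if "K \<subseteq> carrier L \<rightarrow>\<^sub>E carrier S" for K :: "('a \<Rightarrow> 's) set"
  proof -
    have "(\<lambda>x\<in>carrier L. \<delta> x) = \<delta>" if "\<delta> \<in> K" for \<delta>
      using that \<open>K \<subseteq> _\<close> by (intro restrict_ext extensional_restrict) (auto simp: PiE_def)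
    then show ?thesis by force
  qed
  have HP: "lmod_fin_dim D (res_cohomology p F L P d 1 S)" "lmod_dim D (res_cohomology p F L P d 1 S) = n"
  proof -
    have "rel_dim Cent (fun_module (carrier L) S) ((\<lambda>\<delta>. \<lambda>x\<in>carrier L. \<delta> x) ` inner_der L S)
        ((\<lambda>\<delta>. \<lambda>x\<in>carrier L. \<delta> x) ` res_der p F L S) n"
      using n id_pull[of "inner_der L S"] id_pull[of "res_der p F L S"]
        submoduleD(1)[OF inner_der_submodule] submoduleD(1)[OF res_der_submodule] by simp
    note * = P.ext_one_dim[OF Cochain.division_module_axioms fun_left_module _ _ this]
    show "lmod_fin_dim D (res_cohomology p F L P d 1 S)" "lmod_dim D (res_cohomology p F L P d 1 S) = n"
      unfolding \<open>D = _\<close> by (rule *; simp)+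
  qed
  have HQ: "lmod_fin_dim D (res_cohomology p F LN Q d' 1 (quot_act S))"
    "lmod_dim D (res_cohomology p F LN Q d' 1 (quot_act S)) = k"
  proof -
    have 1: "division_module Cent (fun_module (carrier L) (quot_act S))"
      "left_module Cent (fun_module (carrier (Q (Suc 0))) (quot_act S))"
      unfolding fun_eq by (rule Cochain.division_module_axioms, rule fun_left_module)
    have 2: "(\<lambda>x. N +>\<^bsub>L\<^esub> x) ` carrier L = carrier LN" by (auto simp: LN_simps(1))
    have 3: "carrier Cent \<subseteq> lie_module_hom F LN (quot_act S) (quot_act S)" using End_quot by simp
    have 4: "rel_dim Cent (fun_module (carrier L) (quot_act S)) (pull ` inner_der LN (quot_act S))
        (pull ` res_der p F LN (quot_act S)) k"
      unfolding fun_eq pull_inner pull_der by (rule k)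
    show "lmod_fin_dim D (res_cohomology p F LN Q d' 1 (quot_act S))"
      "lmod_dim D (res_cohomology p F LN Q d' 1 (quot_act S)) = k"
      unfolding \<open>D = _\<close> by (rule Q.ext_one_dim[OF 1 3 2 4])+
  qed
  have mult: "n = k + p_split_mult F L S m Ls" if "p_chief_series F L m Ls" for m Ls
    using Cochain.rel_dim_unique[OF n Cochain.rel_dim_trans[OF chief_series_rel_dim[OF that] k]] .
  have "p_split_mult F L S m Ls = p_split_mult F L S m' Ls'"
    if "p_chief_series F L m Ls" "p_chief_series F L m' Ls'" for m Ls m' Ls'
    using mult[OF that(1)] mult[OF that(2)] by simp
  moreover have "int (p_split_mult F L S m Ls) = int n - int k" if "p_chief_series F L m Ls" for m Ls
    using mult[OF that] by simp
  ultimately show ?thesis using HP HQ by blast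
qed

end
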